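(* Let $G$ be an $\ell$-group, let $\mathcal{X}$ be an almost transitive $G$-complex, and let $\mathcal{C}=\mathcal{C}(G,\mathcal{X})$. Let $F:\mathcal{C}\to\mathrm{pHil}$ be a semi-elementary functor and let $A$ be an algebra of $(\mathcal{C},F)$-operators. Let $\{\Gamma_\alpha\}_{\alpha\in I}$ be a family of subgroups of $G$ such that $\Gamma_\alpha\leq_{\mathcal{X}}G$ for all $\alpha\in I$. Then the following two conditions are equivalent: (1) For every compact $C\subseteq G$ with $1\in C$, there exist $\alpha\in I$ and $g\in G$ such that $C\cap g^{-1}\Gamma_\alpha g=\{1\}$. (2) For every $n\in\mathbb{N}$, there exist $\alpha\in I$ and a vertex $v$ of $\mathcal{X}$ such that the quotient map $\mathcal{X}\to\Gamma_\alpha\backslash\mathcal{X}$ is injective on the combinatorial ball $B_{\mathcal{X}}(v,n)$. If they hold, then $$\overline{\bigcup_{\alpha\in I}\mathrm{Spec}_A(\Gamma_\alpha\backslash\mathcal{X})}\supseteq\mathrm{Spec}_A(\mathcal{X}),$$ where the closure is taken in the unitary dual $\widehat{A}$.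
   Context: **Complexes.** A simplicial complex is a nonempty set $X$ of finite sets closed under taking subsets (or a poset isomorphic to such a set ordered by inclusion); its elements are cells. Complexes are connected and locally finite. For distinct cells $x,x'$, the distance $\mathrm{d}(x,x')$ is the minimal $t\in\mathbb{N}$ for which there are cells $y_1,\dots,y_t$ with $x\subseteq y_1$, $x'\subseteq y_t$ and $y_i\cap y_{i+1}\neq\emptyset$ for $1\le i<t$; $\mathrm{d}(x,x)=0$. $B_X(v,n)$ is the set of cells at distance at most $n$ from the vertex $v$. A cover map $f:X\to Y$ is a simplicial map (sending $i$-cells to $i$-cells) which is surjective on vertices and for each vertex $v$ induces a bijection from the cells containing $v$ to the cells containing $f(v)$. An $\ell$-group is a totally disconnected locally compact Hausdorff group. A $G$-complex is a simplicial complex $\mathcal{X}$ with a faithful action of $G$ by automorphisms such that stabilizers of nonempty cells are compact open; it is almost transitive if $G\backslash\mathcal{X}$ is finite. For $\Gamma\le G$, order $\Gamma\backslash\mathcal{X}$ by $\Gamma x\le\Gamma y$ iff $\gamma x\subseteq y$ for some $\gamma\in\Gamma$. Write $\Gamma\leq_{\mathcal{X}}G$ if $\Gamma\backslash\mathcal{X}$ is a simplicial complex and $x\mapsto\Gamma x$ is a cover map. **The category and functors.** $\mathcal{C}(G,\mathcal{X})$ has objects $\Gamma\backslash\mathcal{X}$ for $\Gamma\leq_{\mathcal X}G$ (with $1\backslash\mathcal{X}=\mathcal{X}$); $\mathrm{Hom}(\mathcal{X},\Gamma\backslash\mathcal{X})=\{p_\Gamma\circ g: g\in G\}$ with $p_\Gamma(x)=\Gamma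 x$; for $1\ne\Gamma'\le\Gamma$, $\mathrm{Hom}(\Gamma'\backslash\mathcal{X},\Gamma\backslash\mathcal{X})$ consists of the quotient map $p_{\Gamma',\Gamma}$; other Hom-sets are empty. For a set $S$, $\tilde\ell^2(S)$ is the pre-Hilbert space of finitely supported functions $S\to\mathbb{C}$ with the standard inner product, and a map $f:S\to T$ induces $(f_*\varphi)(y)=\sum_{f(x)=y}\varphi(x)$. $\mathrm{pHil}$ is the category of pre-Hilbert spaces with linear (not necessarily continuous) maps. A functor $F:\mathcal{C}(G,\mathcal{X})\to\mathrm{pHil}$ is elementary if there is a functor $S:\mathcal{C}(G,\mathcal{X})\to\mathrm{Set}$ with: (E1) a unitary natural isomorphism $\tilde\ell^2\circ S\cong F$; (E2) for all $x\in S\mathcal{X}$, $\mathrm{Stab}_G(x)$ is compact open and contained in the stabilizer of a nonempty cell of $\mathcal{X}$; (E3) for all $\Gamma\leq_{\mathcal X}G$, $\Gamma x\mapsto S(p_\Gamma)x$ is a bijection $\Gamma\backslash S\mathcal{X}\to S(\Gamma\backslash\mathcal{X})$; (E4) $G\backslash S\mathcal{X}$ is finite. $F$ is semi-elementary if $F\oplus F'$ is elementary for some functor $F':\mathcal{C}(G,\mathcal{X})\to\mathrm{pHil}$. **Algebras of operators.** A $*$-algebra is an associative, not necessarily unital, $\mathbb{C}$-algebra with a conjugate-linear involution $*$ reversing products; it is idempotented if for every finite $T\subseteq A$ there is an idempotent $e=e^*\in A$ with $eae=a$ for all $a\in T$. $A(\mathcal{C},F)$ is the unital $*$-algebra of natural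 transformations $a=\{a_X\}:F\to F$ for which there is a natural transformation $a^*=\{a_X^*\}:F\to F$ with $\langle a_Xu,v\rangle=\langle u,a_X^*v\rangle$. An algebra of $(\mathcal{C},F)$-operators is an idempotented $*$-subalgebra $A$ of $A(\mathcal{C},F)$. It acts on each $FX$ (by bounded operators when $F$ is semi-elementary). **Spectrum.** A unitary representation of an idempotented $*$-algebra $A$ is a Hilbert space $V$ with a left $A$-module structure by bounded operators such that $\langle au,v\rangle=\langle u,a^*v\rangle$ and $AV$ is dense in $V$; it is irreducible if it is nonzero and has no closed submodules except $0,V$. $\widehat{A}$ is the set of unitary isomorphism classes $[V]$ of irreducible unitary representations. It is topologized by the subbasis of sets $N_{V,v,\varepsilon,T}$ ($[V]\in\widehat A$, $v\in V$ a unit vector, $\varepsilon>0$, $T\subseteq A$ finite) consisting of all $[U]$ for which there is $u\in U$ (not necessarily a unit vector) with $|\langle av,v\rangle-\langle au,u\rangle|<\varepsilon$ for all $a\in T$. For $V$ irreducible and $V'$ a unitary representation, $V\prec V'$ means: for every unit $v\in V$, $\varepsilon>0$ and finite $T\subseteq A$ there is a unit $v'\in V'$ with $|\langle av,v\rangle-\langle av',v'\rangle|<\varepsilon$ for all $a\in T$. $\mathrm{Spec}_A(V')=\{[V]\in\widehat A: V\prec V'\}$. For $X\in\mathcal{C}$, $\mathrm{Spec}_A(X):=\mathrm{Spec}_A(\overline{A\cdot FX})$, where the bar denotes completion. *)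

theory Defs
  imports "HOL-Analysis.Analysis" "HOL-Algebra.Group_Action" "HOL-Algebra.Module"
begin

section \<open>Simplicial complexes as posets\<close>

text \<open>
  Quotients of simplicial complexes are only posets, so a complex is represented throughout by
  its face relation \<open>X\<close> (reflexive, hence its cells are \<open>Field X\<close>). A cell is compared with a
  finite set by way of the set of vertices below it; intersections of cells are intersections of
  these vertex sets. The concrete case is \<open>X = {(x, y). x \<in> K \<and> y \<in> K \<and> x \<subseteq> y}\<close>.
\<close>

definition is_set_complex :: "'v set set \<Rightarrow> bool" where
  "is_set_complex K \<longleftrightarrow>
     K \<noteq> {} \<and> (\<forall>x\<in>K. finite x) \<and> (\<forall>x\<in>K. \<forall>y. y \<subseteq> x \<longrightarrow> y \<in> K)"

text \<open>
  It is no restriction to let \<open>K\<close> consist of sets of cells of \<open>X\<close>: one may always relabel the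
  vertices of \<open>K\<close> by the corresponding cells.
\<close>

definition simplicial_poset :: "'c rel \<Rightarrow> bool" where
  "simplicial_poset X \<longleftrightarrow> Partial_order X \<and>
     (\<exists>(K :: 'c set set) f. is_set_complex K \<and> bij_betw f (Field X) K \<and>
        (\<forall>x\<in>Field X. \<forall>y\<in>Field X. (x, y) \<in> X \<longleftrightarrow> f x \<subseteq> f y))"

definition empty_cell :: "'c rel \<Rightarrow> 'c \<Rightarrow> bool" where
  "empty_cell X x \<longleftrightarrow> x \<in> Field X \<and> (\<forall>y\<in>Field X. (x, y) \<in> X)"

definition vertices :: "'c rel \<Rightarrow> 'c set" where
  "vertices X = {v \<in> Field X. \<not> empty_cell X v \<and> (\<forall>u. (u, v) \<in> X \<longrightarrow> u = v \<or> empty_cell X u)}"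

definition vertices_of :: "'c rel \<Rightarrow> 'c \<Rightarrow> 'c set" where
  "vertices_of X x = {v \<in> vertices X. (v, x) \<in> X}"

definition cell_chain :: "'c rel \<Rightarrow> 'c \<Rightarrow> 'c \<Rightarrow> 'c list \<Rightarrow> bool" where
  "cell_chain X x x' ys \<longleftrightarrow> ys \<noteq> [] \<and> set ys \<subseteq> Field X \<and> (x, hd ys) \<in> X \<and> (x', last ys) \<in> X \<and>
     (\<forall>i. Suc i < length ys \<longrightarrow> vertices_of X (ys ! i) \<inter> vertices_of X (ys ! Suc i) \<noteq> {})"

text \<open>A connected complex is required to have a vertex, as connected spaces are nonempty.\<close>

definition connected_complex :: "'c rel \<Rightarrow> bool" where
  "connected_complex X \<longleftrightarrow> vertices X \<noteq> {} \<and>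
     (\<forall>v\<in>vertices X. \<forall>w\<in>vertices X. \<exists>ys. cell_chain X v w ys)"

definition locally_finite_complex :: "'c rel \<Rightarrow> bool" where
  "locally_finite_complex X \<longleftrightarrow> (\<forall>v\<in>vertices X. finite {x. (v, x) \<in> X})"

definition simplicial_complex :: "'c rel \<Rightarrow> bool" where
  "simplicial_complex X \<longleftrightarrow>
     simplicial_poset X \<and> connected_complex X \<and> locally_finite_complex X"

definition cell_dist :: "'c rel \<Rightarrow> 'c \<Rightarrow> 'c \<Rightarrow> nat" where
  "cell_dist X x x' =
     (if x = x' then 0 else LEAST t. \<exists>ys. length ys = t \<and> cell_chain X x x' ys)"

definition cell_ball :: "'c rel \<Rightarrow> 'c \<Rightarrow> nat \<Rightarrow> 'c set" where
  "cell_ball X v n = {x \<in> Field X. cell_dist X v x \<le> n}"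

text \<open>
  The condition on vertex sets says that \<open>f\<close> is induced by a map of vertices, i.e. is simplicial;
  the one on cardinalities says that it preserves dimensions.
\<close>

definition cover_map :: "'c rel \<Rightarrow> 'd rel \<Rightarrow> ('c \<Rightarrow> 'd) \<Rightarrow> bool" where
  "cover_map X Y f \<longleftrightarrow> f \<in> Field X \<rightarrow> Field Y \<and>
     (\<forall>x\<in>Field X. vertices_of Y (f x) = f ` vertices_of X x) \<and>
     (\<forall>x\<in>Field X. card (vertices_of Y (f x)) = card (vertices_of X x)) \<and>
     f ` vertices X = vertices Y \<and>
     (\<forall>v\<in>vertices X. bij_betw f {x. (v, x) \<in> X} {y. (f v, y) \<in> Y})"

section \<open>\<open>G\<close>-complexes and their quotients\<close>

definition ell_group :: "('g, 'k) monoid_scheme \<Rightarrow> 'g topology \<Rightarrow> bool" where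
  "ell_group G T \<longleftrightarrow> Group.group G \<and> topspace T = carrier G \<and>
     continuous_map (prod_topology T T) T (\<lambda>(x, y). x \<otimes>\<^bsub>G\<^esub> y) \<and>
     continuous_map T T (\<lambda>x. inv\<^bsub>G\<^esub> x) \<and>
     Hausdorff_space T \<and> locally_compact_space T \<and>
     (\<forall>S. connectedin T S \<longrightarrow> (\<exists>x. S \<subseteq> {x}))"

definition G_complex ::
  "('g, 'k) monoid_scheme \<Rightarrow> 'g topology \<Rightarrow> 'c rel \<Rightarrow> ('g \<Rightarrow> 'c \<Rightarrow> 'c) \<Rightarrow> bool" where
  "G_complex G T X \<phi> \<longleftrightarrow> simplicial_complex X \<and> faithful_action G (Field X) \<phi> \<and>
     (\<forall>g\<in>carrier G. \<forall>x\<in>Field X. \<forall>y\<in>Field X. (\<phi> g x, \<phi> g y) \<in> X \<longleftrightarrow> (x, y) \<in> X) \<and>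
     (\<forall>x\<in>Field X. \<not> empty_cell X x \<longrightarrow>
        compactin T (stabilizer G \<phi> x) \<and> openin T (stabilizer G \<phi> x))"

definition almost_transitive ::
  "('g, 'k) monoid_scheme \<Rightarrow> 'c rel \<Rightarrow> ('g \<Rightarrow> 'c \<Rightarrow> 'c) \<Rightarrow> bool" where
  "almost_transitive G X \<phi> \<longleftrightarrow> finite (orbits G (Field X) \<phi>)"

definition quot_map ::
  "('g, 'k) monoid_scheme \<Rightarrow> ('g \<Rightarrow> 'c \<Rightarrow> 'c) \<Rightarrow> 'g set \<Rightarrow> 'c \<Rightarrow> 'c set" where
  "quot_map G \<phi> \<Gamma> x = orbit (G\<lparr>carrier := \<Gamma>\<rparr>) \<phi> x"

definition quot_cells ::
  "('g, 'k) monoid_scheme \<Rightarrow> 'c rel \<Rightarrow> ('g \<Rightarrow> 'c \<Rightarrow> 'c) \<Rightarrow> 'g set \<Rightarrow> 'c set set" where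
  "quot_cells G X \<phi> \<Gamma> = orbits (G\<lparr>carrier := \<Gamma>\<rparr>) (Field X) \<phi>"

definition quot_complex ::
  "('g, 'k) monoid_scheme \<Rightarrow> 'c rel \<Rightarrow> ('g \<Rightarrow> 'c \<Rightarrow> 'c) \<Rightarrow> 'g set \<Rightarrow> 'c set rel" where
  "quot_complex G X \<phi> \<Gamma> =
     {(quot_map G \<phi> \<Gamma> x, quot_map G \<phi> \<Gamma> y) | x y.
        x \<in> Field X \<and> y \<in> Field X \<and> (\<exists>\<gamma>\<in>\<Gamma>. (\<phi> \<gamma> x, y) \<in> X)}"

definition covering_subgroup ::
  "('g, 'k) monoid_scheme \<Rightarrow> 'c rel \<Rightarrow> ('g \<Rightarrow> 'c \<Rightarrow> 'c) \<Rightarrow> 'g set \<Rightarrow> bool" where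
  "covering_subgroup G X \<phi> \<Gamma> \<longleftrightarrow> subgroup \<Gamma> G \<and>
     simplicial_complex (quot_complex G X \<phi> \<Gamma>) \<and>
     cover_map X (quot_complex G X \<phi> \<Gamma>) (quot_map G \<phi> \<Gamma>)"

section \<open>Categories and functors\<close>

text \<open>\<open>Comp C a g f\<close> is the composite of \<open>f\<close>, with source \<open>a\<close>, and \<open>g\<close>.\<close>

record ('o, 'm) category =
  Obj :: "'o set"
  Hom :: "'o \<Rightarrow> 'o \<Rightarrow> 'm set"
  Ident :: "'o \<Rightarrow> 'm"
  Comp :: "'o \<Rightarrow> 'm \<Rightarrow> 'm \<Rightarrow> 'm"

text \<open>
  The object \<open>\<Gamma>\<backslash>X\<close> is represented by \<open>\<Gamma>\<close>; distinct \<open>\<Gamma>\<close> have distinct quotients, since the action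
  is faithful, the complex connected and the quotient map a cover map. The complex \<open>X\<close> itself is
  identified with its quotient by the trivial group, a cell \<open>x\<close> corresponding to \<open>{x}\<close>.
  The map \<open>quot_morphism G X \<phi> \<Gamma>' \<Gamma> g\<close> sends \<open>\<Gamma>'x\<close> to \<open>\<Gamma>gx\<close> whenever this is well-defined.
  Morphisms are extensional functions, so that equal maps are equal morphisms.
\<close>

definition quot_morphism ::
  "('g, 'k) monoid_scheme \<Rightarrow> 'c rel \<Rightarrow> ('g \<Rightarrow> 'c \<Rightarrow> 'c) \<Rightarrow> 'g set \<Rightarrow> 'g set \<Rightarrow> 'g \<Rightarrow>
     'c set \<Rightarrow> 'c set" where
  "quot_morphism G X \<phi> \<Gamma>' \<Gamma> g =
     (\<lambda>c \<in> quot_cells G X \<phi> \<Gamma>'. \<Union>x\<in>c. quot_map G \<phi> \<Gamma> (\<phi> g x))"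

definition quot_category ::
  "('g, 'k) monoid_scheme \<Rightarrow> 'c rel \<Rightarrow> ('g \<Rightarrow> 'c \<Rightarrow> 'c) \<Rightarrow> ('g set, 'c set \<Rightarrow> 'c set) category" where
  "quot_category G X \<phi> = \<lparr>
     Obj = {\<Gamma>. covering_subgroup G X \<phi> \<Gamma>},
     Hom = (\<lambda>\<Gamma>' \<Gamma>.
       if \<Gamma>' = {\<one>\<^bsub>G\<^esub>} then {quot_morphism G X \<phi> {\<one>\<^bsub>G\<^esub>} \<Gamma> g | g. g \<in> carrier G}
       else if \<Gamma>' \<subseteq> \<Gamma> then {quot_morphism G X \<phi> \<Gamma>' \<Gamma> \<one>\<^bsub>G\<^esub>}
       else {}),
     Ident = (\<lambda>\<Gamma>. \<lambda>c \<in> quot_cells G X \<phi> \<Gamma>. c),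
     Comp = (\<lambda>\<Gamma> g f. compose (quot_cells G X \<phi> \<Gamma>) g f)\<rparr>"

record ('o, 'm, 'b, 'd) cfunctor =
  ob :: "'o \<Rightarrow> 'b"
  mor :: "'o \<Rightarrow> 'o \<Rightarrow> 'm \<Rightarrow> 'd"

definition set_functor ::
  "('o, 'm) category \<Rightarrow> ('o, 'm, 's set, 's \<Rightarrow> 's) cfunctor \<Rightarrow> bool" where
  "set_functor C S \<longleftrightarrow>
     (\<forall>a\<in>Obj C. \<forall>b\<in>Obj C. \<forall>f\<in>Hom C a b. mor S a b f \<in> ob S a \<rightarrow> ob S b) \<and>
     (\<forall>a\<in>Obj C. \<forall>x\<in>ob S a. mor S a a (Ident C a) x = x) \<and>
     (\<forall>a\<in>Obj C. \<forall>b\<in>Obj C. \<forall>c\<in>Obj C. \<forall>f\<in>Hom C a b. \<forall>g\<in>Hom C b c. \<forall>x\<in>ob S a.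
        mor S a c (Comp C a g f) x = mor S b c g (mor S a b f x))"

section \<open>Pre-Hilbert spaces\<close>

definition complex_ring :: "complex ring" where
  "complex_ring = \<lparr>carrier = UNIV, mult = (*), one = 1, zero = 0, add = (+)\<rparr>"

text \<open>
  The fields \<open>mult\<close> and \<open>one\<close>, present in every library module, are irrelevant for inner product
  spaces. Inner products are linear in the first argument.
\<close>

record 'v inner_space = "(complex, 'v) module" +
  ip :: "'v \<Rightarrow> 'v \<Rightarrow> complex"

definition pre_hilbert :: "'v inner_space \<Rightarrow> bool" where
  "pre_hilbert V \<longleftrightarrow> Module.module complex_ring V \<and>
     (\<forall>u\<in>carrier V. \<forall>v\<in>carrier V. ip V v u = cnj (ip V u v)) \<and>
     (\<forall>u\<in>carrier V. \<forall>v\<in>carrier V. \<forall>w\<in>carrier V. ip V (u \<oplus>\<^bsub>V\<^esub> v) w = ip V u w + ip V v w) \<and>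
     (\<forall>c. \<forall>u\<in>carrier V. \<forall>v\<in>carrier V. ip V (c \<odot>\<^bsub>V\<^esub> u) v = c * ip V u v) \<and>
     (\<forall>u\<in>carrier V. u \<noteq> \<zero>\<^bsub>V\<^esub> \<longrightarrow> 0 < Re (ip V u u))"

definition vnorm :: "'v inner_space \<Rightarrow> 'v \<Rightarrow> real" where
  "vnorm V v = sqrt (Re (ip V v v))"

text \<open>The library's metric spaces need a symmetric nonnegative function on the whole type.\<close>

definition vdist :: "'v inner_space \<Rightarrow> 'v \<Rightarrow> 'v \<Rightarrow> real" where
  "vdist V u v = (if u \<in> carrier V \<and> v \<in> carrier V then vnorm V (u \<ominus>\<^bsub>V\<^esub> v) else 0)"

abbreviation vtopology :: "'v inner_space \<Rightarrow> 'v topology" where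
  "vtopology V \<equiv> Metric_space.mtopology (carrier V) (vdist V)"

definition hilbert :: "'v inner_space \<Rightarrow> bool" where
  "hilbert V \<longleftrightarrow> pre_hilbert V \<and> Metric_space.mcomplete (carrier V) (vdist V)"

definition linear_map :: "'v inner_space \<Rightarrow> 'w inner_space \<Rightarrow> ('v \<Rightarrow> 'w) \<Rightarrow> bool" where
  "linear_map V W f \<longleftrightarrow> f \<in> carrier V \<rightarrow> carrier W \<and>
     (\<forall>u\<in>carrier V. \<forall>v\<in>carrier V. f (u \<oplus>\<^bsub>V\<^esub> v) = f u \<oplus>\<^bsub>W\<^esub> f v) \<and>
     (\<forall>c. \<forall>u\<in>carrier V. f (c \<odot>\<^bsub>V\<^esub> u) = c \<odot>\<^bsub>W\<^esub> f u)"

definition bounded_map :: "'v inner_space \<Rightarrow> 'w inner_space \<Rightarrow> ('v \<Rightarrow> 'w) \<Rightarrow> bool" where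
  "bounded_map V W f \<longleftrightarrow> (\<exists>c. \<forall>u\<in>carrier V. vnorm W (f u) \<le> c * vnorm V u)"

definition unitary_map :: "'v inner_space \<Rightarrow> 'w inner_space \<Rightarrow> ('v \<Rightarrow> 'w) \<Rightarrow> bool" where
  "unitary_map V W f \<longleftrightarrow> linear_map V W f \<and> bij_betw f (carrier V) (carrier W) \<and>
     (\<forall>u\<in>carrier V. \<forall>v\<in>carrier V. ip W (f u) (f v) = ip V u v)"

definition lin_span :: "'v inner_space \<Rightarrow> 'v set \<Rightarrow> 'v set" where
  "lin_span V S = \<Inter>{H. submodule H complex_ring V \<and> S \<subseteq> H}"

definition direct_sum :: "'v inner_space \<Rightarrow> 'w inner_space \<Rightarrow> ('v \<times> 'w) inner_space" where
  "direct_sum V W = \<lparr>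
     carrier = carrier V \<times> carrier W,
     mult = undefined,
     one = undefined,
     zero = (\<zero>\<^bsub>V\<^esub>, \<zero>\<^bsub>W\<^esub>),
     add = (\<lambda>(u, w) (u', w'). (u \<oplus>\<^bsub>V\<^esub> u', w \<oplus>\<^bsub>W\<^esub> w')),
     smult = (\<lambda>c (u, w). (c \<odot>\<^bsub>V\<^esub> u, c \<odot>\<^bsub>W\<^esub> w)),
     ip = (\<lambda>(u, w) (u', w'). ip V u u' + ip W w w')\<rparr>"

definition fin_l2 :: "'s set \<Rightarrow> ('s \<Rightarrow> complex) inner_space" where
  "fin_l2 S = \<lparr>
     carrier = {f. finite {x. f x \<noteq> 0} \<and> {x. f x \<noteq> 0} \<subseteq> S},
     mult = undefined,
     one = undefined,
     zero = (\<lambda>x. 0),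
     add = (\<lambda>f g x. f x + g x),
     smult = (\<lambda>c f x. c * f x),
     ip = (\<lambda>f g. \<Sum>x | f x \<noteq> 0. f x * cnj (g x))\<rparr>"

definition fin_l2_push :: "('s \<Rightarrow> 's) \<Rightarrow> ('s \<Rightarrow> complex) \<Rightarrow> 's \<Rightarrow> complex" where
  "fin_l2_push f u y = (\<Sum>x | u x \<noteq> 0 \<and> f x = y. u x)"

text \<open>
  The completion consists of the classes of Cauchy sequences modulo sequences tending to zero;
  an operator \<open>f\<close> acts on it through its values on the members of any sequence in the class,
  which is independent of that choice if \<open>f\<close> is linear and bounded.
\<close>

definition cauchy_seqs :: "'v inner_space \<Rightarrow> (nat \<Rightarrow> 'v) set" where
  "cauchy_seqs V = {s. Metric_space.MCauchy (carrier V) (vdist V) s}"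

definition cauchy_rel :: "'v inner_space \<Rightarrow> (nat \<Rightarrow> 'v) rel" where
  "cauchy_rel V = {(s, t). s \<in> cauchy_seqs V \<and> t \<in> cauchy_seqs V \<and>
     (\<lambda>n. vdist V (s n) (t n)) \<longlonglongrightarrow> 0}"

definition cauchy_class :: "'v inner_space \<Rightarrow> (nat \<Rightarrow> 'v) \<Rightarrow> (nat \<Rightarrow> 'v) set" where
  "cauchy_class V s = cauchy_rel V `` {s}"

definition cauchy_rep :: "(nat \<Rightarrow> 'v) set \<Rightarrow> nat \<Rightarrow> 'v" where
  "cauchy_rep P = (SOME s. s \<in> P)"

definition completion :: "'v inner_space \<Rightarrow> ((nat \<Rightarrow> 'v) set) inner_space" where
  "completion V = \<lparr>
     carrier = cauchy_seqs V // cauchy_rel V,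
     mult = undefined,
     one = undefined,
     zero = cauchy_class V (\<lambda>n. \<zero>\<^bsub>V\<^esub>),
     add = (\<lambda>P Q. cauchy_class V (\<lambda>n. cauchy_rep P n \<oplus>\<^bsub>V\<^esub> cauchy_rep Q n)),
     smult = (\<lambda>c P. cauchy_class V (\<lambda>n. c \<odot>\<^bsub>V\<^esub> cauchy_rep P n)),
     ip = (\<lambda>P Q. lim (\<lambda>n. ip V (cauchy_rep P n) (cauchy_rep Q n)))\<rparr>"

definition completion_op ::
  "'v inner_space \<Rightarrow> ('v \<Rightarrow> 'v) \<Rightarrow> (nat \<Rightarrow> 'v) set \<Rightarrow> (nat \<Rightarrow> 'v) set" where
  "completion_op V f P = cauchy_class V (\<lambda>n. f (cauchy_rep P n))"

section \<open>Elementary and semi-elementary functors\<close>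

definition phil_functor ::
  "('o, 'm) category \<Rightarrow> ('o, 'm, 'v inner_space, 'v \<Rightarrow> 'v) cfunctor \<Rightarrow> bool" where
  "phil_functor C F \<longleftrightarrow>
     (\<forall>a\<in>Obj C. pre_hilbert (ob F a)) \<and>
     (\<forall>a\<in>Obj C. \<forall>b\<in>Obj C. \<forall>f\<in>Hom C a b. linear_map (ob F a) (ob F b) (mor F a b f)) \<and>
     (\<forall>a\<in>Obj C. \<forall>u\<in>carrier (ob F a). mor F a a (Ident C a) u = u) \<and>
     (\<forall>a\<in>Obj C. \<forall>b\<in>Obj C. \<forall>c\<in>Obj C. \<forall>f\<in>Hom C a b. \<forall>g\<in>Hom C b c. \<forall>u\<in>carrier (ob F a).
        mor F a c (Comp C a g f) u = mor F b c g (mor F a b f u))"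

text \<open>Components are extensional, so that a natural transformation is determined by its values.\<close>

definition nat_trans ::
  "('o, 'm) category \<Rightarrow> ('o, 'm, 'v inner_space, 'v \<Rightarrow> 'v) cfunctor \<Rightarrow>
     ('o, 'm, 'w inner_space, 'w \<Rightarrow> 'w) cfunctor \<Rightarrow> ('o \<Rightarrow> 'v \<Rightarrow> 'w) set" where
  "nat_trans C F F' = {a \<in> (\<Pi>\<^sub>E x\<in>Obj C. carrier (ob F x) \<rightarrow>\<^sub>E carrier (ob F' x)).
     (\<forall>x\<in>Obj C. linear_map (ob F x) (ob F' x) (a x)) \<and>
     (\<forall>x\<in>Obj C. \<forall>y\<in>Obj C. \<forall>f\<in>Hom C x y. \<forall>u\<in>carrier (ob F x).
        a y (mor F x y f u) = mor F' x y f (a x u))}"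

definition unitarily_isomorphic ::
  "('o, 'm) category \<Rightarrow> ('o, 'm, 'v inner_space, 'v \<Rightarrow> 'v) cfunctor \<Rightarrow>
     ('o, 'm, 'w inner_space, 'w \<Rightarrow> 'w) cfunctor \<Rightarrow> bool" where
  "unitarily_isomorphic C F F' \<longleftrightarrow>
     (\<exists>a\<in>nat_trans C F F'. \<forall>x\<in>Obj C. unitary_map (ob F x) (ob F' x) (a x))"

definition l2_functor ::
  "('o, 'm, 's set, 's \<Rightarrow> 's) cfunctor \<Rightarrow>
     ('o, 'm, ('s \<Rightarrow> complex) inner_space, ('s \<Rightarrow> complex) \<Rightarrow> ('s \<Rightarrow> complex)) cfunctor" where
  "l2_functor S = \<lparr>ob = (\<lambda>a. fin_l2 (ob S a)), mor = (\<lambda>a b f. fin_l2_push (mor S a b f))\<rparr>"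

definition sum_functor ::
  "('o, 'm, 'v inner_space, 'v \<Rightarrow> 'v) cfunctor \<Rightarrow> ('o, 'm, 'w inner_space, 'w \<Rightarrow> 'w) cfunctor \<Rightarrow>
     ('o, 'm, ('v \<times> 'w) inner_space, 'v \<times> 'w \<Rightarrow> 'v \<times> 'w) cfunctor" where
  "sum_functor F F' = \<lparr>
     ob = (\<lambda>a. direct_sum (ob F a) (ob F' a)),
     mor = (\<lambda>a b f. map_prod (mor F a b f) (mor F' a b f))\<rparr>"

definition induced_action ::
  "('g, 'k) monoid_scheme \<Rightarrow> 'c rel \<Rightarrow> ('g \<Rightarrow> 'c \<Rightarrow> 'c) \<Rightarrow>
     ('g set, 'c set \<Rightarrow> 'c set, 's set, 's \<Rightarrow> 's) cfunctor \<Rightarrow> 'g \<Rightarrow> 's \<Rightarrow> 's" where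
  "induced_action G X \<phi> S g =
     mor S {\<one>\<^bsub>G\<^esub>} {\<one>\<^bsub>G\<^esub>} (quot_morphism G X \<phi> {\<one>\<^bsub>G\<^esub>} {\<one>\<^bsub>G\<^esub>} g)"

text \<open>
  A formula cannot quantify existentially over types, hence not over all sets or pre-Hilbert spaces. The type
  holding the values of the witnessing functors is therefore an explicit argument; in a hypothesis
  with a free type variable this amounts to existence over an arbitrary type.
\<close>

definition elementary ::
  "'s itself \<Rightarrow> ('g, 'k) monoid_scheme \<Rightarrow> 'g topology \<Rightarrow> 'c rel \<Rightarrow> ('g \<Rightarrow> 'c \<Rightarrow> 'c) \<Rightarrow>
     ('g set, 'c set \<Rightarrow> 'c set, 'v inner_space, 'v \<Rightarrow> 'v) cfunctor \<Rightarrow> bool" where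
  "elementary s G T X \<phi> F \<longleftrightarrow>
     phil_functor (quot_category G X \<phi>) F \<and>
     (\<exists>S :: ('g set, 'c set \<Rightarrow> 'c set, 's set, 's \<Rightarrow> 's) cfunctor.
        set_functor (quot_category G X \<phi>) S \<and>
        unitarily_isomorphic (quot_category G X \<phi>) (l2_functor S) F \<and>
        (\<forall>x\<in>ob S {\<one>\<^bsub>G\<^esub>}.
           compactin T (stabilizer G (induced_action G X \<phi> S) x) \<and>
           openin T (stabilizer G (induced_action G X \<phi> S) x) \<and>
           (\<exists>c\<in>Field X. \<not> empty_cell X c \<and>
              stabilizer G (induced_action G X \<phi> S) x \<subseteq> stabilizer G \<phi> c)) \<and>
        (\<forall>\<Gamma>. covering_subgroup G X \<phi> \<Gamma> \<longrightarrow>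
           (\<exists>\<beta>. bij_betw \<beta>
                  (orbits (G\<lparr>carrier := \<Gamma>\<rparr>) (ob S {\<one>\<^bsub>G\<^esub>}) (induced_action G X \<phi> S)) (ob S \<Gamma>) \<and>
                (\<forall>x\<in>ob S {\<one>\<^bsub>G\<^esub>}.
                   \<beta> (orbit (G\<lparr>carrier := \<Gamma>\<rparr>) (induced_action G X \<phi> S) x) =
                   mor S {\<one>\<^bsub>G\<^esub>} \<Gamma> (quot_morphism G X \<phi> {\<one>\<^bsub>G\<^esub>} \<Gamma> \<one>\<^bsub>G\<^esub>) x))) \<and>
        finite (orbits G (ob S {\<one>\<^bsub>G\<^esub>}) (induced_action G X \<phi> S)))"

definition semi_elementary ::
  "'w itself \<Rightarrow> 's itself \<Rightarrow> ('g, 'k) monoid_scheme \<Rightarrow> 'g topology \<Rightarrow> 'c rel \<Rightarrow>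
     ('g \<Rightarrow> 'c \<Rightarrow> 'c) \<Rightarrow> ('g set, 'c set \<Rightarrow> 'c set, 'v inner_space, 'v \<Rightarrow> 'v) cfunctor \<Rightarrow> bool" where
  "semi_elementary w s G T X \<phi> F \<longleftrightarrow>
     phil_functor (quot_category G X \<phi>) F \<and>
     (\<exists>F' :: ('g set, 'c set \<Rightarrow> 'c set, 'w inner_space, 'w \<Rightarrow> 'w) cfunctor.
        phil_functor (quot_category G X \<phi>) F' \<and> elementary s G T X \<phi> (sum_functor F F'))"

section \<open>Algebras of operators\<close>

text \<open>The field \<open>one\<close> is irrelevant here, as algebras need not be unital.\<close>

record 'a alg = "(complex, 'a) module" +
  star :: "'a \<Rightarrow> 'a"

definition star_algebra :: "'a alg \<Rightarrow> bool" where
  "star_algebra A \<longleftrightarrow> Module.module complex_ring A \<and>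
     (\<forall>a\<in>carrier A. \<forall>b\<in>carrier A. a \<otimes>\<^bsub>A\<^esub> b \<in> carrier A) \<and>
     (\<forall>a\<in>carrier A. \<forall>b\<in>carrier A. \<forall>c\<in>carrier A.
        (a \<otimes>\<^bsub>A\<^esub> b) \<otimes>\<^bsub>A\<^esub> c = a \<otimes>\<^bsub>A\<^esub> (b \<otimes>\<^bsub>A\<^esub> c) \<and>
        (a \<oplus>\<^bsub>A\<^esub> b) \<otimes>\<^bsub>A\<^esub> c = (a \<otimes>\<^bsub>A\<^esub> c) \<oplus>\<^bsub>A\<^esub> (b \<otimes>\<^bsub>A\<^esub> c) \<and>
        a \<otimes>\<^bsub>A\<^esub> (b \<oplus>\<^bsub>A\<^esub> c) = (a \<otimes>\<^bsub>A\<^esub> b) \<oplus>\<^bsub>A\<^esub> (a \<otimes>\<^bsub>A\<^esub> c)) \<and>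
     (\<forall>z. \<forall>a\<in>carrier A. \<forall>b\<in>carrier A.
        (z \<odot>\<^bsub>A\<^esub> a) \<otimes>\<^bsub>A\<^esub> b = z \<odot>\<^bsub>A\<^esub> (a \<otimes>\<^bsub>A\<^esub> b) \<and>
        a \<otimes>\<^bsub>A\<^esub> (z \<odot>\<^bsub>A\<^esub> b) = z \<odot>\<^bsub>A\<^esub> (a \<otimes>\<^bsub>A\<^esub> b)) \<and>
     (\<forall>a\<in>carrier A. star A a \<in> carrier A \<and> star A (star A a) = a) \<and>
     (\<forall>a\<in>carrier A. \<forall>b\<in>carrier A.
        star A (a \<oplus>\<^bsub>A\<^esub> b) = star A a \<oplus>\<^bsub>A\<^esub> star A b \<and>
        star A (a \<otimes>\<^bsub>A\<^esub> b) = star A b \<otimes>\<^bsub>A\<^esub> star A a) \<and>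
     (\<forall>z. \<forall>a\<in>carrier A. star A (z \<odot>\<^bsub>A\<^esub> a) = cnj z \<odot>\<^bsub>A\<^esub> star A a)"

definition idempotented :: "'a alg \<Rightarrow> bool" where
  "idempotented A \<longleftrightarrow> star_algebra A \<and>
     (\<forall>S. S \<subseteq> carrier A \<and> finite S \<longrightarrow>
        (\<exists>e\<in>carrier A. e \<otimes>\<^bsub>A\<^esub> e = e \<and> star A e = e \<and> (\<forall>a\<in>S. e \<otimes>\<^bsub>A\<^esub> a \<otimes>\<^bsub>A\<^esub> e = a)))"

definition adjoint_trans ::
  "('o, 'm) category \<Rightarrow> ('o, 'm, 'v inner_space, 'v \<Rightarrow> 'v) cfunctor \<Rightarrow>
     ('o \<Rightarrow> 'v \<Rightarrow> 'v) \<Rightarrow> ('o \<Rightarrow> 'v \<Rightarrow> 'v) \<Rightarrow> bool" where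
  "adjoint_trans C F a b \<longleftrightarrow>
     (\<forall>x\<in>Obj C. \<forall>u\<in>carrier (ob F x). \<forall>v\<in>carrier (ob F x).
        ip (ob F x) (a x u) v = ip (ob F x) u (b x v))"

definition op_algebra ::
  "('o, 'm) category \<Rightarrow> ('o, 'm, 'v inner_space, 'v \<Rightarrow> 'v) cfunctor \<Rightarrow> ('o \<Rightarrow> 'v \<Rightarrow> 'v) alg" where
  "op_algebra C F = \<lparr>
     carrier = {a \<in> nat_trans C F F. \<exists>b\<in>nat_trans C F F. adjoint_trans C F a b},
     mult = (\<lambda>a b. \<lambda>x\<in>Obj C. \<lambda>u\<in>carrier (ob F x). a x (b x u)),
     one = (\<lambda>x\<in>Obj C. \<lambda>u\<in>carrier (ob F x). u),
     zero = (\<lambda>x\<in>Obj C. \<lambda>u\<in>carrier (ob F x). \<zero>\<^bsub>ob F x\<^esub>),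
     add = (\<lambda>a b. \<lambda>x\<in>Obj C. \<lambda>u\<in>carrier (ob F x). a x u \<oplus>\<^bsub>ob F x\<^esub> b x u),
     smult = (\<lambda>z a. \<lambda>x\<in>Obj C. \<lambda>u\<in>carrier (ob F x). z \<odot>\<^bsub>ob F x\<^esub> a x u),
     star = (\<lambda>a. THE b. b \<in> nat_trans C F F \<and> adjoint_trans C F a b)\<rparr>"

definition algebra_of_operators ::
  "('o, 'm) category \<Rightarrow> ('o, 'm, 'v inner_space, 'v \<Rightarrow> 'v) cfunctor \<Rightarrow>
     ('o \<Rightarrow> 'v \<Rightarrow> 'v) alg \<Rightarrow> bool" where
  "algebra_of_operators C F A \<longleftrightarrow> idempotented A \<and>
     (\<exists>B \<subseteq> carrier (op_algebra C F). A = (op_algebra C F)\<lparr>carrier := B\<rparr>)"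

section \<open>Unitary dual and spectrum\<close>

text \<open>A representation is a space \<open>V\<close> together with the action \<open>\<rho>\<close> of the algebra on it.\<close>

definition unitary_rep :: "'a alg \<Rightarrow> 'v inner_space \<Rightarrow> ('a \<Rightarrow> 'v \<Rightarrow> 'v) \<Rightarrow> bool" where
  "unitary_rep A V \<rho> \<longleftrightarrow> hilbert V \<and>
     (\<forall>a\<in>carrier A. linear_map V V (\<rho> a) \<and> bounded_map V V (\<rho> a)) \<and>
     (\<forall>a\<in>carrier A. \<forall>b\<in>carrier A. \<forall>v\<in>carrier V.
        \<rho> (a \<oplus>\<^bsub>A\<^esub> b) v = \<rho> a v \<oplus>\<^bsub>V\<^esub> \<rho> b v \<and> \<rho> (a \<otimes>\<^bsub>A\<^esub> b) v = \<rho> a (\<rho> b v)) \<and>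
     (\<forall>z. \<forall>a\<in>carrier A. \<forall>v\<in>carrier V. \<rho> (z \<odot>\<^bsub>A\<^esub> a) v = z \<odot>\<^bsub>V\<^esub> \<rho> a v) \<and>
     (\<forall>a\<in>carrier A. \<forall>u\<in>carrier V. \<forall>v\<in>carrier V. ip V (\<rho> a u) v = ip V u (\<rho> (star A a) v)) \<and>
     vtopology V closure_of lin_span V {\<rho> a v | a v. a \<in> carrier A \<and> v \<in> carrier V} = carrier V"

definition irreducible_rep :: "'a alg \<Rightarrow> 'v inner_space \<Rightarrow> ('a \<Rightarrow> 'v \<Rightarrow> 'v) \<Rightarrow> bool" where
  "irreducible_rep A V \<rho> \<longleftrightarrow> unitary_rep A V \<rho> \<and> carrier V \<noteq> {\<zero>\<^bsub>V\<^esub>} \<and>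
     (\<forall>W. submodule W complex_ring V \<and> (\<forall>a\<in>carrier A. \<rho> a ` W \<subseteq> W) \<and> closedin (vtopology V) W
        \<longrightarrow> W = {\<zero>\<^bsub>V\<^esub>} \<or> W = carrier V)"

text \<open>
  The unitary dual is formed from the representations whose vectors have type \<open>'a \<Rightarrow> complex\<close>, where
  \<open>'a\<close> is the type of the algebra. Up to unitary isomorphism these are all the irreducible
  representations: if \<open>v \<noteq> 0\<close> is a vector of an irreducible \<open>V\<close>, then \<open>Av\<close> is dense in \<open>V\<close>, so
  sending \<open>w\<close> to \<open>\<lambda>a. \<langle>w, av\<rangle>\<close> is an injective linear map along which the structure can be
  transported.
\<close>

type_synonym 'a dual_rep = "('a \<Rightarrow> complex) inner_space \<times> ('a \<Rightarrow> ('a \<Rightarrow> complex) \<Rightarrow> ('a \<Rightarrow> complex))"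

definition irreps :: "'a alg \<Rightarrow> 'a dual_rep set" where
  "irreps A = {(V, \<rho>). irreducible_rep A V \<rho>}"

definition rep_iso :: "'a alg \<Rightarrow> 'a dual_rep rel" where
  "rep_iso A = {((V, \<rho>), (W, \<sigma>)). (V, \<rho>) \<in> irreps A \<and> (W, \<sigma>) \<in> irreps A \<and>
     (\<exists>f. unitary_map V W f \<and> (\<forall>a\<in>carrier A. \<forall>v\<in>carrier V. f (\<rho> a v) = \<sigma> a (f v)))}"

definition rep_class :: "'a alg \<Rightarrow> 'a dual_rep \<Rightarrow> 'a dual_rep set" where
  "rep_class A R = rep_iso A `` {R}"

definition unitary_dual :: "'a alg \<Rightarrow> 'a dual_rep set set" where
  "unitary_dual A = irreps A // rep_iso A"

definition dual_nbhd ::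
  "'a alg \<Rightarrow> ('a \<Rightarrow> complex) inner_space \<Rightarrow> ('a \<Rightarrow> ('a \<Rightarrow> complex) \<Rightarrow> ('a \<Rightarrow> complex)) \<Rightarrow>
     ('a \<Rightarrow> complex) \<Rightarrow> real \<Rightarrow> 'a set \<Rightarrow> 'a dual_rep set set" where
  "dual_nbhd A V \<rho> v \<epsilon> S = {rep_class A (U, \<sigma>) | U \<sigma>. (U, \<sigma>) \<in> irreps A \<and>
     (\<exists>u\<in>carrier U. \<forall>a\<in>S. cmod (ip V (\<rho> a v) v - ip U (\<sigma> a u) u) < \<epsilon>)}"

definition dual_topology :: "'a alg \<Rightarrow> 'a dual_rep set topology" where
  "dual_topology A = topology_generated_by {dual_nbhd A V \<rho> v \<epsilon> S | V \<rho> v \<epsilon> S.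
     (V, \<rho>) \<in> irreps A \<and> v \<in> carrier V \<and> vnorm V v = 1 \<and> 0 < \<epsilon> \<and> finite S \<and> S \<subseteq> carrier A}"

definition weakly_contained ::
  "'a alg \<Rightarrow> 'v inner_space \<Rightarrow> ('a \<Rightarrow> 'v \<Rightarrow> 'v) \<Rightarrow> 'w inner_space \<Rightarrow> ('a \<Rightarrow> 'w \<Rightarrow> 'w) \<Rightarrow> bool" where
  "weakly_contained A V \<rho> V' \<rho>' \<longleftrightarrow>
     (\<forall>v \<epsilon> S. v \<in> carrier V \<and> vnorm V v = 1 \<and> 0 < \<epsilon> \<and> finite S \<and> S \<subseteq> carrier A \<longrightarrow>
        (\<exists>v'\<in>carrier V'. vnorm V' v' = 1 \<and>
           (\<forall>a\<in>S. cmod (ip V (\<rho> a v) v - ip V' (\<rho>' a v') v') < \<epsilon>)))"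

definition rep_spectrum ::
  "'a alg \<Rightarrow> 'w inner_space \<Rightarrow> ('a \<Rightarrow> 'w \<Rightarrow> 'w) \<Rightarrow> 'a dual_rep set set" where
  "rep_spectrum A V' \<rho>' =
     {rep_class A (V, \<rho>) | V \<rho>. (V, \<rho>) \<in> irreps A \<and> weakly_contained A V \<rho> V' \<rho>'}"

definition image_space ::
  "('o, 'm, 'v inner_space, 'v \<Rightarrow> 'v) cfunctor \<Rightarrow> ('o \<Rightarrow> 'v \<Rightarrow> 'v) alg \<Rightarrow> 'o \<Rightarrow> 'v inner_space" where
  "image_space F A x = (ob F x)\<lparr>carrier :=
     lin_span (ob F x) {a x u | a u. a \<in> carrier A \<and> u \<in> carrier (ob F x)}\<rparr>"

definition spectrum ::
  "('o, 'm, 'v inner_space, 'v \<Rightarrow> 'v) cfunctor \<Rightarrow> ('o \<Rightarrow> 'v \<Rightarrow> 'v) alg \<Rightarrow> 'o \<Rightarrow>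
     ('o \<Rightarrow> 'v \<Rightarrow> 'v) dual_rep set set" where
  "spectrum F A x = rep_spectrum A
     (completion (image_space F A x)) (\<lambda>a. completion_op (image_space F A x) (a x))"

end

theory Submission
  imports Defs
begin

text \<open>
  Since \<open>\<Gamma>\<close> acts freely, the quotient map by \<open>\<Gamma>\<close> is injective on a ball around \<open>g v\<close> iff \<open>g\<^sup>-\<^sup>1\<Gamma>g\<close> meets a
  certain finite union of transporters of cells only in \<open>1\<close>; these unions are compact and exhaust the
  compact subsets of \<open>G\<close>, whence (1) \<open>\<longleftrightarrow>\<close> (2).

  Let \<open>v\<close> be a unit vector of an irreducible representation weakly contained in \<open>F X\<close>. Its
  coefficients are approximated by those of vectors of \<open>F X\<close>, and finitely many of these can be moved
  isometrically to some \<open>F(X/\<Gamma>\<^sub>\<alpha>)\<close>: in the elementary functor around \<open>F\<close>, they are supported on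
  finitely many points, with compact stabilizers. By the Schur test the elements of \<open>A\<close> act on all
  quotients with a common bound, so the functionals \<open>a \<mapsto> \<langle>a w, w\<rangle>\<close> with \<open>\<parallel>w\<parallel> \<le> 1\<close> lie in a compact
  convex set. The coefficient of \<open>v\<close> is an extreme point of it, so it has arbitrarily small slices around
  it. Such a slice meets the hull of the coefficients of a single \<open>F(X/\<Gamma>\<^sub>\<alpha>)\<close>; the extreme point of this
  hull maximizing the functional that defines the slice comes from an irreducible representation
  weakly contained in \<open>F(X/\<Gamma>\<^sub>\<alpha>)\<close>.
\<close>

section \<open>Inner product spaces\<close>

lemma carrier_complex_ring [simp]: "carrier complex_ring = UNIV"
  and add_complex_ring [simp]: "x \<oplus>\<^bsub>complex_ring\<^esub> y = x + y"
  and mult_complex_ring [simp]: "x \<otimes>\<^bsub>complex_ring\<^esub> y = x * y"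
  and zero_complex_ring [simp]: "\<zero>\<^bsub>complex_ring\<^esub> = 0"
  and one_complex_ring [simp]: "\<one>\<^bsub>complex_ring\<^esub> = 1"
  by (simp_all add: complex_ring_def)

lemma cring_complex_ring: "cring complex_ring"
proof (rule cringI)
  show "abelian_group complex_ring"
  proof (rule abelian_groupI)
    show "\<exists>y\<in>carrier complex_ring. y \<oplus>\<^bsub>complex_ring\<^esub> x = \<zero>\<^bsub>complex_ring\<^esub>" for x
      by (rule bexI[of _ "-x"]) auto
  qed (auto simp: algebra_simps)
  show "Group.comm_monoid complex_ring"
    by (rule comm_monoidI) auto
qed (simp_all add: algebra_simps)

text \<open>Discriminant argument: insert the minimizing \<open>z = - c / q\<close>, or, if
  \<open>q = 0\<close>, use that a real linear function bounded below is constant. Both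
  Cauchy-Schwarz inequalities, for vectors and for positive functionals, come from it; with
  \<open>p = 0\<close> it expresses the vanishing of a first variation.\<close>

lemma quadratic_nonneg_imp_le:
  assumes nonneg: "\<And>z. 0 \<le> p + 2 * Re (cnj z * c) + (cmod z)\<^sup>2 * q" and q: "0 \<le> (q::real)"
  shows "(cmod c)\<^sup>2 \<le> p * q"
proof (cases "q = 0")
  case True
  have p: "0 \<le> p" using nonneg[of 0] by simp
  have *: "0 \<le> p - 2 * t * (cmod c)\<^sup>2" for t :: real
  proof -
    have "Re (cnj (- of_real t * c) * c) = - t * (cmod c)\<^sup>2"
      by (simp add: cmod_power2) (simp add: power2_eq_square algebra_simps)
    then show ?thesis using nonneg[of "- of_real t * c"] True by simp
  qed
  have "c = 0"
  proof (rule ccontr)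
    assume "c \<noteq> 0"
    then have "(cmod c)\<^sup>2 > 0" by simp
    \<comment> \<open>This \<open>t\<close> turns the right-hand side into
      \<open>- p - 2\<close>.\<close>
    with *[of "(p+1)/(cmod c)\<^sup>2"] p show False by simp
  qed
  then show ?thesis using True by simp
next
  case False
  with q have q: "0 < q" by simp
  have "0 \<le> p + 2 * Re (cnj (- c / of_real q) * c) + (cmod (- c / of_real q))\<^sup>2 * q"
    by (rule nonneg)
  also have "Re (cnj (- c / of_real q) * c) = - (cmod c)\<^sup>2 / q"
    using q cmod_power2[of c] by (simp add: power2_eq_square field_simps)
  also have "(cmod (- c / of_real q))\<^sup>2 * q = (cmod c)\<^sup>2 / q"
    using q by (simp add: norm_divide power2_eq_square field_simps)
  finally have "0 \<le> p - (cmod c)\<^sup>2 / q" by simp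
  then show ?thesis using q by (simp add: field_simps)
qed

locale prehil =
  fixes V :: "'v inner_space" (structure)
  assumes pre_hilbert: "pre_hilbert V"
begin

sublocale Module.module complex_ring V
  using pre_hilbert by (simp add: pre_hilbert_def)

lemma smult_in [simp, intro]: "u \<in> carrier V \<Longrightarrow> c \<odot> u \<in> carrier V"
  by simp

lemma ip_commute: "u \<in> carrier V \<Longrightarrow> v \<in> carrier V \<Longrightarrow> ip V v u = cnj (ip V u v)"
  using pre_hilbert unfolding pre_hilbert_def by blast

lemma ip_add_left [simp]:
  "u \<in> carrier V \<Longrightarrow> v \<in> carrier V \<Longrightarrow> w \<in> carrier V \<Longrightarrow> ip V (u \<oplus> v) w = ip V u w + ip V v w"
  using pre_hilbert unfolding pre_hilbert_def by blast

lemma ip_smult_left [simp]: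
  "u \<in> carrier V \<Longrightarrow> v \<in> carrier V \<Longrightarrow> ip V (c \<odot> u) v = c * ip V u v"
  using pre_hilbert unfolding pre_hilbert_def by blast

lemma ip_add_right [simp]:
  "u \<in> carrier V \<Longrightarrow> v \<in> carrier V \<Longrightarrow> w \<in> carrier V \<Longrightarrow> ip V w (u \<oplus> v) = ip V w u + ip V w v"
  by (subst (1 2 3) ip_commute) auto

lemma ip_smult_right [simp]:
  "u \<in> carrier V \<Longrightarrow> v \<in> carrier V \<Longrightarrow> ip V v (c \<odot> u) = cnj c * ip V v u"
  by (subst (1 2) ip_commute) auto

lemma neg_eq_smult: "u \<in> carrier V \<Longrightarrow> \<ominus> u = (-1) \<odot> u"
proof -
  assume u: "u \<in> carrier V"
  have "u \<oplus> (-1) \<odot> u = (1 + -1) \<odot> u"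
    using u smult_l_distr[of 1 "-1" u] smult_one[of u] by simp
  also have "\<dots> = \<zero>" using u smult_l_null[of u] by simp
  finally have "(-1) \<odot> u \<oplus> u = \<zero>" using u by (simp add: a_comm)
  then show ?thesis using u by (simp add: M.minus_equality)
qed

lemma ip_minus_left [simp]:
  "u \<in> carrier V \<Longrightarrow> v \<in> carrier V \<Longrightarrow> w \<in> carrier V \<Longrightarrow> ip V (u \<ominus> v) w = ip V u w - ip V v w"
  by (simp add: a_minus_def neg_eq_smult)

lemma ip_minus_right [simp]:
  "u \<in> carrier V \<Longrightarrow> v \<in> carrier V \<Longrightarrow> w \<in> carrier V \<Longrightarrow> ip V w (u \<ominus> v) = ip V w u - ip V w v"
  by (simp add: a_minus_def neg_eq_smult)

lemma ip_zero_left [simp]: "w \<in> carrier V \<Longrightarrow> ip V \<zero> w = 0"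
  using ip_smult_left[of \<zero> w 0] by simp

lemma ip_zero_right [simp]: "w \<in> carrier V \<Longrightarrow> ip V w \<zero> = 0"
  using ip_smult_right[of \<zero> w 0] by simp

lemma Im_ip_self [simp]: "u \<in> carrier V \<Longrightarrow> Im (ip V u u) = 0"
  using ip_commute[of u u] by (metis cnj.simps(2) equal_neg_zero)

lemma Re_ip_self_pos: "u \<in> carrier V \<Longrightarrow> u \<noteq> \<zero> \<Longrightarrow> 0 < Re (ip V u u)"
  using pre_hilbert unfolding pre_hilbert_def by blast

lemma Re_ip_self_nonneg [simp]: "u \<in> carrier V \<Longrightarrow> 0 \<le> Re (ip V u u)"
  using Re_ip_self_pos[of u] ip_zero_left[of u] by (cases "u = \<zero>") auto

lemma Re_ip_self_eq_0: "u \<in> carrier V \<Longrightarrow> Re (ip V u u) = 0 \<longleftrightarrow> u = \<zero>"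
  using Re_ip_self_pos[of u] ip_zero_left[of u] by (cases "u = \<zero>") auto

lemma vnorm_nonneg [simp]: "u \<in> carrier V \<Longrightarrow> 0 \<le> vnorm V u"
  by (simp add: vnorm_def)

lemma vnorm_sq: "u \<in> carrier V \<Longrightarrow> (vnorm V u)\<^sup>2 = Re (ip V u u)"
  by (simp add: vnorm_def)

lemma ip_self: "u \<in> carrier V \<Longrightarrow> ip V u u = of_real ((vnorm V u)\<^sup>2)"
  by (simp add: vnorm_sq complex_eq_iff)

lemma vnorm_eq_0: "u \<in> carrier V \<Longrightarrow> vnorm V u = 0 \<longleftrightarrow> u = \<zero>"
  by (simp add: vnorm_def Re_ip_self_eq_0)

lemma vnorm_zero [simp]: "vnorm V \<zero> = 0"
  by (simp add: vnorm_eq_0)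

lemma vnorm_smult: "u \<in> carrier V \<Longrightarrow> vnorm V (c \<odot> u) = cmod c * vnorm V u"
proof (rule power2_eq_imp_eq)
  assume u: "u \<in> carrier V"
  have "ip V (c \<odot> u) (c \<odot> u) = of_real ((cmod c)\<^sup>2) * ip V u u"
    using u complex_norm_square[of c] by (simp add: mult.assoc[symmetric] del: of_real_power)
  also have "Re \<dots> = (cmod c)\<^sup>2 * Re (ip V u u)" by (simp only: Re_complex_of_real times_complex.simps) simp
  finally show "(vnorm V (c \<odot> u))\<^sup>2 = (cmod c * vnorm V u)\<^sup>2"
    using u by (simp add: vnorm_sq power_mult_distrib)
qed simp_all

text \<open>Cauchy-Schwarz and the formulas for sums and differences are read off from this
  expansion by choosing \<open>z\<close>.\<close>

lemma vnorm_add_smult_sq: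
  assumes "u \<in> carrier V" "v \<in> carrier V"
  shows "(vnorm V (u \<oplus> z \<odot> v))\<^sup>2
    = (vnorm V u)\<^sup>2 + 2 * Re (cnj z * ip V u v) + (cmod z)\<^sup>2 * (vnorm V v)\<^sup>2"
  using assms ip_commute[of u v]
  by (simp add: vnorm_sq cmod_power2) (simp add: power2_eq_square algebra_simps)

lemma cauchy_schwarz:
  assumes "u \<in> carrier V" "v \<in> carrier V"
  shows "cmod (ip V u v) \<le> vnorm V u * vnorm V v"
proof -
  have "(cmod (ip V u v))\<^sup>2 \<le> (vnorm V u)\<^sup>2 * (vnorm V v)\<^sup>2"
  proof (rule quadratic_nonneg_imp_le)
    show "0 \<le> (vnorm V u)\<^sup>2 + 2 * Re (cnj z * ip V u v) + (cmod z)\<^sup>2 * (vnorm V v)\<^sup>2" for z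
      using vnorm_add_smult_sq[OF assms, of z] by (metis zero_le_power2)
  qed simp
  then show ?thesis
    using assms by (metis power_mult_distrib power2_le_imp_le mult_nonneg_nonneg vnorm_nonneg)
qed

lemma vnorm_add_sq:
  assumes "u \<in> carrier V" "v \<in> carrier V"
  shows "(vnorm V (u \<oplus> v))\<^sup>2 = (vnorm V u)\<^sup>2 + 2 * Re (ip V u v) + (vnorm V v)\<^sup>2"
  using vnorm_add_smult_sq[OF assms, of 1] assms smult_one[of v] by simp

lemma vnorm_minus_sq:
  assumes "u \<in> carrier V" "v \<in> carrier V"
  shows "(vnorm V (u \<ominus> v))\<^sup>2 = (vnorm V u)\<^sup>2 - 2 * Re (ip V u v) + (vnorm V v)\<^sup>2"
  using vnorm_add_smult_sq[OF assms, of "-1"] assms by (simp add: a_minus_def neg_eq_smult)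

lemma vnorm_triangle:
  assumes "u \<in> carrier V" "v \<in> carrier V"
  shows "vnorm V (u \<oplus> v) \<le> vnorm V u + vnorm V v"
proof (rule power2_le_imp_le)
  have "Re (ip V u v) \<le> vnorm V u * vnorm V v"
    using cauchy_schwarz[OF assms] complex_Re_le_cmod order_trans by blast
  then show "(vnorm V (u \<oplus> v))\<^sup>2 \<le> (vnorm V u + vnorm V v)\<^sup>2"
    using vnorm_add_sq[OF assms] by (simp add: power2_eq_square algebra_simps)
qed (use assms in auto)

lemma vnorm_minus_commute:
  assumes "u \<in> carrier V" "v \<in> carrier V"
  shows "vnorm V (u \<ominus> v) = vnorm V (v \<ominus> u)"
  by (rule power2_eq_imp_eq) (use assms ip_commute[of u v] in \<open>simp_all add: vnorm_minus_sq\<close>)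

lemma minus_eq_zero_iff:
  assumes "u \<in> carrier V" "v \<in> carrier V"
  shows "u \<ominus> v = \<zero> \<longleftrightarrow> u = v"
proof
  assume "u \<ominus> v = \<zero>"
  then have "\<ominus> (\<ominus> v) = u" using assms by (intro M.minus_equality) (simp_all add: a_minus_def)
  then show "u = v" using assms by simp
qed (use assms in \<open>simp add: a_minus_def M.r_neg\<close>)

lemma vnorm_triangle_minus:
  assumes "u \<in> carrier V" "v \<in> carrier V" "w \<in> carrier V"
  shows "vnorm V (u \<ominus> w) \<le> vnorm V (u \<ominus> v) + vnorm V (v \<ominus> w)"
proof -
  have "u \<ominus> w = (u \<ominus> v) \<oplus> (v \<ominus> w)"
    using assms unfolding a_minus_def
    by (simp add: M.a_assoc) (simp add: M.r_neg2 M.r_neg1)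
  then show ?thesis using vnorm_triangle[of "u \<ominus> v" "v \<ominus> w"] assms by simp
qed

lemma minus_zero [simp]: "u \<in> carrier V \<Longrightarrow> u \<ominus> \<zero> = u"
  using smult_r_null[of "-1"] by (simp add: a_minus_def neg_eq_smult)

lemma vnorm_diff_le:
  assumes "u \<in> carrier V" "v \<in> carrier V"
  shows "\<bar>vnorm V u - vnorm V v\<bar> \<le> vnorm V (u \<ominus> v)"
proof -
  have "vnorm V u \<le> vnorm V (u \<ominus> v) + vnorm V v"
    using vnorm_triangle_minus[of u v \<zero>] assms by simp
  moreover have "vnorm V v \<le> vnorm V (v \<ominus> u) + vnorm V u"
    using vnorm_triangle_minus[of v u \<zero>] assms by simp
  ultimately show ?thesis using vnorm_minus_commute[OF assms] by simp
qed

sublocale MS: Metric_space "carrier V" "vdist V"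
proof
  show "0 \<le> vdist V u v" for u v by (simp add: vdist_def)
  show "vdist V u v = vdist V v u" for u v
    by (simp add: vdist_def vnorm_minus_commute)
  show "vdist V u v = 0 \<longleftrightarrow> u = v" if "u \<in> carrier V" "v \<in> carrier V" for u v
    using that by (simp add: vdist_def vnorm_eq_0 minus_eq_zero_iff)
  show "vdist V u w \<le> vdist V u v + vdist V v w"
    if "u \<in> carrier V" "v \<in> carrier V" "w \<in> carrier V" for u v w
    using that by (simp add: vdist_def vnorm_triangle_minus)
qed

lemma vector_eqI:
  assumes "u \<in> carrier V" "v \<in> carrier V" "\<And>w. w \<in> carrier V \<Longrightarrow> ip V u w = ip V v w"
  shows "u = v"
proof -
  have "Re (ip V (u \<ominus> v) (u \<ominus> v)) = 0"
    using assms by (simp del: ip_minus_right)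
  then have "u \<ominus> v = \<zero>" using assms Re_ip_self_eq_0[of "u \<ominus> v"] by blast
  then show ?thesis using assms minus_eq_zero_iff by blast
qed

end

section \<open>Convergence and completeness in terms of sequences\<close>

definition vconv :: "'v inner_space \<Rightarrow> (nat \<Rightarrow> 'v) \<Rightarrow> 'v \<Rightarrow> bool" where
  "vconv V s x \<longleftrightarrow> (\<forall>n. s n \<in> carrier V) \<and> x \<in> carrier V \<and> (\<lambda>n. vnorm V (s n \<ominus>\<^bsub>V\<^esub> x)) \<longlonglongrightarrow> 0"

definition vcauchy :: "'v inner_space \<Rightarrow> (nat \<Rightarrow> 'v) \<Rightarrow> bool" where
  "vcauchy V s \<longleftrightarrow> (\<forall>n. s n \<in> carrier V) \<and>
     (\<forall>e>0. \<exists>N. \<forall>m\<ge>N. \<forall>n\<ge>N. vnorm V (s m \<ominus>\<^bsub>V\<^esub> s n) < e)"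

context prehil
begin

lemma vconvD: "vconv V s x \<Longrightarrow> s n \<in> carrier V" "vconv V s x \<Longrightarrow> x \<in> carrier V"
  by (auto simp: vconv_def)

text \<open>Topological convergence constrains only a tail of the sequence, and \<open>vdist\<close>
  is 0 outside the carrier; hence all terms are assumed to lie in the carrier here, and
  \<open>vconv\<close> has this built in.\<close>

lemma limitin_iff_vconv:
  assumes "\<And>n. s n \<in> carrier V"
  shows "limitin MS.mtopology s x sequentially \<longleftrightarrow> vconv V s x"
  unfolding MS.limit_metric_sequentially vconv_def LIMSEQ_iff
  using assms by (auto simp: vdist_def)

lemma MCauchy_iff_vcauchy: "MS.MCauchy s \<longleftrightarrow> vcauchy V s"
proof (cases "\<forall>n. s n \<in> carrier V")
  case True
  then have "vdist V (s m) (s n) = vnorm V (s m \<ominus> s n)" for m n by (simp add: vdist_def)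
  with True show ?thesis unfolding MS.MCauchy_def vcauchy_def by auto
qed (auto simp: MS.MCauchy_def vcauchy_def)

lemma hilbert_iff: "hilbert V \<longleftrightarrow> (\<forall>s. vcauchy V s \<longrightarrow> (\<exists>x. vconv V s x))"
  unfolding hilbert_def MS.mcomplete_def MCauchy_iff_vcauchy
  using pre_hilbert limitin_iff_vconv by (auto simp: vcauchy_def)

lemma closedin_iff_vconv:
  "closedin MS.mtopology S \<longleftrightarrow> S \<subseteq> carrier V \<and> (\<forall>s x. (\<forall>n. s n \<in> S) \<and> vconv V s x \<longrightarrow> x \<in> S)"
proof -
  have "range s \<subseteq> S \<and> limitin MS.mtopology s x sequentially \<longleftrightarrow> (\<forall>n. s n \<in> S) \<and> vconv V s x"
    if "S \<subseteq> carrier V" for s x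
    using that limitin_iff_vconv[of s x] by auto
  then show ?thesis unfolding MS.metric_closedin_iff_sequentially_closed by blast
qed

lemma closure_of_iff_vconv:
  assumes "S \<subseteq> carrier V"
  shows "x \<in> MS.mtopology closure_of S \<longleftrightarrow> (\<exists>s. (\<forall>n. s n \<in> S) \<and> vconv V s x)"
proof
  assume x: "x \<in> MS.mtopology closure_of S"
  then have xc: "x \<in> carrier V" by (simp add: MS.metric_closure_of)
  have "\<exists>y\<in>S. vnorm V (y \<ominus> x) < 1 / Suc n" for n
    using x assms unfolding MS.metric_closure_of
    by (auto simp: vdist_def vnorm_minus_commute dest!: spec[of _ "1 / Suc n"])
  then obtain s where s: "\<And>n. s n \<in> S" "\<And>n. vnorm V (s n \<ominus> x) < 1 / Suc n" by metis
  have "(\<lambda>n. vnorm V (s n \<ominus> x)) \<longlonglongrightarrow> 0"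
  proof (rule tendsto_sandwich[OF _ _ tendsto_const LIMSEQ_inverse_real_of_nat])
    show "\<forall>\<^sub>F n in sequentially. 0 \<le> vnorm V (s n \<ominus> x)"
      using s(1) xc assms by (intro always_eventually allI vnorm_nonneg M.minus_closed) auto
    show "\<forall>\<^sub>F n in sequentially. vnorm V (s n \<ominus> x) \<le> inverse (real (Suc n))"
      using s(2) by (auto simp: inverse_eq_divide intro!: always_eventually less_imp_le)
  qed
  then show "\<exists>s. (\<forall>n. s n \<in> S) \<and> vconv V s x" using s xc assms unfolding vconv_def by auto
next
  assume "\<exists>s. (\<forall>n. s n \<in> S) \<and> vconv V s x"
  then obtain s where s: "\<And>n. s n \<in> S" "vconv V s x" by auto
  then have "limitin MS.mtopology s x sequentially" using limitin_iff_vconv vconvD(1) by blast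
  then show "x \<in> MS.mtopology closure_of S"
    unfolding MS.metric_closure_of MS.limit_metric_sequentially
    using s(1) by (auto, metis MS.commute order_refl)
qed

lemma vconv_const: "x \<in> carrier V \<Longrightarrow> vconv V (\<lambda>_. x) x"
  by (simp add: vconv_def minus_eq_zero_iff[THEN iffD2])

lemma vconv_vnorm: assumes "vconv V s x" shows "(\<lambda>n. vnorm V (s n)) \<longlonglongrightarrow> vnorm V x"
proof -
  have "(\<lambda>n. vnorm V (s n) - vnorm V x) \<longlonglongrightarrow> 0"
    by (rule Lim_null_comparison[of _ "\<lambda>n. vnorm V (s n \<ominus> x)"])
       (use assms vnorm_diff_le in \<open>auto simp: vconv_def\<close>)
  then show ?thesis by (simp add: LIM_zero_iff)
qed

lemma vconv_ip:
  assumes s: "vconv V s x" and t: "vconv V t y"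
  shows "(\<lambda>n. ip V (s n) (t n)) \<longlonglongrightarrow> ip V x y"
proof -
  have "(\<lambda>n. ip V (s n) (t n) - ip V x y) \<longlonglongrightarrow> 0"
  proof (rule Lim_null_comparison)
    show "\<forall>\<^sub>F n in sequentially. norm (ip V (s n) (t n) - ip V x y)
        \<le> vnorm V (s n \<ominus> x) * vnorm V (t n) + vnorm V x * vnorm V (t n \<ominus> y)"
    proof (intro always_eventually allI)
      fix n
      note c = vconvD(1)[OF s] vconvD(2)[OF s] vconvD(1)[OF t] vconvD(2)[OF t]
      have "ip V (s n) (t n) - ip V x y = ip V (s n \<ominus> x) (t n) + ip V x (t n \<ominus> y)"
        using c by simp
      also have "norm \<dots> \<le> norm (ip V (s n \<ominus> x) (t n)) + norm (ip V x (t n \<ominus> y))"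
        by (rule norm_triangle_ineq)
      also have "\<dots> \<le> vnorm V (s n \<ominus> x) * vnorm V (t n) + vnorm V x * vnorm V (t n \<ominus> y)"
        using c by (intro add_mono cauchy_schwarz) auto
      finally show "norm (ip V (s n) (t n) - ip V x y)
        \<le> vnorm V (s n \<ominus> x) * vnorm V (t n) + vnorm V x * vnorm V (t n \<ominus> y)" .
    qed
    have "(\<lambda>n. vnorm V (s n \<ominus> x) * vnorm V (t n) + vnorm V x * vnorm V (t n \<ominus> y))
        \<longlonglongrightarrow> 0 * vnorm V y + vnorm V x * 0"
      using s t vconv_vnorm[OF t] by (intro tendsto_intros) (auto simp: vconv_def)
    then show "(\<lambda>n. vnorm V (s n \<ominus> x) * vnorm V (t n) + vnorm V x * vnorm V (t n \<ominus> y)) \<longlonglongrightarrow> 0"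
      by simp
  qed
  then show ?thesis by (simp add: LIM_zero_iff)
qed

lemma vconv_ip_left: "vconv V s x \<Longrightarrow> y \<in> carrier V \<Longrightarrow> (\<lambda>n. ip V (s n) y) \<longlonglongrightarrow> ip V x y"
  using vconv_ip[OF _ vconv_const] by blast

lemma vconv_ip_right: "vconv V s x \<Longrightarrow> y \<in> carrier V \<Longrightarrow> (\<lambda>n. ip V y (s n)) \<longlonglongrightarrow> ip V y x"
  using vconv_ip[OF vconv_const] by blast

lemma vconv_unique:
  assumes "vconv V s x" "vconv V s y"
  shows "x = y"
proof (rule vector_eqI)
  show "x \<in> carrier V" "y \<in> carrier V" using assms vconvD(2) by auto
  show "ip V x w = ip V y w" if "w \<in> carrier V" for w
    using LIMSEQ_unique[OF vconv_ip_left[OF assms(1) that] vconv_ip_left[OF assms(2) that]] .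
qed

lemma linear_map_props:
  assumes "linear_map V V f" "u \<in> carrier V"
  shows "f u \<in> carrier V" "v \<in> carrier V \<Longrightarrow> f (u \<oplus> v) = f u \<oplus> f v" "f (c \<odot> u) = c \<odot> f u"
    "v \<in> carrier V \<Longrightarrow> f (u \<ominus> v) = f u \<ominus> f v"
proof -
  show 1: "f u \<in> carrier V" using assms unfolding linear_map_def by blast
  show 2: "f (u \<oplus> v) = f u \<oplus> f v" if "v \<in> carrier V" for v
    using assms that unfolding linear_map_def by blast
  show 3: "f (c \<odot> u) = c \<odot> f u" for c using assms unfolding linear_map_def by blast
  show "f (u \<ominus> v) = f u \<ominus> f v" if v: "v \<in> carrier V"
  proof -
    have "f v \<in> carrier V" "f ((-1) \<odot> v) = (-1) \<odot> f v"
      using assms(1) v unfolding linear_map_def by blast+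
    then show ?thesis using 2[of "(-1) \<odot> v"] v by (simp add: a_minus_def neg_eq_smult)
  qed
qed

lemma vconv_map:
  assumes s: "vconv V s x" and f: "linear_map V V f" "bounded_map V V f"
  shows "vconv V (\<lambda>n. f (s n)) (f x)"
proof -
  note c = vconvD(1)[OF s] vconvD(2)[OF s]
  obtain k where k: "\<And>u. u \<in> carrier V \<Longrightarrow> vnorm V (f u) \<le> k * vnorm V u"
    using f(2) unfolding bounded_map_def by auto
  have fc: "f u \<in> carrier V" if "u \<in> carrier V" for u
    using f(1) that unfolding linear_map_def by auto
  have "(\<lambda>n. vnorm V (f (s n) \<ominus> f x)) \<longlonglongrightarrow> 0"
  proof (rule tendsto_sandwich[OF _ _ tendsto_const])
    show "\<forall>\<^sub>F n in sequentially. 0 \<le> vnorm V (f (s n) \<ominus> f x)"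
      using c fc by (intro always_eventually) auto
    show "\<forall>\<^sub>F n in sequentially. vnorm V (f (s n) \<ominus> f x) \<le> k * vnorm V (s n \<ominus> x)"
      using k c linear_map_props(4)[OF f(1)] by (intro always_eventually allI) (metis M.minus_closed)
    show "(\<lambda>n. k * vnorm V (s n \<ominus> x)) \<longlonglongrightarrow> 0"
      using s tendsto_mult_right_zero unfolding vconv_def by blast
  qed
  then show ?thesis using c fc unfolding vconv_def by auto
qed

end

text \<open>The bound is on the squared distance and splits into one term for each index, since this
  is what the parallelogram law yields for a minimizing sequence.\<close>

lemma vcauchyI:
  fixes V :: "'v inner_space" (structure)
  assumes V: "prehil V" and "\<And>n. s n \<in> carrier V"
    and le: "\<And>m n. (vnorm V (s m \<ominus>\<^bsub>V\<^esub> s n))\<^sup>2 \<le> c m + c n" and c: "c \<longlonglongrightarrow> (0::real)"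
  shows "vcauchy V s"
  unfolding vcauchy_def
proof (intro conjI allI impI)
  interpret prehil V by fact
  fix e :: real assume e: "e > 0"
  then have "e\<^sup>2/2 > 0" by simp
  with c have "\<forall>\<^sub>F n in sequentially. c n < e\<^sup>2/2" by (rule order_tendstoD(2))
  then obtain N where N: "\<And>n. n \<ge> N \<Longrightarrow> c n < e\<^sup>2/2" unfolding eventually_sequentially by auto
  show "\<exists>N. \<forall>m\<ge>N. \<forall>n\<ge>N. vnorm V (s m \<ominus>\<^bsub>V\<^esub> s n) < e"
  proof (intro exI allI impI)
    fix m n assume "N \<le> m" "N \<le> n"
    then have "(vnorm V (s m \<ominus>\<^bsub>V\<^esub> s n))\<^sup>2 < e\<^sup>2" using N[of m] N[of n] le[of m n] by linarith
    then show "vnorm V (s m \<ominus>\<^bsub>V\<^esub> s n) < e" using e by (simp add: power_less_imp_less_base)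
  qed
qed (use assms in auto)

text \<open>
  The Riesz theorem for a functional on a subspace \<open>D\<close> that need not be closed: the vectors of \<open>D\<close>
  minimizing \<open>\<parallel>x\<parallel>\<^sup>2 - 2 Re (L x)\<close> approximately form a Cauchy sequence, by the parallelogram law.
  For \<open>L = \<langle>-, x\<rangle>\<close> this is the orthogonal projection of \<open>x\<close> to the closure of \<open>D\<close>.
\<close>

lemma riesz_on_subspace:
  fixes V :: "'v inner_space" (structure)
  assumes V: "hilbert V" and D: "D \<subseteq> carrier V" "D \<noteq> {}"
    and D_add: "\<And>x y. x \<in> D \<Longrightarrow> y \<in> D \<Longrightarrow> x \<oplus>\<^bsub>V\<^esub> y \<in> D"
    and D_smult: "\<And>c x. x \<in> D \<Longrightarrow> c \<odot>\<^bsub>V\<^esub> x \<in> D"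
    and L_add: "\<And>x y. x \<in> D \<Longrightarrow> y \<in> D \<Longrightarrow> L (x \<oplus>\<^bsub>V\<^esub> y) = L x + L y"
    and L_smult: "\<And>c x. x \<in> D \<Longrightarrow> L (c \<odot>\<^bsub>V\<^esub> x) = c * L x"
    and L_bound: "\<And>x. x \<in> D \<Longrightarrow> cmod (L x) \<le> k * vnorm V x"
  shows "\<exists>s d. (\<forall>n. s n \<in> D) \<and> vconv V s d \<and> (\<forall>x\<in>D. L x = ip V x d)"
proof -
  interpret prehil V using V by unfold_locales (simp add: hilbert_def)
  define J where "J x = (vnorm V x)\<^sup>2 - 2 * Re (L x)" for x
  have J_bdd: "- (k\<^sup>2) \<le> J x" if "x \<in> D" for x
  proof -
    have "Re (L x) \<le> k * vnorm V x" using L_bound[OF that] complex_Re_le_cmod order_trans by blast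
    moreover have "0 \<le> (vnorm V x - k)\<^sup>2" by simp
    ultimately show ?thesis unfolding J_def by (simp add: power2_eq_square algebra_simps)
  qed
  define m where "m = Inf (J ` D)"
  have bdd: "bdd_below (J ` D)" using J_bdd by (auto intro!: bdd_belowI)
  have m_le: "m \<le> J x" if "x \<in> D" for x unfolding m_def using bdd that by (simp add: cInf_lower)
  have "\<exists>x\<in>D. J x < m + 1 / Suc n" for n
    using cInf_lessD[of "J ` D" "m + 1 / Suc n"] D(2) unfolding m_def by auto
  then obtain s where s: "\<And>n. s n \<in> D" "\<And>n. J (s n) < m + 1 / Suc n" by metis
  have sc: "s n \<in> carrier V" for n using s D by auto
  have inv0: "(\<lambda>n. 1 / real (Suc n)) \<longlonglongrightarrow> 0"
    using LIMSEQ_inverse_real_of_nat by (simp add: inverse_eq_divide)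
  have "vcauchy V s"
  proof (rule vcauchyI[of V s "\<lambda>n. 2 * (1 / Suc n)"])
    fix i j
    let ?c = "(1/2) \<odot> (s i \<oplus> s j)"
    have cD: "?c \<in> D" using s D_add D_smult by blast
    have "m \<le> J ?c" by (rule m_le[OF cD])
    moreover have "J ?c = (vnorm V (s i \<oplus> s j))\<^sup>2 / 4 - (Re (L (s i)) + Re (L (s j)))"
      unfolding J_def using s(1) L_add L_smult D_add sc
      by (simp add: vnorm_smult power_mult_distrib power_divide add_divide_distrib)
    moreover have "(vnorm V (s i \<oplus> s j))\<^sup>2 + (vnorm V (s i \<ominus> s j))\<^sup>2
        = 2 * (vnorm V (s i))\<^sup>2 + 2 * (vnorm V (s j))\<^sup>2"
      using sc by (simp add: vnorm_add_sq vnorm_minus_sq)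
    moreover have "J (s i) < m + 1 / Suc i" "J (s j) < m + 1 / Suc j" by (rule s(2))+
    ultimately show "(vnorm V (s i \<ominus> s j))\<^sup>2 \<le> 2 * (1 / Suc i) + 2 * (1 / Suc j)"
      unfolding J_def by linarith
  qed (use sc inv0 tendsto_mult_right_zero[of "\<lambda>n. 1 / real (Suc n)" sequentially 2] in
        \<open>auto intro: prehil_axioms\<close>)
  then obtain d where d: "vconv V s d" using V hilbert_iff by blast
  have "L x = ip V x d" if x: "x \<in> D" for x
  proof -
    have xc: "x \<in> carrier V" using x D by auto
    \<comment> \<open>First variation. The limit \<open>d\<close> need not lie in \<open>D\<close>,
      so the perturbation is made at \<open>s n\<close>, which minimizes up to
      \<open>1 / Suc n\<close>; in the limit a quadratic in \<open>z\<close> without constant term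
      remains nonnegative.\<close>
    have "(cmod (ip V d x - cnj (L x)))\<^sup>2 \<le> 0 * (vnorm V x)\<^sup>2"
    proof (rule quadratic_nonneg_imp_le)
      fix z
      have *: "0 \<le> 1 / Suc n + 2 * Re (cnj z * (ip V (s n) x - cnj (L x))) + (cmod z)\<^sup>2 * (vnorm V x)\<^sup>2"
        for n
      proof -
        have "m \<le> J (s n \<oplus> z \<odot> x)" using m_le s(1) x D_add D_smult by blast
        moreover have "J (s n \<oplus> z \<odot> x) = J (s n) + 2 * Re (cnj z * (ip V (s n) x - cnj (L x)))
             + (cmod z)\<^sup>2 * (vnorm V x)\<^sup>2"
          unfolding J_def using s(1) x L_add L_smult D_smult sc xc
          by (simp add: vnorm_add_smult_sq algebra_simps)
        ultimately show ?thesis using s(2)[of n] by linarith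
      qed
      have "(\<lambda>n. 1 / Suc n + 2 * Re (cnj z * (ip V (s n) x - cnj (L x))) + (cmod z)\<^sup>2 * (vnorm V x)\<^sup>2)
          \<longlonglongrightarrow> 0 + 2 * Re (cnj z * (ip V d x - cnj (L x))) + (cmod z)\<^sup>2 * (vnorm V x)\<^sup>2"
        by (intro tendsto_intros inv0 vconv_ip_left[OF d xc])
      then show "0 \<le> 0 + 2 * Re (cnj z * (ip V d x - cnj (L x))) + (cmod z)\<^sup>2 * (vnorm V x)\<^sup>2"
        by (rule LIMSEQ_le_const) (use * in auto)
    qed simp
    then have "ip V d x = cnj (L x)" by simp
    then show ?thesis using ip_commute[of d x] vconvD(2)[OF d] xc by simp
  qed
  with s d show ?thesis by blast
qed

section \<open>Compact convex sets of functionals\<close>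

text \<open>Functionals are points of the product space \<open>'a \<Rightarrow> complex\<close>, so
  its topology is that of pointwise convergence, the weak-* topology. The parameter is the weight of
  the second point.\<close>

definition mix :: "real \<Rightarrow> ('a \<Rightarrow> complex) \<Rightarrow> ('a \<Rightarrow> complex) \<Rightarrow> 'a \<Rightarrow> complex" where
  "mix t x y = (\<lambda>a. of_real (1 - t) * x a + of_real t * y a)"

definition convex_fun :: "('a \<Rightarrow> complex) set \<Rightarrow> bool" where
  "convex_fun K \<longleftrightarrow> (\<forall>x\<in>K. \<forall>y\<in>K. \<forall>t. 0 \<le> t \<and> t \<le> 1 \<longrightarrow> mix t x y \<in> K)"

definition extreme_fun :: "('a \<Rightarrow> complex) \<Rightarrow> ('a \<Rightarrow> complex) set \<Rightarrow> bool" where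
  "extreme_fun \<phi> K \<longleftrightarrow> \<phi> \<in> K \<and>
     (\<forall>x\<in>K. \<forall>y\<in>K. \<forall>t. 0 < t \<and> t < 1 \<and> mix t x y = \<phi> \<longrightarrow> x = \<phi> \<and> y = \<phi>)"

text \<open>Faces are always taken relative to the full set \<open>K\<close>, so that passing to
  smaller and smaller faces never changes the ambient set.\<close>

definition face_fun :: "('a \<Rightarrow> complex) set \<Rightarrow> ('a \<Rightarrow> complex) set \<Rightarrow> bool" where
  "face_fun K F \<longleftrightarrow> F \<subseteq> K \<and> F \<noteq> {} \<and> closed F \<and>
     (\<forall>x\<in>K. \<forall>y\<in>K. \<forall>t. 0 < t \<and> t < 1 \<and> mix t x y \<in> F \<longrightarrow> x \<in> F \<and> y \<in> F)"

definition affine_fun :: "(('a \<Rightarrow> complex) \<Rightarrow> real) \<Rightarrow> bool" where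
  "affine_fun g \<longleftrightarrow> (\<forall>t x y. g (mix t x y) = (1 - t) * g x + t * g y)"

lemma mix_0 [simp]: "mix 0 x y = x" and mix_1 [simp]: "mix 1 x y = y"
  by (auto simp: mix_def)

lemma affine_fun_Re: "affine_fun (\<lambda>x. Re (\<Sum>a\<in>S. c a * x a))"
proof -
  have "(\<Sum>a\<in>S. c a * mix t x y a)
      = of_real (1 - t) * (\<Sum>a\<in>S. c a * x a) + of_real t * (\<Sum>a\<in>S. c a * y a)" for t x y
    by (simp only: sum_distrib_left sum.distrib[symmetric])
       (rule sum.cong, auto simp: mix_def algebra_simps)
  then show ?thesis unfolding affine_fun_def by (simp del: of_real_diff)
qed

lemma continuous_fun_coord [continuous_intros]:
  "continuous_on S f \<Longrightarrow> continuous_on S (\<lambda>x. f x (a::'a) :: complex)"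
  by (rule continuous_on_product_then_coordinatewise)

lemma continuous_fun_Re: "continuous_on UNIV (\<lambda>x :: 'a \<Rightarrow> complex. Re (\<Sum>a\<in>S. c a * x a))"
  by (intro continuous_intros)

text \<open>A proper convex combination at which an affine function attains its maximum over
  \<open>F\<close> forces both end points to attain it as well.\<close>

lemma face_maximizers:
  assumes K: "compact K" and F: "face_fun K F"
    and g: "continuous_on UNIV g" "affine_fun g"
  shows "face_fun K {x \<in> F. \<forall>y\<in>F. g y \<le> g x}"
proof -
  have Fc: "compact F" using F K unfolding face_fun_def
    by (metis compact_Int_closed inf.absorb2)
  obtain m where m: "m \<in> F" "\<And>y. y \<in> F \<Longrightarrow> g y \<le> g m"
  proof -
    have "F \<noteq> {}" using F unfolding face_fun_def by blast
    moreover have "continuous_on F g" using g(1) continuous_on_subset by blast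
    ultimately show ?thesis using continuous_attains_sup[OF Fc] that by blast
  qed
  have eq: "{x \<in> F. \<forall>y\<in>F. g y \<le> g x} = F \<inter> {x. g m \<le> g x}" 
    using m order_trans by auto
  have cl: "closed {x. g m \<le> g x}"
    using closed_Collect_le[of "\<lambda>_. g m" g] g(1) by auto
  have ext: "x \<in> F \<inter> {x. g m \<le> g x} \<and> y \<in> F \<inter> {x. g m \<le> g x}"
    if xy: "x \<in> K" "y \<in> K" and t: "0 < t" "t < 1" and mix: "mix t x y \<in> F" "g m \<le> g (mix t x y)" for x y t
  proof -
    have F': "x \<in> F" "y \<in> F" using F xy t mix unfolding face_fun_def by blast+
    have "g m \<le> (1 - t) * g x + t * g y" using mix g(2) unfolding affine_fun_def by simp
    moreover have "(1 - t) * g x \<le> (1 - t) * g m" "t * g y \<le> t * g m"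
      using m F' t by (auto intro: mult_left_mono)
    ultimately have "(1 - t) * g m \<le> (1 - t) * g x" "t * g m \<le> t * g y"
      by (auto simp: algebra_simps)
    then show ?thesis using F' t by simp
  qed
  show ?thesis
    using F m cl ext unfolding face_fun_def eq by (intro conjI closed_Int) blast+
qed

text \<open>Zorn's lemma is applied to complements, since a minimal element is wanted. The
  intersection of a chain of faces is again a face; compactness makes it nonempty.\<close>

lemma minimal_face:
  assumes K: "compact K" and F: "face_fun K F"
  shows "\<exists>E. face_fun K E \<and> E \<subseteq> F \<and> (\<forall>E'. face_fun K E' \<and> E' \<subseteq> E \<longrightarrow> E' = E)"
proof -
  let ?A = "{- E | E. face_fun K E \<and> E \<subseteq> F}"
  have "\<exists>M\<in>?A. \<forall>X\<in>?A. M \<subseteq> X \<longrightarrow> X = M"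
  proof (rule subset_Zorn_nonempty)
    show "?A \<noteq> {}" using F by auto
    fix \<C> assume ne: "\<C> \<noteq> {}" and ch: "subset.chain ?A \<C>"
    let ?B = "uminus ` \<C>"
    have B: "face_fun K E" "E \<subseteq> F" if "E \<in> ?B" for E
      using ch that unfolding subset.chain_def by auto
    have chB: "E \<subseteq> E' \<or> E' \<subseteq> E" if "E \<in> ?B" "E' \<in> ?B" for E E'
    proof -
      obtain P P' where P: "P \<in> \<C>" "P' \<in> \<C>" "E = - P" "E' = - P'" using \<open>E \<in> ?B\<close> \<open>E' \<in> ?B\<close> by auto
      have "\<forall>x\<in>\<C>. \<forall>y\<in>\<C>. x \<subseteq> y \<or> y \<subseteq> x" using ch unfolding subset_chain_def by (rule conjunct2)
      then have "P \<subseteq> P' \<or> P' \<subseteq> P" using P(1,2) by blast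
      then show ?thesis using P(3,4) by auto
    qed
    have neB: "?B \<noteq> {}" using ne by auto
    have fin: "\<exists>E\<in>?B. E \<subseteq> \<Inter> F'" if "finite F'" "F' \<subseteq> ?B" for F'
      using that
    proof (induction F')
      case empty then show ?case using neB by auto
    next
      case (insert E F')
      then obtain E' where E': "E' \<in> ?B" "E' \<subseteq> \<Inter> F'" by blast
      have "E \<in> ?B" using insert by blast
      then consider "E \<subseteq> E'" | "E' \<subseteq> E" using chB E'(1) by blast
      then show ?case
      proof cases
        case 1 then show ?thesis using E' \<open>E \<in> ?B\<close> by (intro bexI[of _ E]) auto
      next
        case 2 then show ?thesis using E' by (intro bexI[of _ E']) auto
      qed
    qed
    have "K \<inter> \<Inter> ?B \<noteq> {}"
    proof (rule compact_imp_fip[OF K])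
      show "closed T" if "T \<in> ?B" for T using B(1)[OF that] unfolding face_fun_def by blast
      show "K \<inter> \<Inter> F' \<noteq> {}" if F': "finite F'" "F' \<subseteq> ?B" for F'
      proof -
        obtain E where "E \<in> ?B" "E \<subseteq> \<Inter> F'" using fin[OF F'] by blast
        then show ?thesis using B(1)[of E] unfolding face_fun_def by blast
      qed
    qed
    then have 1: "\<Inter> ?B \<noteq> {}" by blast
    have 2: "\<Inter> ?B \<subseteq> K"
    proof -
      obtain E where "E \<in> ?B" using neB by blast
      then show ?thesis using B(1)[of E] unfolding face_fun_def by blast
    qed
    have 3: "closed (\<Inter> ?B)" using B(1) unfolding face_fun_def by (intro closed_Inter) blast
    have 4: "x \<in> \<Inter> ?B \<and> y \<in> \<Inter> ?B"
      if "x \<in> K" "y \<in> K" "0 < t" "t < 1" "mix t x y \<in> \<Inter> ?B" for x y t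
      using B(1) that unfolding face_fun_def by (meson InterE InterI)
    have "face_fun K (\<Inter> ?B)"
      unfolding face_fun_def
    proof (intro conjI ballI allI impI)
      fix x y and t :: real
      assume "x \<in> K" "y \<in> K" "0 < t \<and> t < 1 \<and> mix t x y \<in> \<Inter> ?B"
      then have "x \<in> \<Inter> ?B \<and> y \<in> \<Inter> ?B" by (intro 4[of x y t]) simp_all
      then show "x \<in> \<Inter> ?B" "y \<in> \<Inter> ?B" by simp_all
    qed (rule 2 1 3)+
    moreover have "\<Inter> ?B \<subseteq> F" using B(2) neB by blast
    moreover have "\<Union> \<C> = - \<Inter> ?B" by auto
    ultimately show "\<Union> \<C> \<in> ?A" by blast
  qed
  then obtain M where M: "M \<in> ?A" and min: "\<forall>X\<in>?A. M \<subseteq> X \<longrightarrow> X = M" by (elim bexE)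
  then obtain E where E: "M = - E" "face_fun K E" "E \<subseteq> F" by (auto simp only: mem_Collect_eq)
  have "E' = E" if E': "face_fun K E'" "E' \<subseteq> E" for E'
  proof -
    have "E' \<subseteq> F" using E' E by simp
    then have "- E' \<in> ?A" using E'(1) by (intro CollectI exI[of _ E']) simp
    moreover have "M \<subseteq> - E'" using E' E by simp
    ultimately have "- E' = M" using min by simp
    then show ?thesis using E(1) by simp
  qed
  with E show ?thesis by blast
qed

text \<open>The argument of Krein and Milman: choose a minimal face among the maximizers of
  \<open>g\<close>. Maximizing a coordinate over it cannot make it smaller, so all coordinates are
  constant on it and it is a single point.\<close>

lemma extreme_maximizer:
  assumes K: "compact K" "closed K" "K \<noteq> {}"
    and g: "continuous_on UNIV g" "affine_fun g"
  shows "\<exists>\<phi>. extreme_fun \<phi> K \<and> (\<forall>\<psi>\<in>K. g \<psi> \<le> g \<phi>)"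
proof -
  have "face_fun K K" using K unfolding face_fun_def by blast
  then have "face_fun K {x \<in> K. \<forall>y\<in>K. g y \<le> g x}" by (rule face_maximizers[OF K(1) _ g])
  then obtain E where E: "face_fun K E" "E \<subseteq> {x \<in> K. \<forall>y\<in>K. g y \<le> g x}"
    and min: "\<And>E'. face_fun K E' \<Longrightarrow> E' \<subseteq> E \<Longrightarrow> E' = E"
  proof -
    assume a: "\<And>E. face_fun K E \<Longrightarrow> E \<subseteq> {x \<in> K. \<forall>y\<in>K. g y \<le> g x} \<Longrightarrow>
      (\<And>E'. face_fun K E' \<Longrightarrow> E' \<subseteq> E \<Longrightarrow> E' = E) \<Longrightarrow> thesis"
    assume "face_fun K {x \<in> K. \<forall>y\<in>K. g y \<le> g x}"
    from minimal_face[OF K(1) this] show thesis by (elim exE conjE) (rule a, blast+)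
  qed
  have const: "h x = h y" if "x \<in> E" "y \<in> E" "continuous_on UNIV h" "affine_fun h"
    for x y and h :: "('a \<Rightarrow> complex) \<Rightarrow> real"
  proof -
    have "{x \<in> E. \<forall>y\<in>E. h y \<le> h x} = E"
      by (rule min[OF face_maximizers[OF K(1) E(1) that(3,4)]]) auto
    then show ?thesis using that(1,2) by (metis (mono_tags, lifting) mem_Collect_eq order_antisym)
  qed
  have eq: "x = y" if "x \<in> E" "y \<in> E" for x y
  proof
    fix a
    have "Re (\<Sum>a\<in>{a}. c * x a) = Re (\<Sum>a\<in>{a}. c * y a)" for c
      by (rule const[OF that continuous_fun_Re affine_fun_Re])
    \<comment> \<open>The multiplier \<open>-\<i>\<close> turns the real part into the imaginary
      part.\<close>
    from this[of 1] this[of "-\<i>"] show "x a = y a" by (simp add: complex_eq_iff)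
  qed
  obtain \<phi> where \<phi>: "\<phi> \<in> E" using E(1) unfolding face_fun_def by blast
  with eq have "E = {\<phi>}" by blast
  with E show ?thesis unfolding extreme_fun_def face_fun_def by auto
qed

text \<open>Regrouping of a combination of four points: \<open>r\<close> is the total weight of
  \<open>y\<close> and \<open>y'\<close>, and the inner parameters are the relative weights of
  \<open>x'\<close> and \<open>y'\<close> within their groups. They divide by \<open>1 - r\<close>
  and \<open>r\<close>.\<close>

lemma mix_comm_eq:
  fixes x x' y y' :: "'a \<Rightarrow> complex"
  assumes r: "r = (1 - t) * s + t * s'" and "r \<noteq> 0" "r \<noteq> 1"
  shows "mix t (mix s x y) (mix s' x' y') = mix r (mix (t * (1 - s') / (1 - r)) x x') (mix (t * s' / r) y y')"
proof
  fix a
  define u w where "u = t * (1 - s') / (1 - r)" and "w = t * s' / r"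
  have u: "(1 - r) * u = t * (1 - s')" and w: "r * w = t * s'" unfolding u_def w_def using assms by auto
  have *: "(1 - r) * (1 - u) = (1 - t) * (1 - s)" "r * (1 - w) = (1 - t) * s"
  proof -
    have "(1 - r) * (1 - u) = (1 - r) - t * (1 - s')" "r * (1 - w) = r - t * s'"
      unfolding right_diff_distrib[of _ 1] u w by simp_all
    then show "(1 - r) * (1 - u) = (1 - t) * (1 - s)" "r * (1 - w) = (1 - t) * s"
      unfolding r by (simp_all add: algebra_simps)
  qed
  have "mix r (mix u x x') (mix w y y') a
    = of_real ((1 - r) * (1 - u)) * x a + of_real ((1 - r) * u) * x' a
      + of_real (r * (1 - w)) * y a + of_real (r * w) * y' a"
    unfolding mix_def by (simp only: of_real_mult distrib_left mult.assoc add.assoc)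
  also have "\<dots> = of_real ((1 - t) * (1 - s)) * x a + of_real (t * (1 - s')) * x' a
      + of_real ((1 - t) * s) * y a + of_real (t * s') * y' a"
    by (simp only: * u w)
  also have "\<dots> = mix t (mix s x y) (mix s' x' y') a"
    unfolding mix_def by (simp add: algebra_simps)
  finally show "mix t (mix s x y) (mix s' x' y') a
    = mix r (mix (t * (1 - s') / (1 - r)) x x') (mix (t * s' / r) y y') a"
    unfolding u_def w_def by simp
qed

text \<open>The union of all segments between \<open>C\<close> and \<open>D\<close> is convex, and
  it is compact as a continuous image of a product, so no closure has to be taken. An extreme point
  of \<open>K\<close> on such a segment would be one of its ends.\<close>

lemma convex_join:
  fixes C D K :: "('a \<Rightarrow> complex) set"
  assumes C: "compact C" "convex_fun C" and D: "compact D" "convex_fun D"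
    and K: "C \<subseteq> K" "D \<subseteq> K" "convex_fun K"
    and \<phi>: "extreme_fun \<phi> K" "\<phi> \<notin> C" "\<phi> \<notin> D"
  shows "\<exists>E. compact E \<and> convex_fun E \<and> C \<union> D \<subseteq> E \<and> E \<subseteq> K \<and> \<phi> \<notin> E"
proof (cases "C = {} \<or> D = {}")
  \<comment> \<open>If one of the sets is empty there are no segments, and the other set is taken
    alone.\<close>
  case True
  then show ?thesis using C D K \<phi> by (elim disjE) (metis Un_empty_left Un_empty_right order_refl)+
next
  case False
  let ?m = "\<lambda>(t, x, y). mix t x y"
  let ?E = "?m ` ({0..1} \<times> C \<times> D)"
  have "compact ?E"
  proof (rule compact_continuous_image)
    show "continuous_on ({0..1} \<times> C \<times> D) ?m"
      unfolding mix_def case_prod_unfold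
      by (rule continuous_on_coordinatewise_then_product)
         (intro continuous_on_add continuous_on_mult continuous_on_of_real continuous_on_diff
           continuous_on_const continuous_fun_coord continuous_on_fst continuous_on_snd continuous_on_id)
    show "compact ({0..1::real} \<times> C \<times> D)" using C D by (intro compact_Times) auto
  qed
  moreover have "convex_fun ?E"
    unfolding convex_fun_def
  proof (intro ballI allI impI)
    fix p q and t :: real assume p: "p \<in> ?E" and q: "q \<in> ?E" and t: "0 \<le> t \<and> t \<le> 1"
    obtain s x y where p': "p = mix s x y" "0 \<le> s" "s \<le> 1" "x \<in> C" "y \<in> D" using p by auto
    obtain s' x' y' where q': "q = mix s' x' y'" "0 \<le> s'" "s' \<le> 1" "x' \<in> C" "y' \<in> D" using q by auto
    define r where "r = (1 - t) * s + t * s'"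
    have parts: "0 \<le> (1-t)* s" "0 \<le> t* s'" "0 \<le> (1-t)*(1-s)" "0 \<le> t*(1-s')" using t p' q' by auto
    have r1: "1 - r = (1-t)*(1-s) + t*(1-s')" unfolding r_def by (simp add: algebra_simps)
    have "0 \<le> r" using parts(1,2) unfolding r_def by simp
    moreover have "r \<le> 1" using parts(3,4) r1 by linarith
    ultimately have r01: "0 \<le> r" "r \<le> 1" .
    consider "r = 0" | "r = 1" | "r \<noteq> 0" "r \<noteq> 1" by blast
    then show "mix t p q \<in> ?E"
    proof cases
      case 1
      \<comment> \<open>Total weight 0 on \<open>D\<close> makes the coefficients of
        \<open>y\<close> and \<open>y'\<close> vanish separately, so the point lies in
        \<open>C\<close>.\<close>
      then have z: "(1-t)* s = 0" "t* s' = 0" using parts r_def by linarith+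
      have "mix t p q = mix 0 (mix t x x') y"
      proof
        fix a
        have "mix t p q a = of_real ((1-t) - (1-t)* s) * x a + of_real ((1-t)* s) * y a
           + of_real (t - t* s') * x' a + of_real (t* s') * y' a"
          unfolding p' q' mix_def by (simp add: algebra_simps)
        then show "mix t p q a = mix 0 (mix t x x') y a" unfolding z by (simp add: mix_def)
      qed
      moreover have "mix t x x' \<in> C" using C(2) p' q' t unfolding convex_fun_def by blast
      ultimately show ?thesis using p' by (intro image_eqI[of _ _ "(0, mix t x x', y)"]) auto
    next
      case 2
      then have z: "(1-t)*(1-s) = 0" "t*(1-s') = 0" using parts r1 by linarith+
      have "mix t p q = mix 1 x (mix t y y')"
      proof
        fix a
        have "mix t p q a = of_real ((1-t)*(1-s)) * x a + of_real ((1-t) - (1-t)*(1-s)) * y a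
           + of_real (t*(1-s')) * x' a + of_real (t - t*(1-s')) * y' a"
          unfolding p' q' mix_def by (simp add: algebra_simps)
        then show "mix t p q a = mix 1 x (mix t y y') a" unfolding z by (simp add: mix_def)
      qed
      moreover have "mix t y y' \<in> D" using D(2) p' q' t unfolding convex_fun_def by blast
      ultimately show ?thesis using p' by (intro image_eqI[of _ _ "(1, x, mix t y y')"]) auto
    next
      case 3
      let ?u = "t * (1 - s') / (1 - r)" and ?w = "t * s' / r"
      have pos: "0 < r" "0 < 1 - r" using 3 r01 by simp_all
      have "t * (1 - s') \<le> 1 - r" using r1 parts(3) by linarith
      moreover have "t * s' \<le> r" unfolding r_def using parts(1) by simp
      ultimately have "0 \<le> ?u" "?u \<le> 1" "0 \<le> ?w" "?w \<le> 1"
        using pos parts(2,4) by (simp_all add: pos_divide_le_eq)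
      then have "mix ?u x x' \<in> C" "mix ?w y y' \<in> D"
        using C(2) D(2) p' q' unfolding convex_fun_def by blast+
      moreover have "mix t p q = mix r (mix ?u x x') (mix ?w y y')"
        unfolding p' q' by (rule mix_comm_eq[OF r_def 3])
      ultimately show ?thesis using r01
        by (intro image_eqI[of _ _ "(r, mix ?u x x', mix ?w y y')"]) auto
    qed
  qed
  moreover have "C \<union> D \<subseteq> ?E"
  proof
    fix z assume "z \<in> C \<union> D"
    moreover obtain c d where cd: "c \<in> C" "d \<in> D" using False by auto
    ultimately show "z \<in> ?E"
      using image_eqI[of z ?m "(0, z, d)"] image_eqI[of z ?m "(1, c, z)"] by auto
  qed
  moreover have "?E \<subseteq> K"
  proof clarify
    fix t x y assume "t \<in> {0..1::real}" "x \<in> C" "y \<in> D"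
    then have "x \<in> K" "y \<in> K" "0 \<le> t \<and> t \<le> 1" using K by auto
    then show "mix t x y \<in> K" using K(3) unfolding convex_fun_def by blast
  qed
  moreover have "\<phi> \<notin> ?E"
  proof
    assume "\<phi> \<in> ?E"
    then obtain t x y where t: "\<phi> = mix t x y" "0 \<le> t" "t \<le> 1" "x \<in> C" "y \<in> D" by auto
    then consider "t = 0" | "t = 1" | "0 < t" "t < 1" by linarith
    then show False
    proof cases
      case 3
      then have "x = \<phi>" using t K \<phi>(1) unfolding extreme_fun_def by blast
      then show False using t \<phi> by simp
    qed (use t \<phi> in auto)
  qed
  ultimately show ?thesis by blast
qed

lemma convex_join_finite:
  assumes "finite S" and C: "\<And>i. i \<in> S \<Longrightarrow> compact (C i) \<and> convex_fun (C i) \<and> C i \<subseteq> K \<and> \<phi> \<notin> C i"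
    and K: "convex_fun K" "extreme_fun \<phi> K"
  shows "\<exists>E. compact E \<and> convex_fun E \<and> (\<Union>i\<in>S. C i) \<subseteq> E \<and> E \<subseteq> K \<and> \<phi> \<notin> E"
  using assms(1) C
proof (induction S)
  case empty
  then show ?case by (intro exI[of _ "{}"]) (auto simp: convex_fun_def)
next
  case (insert i S)
  then obtain E where E: "compact E" "convex_fun E" "(\<Union>i\<in>S. C i) \<subseteq> E" "E \<subseteq> K" "\<phi> \<notin> E" by auto
  have "\<exists>E'. compact E' \<and> convex_fun E' \<and> C i \<union> E \<subseteq> E' \<and> E' \<subseteq> K \<and> \<phi> \<notin> E'"
    by (rule convex_join[of "C i" E K \<phi>]) (use insert.prems[of i] E K in auto)
  then obtain E' where "compact E'" "convex_fun E'" "C i \<union> E \<subseteq> E'" "E' \<subseteq> K" "\<phi> \<notin> E'" by blast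
  then show ?case using E(3) by (intro exI[of _ E']) auto
qed

text \<open>
  Separation from a compact convex set: finitely many coordinates suffice to distinguish \<open>\<phi>\<close> from
  all points of \<open>E\<close>, and the functional is the direction from \<open>\<phi>\<close> to the closest point of \<open>E\<close> in
  these coordinates.
\<close>

lemma separate_compact_convex:
  fixes E :: "('a \<Rightarrow> complex) set"
  assumes E: "compact E" "convex_fun E" and \<phi>: "\<phi> \<notin> E"
  shows "\<exists>S c \<delta>. finite S \<and> S \<subseteq> {a. \<exists>\<psi>\<in>E. \<psi> a \<noteq> \<phi> a} \<and> 0 < \<delta> \<and>
    (\<forall>\<psi>\<in>E. Re (\<Sum>a\<in>S. c a * \<psi> a) + \<delta> \<le> Re (\<Sum>a\<in>S. c a * \<phi> a))"
proof (cases "E = {}")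
  case True
  then show ?thesis by (intro exI[of _ "{}"] exI[of _ undefined] exI[of _ 1]) auto
next
  case False
  have opn: "open {\<psi> :: 'a \<Rightarrow> complex. \<psi> a \<noteq> \<phi> a}" for a
    by (intro open_Collect_neq continuous_intros) 
  have "E \<subseteq> (\<Union>a\<in>{a. \<exists>\<psi>\<in>E. \<psi> a \<noteq> \<phi> a}. {\<psi>. \<psi> a \<noteq> \<phi> a})"
  proof
    fix \<psi> assume \<psi>: "\<psi> \<in> E"
    then have "\<psi> \<noteq> \<phi>" using \<phi> by auto
    then obtain a where "\<psi> a \<noteq> \<phi> a" by auto
    then show "\<psi> \<in> (\<Union>a\<in>{a. \<exists>\<psi>\<in>E. \<psi> a \<noteq> \<phi> a}. {\<psi>. \<psi> a \<noteq> \<phi> a})" using \<psi> by blast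
  qed
  then obtain S where S: "S \<subseteq> {a. \<exists>\<psi>\<in>E. \<psi> a \<noteq> \<phi> a}" "finite S" "E \<subseteq> (\<Union>a\<in>S. {\<psi>. \<psi> a \<noteq> \<phi> a})"
    by (rule compactE_image[OF E(1), rotated]) (use opn in auto)
  define h where "h \<psi> = (\<Sum>a\<in>S. (cmod (\<psi> a - \<phi> a))\<^sup>2)" for \<psi>
  have "continuous_on E h" unfolding h_def by (intro continuous_intros)
  then obtain d where d: "d \<in> E" "\<And>\<psi>. \<psi> \<in> E \<Longrightarrow> h d \<le> h \<psi>"
    using continuous_attains_inf[OF E(1) False] by blast
  have "h d > 0"
  proof -
    obtain a where "a \<in> S" "d a \<noteq> \<phi> a" using S(3) d(1) by auto
    then show ?thesis unfolding h_def using S(2) by (intro sum_pos2[of _ a]) auto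
  qed
  define c where "c a = - cnj (d a - \<phi> a)" for a
  have "Re (\<Sum>a\<in>S. c a * \<psi> a) + h d \<le> Re (\<Sum>a\<in>S. c a * \<phi> a)" if \<psi>: "\<psi> \<in> E" for \<psi>
  proof -
    define p where "p = (\<Sum>a\<in>S. Re (cnj (d a - \<phi> a) * (\<psi> a - d a)))"
    define q where "q = (\<Sum>a\<in>S. (cmod (\<psi> a - d a))\<^sup>2)"
    \<comment> \<open>Minimality of \<open>h d\<close> along the segment from \<open>d\<close> to
      \<open>\<psi>\<close>; the derivative there at \<open>t = 0\<close> is
      \<open>2 * p\<close>.\<close>
    have *: "0 \<le> 2 * t * p + t\<^sup>2 * q" if t: "0 \<le> t" "t \<le> 1" for t
    proof -
      have "h d \<le> h (mix t d \<psi>)" using d E(2) \<psi> t unfolding convex_fun_def by blast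
      also have "h (mix t d \<psi>) = h d + 2 * t * p + t\<^sup>2 * q"
        unfolding h_def p_def q_def sum_distrib_left sum.distrib[symmetric]
      proof (rule sum.cong)
        fix a
        have "mix t d \<psi> a - \<phi> a = (d a - \<phi> a) + of_real t * (\<psi> a - d a)"
          unfolding mix_def by (simp add: algebra_simps)
        moreover have "(cmod (z + of_real t * w))\<^sup>2
            = (cmod z)\<^sup>2 + 2 * t * Re (cnj z * w) + t\<^sup>2 * (cmod w)\<^sup>2" for z w
          by (simp add: cmod_power2) (simp add: power2_eq_square algebra_simps)
        ultimately show "(cmod (mix t d \<psi> a - \<phi> a))\<^sup>2 = (cmod (d a - \<phi> a))\<^sup>2 +
            2 * t * Re (cnj (d a - \<phi> a) * (\<psi> a - d a)) + t\<^sup>2 * (cmod (\<psi> a - d a))\<^sup>2"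
          by (simp only:)
      qed simp
      finally show ?thesis by simp
    qed
    have "p \<ge> 0"
    proof (rule ccontr)
      assume "\<not> 0 \<le> p"
      have q0: "q \<ge> 0" unfolding q_def by (simp add: sum_nonneg)
      \<comment> \<open>So small that \<open>\<tau> * q \<le> - p\<close>, whence
        \<open>2 * p + \<tau> * q \<le> p < 0\<close>; the summand 1 guards against
        \<open>q = 0\<close>.\<close>
      define \<tau> where "\<tau> = min 1 (- p / (q + 1))"
      have "0 < - p / (q + 1)" using \<open>\<not> 0 \<le> p\<close> q0 by (intro divide_pos_pos) auto
      then have t: "0 < \<tau>" "\<tau> \<le> 1" "\<tau> \<le> - p / (q + 1)" unfolding \<tau>_def by auto
      then have "0 \<le> \<tau> * (2 * p + \<tau> * q)" using *[of \<tau>] by (simp add: power2_eq_square algebra_simps)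
      then have "0 \<le> 2 * p + \<tau> * q" using t by (simp add: zero_le_mult_iff)
      moreover have "\<tau> * q \<le> (- p / (q + 1)) * (q + 1)"
        using q0 t by (intro mult_mono) auto
      moreover have "(- p / (q + 1)) * (q + 1) = - p" using q0 by simp
      ultimately show False using \<open>\<not> 0 \<le> p\<close> by linarith
    qed
    have "Re (\<Sum>a\<in>S. c a * \<phi> a) - Re (\<Sum>a\<in>S. c a * \<psi> a) = p + h d"
      unfolding p_def h_def Re_sum sum_subtractf[symmetric] sum.distrib[symmetric]
    proof (rule sum.cong)
      fix a
      have "(cmod z)\<^sup>2 = Re (cnj z * z)" for z
        by (simp only: cmod_power2) (simp add: power2_eq_square)
      then show "Re (c a * \<phi> a) - Re (c a * \<psi> a)
        = Re (cnj (d a - \<phi> a) * (\<psi> a - d a)) + (cmod (d a - \<phi> a))\<^sup>2"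
        unfolding c_def by (simp add: algebra_simps)
    qed simp
    then show ?thesis using \<open>p \<ge> 0\<close> by linarith
  qed
  with S \<open>h d > 0\<close> show ?thesis by blast
qed

text \<open>The points that are \<epsilon>-far from \<phi> in a coordinate of \<open>T\<close> lie
  in finitely many compact convex pieces of \<open>K\<close> that miss \<phi>. By extremality their
  join still misses \<phi> and can be separated from it. The restriction on \<open>S\<close> later
  places these coordinates in the algebra.\<close>

lemma extreme_point_slice:
  fixes K :: "('a \<Rightarrow> complex) set"
  assumes K: "compact K" "convex_fun K" and \<phi>: "extreme_fun \<phi> K" and T: "finite T" and \<epsilon>: "0 < \<epsilon>"
  shows "\<exists>S c \<delta>. finite S \<and> S \<subseteq> {a. \<exists>\<psi>\<in>K. \<psi> a \<noteq> \<phi> a} \<and> 0 < \<delta> \<and>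
    (\<forall>\<psi>\<in>K. (\<exists>a\<in>T. \<epsilon> \<le> cmod (\<psi> a - \<phi> a)) \<longrightarrow> Re (\<Sum>a\<in>S. c a * \<psi> a) + \<delta> \<le> Re (\<Sum>a\<in>S. c a * \<phi> a))"
proof -
  \<comment> \<open>Multiplying by the four units extracts plus or minus the real or imaginary part;
    if a number has modulus at least \<epsilon>, one of these is at least \<epsilon>/2.\<close>
  let ?S = "T \<times> {1, -1, \<i>, -\<i>}"
  define C where "C = (\<lambda>(a, z). {\<psi> \<in> K. \<epsilon>/2 \<le> Re (z * (\<psi> a - \<phi> a))})"
  have "\<exists>E. compact E \<and> convex_fun E \<and> (\<Union>i\<in>?S. C i) \<subseteq> E \<and> E \<subseteq> K \<and> \<phi> \<notin> E"
  proof (rule convex_join_finite[OF _ _ K(2) \<phi>])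
    fix i assume "i \<in> ?S"
    obtain a z where i: "i = (a, z)" by (cases i)
    have "C i = K \<inter> {\<psi>. \<epsilon>/2 \<le> Re (z * (\<psi> a - \<phi> a))}" unfolding C_def i by auto
    moreover have "closed {\<psi> :: 'a \<Rightarrow> complex. \<epsilon>/2 \<le> Re (z * (\<psi> a - \<phi> a))}"
      by (intro closed_Collect_le continuous_intros)
    ultimately have "compact (C i)" using K(1) by (simp add: compact_Int_closed)
    moreover have "convex_fun (C i)"
      unfolding convex_fun_def
    proof (intro ballI allI impI)
      fix x y and t :: real assume x: "x \<in> C i" and y: "y \<in> C i" and t: "0 \<le> t \<and> t \<le> 1"
      have "z * (mix t x y a - \<phi> a) = of_real (1 - t) * (z * (x a - \<phi> a)) + of_real t * (z * (y a - \<phi> a))"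
        unfolding mix_def by (simp add: algebra_simps)
      then have "Re (z * (mix t x y a - \<phi> a)) = (1 - t) * Re (z * (x a - \<phi> a)) + t * Re (z * (y a - \<phi> a))"
        by (simp del: of_real_diff)
      moreover have "(1 - t) * (\<epsilon>/2) \<le> (1 - t) * Re (z * (x a - \<phi> a))" "t * (\<epsilon>/2) \<le> t * Re (z * (y a - \<phi> a))"
        using x y t unfolding C_def i by (intro mult_left_mono; simp)+
      moreover have "\<epsilon>/2 = (1 - t) * (\<epsilon>/2) + t * (\<epsilon>/2)" by (simp only: distrib_right[symmetric]) simp
      ultimately have "\<epsilon>/2 \<le> Re (z * (mix t x y a - \<phi> a))" by linarith
      moreover have "mix t x y \<in> K" using K(2) x y t unfolding convex_fun_def C_def i by auto
      ultimately show "mix t x y \<in> C i" unfolding C_def i by auto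
    qed
    moreover have "C i \<subseteq> K" "\<phi> \<notin> C i" using \<epsilon> unfolding C_def i by auto
    ultimately show "compact (C i) \<and> convex_fun (C i) \<and> C i \<subseteq> K \<and> \<phi> \<notin> C i" by blast
  qed (use T in simp)
  then obtain E where E: "compact E" "convex_fun E" "(\<Union>i\<in>?S. C i) \<subseteq> E" "E \<subseteq> K" "\<phi> \<notin> E" by blast
  have inE: "\<psi> \<in> E" if \<psi>: "\<psi> \<in> K" "a \<in> T" "\<epsilon> \<le> cmod (\<psi> a - \<phi> a)" for \<psi> a
  proof -
    have "\<epsilon> \<le> \<bar>Re (\<psi> a - \<phi> a)\<bar> + \<bar>Im (\<psi> a - \<phi> a)\<bar>"
      using \<psi>(3) cmod_le[of "\<psi> a - \<phi> a"] by linarith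
    then consider "\<epsilon>/2 \<le> Re (1 * (\<psi> a - \<phi> a))" | "\<epsilon>/2 \<le> Re (-1 * (\<psi> a - \<phi> a))"
      | "\<epsilon>/2 \<le> Re (\<i> * (\<psi> a - \<phi> a))" | "\<epsilon>/2 \<le> Re (-\<i> * (\<psi> a - \<phi> a))" by simp linarith
    then have "\<exists>z\<in>{1, -1, \<i>, -\<i>}. \<epsilon>/2 \<le> Re (z * (\<psi> a - \<phi> a))" by cases blast+
    then obtain z where "(a, z) \<in> ?S" "\<psi> \<in> C (a, z)" using \<psi>(1,2) unfolding C_def by blast
    then show ?thesis using E(3) by blast
  qed
  moreover obtain S c \<delta> where "finite S" "S \<subseteq> {a. \<exists>\<psi>\<in>E. \<psi> a \<noteq> \<phi> a}" "0 < \<delta>"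
    "\<forall>\<psi>\<in>E. Re (\<Sum>a\<in>S. c a * \<psi> a) + \<delta> \<le> Re (\<Sum>a\<in>S. c a * \<phi> a)"
    using separate_compact_convex[OF E(1,2,5)] by blast
  ultimately show ?thesis using E(4) by (intro exI[of _ S] exI[of _ c] exI[of _ \<delta>]) blast
qed

text \<open>Tychonoff's theorem for a product of discs, in which \<open>K\<close> is closed.\<close>

lemma compact_pointwise_bounded:
  fixes K :: "('a \<Rightarrow> complex) set"
  assumes "closed K" and "\<And>\<psi> a. \<psi> \<in> K \<Longrightarrow> cmod (\<psi> a) \<le> B a"
  shows "compact K"
proof -
  have "compactin (product_topology (\<lambda>_::'a. euclidean) UNIV) (\<Pi>\<^sub>E a\<in>UNIV. cball (0::complex) (B a))"
    by (subst compactin_PiE) auto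
  then have "compact (\<Pi>\<^sub>E a\<in>UNIV. cball (0::complex) (B a))"
    by (simp add: euclidean_product_topology)
  moreover have "K = (\<Pi>\<^sub>E a\<in>UNIV. cball (0::complex) (B a)) \<inter> K" using assms(2) by auto
  ultimately show ?thesis using assms(1) by (metis compact_Int_closed)
qed

section \<open>Positive functionals on idempotented algebras\<close>

locale stalg =
  fixes A :: "'a alg" (structure)
  assumes idempotented: "idempotented A"
begin

lemma star_alg: "star_algebra A"
  using idempotented unfolding idempotented_def by blast

sublocale Module.module complex_ring A
  using star_alg unfolding star_algebra_def by blast

lemma smult_in [simp, intro]: "a \<in> carrier A \<Longrightarrow> c \<odot> a \<in> carrier A"
  by simp

lemma mult_in [simp, intro]: "a \<in> carrier A \<Longrightarrow> b \<in> carrier A \<Longrightarrow> a \<otimes> b \<in> carrier A"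
  using star_alg unfolding star_algebra_def by blast

lemma mult_assoc: "a \<in> carrier A \<Longrightarrow> b \<in> carrier A \<Longrightarrow> c \<in> carrier A \<Longrightarrow> (a \<otimes> b) \<otimes> c = a \<otimes> (b \<otimes> c)"
  using star_alg unfolding star_algebra_def by blast

lemma mult_add_left: "a \<in> carrier A \<Longrightarrow> b \<in> carrier A \<Longrightarrow> c \<in> carrier A \<Longrightarrow> (a \<oplus> b) \<otimes> c = (a \<otimes> c) \<oplus> (b \<otimes> c)"
  using star_alg unfolding star_algebra_def by blast

lemma mult_add_right: "a \<in> carrier A \<Longrightarrow> b \<in> carrier A \<Longrightarrow> c \<in> carrier A \<Longrightarrow> a \<otimes> (b \<oplus> c) = (a \<otimes> b) \<oplus> (a \<otimes> c)"
  using star_alg unfolding star_algebra_def by blast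

lemma smult_mult: "a \<in> carrier A \<Longrightarrow> b \<in> carrier A \<Longrightarrow> (z \<odot> a) \<otimes> b = z \<odot> (a \<otimes> b)"
  using star_alg unfolding star_algebra_def by blast

lemma mult_smult: "a \<in> carrier A \<Longrightarrow> b \<in> carrier A \<Longrightarrow> a \<otimes> (z \<odot> b) = z \<odot> (a \<otimes> b)"
  using star_alg unfolding star_algebra_def by blast

lemma star_in [simp, intro]: "a \<in> carrier A \<Longrightarrow> star A a \<in> carrier A"
  using star_alg unfolding star_algebra_def by blast

lemma star_star [simp]: "a \<in> carrier A \<Longrightarrow> star A (star A a) = a"
  using star_alg unfolding star_algebra_def by blast

lemma star_add: "a \<in> carrier A \<Longrightarrow> b \<in> carrier A \<Longrightarrow> star A (a \<oplus> b) = star A a \<oplus> star A b"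
  using star_alg unfolding star_algebra_def by blast

lemma star_mult: "a \<in> carrier A \<Longrightarrow> b \<in> carrier A \<Longrightarrow> star A (a \<otimes> b) = star A b \<otimes> star A a"
  using star_alg unfolding star_algebra_def by blast

lemma star_smult: "a \<in> carrier A \<Longrightarrow> star A (z \<odot> a) = cnj z \<odot> star A a"
  using star_alg unfolding star_algebra_def by blast

text \<open>That \<open>e\<close> fixes \<open>a\<close> from each side separately follows by
  multiplying \<open>e a e = a\<close> by \<open>e\<close> once more.\<close>

lemma local_unit:
  assumes "finite S" "S \<subseteq> carrier A"
  obtains e where "e \<in> carrier A" "e \<otimes> e = e" "star A e = e"
    "\<And>a. a \<in> S \<Longrightarrow> e \<otimes> a = a" "\<And>a. a \<in> S \<Longrightarrow> a \<otimes> e = a"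
proof -
  obtain e where e: "e \<in> carrier A" "e \<otimes> e = e" "star A e = e" "\<And>a. a \<in> S \<Longrightarrow> e \<otimes> a \<otimes> e = a"
    using idempotented assms unfolding idempotented_def by meson
  have "e \<otimes> a = a" "a \<otimes> e = a" if a: "a \<in> S" for a
  proof -
    have c: "a \<in> carrier A" using a assms by auto
    have "e \<otimes> (e \<otimes> a \<otimes> e) = e \<otimes> a \<otimes> e" using e(1,2) c mult_assoc by (metis mult_in)
    then show "e \<otimes> a = a" using e(4)[OF a] by simp
    have "(e \<otimes> a \<otimes> e) \<otimes> e = e \<otimes> a \<otimes> e" using e(1,2) c mult_assoc by (metis mult_in)
    then show "a \<otimes> e = a" using e(4)[OF a] by simp
  qed
  with e show thesis using that by blast
qed

text \<open>The value 0 off the carrier makes a functional determined by its restriction to the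
  algebra, so equality and limits of functionals are those of the restrictions.\<close>

definition lin_fun :: "('a \<Rightarrow> complex) \<Rightarrow> bool" where
  "lin_fun \<psi> \<longleftrightarrow> (\<forall>a\<in>carrier A. \<forall>b\<in>carrier A. \<psi> (a \<oplus> b) = \<psi> a + \<psi> b) \<and>
     (\<forall>c. \<forall>a\<in>carrier A. \<psi> (c \<odot> a) = c * \<psi> a) \<and> (\<forall>a. a \<notin> carrier A \<longrightarrow> \<psi> a = 0)"

lemma lin_funD:
  assumes "lin_fun \<psi>"
  shows "a \<in> carrier A \<Longrightarrow> b \<in> carrier A \<Longrightarrow> \<psi> (a \<oplus> b) = \<psi> a + \<psi> b"
    "a \<in> carrier A \<Longrightarrow> \<psi> (c \<odot> a) = c * \<psi> a" "a \<notin> carrier A \<Longrightarrow> \<psi> a = 0"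
  using assms unfolding lin_fun_def by blast+

lemma lin_fun_eqI:
  "lin_fun \<psi> \<Longrightarrow> lin_fun \<eta> \<Longrightarrow> (\<And>a. a \<in> carrier A \<Longrightarrow> \<psi> a = \<eta> a) \<Longrightarrow> \<psi> = \<eta>"
  using lin_funD(3) by (metis ext)

text \<open>Turns a linear form in finitely many coordinates, as produced by separation, into
  evaluation at one element of the algebra, which is the form of the inequalities defining
  \<open>weak_hull\<close>.\<close>

lemma lin_fun_sum:
  assumes "finite S" "S \<subseteq> carrier A"
  shows "\<exists>a\<in>carrier A. \<forall>\<psi>. lin_fun \<psi> \<longrightarrow> \<psi> a = (\<Sum>s\<in>S. c s * \<psi> s)"
  using assms
proof (induction S)
  case empty
  have "\<psi> \<zero> = 0" if "lin_fun \<psi>" for \<psi>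
    using lin_funD(2)[OF that, of \<zero> 0] smult_r_null[of 0] by simp
  then show ?case by (intro bexI[of _ \<zero>]) auto
next
  case (insert s S)
  then obtain a where a: "a \<in> carrier A" "\<And>\<psi>. lin_fun \<psi> \<Longrightarrow> \<psi> a = (\<Sum>s\<in>S. c s * \<psi> s)" by auto
  show ?case
    using insert.hyps insert.prems a lin_funD(1,2)
    by (intro bexI[of _ "c s \<odot> s \<oplus> a"]) auto
qed

lemma closed_lin_fun: "closed {\<psi>. lin_fun \<psi>}"
proof -
  have "{\<psi>. lin_fun \<psi>} = (\<Inter>a\<in>carrier A. \<Inter>b\<in>carrier A. {\<psi>. \<psi> (a \<oplus> b) = \<psi> a + \<psi> b})
     \<inter> (\<Inter>c. \<Inter>a\<in>carrier A. {\<psi>. \<psi> (c \<odot> a) = c * \<psi> a}) \<inter> (\<Inter>a\<in>-carrier A. {\<psi>. \<psi> a = 0})"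
    by (auto simp: lin_fun_def)
  also have "closed \<dots>"
    by (intro closed_Int closed_INT ballI closed_Collect_eq continuous_on_add continuous_on_mult
        continuous_on_const continuous_fun_coord continuous_on_id)
  finally show ?thesis .
qed

lemma lin_fun_mix: "lin_fun \<psi> \<Longrightarrow> lin_fun \<eta> \<Longrightarrow> lin_fun (mix t \<psi> \<eta>)"
  unfolding lin_fun_def mix_def by (simp add: algebra_simps)

text \<open>The closed convex hull of \<open>E\<close> among the linear functionals.\<close>

definition weak_hull :: "('a \<Rightarrow> complex) set \<Rightarrow> ('a \<Rightarrow> complex) set" where
  "weak_hull E = {\<psi>. lin_fun \<psi> \<and>
     (\<forall>a\<in>carrier A. \<forall>c. (\<forall>\<eta>\<in>E. Re (\<eta> a) \<le> c) \<longrightarrow> Re (\<psi> a) \<le> c)}"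

lemma weak_hullD:
  assumes "\<psi> \<in> weak_hull E" "a \<in> carrier A" "\<And>\<eta>. \<eta> \<in> E \<Longrightarrow> Re (\<eta> a) \<le> c"
  shows "Re (\<psi> a) \<le> c"
  using assms unfolding weak_hull_def by blast

lemma weak_hull_lin: "\<psi> \<in> weak_hull E \<Longrightarrow> lin_fun \<psi>"
  unfolding weak_hull_def by blast

lemma weak_hull_incl: "\<eta> \<in> E \<Longrightarrow> lin_fun \<eta> \<Longrightarrow> \<eta> \<in> weak_hull E"
  unfolding weak_hull_def by blast

lemma weak_hull_mono: "E \<subseteq> E' \<Longrightarrow> weak_hull E \<subseteq> weak_hull E'"
  unfolding weak_hull_def by blast

lemma closed_weak_hull: "closed (weak_hull E)"
proof -
  have "weak_hull E = {\<psi>. lin_fun \<psi>} \<inter>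
     (\<Inter>a\<in>carrier A. \<Inter>c\<in>{c. \<forall>\<eta>\<in>E. Re (\<eta> a) \<le> c}. {\<psi>. Re (\<psi> a) \<le> c})"
    unfolding weak_hull_def by auto
  also have "closed \<dots>"
    by (intro closed_Int closed_INT ballI closed_lin_fun closed_Collect_le continuous_on_Re
        continuous_on_const continuous_fun_coord continuous_on_id)
  finally show ?thesis .
qed

lemma convex_weak_hull: "convex_fun (weak_hull E)"
  unfolding convex_fun_def
proof (intro ballI allI impI)
  fix x y and t :: real assume x: "x \<in> weak_hull E" and y: "y \<in> weak_hull E" and t: "0 \<le> t \<and> t \<le> 1"
  show "mix t x y \<in> weak_hull E"
    unfolding weak_hull_def
  proof (intro CollectI conjI ballI allI impI)
    show "lin_fun (mix t x y)" using x y by (intro lin_fun_mix) (auto intro: weak_hull_lin)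
    fix a c assume a: "a \<in> carrier A" and c: "\<forall>\<eta>\<in>E. Re (\<eta> a) \<le> c"
    have "Re (x a) \<le> c" "Re (y a) \<le> c" using weak_hullD[OF x a] weak_hullD[OF y a] c by auto
    then have "(1 - t) * Re (x a) + t * Re (y a) \<le> (1 - t) * c + t * c"
      using t by (intro add_mono mult_left_mono) auto
    then show "Re (mix t x y a) \<le> c" unfolding mix_def by (simp del: of_real_diff add: algebra_simps)
  qed
qed

text \<open>Hull membership only controls real parts; multiplying \<open>a\<close> by a phase makes
  \<open>\<psi> a\<close> equal to its modulus without changing the bound on
  \<open>E\<close>.\<close>

lemma weak_hull_bound:
  assumes \<psi>: "\<psi> \<in> weak_hull E" and a: "a \<in> carrier A"
    and E: "\<And>\<eta>. \<eta> \<in> E \<Longrightarrow> lin_fun \<eta> \<and> cmod (\<eta> a) \<le> M"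
  shows "cmod (\<psi> a) \<le> M"
proof (cases "\<psi> a = 0")
  case True
  have "0 \<le> M" if "\<eta> \<in> E" for \<eta> using E[OF that] norm_ge_zero order_trans by blast
  moreover have "E \<noteq> {}"
  proof
    \<comment> \<open>With \<open>E\<close> empty every real number is an upper bound, so the hull
      is empty as well.\<close>
    assume "E = {}"
    then have "Re (\<psi> a) \<le> Re (\<psi> a) - 1" by (intro weak_hullD[OF \<psi> a]) auto
    then show False by simp
  qed
  ultimately show ?thesis using True by auto
next
  case False
  define z where "z = cnj (\<psi> a) / of_real (cmod (\<psi> a))"
  have z: "cmod z = 1" unfolding z_def using False by (simp add: norm_divide)
  have "Re (\<psi> (z \<odot> a)) \<le> M"
  proof (rule weak_hullD[OF \<psi>])
    fix \<eta> assume \<eta>: "\<eta> \<in> E"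
    have "Re (\<eta> (z \<odot> a)) \<le> cmod (\<eta> (z \<odot> a))" by (rule complex_Re_le_cmod)
    also have "\<dots> = cmod (\<eta> a)" using E[OF \<eta>] a z by (simp add: lin_funD norm_mult)
    finally show "Re (\<eta> (z \<odot> a)) \<le> M" using E[OF \<eta>] by simp
  qed (use a in auto)
  also have "\<psi> (z \<odot> a) = z * \<psi> a" using weak_hull_lin[OF \<psi>] a by (simp add: lin_funD)
  also have "z * \<psi> a = of_real (cmod (\<psi> a))"
    unfolding z_def using False complex_norm_square[of "\<psi> a"]
    by (simp add: field_simps power2_eq_square)
  finally show ?thesis by simp
qed

text \<open>The theorem of Banach and Alaoglu, with a bound for every single element in place of a
  norm.\<close>

lemma compact_weak_hull:
  assumes E: "\<And>\<eta> a. \<eta> \<in> E \<Longrightarrow> a \<in> carrier A \<Longrightarrow> lin_fun \<eta> \<and> cmod (\<eta> a) \<le> M a"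
  shows "compact (weak_hull E)"
proof (rule compact_pointwise_bounded[OF closed_weak_hull])
  fix \<psi> a assume \<psi>: "\<psi> \<in> weak_hull E"
  show "cmod (\<psi> a) \<le> (if a \<in> carrier A then M a else 0)"
    using weak_hull_bound[OF \<psi>] E lin_funD(3)[OF weak_hull_lin[OF \<psi>]] by auto
qed

text \<open>Hermitian symmetry makes \<psi>(b*b) real, so positivity can be stated through the real
  part.\<close>

definition pos_fun :: "('a \<Rightarrow> complex) \<Rightarrow> bool" where
  "pos_fun \<psi> \<longleftrightarrow> lin_fun \<psi> \<and> (\<forall>b\<in>carrier A. \<psi> (star A b) = cnj (\<psi> b) \<and> 0 \<le> Re (\<psi> (star A b \<otimes> b)))"

lemma pos_funD:
  assumes "pos_fun \<psi>"
  shows "lin_fun \<psi>" "b \<in> carrier A \<Longrightarrow> \<psi> (star A b) = cnj (\<psi> b)"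
    "b \<in> carrier A \<Longrightarrow> 0 \<le> Re (\<psi> (star A b \<otimes> b))"
    "b \<in> carrier A \<Longrightarrow> Im (\<psi> (star A b \<otimes> b)) = 0"
proof -
  show "lin_fun \<psi>" and h: "b \<in> carrier A \<Longrightarrow> \<psi> (star A b) = cnj (\<psi> b)"
    and "b \<in> carrier A \<Longrightarrow> 0 \<le> Re (\<psi> (star A b \<otimes> b))" for b
    using assms unfolding pos_fun_def by blast+
  show "Im (\<psi> (star A b \<otimes> b)) = 0" if "b \<in> carrier A" for b
    using h[of "star A b \<otimes> b"] that by (simp add: star_mult complex_eq_iff)
qed

lemma pos_fun_quadratic:
  assumes \<psi>: "pos_fun \<psi>" and b: "b \<in> carrier A" and c: "c \<in> carrier A"
  shows "Re (\<psi> (star A (b \<oplus> z \<odot> c) \<otimes> (b \<oplus> z \<odot> c)))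
    = Re (\<psi> (star A b \<otimes> b)) + 2 * Re (cnj z * \<psi> (star A c \<otimes> b)) + (cmod z)\<^sup>2 * Re (\<psi> (star A c \<otimes> c))"
proof -
  note l = lin_funD[OF pos_funD(1)[OF \<psi>]]
  have "\<psi> (star A b \<otimes> c) = cnj (\<psi> (star A c \<otimes> b))"
    using pos_funD(2)[OF \<psi>, of "star A c \<otimes> b"] b c by (simp add: star_mult)
  moreover have "\<psi> (star A (b \<oplus> z \<odot> c) \<otimes> (b \<oplus> z \<odot> c)) = \<psi> (star A b \<otimes> b) + z * \<psi> (star A b \<otimes> c)
      + cnj z * \<psi> (star A c \<otimes> b) + of_real ((cmod z)\<^sup>2) * \<psi> (star A c \<otimes> c)"
    using b c complex_norm_square[of z]
    by (simp add: star_add star_smult mult_add_left mult_add_right smult_mult mult_smult l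
        algebra_simps del: of_real_power)
  ultimately show ?thesis by (simp add: algebra_simps)
qed

lemma pos_fun_cauchy_schwarz:
  assumes \<psi>: "pos_fun \<psi>" and b: "b \<in> carrier A" and c: "c \<in> carrier A"
  shows "(cmod (\<psi> (star A c \<otimes> b)))\<^sup>2 \<le> Re (\<psi> (star A b \<otimes> b)) * Re (\<psi> (star A c \<otimes> c))"
proof (rule quadratic_nonneg_imp_le)
  fix z
  show "0 \<le> Re (\<psi> (star A b \<otimes> b)) + 2 * Re (cnj z * \<psi> (star A c \<otimes> b)) + (cmod z)\<^sup>2 * Re (\<psi> (star A c \<otimes> c))"
    using pos_fun_quadratic[OF \<psi> b c, of z] pos_funD(3)[OF \<psi>, of "b \<oplus> z \<odot> c"] b c by simp
qed (use pos_funD(3)[OF \<psi> c] in simp)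

end

section \<open>Representations on inner product spaces\<close>

text \<open>Completeness is left open, so that the definition covers the subspaces generated by the
  algebra in \<open>F X\<close> as well as Hilbert spaces. The bound \<open>M\<close> is a parameter
  because a whole family of representations has to share it.\<close>

locale op_rep = stalg A + prehil H for A :: "'a alg" (structure) and H :: "'h inner_space" +
  fixes \<rho> :: "'a \<Rightarrow> 'h \<Rightarrow> 'h" and M :: "'a \<Rightarrow> real"
  assumes rep_in [simp, intro]: "a \<in> carrier A \<Longrightarrow> w \<in> carrier H \<Longrightarrow> \<rho> a w \<in> carrier H"
    and rep_vadd: "a \<in> carrier A \<Longrightarrow> w \<in> carrier H \<Longrightarrow> w' \<in> carrier H \<Longrightarrow> \<rho> a (w \<oplus>\<^bsub>H\<^esub> w') = \<rho> a w \<oplus>\<^bsub>H\<^esub> \<rho> a w'"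
    and rep_vsmult: "a \<in> carrier A \<Longrightarrow> w \<in> carrier H \<Longrightarrow> \<rho> a (c \<odot>\<^bsub>H\<^esub> w) = c \<odot>\<^bsub>H\<^esub> \<rho> a w"
    and rep_bound: "a \<in> carrier A \<Longrightarrow> w \<in> carrier H \<Longrightarrow> vnorm H (\<rho> a w) \<le> M a * vnorm H w"
    and rep_add: "a \<in> carrier A \<Longrightarrow> b \<in> carrier A \<Longrightarrow> w \<in> carrier H \<Longrightarrow> \<rho> (a \<oplus> b) w = \<rho> a w \<oplus>\<^bsub>H\<^esub> \<rho> b w"
    and rep_mult: "a \<in> carrier A \<Longrightarrow> b \<in> carrier A \<Longrightarrow> w \<in> carrier H \<Longrightarrow> \<rho> (a \<otimes> b) w = \<rho> a (\<rho> b w)"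
    and rep_smult: "a \<in> carrier A \<Longrightarrow> w \<in> carrier H \<Longrightarrow> \<rho> (c \<odot> a) w = c \<odot>\<^bsub>H\<^esub> \<rho> a w"
    and rep_adj: "a \<in> carrier A \<Longrightarrow> w \<in> carrier H \<Longrightarrow> w' \<in> carrier H \<Longrightarrow>
      ip H (\<rho> a w) w' = ip H w (\<rho> (star A a) w')"

definition coef :: "'a alg \<Rightarrow> 'h inner_space \<Rightarrow> ('a \<Rightarrow> 'h \<Rightarrow> 'h) \<Rightarrow> 'h \<Rightarrow> 'a \<Rightarrow> complex" where
  "coef A H \<rho> w = (\<lambda>a. if a \<in> carrier A then ip H (\<rho> a w) w else 0)"

definition unit_coefs :: "'a alg \<Rightarrow> 'h inner_space \<Rightarrow> ('a \<Rightarrow> 'h \<Rightarrow> 'h) \<Rightarrow> ('a \<Rightarrow> complex) set" where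
  "unit_coefs A H \<rho> = {coef A H \<rho> w | w. w \<in> carrier H \<and> vnorm H w \<le> 1}"

context op_rep
begin

lemma rep_linear: "a \<in> carrier A \<Longrightarrow> linear_map H H (\<rho> a)"
  unfolding linear_map_def by (auto simp: rep_vadd rep_vsmult)

lemma rep_bounded: "a \<in> carrier A \<Longrightarrow> bounded_map H H (\<rho> a)"
  unfolding bounded_map_def using rep_bound by blast

lemma rep_star_mult:
  "a \<in> carrier A \<Longrightarrow> b \<in> carrier A \<Longrightarrow> w \<in> carrier H \<Longrightarrow> ip H (\<rho> (star A b \<otimes> a) w) w = ip H (\<rho> a w) (\<rho> b w)"
  by (simp add: rep_mult rep_adj)

lemma lin_fun_coef: "w \<in> carrier H \<Longrightarrow> lin_fun (coef A H \<rho> w)"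
  unfolding lin_fun_def coef_def by (simp add: rep_add rep_smult)

lemma coef_star: "w \<in> carrier H \<Longrightarrow> b \<in> carrier A \<Longrightarrow> coef A H \<rho> w (star A b) = cnj (coef A H \<rho> w b)"
  unfolding coef_def using ip_commute[of w "\<rho> b w"] ip_commute[of "\<rho> b w" w] by (simp add: rep_adj)

lemma coef_star_mult:
  "w \<in> carrier H \<Longrightarrow> b \<in> carrier A \<Longrightarrow> c \<in> carrier A \<Longrightarrow>
    coef A H \<rho> w (star A b \<otimes> c) = ip H (\<rho> c w) (\<rho> b w)"
  unfolding coef_def by (simp add: rep_star_mult)

lemma pos_fun_coef: "w \<in> carrier H \<Longrightarrow> pos_fun (coef A H \<rho> w)"
  unfolding pos_fun_def using lin_fun_coef coef_star by (simp add: coef_star_mult)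

lemma coef_bound:
  assumes "w \<in> carrier H" "vnorm H w \<le> 1" "a \<in> carrier A"
  shows "cmod (coef A H \<rho> w a) \<le> \<bar>M a\<bar>"
proof -
  have "cmod (coef A H \<rho> w a) \<le> vnorm H (\<rho> a w) * vnorm H w"
    using assms cauchy_schwarz[of "\<rho> a w" w] unfolding coef_def by simp
  also have "\<dots> \<le> vnorm H (\<rho> a w)" using assms by (simp add: mult_left_le)
  also have "\<dots> \<le> M a * vnorm H w" using assms rep_bound by simp
  also have "\<dots> \<le> \<bar>M a\<bar> * 1" using assms by (intro mult_mono) auto
  finally show ?thesis by simp
qed

end

text \<open>Both properties are systems of half-spaces. For the symmetry, hermitian functionals take
  purely imaginary values at the difference of \<open>z \<odot> b\<close> and its adjoint.\<close>

lemma (in stalg) weak_hull_pos: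
  assumes E: "\<And>\<eta>. \<eta> \<in> E \<Longrightarrow> pos_fun \<eta>" and \<psi>: "\<psi> \<in> weak_hull E"
  shows "pos_fun \<psi>"
  unfolding pos_fun_def
proof (intro conjI ballI)
  show l: "lin_fun \<psi>" by (rule weak_hull_lin[OF \<psi>])
  fix b assume b: "b \<in> carrier A"
  note El = lin_funD[OF pos_funD(1)[OF E]]
  have *: "Re (z * \<psi> b) \<le> Re (cnj z * \<psi> (star A b))" for z
  proof -
    have "Re (\<psi> (z \<odot> b \<oplus> (- cnj z) \<odot> star A b)) \<le> 0"
    proof (rule weak_hullD[OF \<psi>])
      fix \<eta> assume \<eta>: "\<eta> \<in> E"
      have "\<eta> (z \<odot> b \<oplus> (- cnj z) \<odot> star A b) = z * \<eta> b - cnj z * cnj (\<eta> b)"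
        using El[OF \<eta>] pos_funD(2)[OF E[OF \<eta>] b] b by simp
      then show "Re (\<eta> (z \<odot> b \<oplus> (- cnj z) \<odot> star A b)) \<le> 0" by simp
    qed (use b in auto)
    then show ?thesis using lin_funD[OF l] b by simp
  qed
  have eq: "Re (z * \<psi> b) = Re (cnj z * \<psi> (star A b))" for z
    using *[of z] *[of "-z"] by simp
  show "\<psi> (star A b) = cnj (\<psi> b)" using eq[of 1] eq[of \<i>] by (simp add: complex_eq_iff)
  have "Re (\<psi> ((-1) \<odot> (star A b \<otimes> b))) \<le> 0"
  proof (rule weak_hullD[OF \<psi>])
    fix \<eta> assume \<eta>: "\<eta> \<in> E"
    then show "Re (\<eta> ((-1) \<odot> (star A b \<otimes> b))) \<le> 0"
      using El(2)[OF \<eta>, of "star A b \<otimes> b" "-1"] pos_funD(3)[OF E[OF \<eta>] b] b by simp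
  qed (use b in auto)
  then show "0 \<le> Re (\<psi> (star A b \<otimes> b))" using lin_funD[OF l] b by simp
qed

lemma (in stalg) weak_hull_nonneg:
  assumes "\<And>\<eta>. \<eta> \<in> E \<Longrightarrow> lin_fun \<eta> \<and> 0 \<le> Re (\<eta> a)" and "\<psi> \<in> weak_hull E" "a \<in> carrier A"
  shows "0 \<le> Re (\<psi> a)"
proof -
  have "Re (\<psi> ((-1) \<odot> a)) \<le> 0"
  proof (rule weak_hullD[OF assms(2)])
    fix \<eta> assume "\<eta> \<in> E"
    then have "lin_fun \<eta>" "0 \<le> Re (\<eta> a)" using assms(1) by auto
    then show "Re (\<eta> ((-1) \<odot> a)) \<le> 0" using lin_funD(2)[of \<eta> a "-1"] assms(3) by simp
  qed (use assms(3) in auto)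
  then show ?thesis using lin_funD(2)[OF weak_hull_lin[OF assms(2)] assms(3)] by simp
qed

text \<open>One bound \<open>M\<close> serves all indices; this is what makes the hull of all
  coefficients together compact.\<close>

locale op_rep_family = stalg A for A :: "'a alg" (structure) +
  fixes J :: "'j set" and H :: "'j \<Rightarrow> 'h inner_space" and \<rho> :: "'j \<Rightarrow> 'a \<Rightarrow> 'h \<Rightarrow> 'h" and M :: "'a \<Rightarrow> real"
  assumes fam: "j \<in> J \<Longrightarrow> op_rep A (H j) (\<rho> j) M"
begin

definition coefs :: "('a \<Rightarrow> complex) set" where
  "coefs = (\<Union>j\<in>J. unit_coefs A (H j) (\<rho> j))"

lemma coefsE:
  assumes "\<eta> \<in> coefs"
  obtains j w where "j \<in> J" "w \<in> carrier (H j)" "vnorm (H j) w \<le> 1" "\<eta> = coef A (H j) (\<rho> j) w"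
  using assms unfolding coefs_def unit_coefs_def by blast

lemma coefs_pos: "\<eta> \<in> coefs \<Longrightarrow> pos_fun \<eta>"
  by (elim coefsE) (simp add: op_rep.pos_fun_coef[OF fam])

lemma coefs_bound: "\<eta> \<in> coefs \<Longrightarrow> a \<in> carrier A \<Longrightarrow> lin_fun \<eta> \<and> cmod (\<eta> a) \<le> \<bar>M a\<bar>"
proof
  assume \<eta>: "\<eta> \<in> coefs" and a: "a \<in> carrier A"
  show "lin_fun \<eta>" by (rule pos_funD(1)[OF coefs_pos[OF \<eta>]])
  show "cmod (\<eta> a) \<le> \<bar>M a\<bar>"
    using \<eta> a by (elim coefsE) (simp add: op_rep.coef_bound[OF fam])
qed

lemma compact_hull: "compact (weak_hull coefs)"
  by (rule compact_weak_hull[of _ "\<lambda>a. \<bar>M a\<bar>"]) (rule coefs_bound)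

lemma hull_pos: "\<psi> \<in> weak_hull coefs \<Longrightarrow> pos_fun \<psi>"
  by (rule weak_hull_pos) (auto intro: coefs_pos)

text \<open>The claim is quadratic in \<psi>, so it is replaced by the linear inequalities 2 Re(cnj
  z \<psi>(b)) - \<psi>(b*b) \<le> |z|^2 for all \<open>z\<close>. On coefficients they say that the
  squared norm of \<open>\<rho> b w - z w\<close> is nonnegative, for \<open>w\<close> of norm at
  most 1; the choice \<open>z = \<psi> b\<close> gives the claim.\<close>

lemma hull_contractive:
  assumes \<psi>: "\<psi> \<in> weak_hull coefs" and b: "b \<in> carrier A"
  shows "(cmod (\<psi> b))\<^sup>2 \<le> Re (\<psi> (star A b \<otimes> b))"
proof -
  define z where "z = \<psi> b"
  have "Re (\<psi> ((2 * cnj z) \<odot> b \<oplus> (-1) \<odot> (star A b \<otimes> b))) \<le> (cmod z)\<^sup>2"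
  proof (rule weak_hullD[OF \<psi>])
    fix \<eta> assume "\<eta> \<in> coefs"
    then show "Re (\<eta> ((2 * cnj z) \<odot> b \<oplus> (-1) \<odot> (star A b \<otimes> b))) \<le> (cmod z)\<^sup>2"
    proof (elim coefsE)
      fix j w assume j: "j \<in> J" "w \<in> carrier (H j)" "vnorm (H j) w \<le> 1" "\<eta> = coef A (H j) (\<rho> j) w"
      interpret op_rep A "H j" "\<rho> j" M by (rule fam[OF j(1)])
      have "\<eta> ((2 * cnj z) \<odot> b \<oplus> (-1) \<odot> (star A b \<otimes> b))
         = 2 * cnj z * ip (H j) (\<rho> j b w) w - ip (H j) (\<rho> j b w) (\<rho> j b w)"
        using lin_funD[OF lin_fun_coef[OF j(2)]] b j(2,4) coef_star_mult[of w b b]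
        by simp (simp add: coef_def)
      moreover have "0 \<le> (vnorm (H j) (\<rho> j b w \<oplus>\<^bsub>H j\<^esub> (- z) \<odot>\<^bsub>H j\<^esub> w))\<^sup>2" by simp
      moreover have "(cmod z)\<^sup>2 * (vnorm (H j) w)\<^sup>2 \<le> (cmod z)\<^sup>2 * 1"
        using j by (intro mult_left_mono power_le_one) auto
      ultimately show ?thesis
        using vnorm_add_smult_sq[of "\<rho> j b w" w "-z"] j(2) b by (simp add: vnorm_sq)
    qed
  qed (use b in auto)
  then have "2 * Re (cnj z * z) - Re (\<psi> (star A b \<otimes> b)) \<le> (cmod z)\<^sup>2"
    using lin_funD[OF weak_hull_lin[OF \<psi>]] b unfolding z_def by (simp add: algebra_simps)
  moreover have "cnj z * z = of_real ((cmod z)\<^sup>2)" using complex_norm_square[of z] by (simp add: mult.commute)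
  ultimately show ?thesis unfolding z_def by simp
qed

text \<open>For fixed \<open>a\<close> and \<open>b\<close> this is linear in \<psi>, and for
  coefficients it is the operator bound at the vector \<open>\<rho> b w\<close>. It makes the
  algebra act by bounded operators after the GNS construction.\<close>

lemma hull_bounded_op:
  assumes \<psi>: "\<psi> \<in> weak_hull coefs" and a: "a \<in> carrier A" and b: "b \<in> carrier A"
  shows "Re (\<psi> (star A (a \<otimes> b) \<otimes> (a \<otimes> b))) \<le> (M a)\<^sup>2 * Re (\<psi> (star A b \<otimes> b))"
proof -
  let ?c = "of_real ((M a)\<^sup>2) \<odot> (star A b \<otimes> b) \<oplus> (-1) \<odot> (star A (a \<otimes> b) \<otimes> (a \<otimes> b))"
  have "0 \<le> Re (\<psi> ?c)"
  proof (rule weak_hull_nonneg[OF _ \<psi>])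
    fix \<eta> assume \<eta>: "\<eta> \<in> coefs"
    then show "lin_fun \<eta> \<and> 0 \<le> Re (\<eta> ?c)"
    proof (elim coefsE)
      fix j w assume j: "j \<in> J" "w \<in> carrier (H j)" "vnorm (H j) w \<le> 1" "\<eta> = coef A (H j) (\<rho> j) w"
      interpret op_rep A "H j" "\<rho> j" M by (rule fam[OF j(1)])
      have "(vnorm (H j) (\<rho> j a (\<rho> j b w)))\<^sup>2 \<le> (M a * vnorm (H j) (\<rho> j b w))\<^sup>2"
        using rep_bound[of a "\<rho> j b w"] a b j(2) by (intro power_mono) auto
      moreover have "\<eta> ?c = of_real ((M a)\<^sup>2) * ip (H j) (\<rho> j b w) (\<rho> j b w)
          - ip (H j) (\<rho> j a (\<rho> j b w)) (\<rho> j a (\<rho> j b w))"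
        using lin_funD[OF lin_fun_coef[OF j(2)]] a b j(2,4) coef_star_mult[of w b b]
          coef_star_mult[of w "a \<otimes> b" "a \<otimes> b"] by (simp add: rep_mult)
      ultimately have "0 \<le> Re (\<eta> ?c)"
        using a b j(2) by (simp add: vnorm_sq power_mult_distrib flip: of_real_power)
      then show ?thesis using coefs_bound[OF \<eta> a] by blast
    qed
  qed (use a b in auto)
  then show ?thesis using lin_funD[OF weak_hull_lin[OF \<psi>]] a b by (simp flip: of_real_power)
qed

end

section \<open>Irreducible representations\<close>

context prehil
begin

lemma submodule_subspaceI:
  assumes "S \<subseteq> carrier V" "\<zero> \<in> S" "\<And>u v. u \<in> S \<Longrightarrow> v \<in> S \<Longrightarrow> u \<oplus> v \<in> S"
    and smult: "\<And>c u. u \<in> S \<Longrightarrow> c \<odot> u \<in> S"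
  shows "submodule S complex_ring V"
proof (rule submoduleI)
  show "\<ominus> u \<in> S" if "u \<in> S" for u using smult[OF that, of "-1"] that assms(1) neg_eq_smult by auto
qed (use assms in auto)

lemma lin_span_minimal: "submodule S complex_ring V \<Longrightarrow> X \<subseteq> S \<Longrightarrow> lin_span V X \<subseteq> S"
  unfolding lin_span_def by blast

definition orth :: "'v set \<Rightarrow> 'v set" where
  "orth S = {u \<in> carrier V. \<forall>v\<in>S. ip V u v = 0}"

lemma submodule_orth: "S \<subseteq> carrier V \<Longrightarrow> submodule (orth S) complex_ring V"
  by (rule submodule_subspaceI) (auto simp: orth_def subset_iff)

lemma orth_closed:
  assumes "S \<subseteq> carrier V" "\<And>n. s n \<in> orth S" "vconv V s x"
  shows "x \<in> orth S"
proof -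
  have "ip V x v = 0" if "v \<in> S" for v
  proof -
    have "(\<lambda>n. ip V (s n) v) \<longlonglongrightarrow> ip V x v" using vconv_ip_left[OF assms(3)] assms(1) that by auto
    moreover have "ip V (s n) v = 0" for n using assms(2)[of n] that unfolding orth_def by auto
    ultimately show ?thesis using LIMSEQ_unique[OF _ tendsto_const] by simp
  qed
  then show ?thesis using vconvD(2)[OF assms(3)] unfolding orth_def by auto
qed

lemma closedin_orth: "S \<subseteq> carrier V \<Longrightarrow> closedin MS.mtopology (orth S)"
proof -
  assume S: "S \<subseteq> carrier V"
  have "orth S \<subseteq> carrier V" unfolding orth_def by blast
  then show ?thesis unfolding closedin_iff_vconv using orth_closed[OF S] by blast
qed

end

lemma (in op_rep) rep_zero: "a \<in> carrier A \<Longrightarrow> \<rho> a \<zero>\<^bsub>H\<^esub> = \<zero>\<^bsub>H\<^esub>"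
  using rep_bound[of a "\<zero>\<^bsub>H\<^esub>"] vnorm_nonneg[of "\<rho> a \<zero>\<^bsub>H\<^esub>"] vnorm_eq_0[of "\<rho> a \<zero>\<^bsub>H\<^esub>"]
  by (simp add: order_antisym)

text \<open>\<open>bounded_map\<close> asserts the existence of a constant; \<open>op_rep\<close>
  takes it as a function of the algebra element, so one is chosen.\<close>

definition op_bound :: "'v inner_space \<Rightarrow> ('v \<Rightarrow> 'v) \<Rightarrow> real" where
  "op_bound V f = (SOME c. \<forall>u\<in>carrier V. vnorm V (f u) \<le> c * vnorm V u)"

locale unirep = stalg A for A :: "'a alg" (structure) +
  fixes V :: "'v inner_space" and \<sigma> :: "'a \<Rightarrow> 'v \<Rightarrow> 'v"
  assumes unitary: "unitary_rep A V \<sigma>"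
begin

lemma hilbert: "hilbert V"
  using unitary unfolding unitary_rep_def by blast

sublocale op_rep A V \<sigma> "\<lambda>a. op_bound V (\<sigma> a)"
proof
  show "pre_hilbert V" using hilbert unfolding hilbert_def by blast
  fix a w assume a: "a \<in> carrier A" and w: "w \<in> carrier V"
  have lin: "linear_map V V (\<sigma> a)" and bd: "bounded_map V V (\<sigma> a)"
    using unitary a unfolding unitary_rep_def by blast+
  show "\<sigma> a w \<in> carrier V" using lin w unfolding linear_map_def by blast
  show "\<sigma> a (w \<oplus>\<^bsub>V\<^esub> w') = \<sigma> a w \<oplus>\<^bsub>V\<^esub> \<sigma> a w'" if "w' \<in> carrier V" for w'
    using lin w that unfolding linear_map_def by blast
  show "\<sigma> a (c \<odot>\<^bsub>V\<^esub> w) = c \<odot>\<^bsub>V\<^esub> \<sigma> a w" for c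
    using lin w unfolding linear_map_def by blast
  have "\<exists>c. \<forall>u\<in>carrier V. vnorm V (\<sigma> a u) \<le> c * vnorm V u" using bd unfolding bounded_map_def .
  then have "\<forall>u\<in>carrier V. vnorm V (\<sigma> a u) \<le> op_bound V (\<sigma> a) * vnorm V u"
    unfolding op_bound_def by (rule someI_ex)
  then show "vnorm V (\<sigma> a w) \<le> op_bound V (\<sigma> a) * vnorm V w" using w by blast
  show "\<sigma> (a \<oplus> b) w = \<sigma> a w \<oplus>\<^bsub>V\<^esub> \<sigma> b w" if "b \<in> carrier A" for b
    using unitary a w that unfolding unitary_rep_def by blast
  show "\<sigma> (a \<otimes> b) w = \<sigma> a (\<sigma> b w)" if "b \<in> carrier A" for b
    using unitary a w that unfolding unitary_rep_def by blast
  show "\<sigma> (c \<odot> a) w = c \<odot>\<^bsub>V\<^esub> \<sigma> a w" for c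
    using unitary a w unfolding unitary_rep_def by blast
  show "ip V (\<sigma> a w) w' = ip V w (\<sigma> (star A a) w')" if "w' \<in> carrier V" for w'
    using unitary a w that unfolding unitary_rep_def by blast
qed

lemma nondegenerate:
  assumes x: "x \<in> carrier V" and orth: "\<And>a w. a \<in> carrier A \<Longrightarrow> w \<in> carrier V \<Longrightarrow> ip V (\<sigma> a w) x = 0"
  shows "x = \<zero>\<^bsub>V\<^esub>"
proof -
  let ?S = "{\<sigma> a v | a v. a \<in> carrier A \<and> v \<in> carrier V}"
  have "?S \<subseteq> orth {x}" using orth unfolding orth_def by auto
  then have *: "lin_span V ?S \<subseteq> orth {x}" using lin_span_minimal submodule_orth[of "{x}"] x by simp
  then have sub: "lin_span V ?S \<subseteq> carrier V" unfolding orth_def by auto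
  have "x \<in> MS.mtopology closure_of lin_span V ?S"
    using unitary x unfolding unitary_rep_def by simp
  then obtain s where s: "\<And>n. s n \<in> lin_span V ?S" "vconv V s x"
    using closure_of_iff_vconv[OF sub] by blast
  then have "x \<in> orth {x}" using orth_closed[of "{x}" s x] * x by blast
  then have "Re (ip V x x) = 0" unfolding orth_def by simp
  then show ?thesis using Re_ip_self_eq_0[OF x] by blast
qed

text \<open>For a self-adjoint idempotent the squared norm of \<open>\<sigma> e w\<close> is its
  inner product with \<open>w\<close>.\<close>

lemma projection_contraction:
  assumes e: "e \<in> carrier A" "e \<otimes> e = e" "star A e = e" and w: "w \<in> carrier V"
  shows "vnorm V (\<sigma> e w) \<le> vnorm V w"
proof -
  have "ip V (\<sigma> e w) (\<sigma> e w) = ip V (\<sigma> e w) w"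
    using rep_star_mult[of e e w] e w by simp
  then have "(vnorm V (\<sigma> e w))\<^sup>2 = Re (ip V (\<sigma> e w) w)" using e w by (simp add: vnorm_sq)
  also have "\<dots> \<le> vnorm V (\<sigma> e w) * vnorm V w"
    using complex_Re_le_cmod cauchy_schwarz[of "\<sigma> e w" w] e w order_trans by blast
  finally have "vnorm V (\<sigma> e w) * vnorm V (\<sigma> e w) \<le> vnorm V (\<sigma> e w) * vnorm V w"
    by (simp add: power2_eq_square)
  then show ?thesis using e w vnorm_nonneg[of "\<sigma> e w"] vnorm_nonneg[of w]
    by (metis mult_le_cancel_left_pos less_eq_real_def rep_in)
qed

end

locale irrep = stalg A for A :: "'a alg" (structure) +
  fixes V :: "'v inner_space" and \<sigma> :: "'a \<Rightarrow> 'v \<Rightarrow> 'v"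
  assumes irreducible: "irreducible_rep A V \<sigma>"
begin

sublocale unirep A V \<sigma>
  by unfold_locales (use irreducible in \<open>simp add: irreducible_rep_def\<close>)

lemma nonzero: "carrier V \<noteq> {\<zero>\<^bsub>V\<^esub>}"
  using irreducible unfolding irreducible_rep_def by blast

lemma invariant_subspace:
  assumes "submodule W complex_ring V" "\<And>a w. a \<in> carrier A \<Longrightarrow> w \<in> W \<Longrightarrow> \<sigma> a w \<in> W"
    "closedin MS.mtopology W"
  shows "W = {\<zero>\<^bsub>V\<^esub>} \<or> W = carrier V"
  using irreducible assms unfolding irreducible_rep_def by blast

text \<open>The orthogonal complement of the orbit of \<open>d\<close> is closed and invariant,
  hence zero or everything. In the second case \<open>d\<close> would be orthogonal to the image of
  the algebra, contrary to nondegeneracy.\<close>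

lemma orth_orbit:
  assumes d: "d \<in> carrier V" "d \<noteq> \<zero>\<^bsub>V\<^esub>"
    and x: "x \<in> carrier V" "\<And>a. a \<in> carrier A \<Longrightarrow> ip V x (\<sigma> a d) = 0"
  shows "x = \<zero>\<^bsub>V\<^esub>"
proof -
  let ?S = "{\<sigma> a d | a. a \<in> carrier A}"
  have S: "?S \<subseteq> carrier V" using d by auto
  have "\<sigma> b w \<in> orth ?S" if b: "b \<in> carrier A" and w: "w \<in> orth ?S" for b w
  proof -
    have wc: "w \<in> carrier V" using w unfolding orth_def by auto
    have "ip V (\<sigma> b w) (\<sigma> a d) = 0" if a: "a \<in> carrier A" for a
    proof -
      have "ip V (\<sigma> b w) (\<sigma> a d) = ip V w (\<sigma> (star A b \<otimes> a) d)"
        using a b wc d by (simp add: rep_mult rep_adj)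
      also have "\<dots> = 0" using w a b unfolding orth_def by blast
      finally show ?thesis .
    qed
    then show ?thesis using b wc unfolding orth_def by auto
  qed
  then have "orth ?S = {\<zero>\<^bsub>V\<^esub>} \<or> orth ?S = carrier V"
    using invariant_subspace submodule_orth[OF S] closedin_orth[OF S] by blast
  then show ?thesis
  proof
    assume "orth ?S = {\<zero>\<^bsub>V\<^esub>}"
    then show ?thesis using x unfolding orth_def by blast
  next
    assume *: "orth ?S = carrier V"
    have "d = \<zero>\<^bsub>V\<^esub>"
    proof (rule nondegenerate[OF d(1)])
      fix a w assume a: "a \<in> carrier A" and w: "w \<in> carrier V"
      have "w \<in> orth ?S" using w * by simp
      then have "ip V w (\<sigma> (star A a) d) = 0" using a unfolding orth_def by blast
      then show "ip V (\<sigma> a w) d = 0" using a w d by (simp add: rep_adj)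
    qed
    with d show ?thesis by simp
  qed
qed

text \<open>Project \<open>x\<close> to the closure of the orbit of \<open>v\<close>; the difference
  is orthogonal to the orbit and therefore zero.\<close>

lemma cyclic:
  assumes v: "v \<in> carrier V" "v \<noteq> \<zero>\<^bsub>V\<^esub>" and x: "x \<in> carrier V"
  shows "\<exists>s. (\<forall>n. s n \<in> carrier A) \<and> vconv V (\<lambda>n. \<sigma> (s n) v) x"
proof -
  let ?D = "{\<sigma> a v | a. a \<in> carrier A}"
  have D: "?D \<subseteq> carrier V" using v by auto
  have "\<exists>s d. (\<forall>n. s n \<in> ?D) \<and> vconv V s d \<and> (\<forall>y\<in>?D. ip V y x = ip V y d)"
  proof (rule riesz_on_subspace[OF hilbert D])
    show "?D \<noteq> {}" by auto
    show "u \<oplus>\<^bsub>V\<^esub> w \<in> ?D" if u: "u \<in> ?D" and w: "w \<in> ?D" for u w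
    proof -
      obtain a b where "a \<in> carrier A" "b \<in> carrier A" "u = \<sigma> a v" "w = \<sigma> b v" using u w by auto
      then show ?thesis using rep_add[of a b v] v by (intro CollectI exI[of _ "a \<oplus> b"]) auto
    qed
    show "c \<odot>\<^bsub>V\<^esub> u \<in> ?D" if u: "u \<in> ?D" for u c
    proof -
      obtain a where "a \<in> carrier A" "u = \<sigma> a v" using u by auto
      then show ?thesis using rep_smult[of a v c] v by (intro CollectI exI[of _ "c \<odot> a"]) auto
    qed
    show "cmod (ip V y x) \<le> vnorm V x * vnorm V y" if "y \<in> ?D" for y
      using cauchy_schwarz[of y x] that D x by (simp add: mult.commute subset_iff)
  qed (use D x in \<open>auto simp: subset_iff\<close>)
  then obtain s d where s: "\<And>n. s n \<in> ?D" "vconv V s d" and d: "\<And>y. y \<in> ?D \<Longrightarrow> ip V y x = ip V y d"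
    by blast
  have dc: "d \<in> carrier V" using vconvD(2)[OF s(2)] .
  have "x \<ominus>\<^bsub>V\<^esub> d = \<zero>\<^bsub>V\<^esub>"
  proof (rule orth_orbit[OF v])
    fix a assume a: "a \<in> carrier A"
    then have "ip V (\<sigma> a v) x = ip V (\<sigma> a v) d" using d by blast
    then show "ip V (x \<ominus>\<^bsub>V\<^esub> d) (\<sigma> a v) = 0"
      using ip_commute[of "\<sigma> a v" x] ip_commute[of "\<sigma> a v" d] a v x dc by simp
  qed (use x dc in auto)
  then have "x = d" using minus_eq_zero_iff x dc by blast
  moreover have "\<forall>n. \<exists>a. a \<in> carrier A \<and> s n = \<sigma> a v" using s(1) by blast
  then obtain t where t: "\<And>n. t n \<in> carrier A" "\<And>n. s n = \<sigma> (t n) v" by metis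
  moreover from t(2) have "s = (\<lambda>n. \<sigma> (t n) v)" by auto
  ultimately show ?thesis using s(2) t(1) by (intro exI[of _ t]) simp
qed

end

lemma (in stalg) pos_fun_scale:
  "pos_fun \<psi> \<Longrightarrow> 0 \<le> r \<Longrightarrow> pos_fun (\<lambda>a. of_real r * \<psi> a)"
  unfolding pos_fun_def lin_fun_def by (simp add: algebra_simps)

text \<open>
  Schur's lemma without spectral theory: the functionals dominated by that of a vector \<open>v\<close> form a
  compact convex set. If \<open>\<eta> = \<langle>- v, d\<rangle>\<close> is one of its extreme points, then \<open>\<eta>\<close> is the midpoint of
  \<open>\<langle>- d, d\<rangle>\<close> and \<open>2 \<eta> - \<langle>- d, d\<rangle>\<close>, hence \<open>v - d\<close> is orthogonal to the orbit of \<open>d\<close>, so that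
  \<open>d = 0\<close> or \<open>d = v\<close>.
\<close>

locale irrep_vector = irrep A V \<sigma> for A :: "'a alg" (structure) and V :: "'v inner_space" and \<sigma> +
  fixes v :: 'v
  assumes v: "v \<in> carrier V" "vnorm V v = 1"
begin

lemma v_nonzero: "v \<noteq> \<zero>\<^bsub>V\<^esub>"
  using v by (metis vnorm_zero zero_neq_one)

abbreviation \<phi> :: "'a \<Rightarrow> complex" where
  "\<phi> \<equiv> coef A V \<sigma> v"

lemma phi_star_mult: "b \<in> carrier A \<Longrightarrow> Re (\<phi> (star A b \<otimes> b)) = (vnorm V (\<sigma> b v))\<^sup>2"
  using v by (simp add: coef_star_mult vnorm_sq)

definition dominated :: "('a \<Rightarrow> complex) set" where
  "dominated = {\<eta>. pos_fun \<eta> \<and> (\<forall>b\<in>carrier A. Re (\<eta> (star A b \<otimes> b)) \<le> Re (\<phi> (star A b \<otimes> b)))}"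

lemma dominatedD:
  assumes "\<eta> \<in> dominated"
  shows "pos_fun \<eta>" "b \<in> carrier A \<Longrightarrow> Re (\<eta> (star A b \<otimes> b)) \<le> (vnorm V (\<sigma> b v))\<^sup>2"
  using assms phi_star_mult unfolding dominated_def by auto

text \<open>A projection \<open>e\<close> with \<open>e a = a\<close> replaces the unit:
  Cauchy-Schwarz is applied to \<eta>(e*a), and \<eta>(e*e) is at most 1 because \<open>e\<close>
  contracts the unit vector \<open>v\<close>.\<close>

lemma dominated_bound:
  assumes \<eta>: "\<eta> \<in> dominated" and a: "a \<in> carrier A"
  shows "cmod (\<eta> a) \<le> vnorm V (\<sigma> a v)"
proof -
  obtain e where e: "e \<in> carrier A" "e \<otimes> e = e" "star A e = e" "e \<otimes> a = a"
    using local_unit[of "{a}"] a by auto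
  have "vnorm V (\<sigma> e v) \<le> 1" using projection_contraction[of e v] e v by simp
  then have ev: "(vnorm V (\<sigma> e v))\<^sup>2 \<le> 1" using e v by (simp add: power_le_one)
  have "(cmod (\<eta> a))\<^sup>2 = (cmod (\<eta> (star A e \<otimes> a)))\<^sup>2" using e by simp
  also have "\<dots> \<le> Re (\<eta> (star A a \<otimes> a)) * Re (\<eta> (star A e \<otimes> e))"
    by (rule pos_fun_cauchy_schwarz[OF dominatedD(1)[OF \<eta>] a e(1)])
  also have "\<dots> \<le> (vnorm V (\<sigma> a v))\<^sup>2 * 1"
    using dominatedD(2)[OF \<eta> a] dominatedD(2)[OF \<eta> e(1)] ev pos_funD(3)[OF dominatedD(1)[OF \<eta>]] a e(1)
    by (intro mult_mono) (auto simp del: e)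
  finally show ?thesis using a v by (simp add: power2_le_iff_abs_le)
qed

lemma closed_dominated: "closed dominated"
proof -
  have "dominated = {\<psi>. lin_fun \<psi>} \<inter>
     (\<Inter>b\<in>carrier A. {\<psi>. \<psi> (star A b) = cnj (\<psi> b)} \<inter> {\<psi>. 0 \<le> Re (\<psi> (star A b \<otimes> b))} \<inter>
       {\<psi>. Re (\<psi> (star A b \<otimes> b)) \<le> Re (\<phi> (star A b \<otimes> b))})"
    unfolding dominated_def pos_fun_def by auto
  also have "closed \<dots>"
    by (intro closed_Int closed_INT ballI closed_lin_fun closed_Collect_le closed_Collect_eq
        continuous_on_Re continuous_on_cnj continuous_on_const continuous_fun_coord continuous_on_id)
  finally show ?thesis .
qed

lemma compact_dominated: "compact dominated"
proof (rule compact_pointwise_bounded[OF closed_dominated])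
  fix \<eta> a assume \<eta>: "\<eta> \<in> dominated"
  then show "cmod (\<eta> a) \<le> (if a \<in> carrier A then vnorm V (\<sigma> a v) else 0)"
    using dominated_bound[OF \<eta>] lin_funD(3)[OF pos_funD(1)[OF dominatedD(1)[OF \<eta>]]] by auto
qed

text \<open>By \<open>dominated_bound\<close> the value \<open>\<eta> a\<close> depends only on
  \<open>\<sigma> a v\<close> and is bounded by its norm, so it is a functional on the orbit of
  \<open>v\<close> to which the Riesz theorem applies. Hermitian symmetry then moves the
  representing vector to the other argument.\<close>

lemma dominated_vector:
  assumes \<eta>: "\<eta> \<in> dominated"
  obtains d where "d \<in> carrier V" "\<And>a. a \<in> carrier A \<Longrightarrow> \<eta> a = ip V (\<sigma> a d) v"
proof -
  note l = lin_funD[OF pos_funD(1)[OF dominatedD(1)[OF \<eta>]]]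
  let ?D = "{\<sigma> a v | a. a \<in> carrier A}"
  define L where "L x = \<eta> (SOME a. a \<in> carrier A \<and> x = \<sigma> a v)" for x
  have L: "L (\<sigma> a v) = \<eta> a" if a: "a \<in> carrier A" for a
  proof -
    define b where "b = (SOME b. b \<in> carrier A \<and> \<sigma> a v = \<sigma> b v)"
    have b: "b \<in> carrier A" "\<sigma> a v = \<sigma> b v"
      unfolding b_def using someI[of "\<lambda>b. b \<in> carrier A \<and> \<sigma> a v = \<sigma> b v" a] a by auto
    have "\<sigma> (a \<oplus> (-1) \<odot> b) v = \<sigma> a v \<ominus>\<^bsub>V\<^esub> \<sigma> b v"
      using a b v by (simp add: rep_add rep_smult a_minus_def neg_eq_smult)
    then have "vnorm V (\<sigma> (a \<oplus> (-1) \<odot> b) v) = 0"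
      using minus_eq_zero_iff[of "\<sigma> a v" "\<sigma> b v"] a b v by simp
    then have "\<eta> (a \<oplus> (-1) \<odot> b) = 0" using dominated_bound[OF \<eta>, of "a \<oplus> (-1) \<odot> b"] a b by simp
    then show ?thesis using l a b unfolding L_def b_def[symmetric] by simp
  qed
  have "\<exists>s d. (\<forall>n. s n \<in> ?D) \<and> vconv V s d \<and> (\<forall>y\<in>?D. L y = ip V y d)"
  proof (rule riesz_on_subspace[OF hilbert])
    fix x y c assume x: "x \<in> ?D"
    then obtain a where a: "a \<in> carrier A" "x = \<sigma> a v" by auto
    have s: "c \<odot>\<^bsub>V\<^esub> x = \<sigma> (c \<odot> a) v" using a v by (simp add: rep_smult)
    show "c \<odot>\<^bsub>V\<^esub> x \<in> ?D" unfolding s using a by blast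
    show "L (c \<odot>\<^bsub>V\<^esub> x) = c * L x" unfolding s using a by (simp add: L l)
    show "cmod (L x) \<le> 1 * vnorm V x" using dominated_bound[OF \<eta>] a by (simp add: L)
    assume "y \<in> ?D"
    then obtain b where b: "b \<in> carrier A" "y = \<sigma> b v" by auto
    have s: "x \<oplus>\<^bsub>V\<^esub> y = \<sigma> (a \<oplus> b) v" using a b v by (simp add: rep_add)
    show "x \<oplus>\<^bsub>V\<^esub> y \<in> ?D" unfolding s using a b by blast
    show "L (x \<oplus>\<^bsub>V\<^esub> y) = L x + L y" unfolding s using a b by (simp add: L l)
  qed (use v in auto)
  then obtain d where d: "d \<in> carrier V" "\<And>a. a \<in> carrier A \<Longrightarrow> \<eta> a = ip V (\<sigma> a v) d"
    using L vconvD(2) by (metis (mono_tags, lifting) mem_Collect_eq)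
  have "\<eta> a = ip V (\<sigma> a d) v" if a: "a \<in> carrier A" for a
  proof -
    have "ip V (\<sigma> a d) v = cnj (ip V (\<sigma> (star A a) v) d)"
      using a d(1) v ip_commute[of "\<sigma> (star A a) v" d] by (simp add: rep_adj)
    also have "\<dots> = cnj (\<eta> (star A a))" using d(2) a by simp
    also have "\<dots> = \<eta> a" using pos_funD(2)[OF dominatedD(1)[OF \<eta>] a] by simp
    finally show ?thesis by simp
  qed
  with d(1) show thesis using that by blast
qed

lemma extreme_dominated:
  assumes "extreme_fun \<eta> dominated"
  shows "\<eta> = \<phi> \<or> \<eta> = (\<lambda>_. 0)"
proof -
  have \<eta>: "\<eta> \<in> dominated" using assms unfolding extreme_fun_def by blast
  note p = dominatedD(1)[OF \<eta>]
  note l = lin_funD[OF pos_funD(1)[OF p]]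
  obtain d where d: "d \<in> carrier V" "\<And>a. a \<in> carrier A \<Longrightarrow> \<eta> a = ip V (\<sigma> a d) v"
    using dominated_vector[OF \<eta>] by blast
  define \<eta>2 where "\<eta>2 = coef A V \<sigma> d"
  have p2: "pos_fun \<eta>2" unfolding \<eta>2_def by (rule pos_fun_coef[OF d(1)])
  have \<eta>2: "Re (\<eta>2 (star A b \<otimes> b)) = (vnorm V (\<sigma> b d))\<^sup>2" if "b \<in> carrier A" for b
    unfolding \<eta>2_def using that d by (simp add: coef_star_mult vnorm_sq)
  \<comment> \<open>Cauchy-Schwarz for \<eta> and domination bound the pairing of
    \<open>\<sigma> b d\<close> with every \<open>\<sigma> c v\<close>; as \<open>v\<close> is
    cyclic, \<open>\<sigma> c v\<close> may tend to \<open>\<sigma> b d\<close> itself.\<close>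
  have le: "(vnorm V (\<sigma> b d))\<^sup>2 \<le> Re (\<eta> (star A b \<otimes> b))" if b: "b \<in> carrier A" for b
  proof -
    define r where "r = sqrt (Re (\<eta> (star A b \<otimes> b)))"
    have r: "0 \<le> r" "r\<^sup>2 = Re (\<eta> (star A b \<otimes> b))" unfolding r_def using pos_funD(3)[OF p b] by auto
    have *: "cmod (ip V (\<sigma> b d) (\<sigma> c v)) \<le> r * vnorm V (\<sigma> c v)" if c: "c \<in> carrier A" for c
    proof -
      have "ip V (\<sigma> b d) (\<sigma> c v) = ip V (\<sigma> (star A c \<otimes> b) d) v"
        using b c d(1) v by (simp add: rep_mult rep_adj)
      also have "\<dots> = \<eta> (star A c \<otimes> b)" using d(2) b c by simp
      finally have "(cmod (ip V (\<sigma> b d) (\<sigma> c v)))\<^sup>2 \<le> Re (\<eta> (star A b \<otimes> b)) * Re (\<eta> (star A c \<otimes> c))"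
        using pos_fun_cauchy_schwarz[OF p b c] by simp
      also have "\<dots> \<le> r\<^sup>2 * (vnorm V (\<sigma> c v))\<^sup>2"
        unfolding r(2) by (intro mult_left_mono dominatedD(2)[OF \<eta> c] pos_funD(3)[OF p b])
      finally show ?thesis using r(1) c v
        by (metis power_mult_distrib power2_le_imp_le mult_nonneg_nonneg vnorm_nonneg rep_in)
    qed
    obtain s where s: "\<And>n. s n \<in> carrier A" "vconv V (\<lambda>n. \<sigma> (s n) v) (\<sigma> b d)"
      using cyclic[OF v(1) v_nonzero, of "\<sigma> b d"] b d by auto
    have "cmod (ip V (\<sigma> b d) (\<sigma> b d)) \<le> r * vnorm V (\<sigma> b d)"
    proof (rule LIMSEQ_le)
      show "(\<lambda>n. cmod (ip V (\<sigma> b d) (\<sigma> (s n) v))) \<longlonglongrightarrow> cmod (ip V (\<sigma> b d) (\<sigma> b d))"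
        using vconv_ip_right[OF s(2)] b d by (intro tendsto_norm) auto
      show "(\<lambda>n. r * vnorm V (\<sigma> (s n) v)) \<longlonglongrightarrow> r * vnorm V (\<sigma> b d)"
        by (intro tendsto_mult_left vconv_vnorm[OF s(2)])
    qed (use * s(1) in auto)
    then have "vnorm V (\<sigma> b d) * vnorm V (\<sigma> b d) \<le> r * vnorm V (\<sigma> b d)"
      using b d by (simp add: ip_self norm_power power2_eq_square norm_mult)
    then have "vnorm V (\<sigma> b d) \<le> r"
      using vnorm_nonneg[of "\<sigma> b d"] b d r(1)
      by (metis mult_le_cancel_right_pos less_eq_real_def rep_in)
    then have "(vnorm V (\<sigma> b d))\<^sup>2 \<le> r\<^sup>2" using b d by (intro power_mono) auto
    then show ?thesis using r(2) by simp
  qed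
  define \<eta>3 where "\<eta>3 a = 2 * \<eta> a - \<eta>2 a" for a
  have l2: "lin_fun \<eta>2" by (rule pos_funD(1)[OF p2])
  have "\<eta>2 \<in> dominated"
    using p2 \<eta>2 le dominatedD(2)[OF \<eta>] order_trans phi_star_mult unfolding dominated_def by fastforce
  moreover have "\<eta>3 \<in> dominated"
    unfolding dominated_def pos_fun_def
  proof (intro CollectI conjI ballI)
    show "lin_fun \<eta>3"
      unfolding lin_fun_def \<eta>3_def using l lin_funD[OF l2] by (simp add: algebra_simps)
    fix b assume b: "b \<in> carrier A"
    show "\<eta>3 (star A b) = cnj (\<eta>3 b)"
      unfolding \<eta>3_def using pos_funD(2)[OF p b] pos_funD(2)[OF p2 b] by simp
    show "0 \<le> Re (\<eta>3 (star A b \<otimes> b))"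
      unfolding \<eta>3_def using le[OF b] \<eta>2[OF b] pos_funD(3)[OF p b] by simp
    \<comment> \<open>This is the cross term in the squared norm of \<open>\<sigma> b v\<close>
      minus \<open>\<sigma> b d\<close>, whose nonnegativity says that \<open>\<eta>3\<close> is
      dominated by \<phi>.\<close>
    have "ip V (\<sigma> b d) (\<sigma> b v) = \<eta> (star A b \<otimes> b)"
      using d(1) v b by (simp add: d(2) rep_mult rep_adj star_mult)
    then have "ip V (\<sigma> b v) (\<sigma> b d) = cnj (\<eta> (star A b \<otimes> b))"
      using ip_commute[of "\<sigma> b d" "\<sigma> b v"] b d v by simp
    moreover have "0 \<le> (vnorm V (\<sigma> b v \<ominus>\<^bsub>V\<^esub> \<sigma> b d))\<^sup>2" by simp
    ultimately show "Re (\<eta>3 (star A b \<otimes> b)) \<le> Re (\<phi> (star A b \<otimes> b))"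
      unfolding \<eta>3_def using vnorm_minus_sq[of "\<sigma> b v" "\<sigma> b d"] \<eta>2[OF b] phi_star_mult[OF b] b d v by simp
  qed
  moreover have "mix (1/2) \<eta>2 \<eta>3 = \<eta>" unfolding mix_def \<eta>3_def by (auto simp: field_simps)
  ultimately have "\<eta>2 = \<eta>"
    using assms[unfolded extreme_fun_def, THEN conjunct2, rule_format, of \<eta>2 \<eta>3 "1/2"] by simp
  then have eq: "ip V (\<sigma> a d) d = ip V (\<sigma> a d) v" if "a \<in> carrier A" for a
  proof -
    have "\<eta>2 a = ip V (\<sigma> a d) d" unfolding \<eta>2_def coef_def using that by simp
    then show ?thesis using d(2)[OF that] \<open>\<eta>2 = \<eta>\<close> by simp
  qed
  show ?thesis
  proof (cases "d = \<zero>\<^bsub>V\<^esub>")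
    case True
    have "\<eta> a = 0" for a
    proof (cases "a \<in> carrier A")
      case True
      then show ?thesis using d(2)[OF True] rep_zero v \<open>d = \<zero>\<^bsub>V\<^esub>\<close> by simp
    qed (use l in auto)
    then show ?thesis by auto
  next
    case False
    have "v \<ominus>\<^bsub>V\<^esub> d = \<zero>\<^bsub>V\<^esub>"
    proof (rule orth_orbit[OF d(1) False])
      fix a assume a: "a \<in> carrier A"
      then show "ip V (v \<ominus>\<^bsub>V\<^esub> d) (\<sigma> a d) = 0"
        using eq[OF a] ip_commute[of "\<sigma> a d" d] ip_commute[of "\<sigma> a d" v] d v by simp
    qed (use d v in auto)
    then have "v = d" using minus_eq_zero_iff v d by blast
    then have "\<eta> = \<phi>" using \<open>\<eta>2 = \<eta>\<close> unfolding \<eta>2_def by simp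
    then show ?thesis by simp
  qed
qed

text \<open>Every real linear functional on the compact set is maximal at an extreme point, that is,
  at 0 or \<phi>. Where \<phi> vanishes, maximizing Re(cnj \<eta>(a) \<xi>(a)) over \<xi> therefore
  gives 0 and forces \<eta>(a) = 0. Functionals with such kernels are proportional, and evaluation
  at some b*b with positive value shows that the factor is nonnegative.\<close>

lemma dominated_scalar:
  assumes \<eta>: "\<eta> \<in> dominated"
  shows "\<exists>t\<ge>0. \<forall>a. \<eta> a = of_real t * \<phi> a"
proof -
  note p = dominatedD(1)[OF \<eta>]
  note l = lin_funD[OF pos_funD(1)[OF p]]
  note l' = lin_funD[OF lin_fun_coef[OF v(1)]]
  have ker: "\<eta> a = 0" if "\<phi> a = 0" for a
  proof -
    have "dominated \<noteq> {}" using \<eta> by auto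
    then obtain \<xi> where \<xi>: "extreme_fun \<xi> dominated"
      "\<forall>\<psi>\<in>dominated. Re (\<Sum>x\<in>{a}. cnj (\<eta> a) * \<psi> x) \<le> Re (\<Sum>x\<in>{a}. cnj (\<eta> a) * \<xi> x)"
      using extreme_maximizer[OF compact_dominated closed_dominated _
          continuous_fun_Re[of "\<lambda>_. cnj (\<eta> a)" "{a}"] affine_fun_Re] by blast
    have "\<xi> a = 0" using extreme_dominated[OF \<xi>(1)] that by auto
    then have "Re (cnj (\<eta> a) * \<eta> a) \<le> 0" using \<xi>(2) \<eta> by auto
    then show ?thesis by (simp add: complex_mult_cnj mult.commute sum_power2_le_zero_iff complex_eq_iff flip: power2_eq_square)
  qed
  have "\<exists>b\<in>carrier A. \<sigma> b v \<noteq> \<zero>\<^bsub>V\<^esub>"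
  proof (rule ccontr)
    assume "\<not> ?thesis"
    then have z: "\<sigma> b v = \<zero>\<^bsub>V\<^esub>" if "b \<in> carrier A" for b using that by blast
    obtain s where "\<And>n. s n \<in> carrier A" "vconv V (\<lambda>n. \<sigma> (s n) v) v"
      using cyclic[OF v(1) v_nonzero v(1)] by blast
    then have "vconv V (\<lambda>n. \<zero>\<^bsub>V\<^esub>) v" using z by simp
    then have "v = \<zero>\<^bsub>V\<^esub>" using vconv_unique[OF _ vconv_const] by blast
    then show False using v_nonzero by simp
  qed
  then obtain b where b: "b \<in> carrier A" "\<sigma> b v \<noteq> \<zero>\<^bsub>V\<^esub>" by blast
  let ?c = "star A b \<otimes> b"
  define r where "r = (vnorm V (\<sigma> b v))\<^sup>2"
  have "r > 0" unfolding r_def using b v vnorm_eq_0[of "\<sigma> b v"] by simp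
  have rc: "\<phi> ?c = of_real r" unfolding r_def using b v by (simp add: coef_star_mult ip_self)
  define t where "t = Re (\<eta> ?c) / r"
  have tc: "\<eta> ?c = of_real t * of_real r"
    unfolding t_def using pos_funD(4)[OF p b(1)] \<open>r > 0\<close> by (simp add: complex_eq_iff)
  have "\<eta> a = of_real t * \<phi> a" for a
  proof (cases "a \<in> carrier A")
    case True
    \<comment> \<open>\<open>a\<close> corrected by a multiple of b*b so as to lie in the kernel of
      \<phi>.\<close>
    let ?x = "a \<oplus> (- \<phi> a / of_real r) \<odot> ?c"
    have "\<phi> ?x = 0" using l' True b(1) rc \<open>r > 0\<close> by simp
    then have "\<eta> ?x = 0" by (rule ker)
    then show ?thesis using l True b(1) tc \<open>r > 0\<close> by (simp add: field_simps)
  qed (use l l' in auto)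
  moreover have "0 \<le> t" unfolding t_def using pos_funD(3)[OF p b(1)] \<open>r > 0\<close> by simp
  ultimately show ?thesis by blast
qed

text \<open>These elements stand in for a unit: they move \<open>v\<close> arbitrarily
  little.\<close>

lemma approximate_vector:
  obtains s where "\<And>n. s n \<in> carrier A" "(\<lambda>n. \<phi> (s n)) \<longlonglongrightarrow> 1" "(\<lambda>n. vnorm V (\<sigma> (s n) v)) \<longlonglongrightarrow> 1"
proof -
  obtain s where s: "\<And>n. s n \<in> carrier A" "vconv V (\<lambda>n. \<sigma> (s n) v) v"
    using cyclic[OF v(1) v_nonzero v(1)] by blast
  have "(\<lambda>n. \<phi> (s n)) \<longlonglongrightarrow> ip V v v"
    using vconv_ip_left[OF s(2) v(1)] s(1) unfolding coef_def by simp
  moreover have "ip V v v = 1" using v by (simp add: ip_self)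
  ultimately show thesis using that[OF s(1)] vconv_vnorm[OF s(2)] v by simp
qed

text \<open>In a decomposition of \<phi> each weighted component is dominated by \<phi>, hence a
  multiple of it. Contractivity keeps the factors of the components themselves at most 1; as their
  weighted mean is 1, both are 1.\<close>

theorem extreme_coef:
  assumes K: "\<And>\<psi>. \<psi> \<in> K \<Longrightarrow> pos_fun \<psi>"
    and contr: "\<And>\<psi> b. \<psi> \<in> K \<Longrightarrow> b \<in> carrier A \<Longrightarrow> (cmod (\<psi> b))\<^sup>2 \<le> Re (\<psi> (star A b \<otimes> b))"
    and \<phi>K: "\<phi> \<in> K"
  shows "extreme_fun \<phi> K"
  unfolding extreme_fun_def
proof (intro conjI ballI allI impI)
  fix x y and t :: real assume x: "x \<in> K" and y: "y \<in> K" and t: "0 < t \<and> t < 1 \<and> mix t x y = \<phi>"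
  obtain s where s: "\<And>n. s n \<in> carrier A" "(\<lambda>n. \<phi> (s n)) \<longlonglongrightarrow> 1" "(\<lambda>n. vnorm V (\<sigma> (s n) v)) \<longlonglongrightarrow> 1"
    using approximate_vector by blast
  have phi: "\<phi> a = of_real (1 - t) * x a + of_real t * y a" for a using t unfolding mix_def by metis
  have scal: "\<exists>q. 0 \<le> q \<and> q \<le> 1 \<and> (\<forall>a. z a = of_real q * \<phi> a)"
    if z: "z \<in> K" "z' \<in> K" and r: "0 < r" "r < 1" and eq: "\<And>a. \<phi> a = of_real r * z a + of_real (1 - r) * z' a"
    for z z' r
  proof -
    have "(\<lambda>a. of_real r * z a) \<in> dominated"
      unfolding dominated_def
    proof (intro CollectI conjI ballI)
      show "pos_fun (\<lambda>a. of_real r * z a)" using pos_fun_scale[OF K[OF z(1)], of r] r by simp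
      fix b assume b: "b \<in> carrier A"
      show "Re (of_real r * z (star A b \<otimes> b)) \<le> Re (\<phi> (star A b \<otimes> b))"
        unfolding eq using pos_funD(3)[OF K[OF z(2)] b] r by (simp del: of_real_diff)
    qed
    then obtain q where q: "q \<ge> 0" "\<And>a. of_real r * z a = of_real q * \<phi> a" using dominated_scalar by blast
    have z': "z a = of_real (q / r) * \<phi> a" for a using q(2)[of a] r by (simp add: field_simps)
    have *: "(q/r)\<^sup>2 * (cmod (\<phi> b))\<^sup>2 \<le> (q/r) * (vnorm V (\<sigma> b v))\<^sup>2" if b: "b \<in> carrier A" for b
      using contr[OF z(1) b] q(1) r phi_star_mult[OF b] unfolding z'
      by (simp add: norm_mult power_mult_distrib norm_divide power_divide del: of_real_divide)
    \<comment> \<open>Contractivity of \<open>z\<close> along \<open>s\<close>, where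
      \<open>\<phi> (s n)\<close> and the norm of \<open>\<sigma> (s n) v\<close> tend to 1; with a
      unit one would simply evaluate there.\<close>
    have "(q/r)\<^sup>2 * (cmod 1)\<^sup>2 \<le> (q/r) * 1\<^sup>2"
    proof (rule LIMSEQ_le)
      show "(\<lambda>n. (q/r)\<^sup>2 * (cmod (\<phi> (s n)))\<^sup>2) \<longlonglongrightarrow> (q/r)\<^sup>2 * (cmod 1)\<^sup>2"
        by (intro tendsto_intros s)
      show "(\<lambda>n. (q/r) * (vnorm V (\<sigma> (s n) v))\<^sup>2) \<longlonglongrightarrow> (q/r) * 1\<^sup>2"
        by (intro tendsto_intros s)
    qed (use * s in auto)
    then have "(q/r) * (q/r) \<le> (q/r) * 1" by (simp add: power2_eq_square)
    moreover have "0 \<le> q / r" using q(1) r by simp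
    ultimately have "q / r \<le> 1" by (metis mult_le_cancel_left_pos less_eq_real_def zero_le_one)
    then show ?thesis using z' q(1) r by (intro exI[of _ "q/r"]) auto
  qed
  obtain p where p: "0 \<le> p" "p \<le> 1" "\<And>a. x a = of_real p * \<phi> a"
    using scal[OF x y, of "1 - t"] t phi by auto
  obtain q where q: "0 \<le> q" "q \<le> 1" "\<And>a. y a = of_real q * \<phi> a"
    using scal[OF y x, of t] t phi by (auto simp: add.commute)
  obtain a where a: "\<phi> a \<noteq> 0"
  proof (rule ccontr)
    assume "\<not> thesis"
    then have "\<And>n. \<phi> (s n) = 0" using that by blast
    then show False using s(2) LIMSEQ_unique[OF tendsto_const] by fastforce
  qed
  have "of_real ((1 - t) * p + t * q) * \<phi> a = \<phi> a"
    using phi[of a] p(3)[of a] q(3)[of a] by (simp add: algebra_simps)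
  then have "complex_of_real ((1 - t) * p + t * q) = 1" using a by simp
  then have sum: "(1 - t) * p + t * q = 1" by (metis of_real_eq_1_iff)
  define P Q where "P = (1 - t) * p" and "Q = t * q"
  have "P \<le> (1 - t) * 1" "Q \<le> t * 1" unfolding P_def Q_def using p q t by (auto intro!: mult_left_mono)
  moreover have "P + Q = 1" unfolding P_def Q_def by (rule sum)
  ultimately have "P = 1 - t" "Q = t" by auto
  then have "(1 - t) * p = 1 - t" "t * q = t" unfolding P_def Q_def by auto
  then have "p = 1" "q = 1" using t by auto
  then show "x = \<phi>" "y = \<phi>" using p(3) q(3) by auto
qed (rule \<phi>K)

end

section \<open>The Gelfand-Naimark-Segal construction\<close>

text \<open>
  The Hilbert space is realized by functions on the algebra: a vector \<open>x\<close> becomes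
  \<open>a \<mapsto> \<langle>x, a u\<rangle>\<close>, where \<open>u\<close> is the cyclic vector. Every vector is thus a pointwise limit of the
  functions \<open>a \<mapsto> \<psi> (a* s\<^sub>n)\<close> for a Cauchy sequence \<open>s\<close> in the algebra.
\<close>

lemma mult_divide_add_one_less: "0 < e \<Longrightarrow> 0 \<le> c \<Longrightarrow> c * (e / (c + 1)) < (e::real)"
  by (simp add: pos_divide_less_eq algebra_simps)

locale gns = stalg A for A :: "'a alg" (structure) +
  fixes \<psi> :: "'a \<Rightarrow> complex" and N :: "'a \<Rightarrow> real"
  assumes pos: "pos_fun \<psi>"
    and contractive: "b \<in> carrier A \<Longrightarrow> (cmod (\<psi> b))\<^sup>2 \<le> Re (\<psi> (star A b \<otimes> b))"
    and bounded_op: "a \<in> carrier A \<Longrightarrow> b \<in> carrier A \<Longrightarrow>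
      Re (\<psi> (star A (a \<otimes> b) \<otimes> (a \<otimes> b))) \<le> (N a)\<^sup>2 * Re (\<psi> (star A b \<otimes> b))"
begin

lemmas lin = lin_funD[OF pos_funD(1)[OF pos]]

definition B :: "'a \<Rightarrow> 'a \<Rightarrow> complex" where
  "B b c = \<psi> (star A c \<otimes> b)"

definition nn :: "'a \<Rightarrow> real" where
  "nn b = sqrt (Re (B b b))"

lemma neg_smult: "a \<in> carrier A \<Longrightarrow> \<ominus> a = (-1) \<odot> a"
proof -
  assume a: "a \<in> carrier A"
  have "(-1) \<odot> a \<oplus> a = ((-1) + 1) \<odot> a"
    using a smult_l_distr[of "-1" 1 a] smult_one[of a] by simp
  also have "\<dots> = \<zero>" using a smult_l_null[of a] by simp
  finally show ?thesis using a by (simp add: M.minus_equality)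
qed

lemma B_add: "b \<in> carrier A \<Longrightarrow> b' \<in> carrier A \<Longrightarrow> c \<in> carrier A \<Longrightarrow> B (b \<oplus> b') c = B b c + B b' c"
  unfolding B_def by (simp add: mult_add_right lin)

lemma B_smult: "b \<in> carrier A \<Longrightarrow> c \<in> carrier A \<Longrightarrow> B (z \<odot> b) c = z * B b c"
  unfolding B_def by (simp add: mult_smult lin)

lemma B_minus: "b \<in> carrier A \<Longrightarrow> b' \<in> carrier A \<Longrightarrow> c \<in> carrier A \<Longrightarrow> B (b \<ominus> b') c = B b c - B b' c"
  by (simp add: a_minus_def neg_smult B_add B_smult)

lemma B_commute: "b \<in> carrier A \<Longrightarrow> c \<in> carrier A \<Longrightarrow> B c b = cnj (B b c)"
  using pos_funD(2)[OF pos, of "star A c \<otimes> b"] unfolding B_def by (simp add: star_mult)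

lemma B_mult: "a \<in> carrier A \<Longrightarrow> b \<in> carrier A \<Longrightarrow> c \<in> carrier A \<Longrightarrow> B (a \<otimes> b) c = B b (star A a \<otimes> c)"
  unfolding B_def by (simp add: star_mult mult_assoc)

lemma nn_nonneg: "b \<in> carrier A \<Longrightarrow> 0 \<le> nn b"
  unfolding nn_def B_def using pos_funD(3)[OF pos] by simp

lemma nn_sq: "b \<in> carrier A \<Longrightarrow> (nn b)\<^sup>2 = Re (B b b)"
  unfolding nn_def B_def using pos_funD(3)[OF pos] by simp

lemma B_self: "b \<in> carrier A \<Longrightarrow> B b b = of_real ((nn b)\<^sup>2)"
  using pos_funD(4)[OF pos] by (simp add: complex_eq_iff nn_sq) (simp add: B_def)

lemma B_bound: "b \<in> carrier A \<Longrightarrow> c \<in> carrier A \<Longrightarrow> cmod (B b c) \<le> nn b * nn c"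
proof -
  assume b: "b \<in> carrier A" and c: "c \<in> carrier A"
  have "(cmod (B b c))\<^sup>2 \<le> (nn b * nn c)\<^sup>2"
    unfolding power_mult_distrib nn_sq[OF b] nn_sq[OF c] B_def by (rule pos_fun_cauchy_schwarz[OF pos b c])
  then show ?thesis by (rule power2_le_imp_le) (use nn_nonneg[OF b] nn_nonneg[OF c] in simp)
qed

lemma nn_add: "b \<in> carrier A \<Longrightarrow> c \<in> carrier A \<Longrightarrow> nn (b \<oplus> c) \<le> nn b + nn c"
proof -
  assume b: "b \<in> carrier A" and c: "c \<in> carrier A"
  have "(nn (b \<oplus> c))\<^sup>2 = (nn b)\<^sup>2 + 2 * Re (B b c) + (nn c)\<^sup>2"
    using pos_fun_quadratic[OF pos b c, of 1] smult_one[of c] b c by (simp add: nn_sq B_def)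
  also have "\<dots> \<le> (nn b + nn c)\<^sup>2"
    using B_bound[OF b c] complex_Re_le_cmod[of "B b c"] by (simp add: power2_eq_square algebra_simps)
  finally show ?thesis by (rule power2_le_imp_le) (use nn_nonneg[OF b] nn_nonneg[OF c] in simp)
qed

lemma nn_smult: "b \<in> carrier A \<Longrightarrow> nn (z \<odot> b) = cmod z * nn b"
proof -
  assume b: "b \<in> carrier A"
  have "B (z \<odot> b) (z \<odot> b) = z * cnj z * B b b"
    using b B_commute[of "z \<odot> b" b] B_self[of b] by (simp add: B_smult del: of_real_power)
  then have "(nn (z \<odot> b))\<^sup>2 = (cmod z * nn b)\<^sup>2"
    unfolding power_mult_distrib using b
    by (simp only: nn_sq smult_in flip: complex_norm_square) (simp flip: of_real_power)
  then show ?thesis by (rule power2_eq_imp_eq) (use nn_nonneg b in auto)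
qed

lemma nn_minus_commute: "b \<in> carrier A \<Longrightarrow> c \<in> carrier A \<Longrightarrow> nn (b \<ominus> c) = nn (c \<ominus> b)"
proof -
  assume b: "b \<in> carrier A" and c: "c \<in> carrier A"
  have "\<ominus> (c \<ominus> b) = b \<ominus> c" using b c by (simp add: a_minus_def M.minus_add M.a_comm)
  then have "b \<ominus> c = (-1) \<odot> (c \<ominus> b)" using neg_smult[of "c \<ominus> b"] b c by simp
  then show ?thesis using nn_smult[of "c \<ominus> b" "-1"] b c by simp
qed

lemma nn_triangle:
  "b \<in> carrier A \<Longrightarrow> c \<in> carrier A \<Longrightarrow> d \<in> carrier A \<Longrightarrow> nn (b \<ominus> d) \<le> nn (b \<ominus> c) + nn (c \<ominus> d)"
proof -
  assume "b \<in> carrier A" "c \<in> carrier A" "d \<in> carrier A"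
  moreover from this have "b \<ominus> d = (b \<ominus> c) \<oplus> (c \<ominus> d)"
    unfolding a_minus_def by (simp add: M.a_assoc) (simp add: M.r_neg2 M.r_neg1)
  ultimately show ?thesis using nn_add[of "b \<ominus> c" "c \<ominus> d"] by simp
qed

lemma nn_mult: "a \<in> carrier A \<Longrightarrow> b \<in> carrier A \<Longrightarrow> nn (a \<otimes> b) \<le> \<bar>N a\<bar> * nn b"
proof -
  assume a: "a \<in> carrier A" and b: "b \<in> carrier A"
  have "(nn (a \<otimes> b))\<^sup>2 \<le> (\<bar>N a\<bar> * nn b)\<^sup>2"
    using bounded_op[OF a b] a b by (simp add: nn_sq power_mult_distrib B_def)
  then show ?thesis by (rule power2_le_imp_le) (use nn_nonneg[OF b] in simp)
qed

section \<open>Cauchy sequences in the algebra and the functions they represent\<close>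

definition cauchy :: "(nat \<Rightarrow> 'a) \<Rightarrow> bool" where
  "cauchy s \<longleftrightarrow> (\<forall>n. s n \<in> carrier A) \<and> (\<forall>e>0. \<exists>k. \<forall>m\<ge>k. \<forall>n\<ge>k. nn (s m \<ominus> s n) < e)"

definition represents :: "(nat \<Rightarrow> 'a) \<Rightarrow> ('a \<Rightarrow> complex) \<Rightarrow> bool" where
  "represents s f \<longleftrightarrow> cauchy s \<and> (\<forall>a\<in>carrier A. (\<lambda>n. B (s n) a) \<longlonglongrightarrow> f a) \<and> (\<forall>a. a \<notin> carrier A \<longrightarrow> f a = 0)"

definition vec :: "'a \<Rightarrow> 'a \<Rightarrow> complex" where
  "vec b = (\<lambda>a. if a \<in> carrier A then B b a else 0)"

lemma cauchy_in: "cauchy s \<Longrightarrow> s n \<in> carrier A"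
  unfolding cauchy_def by blast

lemma representsD:
  assumes "represents s f"
  shows "cauchy s" "s n \<in> carrier A" "a \<in> carrier A \<Longrightarrow> (\<lambda>n. B (s n) a) \<longlonglongrightarrow> f a" "a \<notin> carrier A \<Longrightarrow> f a = 0"
  using assms unfolding represents_def cauchy_def by auto

lemma cauchy_const: "b \<in> carrier A \<Longrightarrow> cauchy (\<lambda>_. b)"
  unfolding cauchy_def using nn_smult[of b 0] smult_l_null[of b]
  by (simp add: a_minus_def M.r_neg)

lemma represents_vec: "b \<in> carrier A \<Longrightarrow> represents (\<lambda>_. b) (vec b)"
  unfolding represents_def vec_def by (simp add: cauchy_const)

lemma cauchy_exists:
  assumes s: "cauchy s"
  shows "\<exists>f. represents s f"
proof -
  have "convergent (\<lambda>n. B (s n) a)" if a: "a \<in> carrier A" for a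
  proof (rule Cauchy_convergent, rule metric_CauchyI)
    fix e :: real assume e: "e > 0"
    then have "e / (nn a + 1) > 0" using nn_nonneg[OF a] by simp
    then obtain k where k: "\<And>m n. m \<ge> k \<Longrightarrow> n \<ge> k \<Longrightarrow> nn (s m \<ominus> s n) < e / (nn a + 1)"
      using s unfolding cauchy_def by blast
    show "\<exists>k. \<forall>m\<ge>k. \<forall>n\<ge>k. dist (B (s m) a) (B (s n) a) < e"
    proof (intro exI allI impI)
      fix m n assume mn: "k \<le> m" "k \<le> n"
      have "dist (B (s m) a) (B (s n) a) = cmod (B (s m \<ominus> s n) a)"
        using cauchy_in[OF s] a by (simp add: B_minus dist_norm)
      also have "\<dots> \<le> nn (s m \<ominus> s n) * nn a" using B_bound cauchy_in[OF s] a by simp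
      also have "\<dots> \<le> e / (nn a + 1) * nn a"
        using k[OF mn] nn_nonneg[OF a] by (intro mult_right_mono) auto
      also have "\<dots> < e" using e nn_nonneg[OF a] by (simp add: field_simps)
      finally show "dist (B (s m) a) (B (s n) a) < e" .
    qed
  qed
  then have "represents s (\<lambda>a. if a \<in> carrier A then lim (\<lambda>n. B (s n) a) else 0)"
    unfolding represents_def using s by (auto simp: convergent_LIMSEQ_iff)
  then show ?thesis by blast
qed

text \<open>Letting one index of the Cauchy estimate tend to infinity gives convergence that is
  uniform in \<open>c\<close> relative to \<open>nn c\<close>; this permits evaluation at a moving
  argument.\<close>

lemma represents_estimate:
  assumes s: "represents s f" and e: "e > 0"
  shows "\<exists>k. \<forall>m\<ge>k. \<forall>c\<in>carrier A. cmod (f c - B (s m) c) \<le> e * nn c"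
proof -
  obtain k where k: "\<And>m n. m \<ge> k \<Longrightarrow> n \<ge> k \<Longrightarrow> nn (s m \<ominus> s n) < e"
    using representsD(1)[OF s] e unfolding cauchy_def by blast
  show ?thesis
  proof (intro exI allI impI ballI)
    fix m c assume m: "k \<le> m" and c: "c \<in> carrier A"
    have "(\<lambda>n. cmod (B (s n) c - B (s m) c)) \<longlonglongrightarrow> cmod (f c - B (s m) c)"
      by (intro tendsto_intros representsD(3)[OF s c])
    moreover have "\<exists>k. \<forall>n\<ge>k. cmod (B (s n) c - B (s m) c) \<le> e * nn c"
    proof (intro exI allI impI)
      fix n assume n: "k \<le> n"
      have "cmod (B (s n) c - B (s m) c) = cmod (B (s n \<ominus> s m) c)"
        using representsD(2)[OF s] c by (simp add: B_minus)
      also have "\<dots> \<le> nn (s n \<ominus> s m) * nn c" using B_bound representsD(2)[OF s] c by simp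
      also have "\<dots> \<le> e * nn c" using k[OF n m] nn_nonneg[OF c] by (intro mult_right_mono) auto
      finally show "cmod (B (s n) c - B (s m) c) \<le> e * nn c" .
    qed
    ultimately show "cmod (f c - B (s m) c) \<le> e * nn c" by (rule LIMSEQ_le_const2)
  qed
qed

lemma cauchy_bounded:
  assumes s: "cauchy s"
  obtains K where "K > 0" "\<And>n. nn (s n) \<le> K"
proof -
  obtain k where k: "\<And>n. n \<ge> k \<Longrightarrow> nn (s n \<ominus> s k) < 1"
    using s unfolding cauchy_def by (metis order_refl zero_less_one)
  define K where "K = (\<Sum>i\<le>k. nn (s i)) + 1"
  have "nn (s n) \<le> K" for n
  proof (cases "n \<le> k")
    case True
    then have "nn (s n) \<le> (\<Sum>i\<le>k. nn (s i))"
      using nn_nonneg cauchy_in[OF s] by (intro member_le_sum) auto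
    then show ?thesis unfolding K_def by simp
  next
    case False
    have "s n = (s n \<ominus> s k) \<oplus> s k"
      using cauchy_in[OF s] by (simp add: a_minus_def M.a_assoc M.l_neg)
    then have "nn (s n) \<le> nn (s n \<ominus> s k) + nn (s k)"
      using nn_add[of "s n \<ominus> s k" "s k"] cauchy_in[OF s] by simp
    moreover have "nn (s k) \<le> (\<Sum>i\<le>k. nn (s i))"
      using nn_nonneg cauchy_in[OF s] by (intro member_le_sum) auto
    ultimately show ?thesis using k[of n] False unfolding K_def by simp
  qed
  moreover have "0 \<le> (\<Sum>i\<le>k. nn (s i))" using nn_nonneg cauchy_in[OF s] by (intro sum_nonneg) auto
  then have "0 < K" unfolding K_def by simp
  ultimately show thesis using that by blast
qed

lemma represents_conj_linear:
  assumes s: "represents s f"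
  shows "a \<in> carrier A \<Longrightarrow> b \<in> carrier A \<Longrightarrow> f (a \<oplus> b) = f a + f b"
    "a \<in> carrier A \<Longrightarrow> f (z \<odot> a) = cnj z * f a"
    "a \<in> carrier A \<Longrightarrow> b \<in> carrier A \<Longrightarrow> f (a \<ominus> b) = f a - f b"
proof -
  note c = representsD(2)[OF s]
  have add: "B (s n) (a \<oplus> b) = B (s n) a + B (s n) b" if "a \<in> carrier A" "b \<in> carrier A" for n a b
    using that c[of n] B_commute[of "a \<oplus> b" "s n"] B_commute[of a "s n"] B_commute[of b "s n"]
    by (simp add: B_add)
  have smult: "B (s n) (z \<odot> a) = cnj z * B (s n) a" if "a \<in> carrier A" for n z a
    using that c[of n] B_commute[of "z \<odot> a" "s n"] B_commute[of a "s n"] by (simp add: B_smult)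
  show 1: "f (a \<oplus> b) = f a + f b" if "a \<in> carrier A" "b \<in> carrier A" for a b
  proof (rule LIMSEQ_unique)
    show "(\<lambda>n. B (s n) (a \<oplus> b)) \<longlonglongrightarrow> f (a \<oplus> b)" using that by (intro representsD(3)[OF s]) auto
    show "(\<lambda>n. B (s n) (a \<oplus> b)) \<longlonglongrightarrow> f a + f b"
      unfolding add[OF that] using that by (intro tendsto_add representsD(3)[OF s])
  qed
  show 2: "f (z \<odot> a) = cnj z * f a" if "a \<in> carrier A" for z a
  proof (rule LIMSEQ_unique)
    show "(\<lambda>n. B (s n) (z \<odot> a)) \<longlonglongrightarrow> f (z \<odot> a)" using that by (intro representsD(3)[OF s]) auto
    show "(\<lambda>n. B (s n) (z \<odot> a)) \<longlonglongrightarrow> cnj z * f a"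
      unfolding smult[OF that] using that by (intro tendsto_mult_left representsD(3)[OF s])
  qed
  show "f (a \<ominus> b) = f a - f b" if "a \<in> carrier A" "b \<in> carrier A"
    using that 1[of a "(-1) \<odot> b"] 2[of b "-1"] by (simp add: a_minus_def neg_smult)
qed

lemma represents_bounded:
  assumes s: "represents s f"
  obtains K where "K > 0" "\<And>c. c \<in> carrier A \<Longrightarrow> cmod (f c) \<le> K * nn c"
proof -
  obtain K where K: "K > 0" "\<And>n. nn (s n) \<le> K" using cauchy_bounded representsD(1)[OF s] by blast
  have "cmod (f c) \<le> K * nn c" if c: "c \<in> carrier A" for c
  proof (rule LIMSEQ_le_const2)
    show "(\<lambda>n. cmod (B (s n) c)) \<longlonglongrightarrow> cmod (f c)" by (intro tendsto_norm representsD(3)[OF s c])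
    have "cmod (B (s n) c) \<le> K * nn c" for n
      using B_bound[OF representsD(2)[OF s] c, of n] mult_right_mono[OF K(2)[of n] nn_nonneg[OF c]]
      by linarith
    then show "\<exists>k. \<forall>n\<ge>k. cmod (B (s n) c) \<le> K * nn c" by blast
  qed
  with K(1) show thesis using that by blast
qed

text \<open>The iterated limit, first along \<open>s\<close> and then along \<open>t\<close>, agrees
  with the diagonal one, because \<open>nn (t n)\<close> is bounded and \<open>f\<close> is
  approximated uniformly.\<close>

lemma represents_pairing:
  assumes s: "represents s f" and t: "represents t g"
  shows "\<exists>l. (\<lambda>n. f (t n)) \<longlonglongrightarrow> l \<and> (\<lambda>n. B (s n) (t n)) \<longlonglongrightarrow> l"
proof -
  obtain K where K: "K > 0" "\<And>c. c \<in> carrier A \<Longrightarrow> cmod (f c) \<le> K * nn c"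
    using represents_bounded[OF s] by blast
  obtain K' where K': "K' > 0" "\<And>n. nn (t n) \<le> K'" using cauchy_bounded representsD(1)[OF t] by blast
  have "convergent (\<lambda>n. f (t n))"
  proof (rule Cauchy_convergent, rule metric_CauchyI)
    fix e :: real assume e: "e > 0"
    then have "e / K > 0" using K by simp
    then obtain k where k: "\<And>m n. m \<ge> k \<Longrightarrow> n \<ge> k \<Longrightarrow> nn (t m \<ominus> t n) < e / K"
      using representsD(1)[OF t] unfolding cauchy_def by blast
    show "\<exists>k. \<forall>m\<ge>k. \<forall>n\<ge>k. dist (f (t m)) (f (t n)) < e"
    proof (intro exI allI impI)
      fix m n assume mn: "k \<le> m" "k \<le> n"
      have "dist (f (t m)) (f (t n)) = cmod (f (t m \<ominus> t n))"
        using representsD(2)[OF t] by (simp add: represents_conj_linear(3)[OF s] dist_norm)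
      also have "\<dots> \<le> K * nn (t m \<ominus> t n)" using K representsD(2)[OF t] by simp
      also have "\<dots> < e" using k[OF mn] K(1) by (simp add: field_simps)
      finally show "dist (f (t m)) (f (t n)) < e" .
    qed
  qed
  then obtain l where l: "(\<lambda>n. f (t n)) \<longlonglongrightarrow> l" unfolding convergent_def by blast
  have "(\<lambda>n. f (t n) - B (s n) (t n)) \<longlonglongrightarrow> 0"
  proof (rule LIMSEQ_I)
    fix e :: real assume e: "e > 0"
    then have "e / (2 * K') > 0" using K' by simp
    from represents_estimate[OF s this] obtain k
      where k: "\<And>m c. m \<ge> k \<Longrightarrow> c \<in> carrier A \<Longrightarrow> cmod (f c - B (s m) c) \<le> e / (2 * K') * nn c" by blast
    show "\<exists>k. \<forall>n\<ge>k. norm (f (t n) - B (s n) (t n) - 0) < e"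
    proof (intro exI allI impI)
      fix n assume n: "k \<le> n"
      have "norm (f (t n) - B (s n) (t n) - 0) \<le> e / (2 * K') * nn (t n)"
        using k[OF n] representsD(2)[OF t] by simp
      also have "\<dots> \<le> e / (2 * K') * K'" using e K' by (intro mult_left_mono) auto
      also have "\<dots> < e" using e K' by simp
      finally show "norm (f (t n) - B (s n) (t n) - 0) < e" .
    qed
  qed
  from tendsto_diff[OF l this] have "(\<lambda>n. B (s n) (t n)) \<longlonglongrightarrow> l" by simp
  with l show ?thesis by blast
qed

text \<open>A sequence is chosen for the second argument of \<open>ip\<close>, and the first
  argument is evaluated on it; independence of the choice is shown below.\<close>

definition space :: "('a \<Rightarrow> complex) inner_space" where
  "space = \<lparr>carrier = {f. \<exists>s. represents s f}, mult = undefined, one = undefined, zero = (\<lambda>_. 0),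
     add = (\<lambda>f g a. f a + g a), smult = (\<lambda>c f a. c * f a),
     ip = (\<lambda>f g. lim (\<lambda>n. f ((SOME t. represents t g) n)))\<rparr>"

lemma space_sel [simp]: "zero space = (\<lambda>_. 0)" "add space = (\<lambda>f g a. f a + g a)"
  "smult space = (\<lambda>c f a. c * f a)"
  unfolding space_def by simp_all

lemma in_space: "f \<in> carrier space \<longleftrightarrow> (\<exists>s. represents s f)"
  unfolding space_def by simp

lemma represents_in: "represents s f \<Longrightarrow> f \<in> carrier space"
  using in_space by blast

text \<open>The limit is identified as the conjugate of the limit of \<open>g (s n)\<close>, in
  which no sequence representing \<open>g\<close> occurs. Hence all such sequences give the same
  value, the chosen one included.\<close>

lemma ip_limits:
  assumes s: "represents s f" and t: "represents t g"
  shows "(\<lambda>n. f (t n)) \<longlonglongrightarrow> ip space f g" "(\<lambda>n. B (s n) (t n)) \<longlonglongrightarrow> ip space f g"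
proof -
  obtain m where m: "(\<lambda>n. g (s n)) \<longlonglongrightarrow> m" using represents_pairing[OF t s] by blast
  have *: "(\<lambda>n. f (t' n)) \<longlonglongrightarrow> cnj m" "(\<lambda>n. B (s n) (t' n)) \<longlonglongrightarrow> cnj m" if t': "represents t' g" for t'
  proof -
    obtain l where l: "(\<lambda>n. f (t' n)) \<longlonglongrightarrow> l" "(\<lambda>n. B (s n) (t' n)) \<longlonglongrightarrow> l"
      using represents_pairing[OF s t'] by blast
    obtain m' where "(\<lambda>n. g (s n)) \<longlonglongrightarrow> m'" "(\<lambda>n. B (t' n) (s n)) \<longlonglongrightarrow> m'"
      using represents_pairing[OF t' s] by blast
    then have "(\<lambda>n. B (t' n) (s n)) \<longlonglongrightarrow> m" using m LIMSEQ_unique by blast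
    then have "(\<lambda>n. cnj (B (t' n) (s n))) \<longlonglongrightarrow> cnj m" by (rule tendsto_cnj)
    moreover have "cnj (B (t' n) (s n)) = B (s n) (t' n)" for n
      using B_commute[of "t' n" "s n"] representsD(2)[OF s] representsD(2)[OF t'] by simp
    ultimately have "l = cnj m" using l(2) LIMSEQ_unique by simp blast
    then show "(\<lambda>n. f (t' n)) \<longlonglongrightarrow> cnj m" "(\<lambda>n. B (s n) (t' n)) \<longlonglongrightarrow> cnj m" using l by auto
  qed
  define r where "r = (SOME t. represents t g)"
  have "represents r g" unfolding r_def using someI[of "\<lambda>t. represents t g", OF t] .
  then have "lim (\<lambda>n. f (r n)) = cnj m" using * limI by blast
  then have "ip space f g = cnj m" unfolding space_def r_def by simp
  then show "(\<lambda>n. f (t n)) \<longlonglongrightarrow> ip space f g" "(\<lambda>n. B (s n) (t n)) \<longlonglongrightarrow> ip space f g" using *[OF t] by auto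
qed

lemma represents_add:
  assumes s: "represents s f" and t: "represents t g"
  shows "represents (\<lambda>n. s n \<oplus> t n) (\<lambda>a. f a + g a)"
  unfolding represents_def
proof (intro conjI ballI allI impI)
  note c = representsD(2)[OF s] representsD(2)[OF t]
  show "cauchy (\<lambda>n. s n \<oplus> t n)"
    unfolding cauchy_def
  proof (intro conjI allI impI)
    fix e :: real assume "e > 0"
    then have "e/2 > 0" by simp
    obtain k where k: "\<And>m n. m \<ge> k \<Longrightarrow> n \<ge> k \<Longrightarrow> nn (s m \<ominus> s n) < e/2"
      using representsD(1)[OF s] \<open>e/2 > 0\<close> unfolding cauchy_def by blast
    obtain k' where k': "\<And>m n. m \<ge> k' \<Longrightarrow> n \<ge> k' \<Longrightarrow> nn (t m \<ominus> t n) < e/2"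
      using representsD(1)[OF t] \<open>e/2 > 0\<close> unfolding cauchy_def by blast
    show "\<exists>k. \<forall>m\<ge>k. \<forall>n\<ge>k. nn (s m \<oplus> t m \<ominus> (s n \<oplus> t n)) < e"
    proof (intro exI allI impI)
      fix m n assume mn: "max k k' \<le> m" "max k k' \<le> n"
      have "s m \<oplus> t m \<ominus> (s n \<oplus> t n) = (s m \<ominus> s n) \<oplus> (t m \<ominus> t n)"
        using c by (simp add: a_minus_def M.minus_add M.a_ac)
      then have "nn (s m \<oplus> t m \<ominus> (s n \<oplus> t n)) \<le> nn (s m \<ominus> s n) + nn (t m \<ominus> t n)"
        using nn_add[of "s m \<ominus> s n" "t m \<ominus> t n"] c by simp
      then show "nn (s m \<oplus> t m \<ominus> (s n \<oplus> t n)) < e" using k[of m n] k'[of m n] mn by simp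
    qed
  qed (use c in simp)
  show "(\<lambda>n. B (s n \<oplus> t n) a) \<longlonglongrightarrow> f a + g a" if a: "a \<in> carrier A" for a
    using tendsto_add[OF representsD(3)[OF s a] representsD(3)[OF t a]] c a by (simp add: B_add)
  show "f a + g a = 0" if "a \<notin> carrier A" for a using representsD(4)[OF s that] representsD(4)[OF t that] by simp
qed

lemma represents_smult:
  assumes s: "represents s f"
  shows "represents (\<lambda>n. z \<odot> s n) (\<lambda>a. z * f a)"
  unfolding represents_def
proof (intro conjI ballI allI impI)
  note c = representsD(2)[OF s]
  show "cauchy (\<lambda>n. z \<odot> s n)"
    unfolding cauchy_def
  proof (intro conjI allI impI)
    fix e :: real assume e: "e > 0"
    then have "e/(cmod z + 1) > 0" by (simp add: add_nonneg_pos)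
    then obtain k where k: "\<And>m n. m \<ge> k \<Longrightarrow> n \<ge> k \<Longrightarrow> nn (s m \<ominus> s n) < e/(cmod z + 1)"
      using representsD(1)[OF s] unfolding cauchy_def by blast
    show "\<exists>k. \<forall>m\<ge>k. \<forall>n\<ge>k. nn (z \<odot> s m \<ominus> z \<odot> s n) < e"
    proof (intro exI allI impI)
      fix m n assume mn: "k \<le> m" "k \<le> n"
      have "z \<odot> s m \<ominus> z \<odot> s n = z \<odot> (s m \<ominus> s n)"
        using c by (simp add: a_minus_def smult_r_distr smult_r_minus)
      then have "nn (z \<odot> s m \<ominus> z \<odot> s n) = cmod z * nn (s m \<ominus> s n)" using nn_smult c by simp
      also have "\<dots> \<le> cmod z * (e/(cmod z + 1))" using k[OF mn] by (intro mult_left_mono) auto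
      also have "\<dots> < e" using e by (intro mult_divide_add_one_less) auto
      finally show "nn (z \<odot> s m \<ominus> z \<odot> s n) < e" .
    qed
  qed (use c in simp)
  show "(\<lambda>n. B (z \<odot> s n) a) \<longlonglongrightarrow> z * f a" if a: "a \<in> carrier A" for a
    using tendsto_mult_left[OF representsD(3)[OF s a], of z] c a by (simp add: B_smult)
  show "z * f a = 0" if "a \<notin> carrier A" for a using representsD(4)[OF s] that by simp
qed

lemma vec_zero: "represents (\<lambda>_. \<zero>) (\<lambda>_. 0)"
proof -
  have "B \<zero> a = 0" if "a \<in> carrier A" for a
    using B_smult[of \<zero> a 0] smult_r_null[of 0] that by simp
  then have "vec \<zero> = (\<lambda>_. 0)" unfolding vec_def by auto
  then show ?thesis using represents_vec[of \<zero>] by simp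
qed

lemma module_space: "Module.module complex_ring space"
proof (rule moduleI[OF cring_complex_ring])
  show "abelian_group space"
  proof (rule abelian_groupI)
    fix f g assume "f \<in> carrier space" "g \<in> carrier space"
    then obtain s t where "represents s f" "represents t g" unfolding in_space by blast
    then show "f \<oplus>\<^bsub>space\<^esub> g \<in> carrier space"
      unfolding in_space space_sel using represents_add by blast
  next
    show "\<zero>\<^bsub>space\<^esub> \<in> carrier space" using vec_zero unfolding in_space by auto
  next
    fix f assume "f \<in> carrier space"
    then obtain s where "represents s f" unfolding in_space by blast
    from represents_smult[OF this, of "-1"] show "\<exists>g\<in>carrier space. g \<oplus>\<^bsub>space\<^esub> f = \<zero>\<^bsub>space\<^esub>"
      by (intro bexI[of _ "\<lambda>a. (-1) * f a"]) (auto simp: in_space)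
  qed (auto simp: algebra_simps)
  fix f z assume "f \<in> carrier space"
  then obtain s where "represents s f" unfolding in_space by blast
  then show "z \<odot>\<^bsub>space\<^esub> f \<in> carrier space"
    unfolding in_space space_sel using represents_smult by blast
qed (auto simp: algebra_simps)

lemma prehil_space: "prehil space"
proof
  show "pre_hilbert space"
    unfolding pre_hilbert_def
  proof (intro conjI ballI allI impI module_space)
    fix f g assume "f \<in> carrier space" "g \<in> carrier space"
    then obtain s t where s: "represents s f" and t: "represents t g" unfolding in_space by blast
    have "(\<lambda>n. B (t n) (s n)) \<longlonglongrightarrow> cnj (ip space f g)"
    proof -
      have "B (t n) (s n) = cnj (B (s n) (t n))" for n
        by (rule B_commute[OF representsD(2)[OF s] representsD(2)[OF t]])
      then show ?thesis using tendsto_cnj[OF ip_limits(2)[OF s t]] by simp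
    qed
    then show "ip space g f = cnj (ip space f g)" using ip_limits(2)[OF t s] LIMSEQ_unique by blast
    have "(\<lambda>n. z * f (t n)) \<longlonglongrightarrow> z * ip space f g" for z
      by (intro tendsto_mult_left ip_limits(1)[OF s t])
    from LIMSEQ_unique[OF ip_limits(1)[OF represents_smult[OF s] t] this]
    show "ip space (z \<odot>\<^bsub>space\<^esub> f) g = z * ip space f g" for z by simp
  next
    fix f g h assume "f \<in> carrier space" "g \<in> carrier space" "h \<in> carrier space"
    then obtain s t r where s: "represents s f" and t: "represents t g" and r: "represents r h"
      unfolding in_space by blast
    have "(\<lambda>n. f (r n) + g (r n)) \<longlonglongrightarrow> ip space f h + ip space g h"
      by (intro tendsto_add ip_limits(1)[OF s r] ip_limits(1)[OF t r])
    from LIMSEQ_unique[OF ip_limits(1)[OF represents_add[OF s t] r] this]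
    show "ip space (f \<oplus>\<^bsub>space\<^esub> g) h = ip space f h + ip space g h" by simp
  next
    fix f assume "f \<in> carrier space" and nz: "f \<noteq> \<zero>\<^bsub>space\<^esub>"
    then obtain s where s: "represents s f" unfolding in_space by blast
    note c = representsD(2)[OF s]
    have lim: "(\<lambda>n. (nn (s n))\<^sup>2) \<longlonglongrightarrow> Re (ip space f f)"
      using tendsto_Re[OF ip_limits(2)[OF s s]] nn_sq c by simp
    have "0 \<le> Re (ip space f f)" by (rule LIMSEQ_le_const[OF lim]) auto
    moreover have "Re (ip space f f) \<noteq> 0"
    proof
      assume "Re (ip space f f) = 0"
      then have "(\<lambda>n. sqrt ((nn (s n))\<^sup>2)) \<longlonglongrightarrow> sqrt 0" using lim by (intro tendsto_real_sqrt) simp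
      then have nn0: "(\<lambda>n. nn (s n)) \<longlonglongrightarrow> 0" using nn_nonneg c by simp
      have "f a = 0" for a
      proof (cases "a \<in> carrier A")
        case True
        have "(\<lambda>n. B (s n) a) \<longlonglongrightarrow> 0"
        proof (rule Lim_null_comparison)
          show "\<forall>\<^sub>F n in sequentially. norm (B (s n) a) \<le> nn (s n) * nn a"
            using B_bound c True by (intro always_eventually) auto
          show "(\<lambda>n. nn (s n) * nn a) \<longlonglongrightarrow> 0" using nn0 by (rule tendsto_mult_left_zero)
        qed
        then show ?thesis using representsD(3)[OF s True] LIMSEQ_unique by blast
      qed (use representsD(4)[OF s] in auto)
      then show False using nz by auto
    qed
    ultimately show "0 < Re (ip space f f)" by simp
  qed
qed

sublocale S: prehil space
  by (rule prehil_space)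

lemma minus_space: "f \<in> carrier space \<Longrightarrow> g \<in> carrier space \<Longrightarrow> f \<ominus>\<^bsub>space\<^esub> g = (\<lambda>a. f a - g a)"
  by (simp add: a_minus_def S.neg_eq_smult)

lemma vec_in: "b \<in> carrier A \<Longrightarrow> vec b \<in> carrier space"
  using represents_vec in_space by blast

lemma ip_vec_right:
  assumes "f \<in> carrier space" "b \<in> carrier A"
  shows "ip space f (vec b) = f b"
proof -
  obtain s where s: "represents s f" using assms(1) in_space by blast
  then show ?thesis using ip_limits(1)[OF s represents_vec[OF assms(2)]] LIMSEQ_unique tendsto_const by blast
qed

lemma vnorm_limit:
  assumes s: "represents s f"
  shows "(\<lambda>n. nn (s n)) \<longlonglongrightarrow> vnorm space f"
proof -
  have "(\<lambda>n. sqrt (Re (B (s n) (s n)))) \<longlonglongrightarrow> sqrt (Re (ip space f f))"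
    by (intro tendsto_real_sqrt tendsto_Re ip_limits(2)[OF s s])
  then show ?thesis unfolding vnorm_def nn_def .
qed

lemma represents_minus:
  assumes s: "represents s f" and t: "represents t g"
  shows "represents (\<lambda>n. s n \<ominus> t n) (f \<ominus>\<^bsub>space\<^esub> g)"
proof -
  have "represents (\<lambda>n. s n \<oplus> (-1) \<odot> t n) (\<lambda>a. f a + (-1) * g a)"
    by (intro represents_add represents_smult s t)
  then show ?thesis
    using representsD(2)[OF t] minus_space[OF represents_in[OF s] represents_in[OF t]]
    by (simp add: a_minus_def neg_smult)
qed

lemma represents_conv:
  assumes s: "represents s f"
  shows "vconv space (\<lambda>n. vec (s n)) f"
  unfolding vconv_def
proof (intro conjI allI)
  show "vec (s n) \<in> carrier space" for n using vec_in representsD(2)[OF s] by blast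
  show "f \<in> carrier space" by (rule represents_in[OF s])
  show "(\<lambda>n. vnorm space (vec (s n) \<ominus>\<^bsub>space\<^esub> f)) \<longlonglongrightarrow> 0"
  proof (rule LIMSEQ_I)
    fix e :: real assume "e > 0"
    then have "e/2 > 0" by simp
    then obtain k where k: "\<And>m n. m \<ge> k \<Longrightarrow> n \<ge> k \<Longrightarrow> nn (s m \<ominus> s n) < e/2"
      using representsD(1)[OF s] unfolding cauchy_def by blast
    show "\<exists>k. \<forall>n\<ge>k. norm (vnorm space (vec (s n) \<ominus>\<^bsub>space\<^esub> f) - 0) < e"
    proof (intro exI allI impI)
      fix n assume n: "k \<le> n"
      have "represents (\<lambda>m. s n \<ominus> s m) (vec (s n) \<ominus>\<^bsub>space\<^esub> f)"
        by (rule represents_minus[OF represents_vec[OF representsD(2)[OF s]] s])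
      then have "(\<lambda>m. nn (s n \<ominus> s m)) \<longlonglongrightarrow> vnorm space (vec (s n) \<ominus>\<^bsub>space\<^esub> f)" by (rule vnorm_limit)
      then have "vnorm space (vec (s n) \<ominus>\<^bsub>space\<^esub> f) \<le> e/2"
        by (rule LIMSEQ_le_const2) (use k[OF n] less_imp_le in blast)
      moreover have "0 \<le> vnorm space (vec (s n) \<ominus>\<^bsub>space\<^esub> f)"
        using vec_in representsD(2)[OF s] represents_in[OF s] by simp
      ultimately show "norm (vnorm space (vec (s n) \<ominus>\<^bsub>space\<^esub> f) - 0) < e" using \<open>e > 0\<close> by simp
    qed
  qed
qed

lemma nn_vec_minus:
  assumes "b \<in> carrier A" "c \<in> carrier A"
  shows "nn (b \<ominus> c) = vnorm space (vec b \<ominus>\<^bsub>space\<^esub> vec c)"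
  using vnorm_limit[OF represents_minus[OF represents_vec[OF assms(1)] represents_vec[OF assms(2)]]]
    LIMSEQ_unique tendsto_const by blast

text \<open>Approximate the \<open>k\<close>-th member of a Cauchy sequence by some
  \<open>vec (b k)\<close> up to \<open>1 / Suc k\<close>; then \<open>b\<close> is a Cauchy
  sequence in the algebra and represents the limit.\<close>

lemma hilbert_space: "hilbert space"
  unfolding S.hilbert_iff
proof (intro allI impI)
  fix F assume F: "vcauchy space F"
  have Fc: "F k \<in> carrier space" for k using F unfolding vcauchy_def by blast
  have "\<exists>b\<in>carrier A. vnorm space (F k \<ominus>\<^bsub>space\<^esub> vec b) < 1 / Suc k" for k
  proof -
    obtain s where s: "represents s (F k)" using Fc in_space by blast
    have "(\<lambda>n. vnorm space (vec (s n) \<ominus>\<^bsub>space\<^esub> F k)) \<longlonglongrightarrow> 0"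
      using represents_conv[OF s] unfolding vconv_def by blast
    then have "\<forall>\<^sub>F n in sequentially. vnorm space (vec (s n) \<ominus>\<^bsub>space\<^esub> F k) < 1 / Suc k"
      by (rule order_tendstoD(2)) simp
    then obtain n where "vnorm space (vec (s n) \<ominus>\<^bsub>space\<^esub> F k) < 1 / Suc k"
      using eventually_happens' sequentially_bot by blast
    then show ?thesis using representsD(2)[OF s] S.vnorm_minus_commute[OF Fc vec_in] by metis
  qed
  then obtain b where b: "\<And>k. b k \<in> carrier A" "\<And>k. vnorm space (F k \<ominus>\<^bsub>space\<^esub> vec (b k)) < 1 / Suc k"
    by metis
  note vb = vec_in[OF b(1)]
  have conv0: "(\<lambda>k. vnorm space (F k \<ominus>\<^bsub>space\<^esub> vec (b k))) \<longlonglongrightarrow> 0"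
  proof (rule tendsto_sandwich[OF _ _ tendsto_const LIMSEQ_inverse_real_of_nat])
    show "\<forall>\<^sub>F n in sequentially. 0 \<le> vnorm space (F n \<ominus>\<^bsub>space\<^esub> vec (b n))"
      using Fc vb by (intro always_eventually allI S.vnorm_nonneg S.M.minus_closed)
    show "\<forall>\<^sub>F n in sequentially. vnorm space (F n \<ominus>\<^bsub>space\<^esub> vec (b n)) \<le> inverse (real (Suc n))"
      using b(2) by (auto simp: inverse_eq_divide intro!: always_eventually less_imp_le)
  qed
  have "cauchy b"
    unfolding cauchy_def
  proof (intro conjI allI impI b(1))
    fix e :: real assume "e > 0"
    then have "e/3 > 0" by simp
    obtain k where k: "\<And>m n. m \<ge> k \<Longrightarrow> n \<ge> k \<Longrightarrow> vnorm space (F m \<ominus>\<^bsub>space\<^esub> F n) < e/3"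
      using F \<open>e/3 > 0\<close> unfolding vcauchy_def by blast
    have "\<forall>\<^sub>F n in sequentially. vnorm space (F n \<ominus>\<^bsub>space\<^esub> vec (b n)) < e/3"
      using conv0 \<open>e/3 > 0\<close> by (rule order_tendstoD(2))
    then obtain k' where k': "\<And>n. n \<ge> k' \<Longrightarrow> vnorm space (F n \<ominus>\<^bsub>space\<^esub> vec (b n)) < e/3"
      unfolding eventually_sequentially by blast
    show "\<exists>k. \<forall>m\<ge>k. \<forall>n\<ge>k. nn (b m \<ominus> b n) < e"
    proof (intro exI allI impI)
      fix m n assume mn: "max k k' \<le> m" "max k k' \<le> n"
      have "nn (b m \<ominus> b n) = vnorm space (vec (b m) \<ominus>\<^bsub>space\<^esub> vec (b n))" using nn_vec_minus b(1) by blast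
      also have "\<dots> \<le> vnorm space (vec (b m) \<ominus>\<^bsub>space\<^esub> F m) + vnorm space (F m \<ominus>\<^bsub>space\<^esub> vec (b n))"
        by (rule S.vnorm_triangle_minus[OF vb Fc vb])
      also have "\<dots> \<le> vnorm space (vec (b m) \<ominus>\<^bsub>space\<^esub> F m) +
          (vnorm space (F m \<ominus>\<^bsub>space\<^esub> F n) + vnorm space (F n \<ominus>\<^bsub>space\<^esub> vec (b n)))"
        by (intro add_left_mono S.vnorm_triangle_minus[OF Fc Fc vb])
      also have "\<dots> < e"
        using k[of m n] k'[of m] k'[of n] mn S.vnorm_minus_commute[OF vb[of m] Fc[of m]] by simp
      finally show "nn (b m \<ominus> b n) < e" .
    qed
  qed
  then obtain f where f: "represents b f" using cauchy_exists by blast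
  have bf: "(\<lambda>k. vnorm space (vec (b k) \<ominus>\<^bsub>space\<^esub> f)) \<longlonglongrightarrow> 0"
    using represents_conv[OF f] unfolding vconv_def by blast
  have "(\<lambda>k. vnorm space (F k \<ominus>\<^bsub>space\<^esub> f)) \<longlonglongrightarrow> 0"
  proof (rule tendsto_sandwich[OF _ _ tendsto_const])
    show "\<forall>\<^sub>F n in sequentially. 0 \<le> vnorm space (F n \<ominus>\<^bsub>space\<^esub> f)"
      using Fc represents_in[OF f] by (intro always_eventually allI S.vnorm_nonneg S.M.minus_closed)
    show "\<forall>\<^sub>F n in sequentially. vnorm space (F n \<ominus>\<^bsub>space\<^esub> f)
        \<le> vnorm space (F n \<ominus>\<^bsub>space\<^esub> vec (b n)) + vnorm space (vec (b n) \<ominus>\<^bsub>space\<^esub> f)"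
      by (intro always_eventually allI S.vnorm_triangle_minus[OF Fc vb represents_in[OF f]])
    show "(\<lambda>n. vnorm space (F n \<ominus>\<^bsub>space\<^esub> vec (b n)) + vnorm space (vec (b n) \<ominus>\<^bsub>space\<^esub> f)) \<longlonglongrightarrow> 0"
      using tendsto_add[OF conv0 bf] by simp
  qed
  then show "\<exists>f. vconv space F f" using Fc represents_in[OF f] unfolding vconv_def by blast
qed

text \<open>If \<open>f a\<close> is the inner product of \<open>x\<close> with \<open>a u\<close>,
  the new value is that of \<open>c x\<close> with \<open>a u\<close>, the adjoint having been moved
  to the second argument.\<close>

definition act :: "'a \<Rightarrow> ('a \<Rightarrow> complex) \<Rightarrow> 'a \<Rightarrow> complex" where
  "act c f = (\<lambda>a. if a \<in> carrier A then f (star A c \<otimes> a) else 0)"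

lemma represents_act:
  assumes c: "c \<in> carrier A" and s: "represents s f"
  shows "represents (\<lambda>n. c \<otimes> s n) (act c f)"
  unfolding represents_def
proof (intro conjI ballI allI impI)
  note sc = representsD(2)[OF s]
  have minus: "c \<otimes> x \<ominus> c \<otimes> y = c \<otimes> (x \<ominus> y)" if "x \<in> carrier A" "y \<in> carrier A" for x y
    using that c by (simp add: a_minus_def neg_smult mult_add_right mult_smult)
  show "cauchy (\<lambda>n. c \<otimes> s n)"
    unfolding cauchy_def
  proof (intro conjI allI impI)
    fix e :: real assume e: "e > 0"
    then have "e/(\<bar>N c\<bar> + 1) > 0" by (simp add: add_nonneg_pos)
    then obtain k where k: "\<And>m n. m \<ge> k \<Longrightarrow> n \<ge> k \<Longrightarrow> nn (s m \<ominus> s n) < e/(\<bar>N c\<bar> + 1)"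
      using representsD(1)[OF s] unfolding cauchy_def by blast
    show "\<exists>k. \<forall>m\<ge>k. \<forall>n\<ge>k. nn (c \<otimes> s m \<ominus> c \<otimes> s n) < e"
    proof (intro exI allI impI)
      fix m n assume mn: "k \<le> m" "k \<le> n"
      have "nn (c \<otimes> s m \<ominus> c \<otimes> s n) \<le> \<bar>N c\<bar> * nn (s m \<ominus> s n)"
        unfolding minus[OF sc sc] using nn_mult c sc by simp
      also have "\<dots> \<le> \<bar>N c\<bar> * (e/(\<bar>N c\<bar> + 1))" using k[OF mn] by (intro mult_left_mono) auto
      also have "\<dots> < e" using e by (intro mult_divide_add_one_less) auto
      finally show "nn (c \<otimes> s m \<ominus> c \<otimes> s n) < e" .
    qed
  qed (use c sc in simp)
  show "(\<lambda>n. B (c \<otimes> s n) a) \<longlonglongrightarrow> act c f a" if a: "a \<in> carrier A" for a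
    using representsD(3)[OF s, of "star A c \<otimes> a"] a c sc unfolding act_def by (simp add: B_mult)
qed (simp add: act_def)

lemma act_in: "c \<in> carrier A \<Longrightarrow> f \<in> carrier space \<Longrightarrow> act c f \<in> carrier space"
  using represents_act in_space by blast

lemma act_vec: "c \<in> carrier A \<Longrightarrow> b \<in> carrier A \<Longrightarrow> act c (vec b) = vec (c \<otimes> b)"
  unfolding act_def vec_def by (auto simp: B_mult)

lemma unitary_rep_space: "unitary_rep A space act"
  unfolding unitary_rep_def
proof (intro conjI ballI allI hilbert_space)
  fix c assume c: "c \<in> carrier A"
  show "linear_map space space (act c)"
    unfolding linear_map_def
  proof (intro conjI ballI allI funcsetI)
    show "act c f \<in> carrier space" if "f \<in> carrier space" for f by (rule act_in[OF c that])
    show "act c (f \<oplus>\<^bsub>space\<^esub> g) = act c f \<oplus>\<^bsub>space\<^esub> act c g" for f g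
      unfolding space_sel act_def by (rule ext) simp
    show "act c (z \<odot>\<^bsub>space\<^esub> f) = z \<odot>\<^bsub>space\<^esub> act c f" for z f
      unfolding space_sel act_def by (rule ext) simp
  qed
  have "vnorm space (act c f) \<le> \<bar>N c\<bar> * vnorm space f" if f: "f \<in> carrier space" for f
  proof -
    obtain s where s: "represents s f" using f unfolding in_space by blast
    have "(\<lambda>n. nn (c \<otimes> s n)) \<longlonglongrightarrow> vnorm space (act c f)" by (rule vnorm_limit[OF represents_act[OF c s]])
    moreover have "(\<lambda>n. \<bar>N c\<bar> * nn (s n)) \<longlonglongrightarrow> \<bar>N c\<bar> * vnorm space f"
      by (intro tendsto_mult_left vnorm_limit[OF s])
    ultimately show ?thesis
      by (rule LIMSEQ_le) (use nn_mult[OF c representsD(2)[OF s]] in blast)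
  qed
  then show "bounded_map space space (act c)" unfolding bounded_map_def by blast
  fix f assume f: "f \<in> carrier space"
  then obtain s where s: "represents s f" using in_space by blast
  show "act (z \<odot> c) f = z \<odot>\<^bsub>space\<^esub> act c f" for z
    using c by (auto simp: act_def star_smult smult_mult represents_conj_linear(2)[OF s])
  fix b assume b: "b \<in> carrier A"
  show "act (c \<oplus> b) f = act c f \<oplus>\<^bsub>space\<^esub> act b f"
    using c b by (auto simp: act_def star_add mult_add_left represents_conj_linear(1)[OF s])
  show "act (c \<otimes> b) f = act c (act b f)"
    using c b by (auto simp: act_def star_mult mult_assoc)
next
  fix c f g assume c: "c \<in> carrier A" and f: "f \<in> carrier space" and g: "g \<in> carrier space"
  obtain s t where s: "represents s f" and t: "represents t g" using f g unfolding in_space by blast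
  have "(\<lambda>n. act c f (t n)) \<longlonglongrightarrow> ip space (act c f) g"
    by (rule ip_limits(1)[OF represents_act[OF c s] t])
  moreover have "(\<lambda>n. f (star A c \<otimes> t n)) \<longlonglongrightarrow> ip space f (act (star A c) g)"
    using ip_limits(1)[OF s represents_act[OF _ t]] c by simp
  moreover have "act c f (t n) = f (star A c \<otimes> t n)" for n
    using representsD(2)[OF t] by (simp add: act_def)
  ultimately show "ip space (act c f) g = ip space f (act (star A c) g)"
    using LIMSEQ_unique by simp blast
next
  let ?S = "{act a v | a v. a \<in> carrier A \<and> v \<in> carrier space}"
  have "?S \<subseteq> carrier space" using act_in by blast
  then have "lin_span space ?S \<subseteq> carrier space"
    by (intro S.lin_span_minimal S.submodule_subspaceI) (auto simp del: space_sel)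
  then have sub: "lin_span space ?S \<subseteq> carrier space" .
  have gen: "?S \<subseteq> lin_span space ?S" unfolding lin_span_def by blast
  have "f \<in> S.MS.mtopology closure_of lin_span space ?S" if f: "f \<in> carrier space" for f
  proof -
    obtain s where s: "represents s f" using f unfolding in_space by blast
    have "vec (s n) \<in> ?S" for n
    proof -
      \<comment> \<open>Nondegeneracy comes from local units: every vector from the algebra is in
        the image of some \<open>act e\<close>.\<close>
      obtain e where e: "e \<in> carrier A" "e \<otimes> s n = s n"
        using local_unit[of "{s n}"] representsD(2)[OF s] by auto
      then have "vec (s n) = act e (vec (s n))" using act_vec representsD(2)[OF s] by simp
      then show ?thesis using e vec_in representsD(2)[OF s] by blast
    qed
    then have "vec (s n) \<in> lin_span space ?S" for n using gen by (rule subsetD[rotated])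
    then show ?thesis
      unfolding S.closure_of_iff_vconv[OF sub] using represents_conv[OF s]
      by (intro exI[of _ "\<lambda>n. vec (s n)"]) simp
  qed
  moreover have "S.MS.mtopology closure_of lin_span space ?S \<subseteq> carrier space"
    using closure_of_subset_topspace[of S.MS.mtopology] by simp
  ultimately show "S.MS.mtopology closure_of lin_span space ?S = carrier space" by blast
qed

sublocale U: unirep A space act
  by unfold_locales (rule unitary_rep_space)

text \<open>The function belonging to the cyclic vector \<open>u\<close> itself:
  \<open>\<psi> a\<close> is to be the inner product of \<open>a u\<close> with \<open>u\<close>, so
  that of \<open>u\<close> with \<open>a u\<close> is its conjugate. That it is represented by a
  Cauchy sequence has to be proved, as the algebra may lack a unit.\<close>

definition cyc :: "'a \<Rightarrow> complex" where
  "cyc = (\<lambda>a. if a \<in> carrier A then \<psi> (star A a) else 0)"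

definition projection :: "'a \<Rightarrow> bool" where
  "projection e \<longleftrightarrow> e \<in> carrier A \<and> e \<otimes> e = e \<and> star A e = e"

lemma common_projection:
  assumes "finite S" "S \<subseteq> carrier A"
  shows "\<exists>e. projection e \<and> (\<forall>a\<in>S. e \<otimes> a = a \<and> a \<otimes> e = a)"
proof (rule local_unit[OF assms])
  fix e assume "e \<in> carrier A" "e \<otimes> e = e" "star A e = e" "\<And>a. a \<in> S \<Longrightarrow> e \<otimes> a = a" "\<And>a. a \<in> S \<Longrightarrow> a \<otimes> e = a"
  then show ?thesis unfolding projection_def by (intro exI[of _ e]) simp
qed

text \<open>At a projection contractivity reads x^2 \<le> x for the real part x of
  \<open>\<psi> e\<close>, which is also the squared norm of \<open>e\<close>.\<close>

lemma projection_le_1: "projection e \<Longrightarrow> nn e \<le> 1 \<and> (nn e)\<^sup>2 = Re (\<psi> e)"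
proof -
  assume e: "projection e"
  then have "(nn e)\<^sup>2 = Re (\<psi> e)" unfolding projection_def by (simp add: nn_sq B_def)
  moreover have "(Re (\<psi> e))\<^sup>2 \<le> Re (\<psi> e)"
    using contractive[of e] e abs_Re_le_cmod[of "\<psi> e"] power_mono[of "\<bar>Re (\<psi> e)\<bar>" "cmod (\<psi> e)" 2]
    unfolding projection_def by simp
  ultimately have "((nn e)\<^sup>2)\<^sup>2 \<le> (nn e)\<^sup>2" by simp
  then have "(nn e)\<^sup>2 \<le> 1"
    by (metis mult_le_cancel_left_pos not_less power2_eq_square mult.right_neutral zero_le_power2 less_eq_real_def zero_le_one)
  then show ?thesis using \<open>(nn e)\<^sup>2 = Re (\<psi> e)\<close> abs_le_square_iff[of "nn e" 1] by simp
qed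

text \<open>Pythagoras for a projection \<open>e\<close> below a projection
  \<open>e'\<close>.\<close>

lemma projection_diff:
  assumes e: "projection e" and e': "projection e'" and le: "e' \<otimes> e = e" "e \<otimes> e' = e"
  shows "(nn (e \<ominus> e'))\<^sup>2 = (nn e')\<^sup>2 - (nn e)\<^sup>2"
proof -
  have c: "e \<in> carrier A" "e' \<in> carrier A" using e e' unfolding projection_def by auto
  have "B (e \<ominus> e') (e \<ominus> e') = B e e - B e' e - (B e e' - B e' e')"
    using c B_commute[of "e \<ominus> e'" e] B_commute[of "e \<ominus> e'" e'] B_commute[of e e'] B_self[of e] B_self[of e']
    by (simp add: B_minus del: of_real_power)
  moreover have "B e e' = \<psi> e" "B e' e = \<psi> e" "B e e = \<psi> e"
    using e e' le unfolding projection_def B_def by auto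
  ultimately show ?thesis using c by (simp add: nn_sq)
qed

text \<open>Choose projections whose squared norms approach the supremum \<open>m\<close>. Two of
  them need not be comparable, but a common larger projection is close to both, since its squared
  norm exceeds theirs by little and \<open>projection_diff\<close> applies. So they form a Cauchy
  sequence.\<close>

lemma represents_cyc:
  obtains s where "represents s cyc" "\<And>n. nn (s n) \<le> 1"
proof -
  define Q where "Q = {(nn e)\<^sup>2 | e. projection e}"
  define m where "m = Sup Q"
  have bdd: "bdd_above Q"
  proof (rule bdd_aboveI[of _ 1])
    fix x assume "x \<in> Q"
    then obtain e where "projection e" "x = (nn e)\<^sup>2" unfolding Q_def by blast
    then show "x \<le> 1" using projection_le_1[of e] nn_nonneg[of e] power_le_one[of "nn e" 2]
      by (metis projection_def)
  qed
  obtain e0 where "projection e0" using common_projection[of "{}"] by auto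
  then have ne: "Q \<noteq> {}" unfolding Q_def by blast
  have "\<exists>e. projection e \<and> m - 1 / Suc n < (nn e)\<^sup>2" for n
    using less_cSupD[OF ne, of "m - 1 / Suc n"] unfolding m_def Q_def by auto
  then obtain s where s: "\<And>n. projection (s n)" "\<And>n. m - 1 / Suc n < (nn (s n))\<^sup>2" by metis
  have sc: "s n \<in> carrier A" for n using s(1) unfolding projection_def by blast
  have near: "nn (s n \<ominus> e) < sqrt (1 / Suc n)"
    if e: "projection e" "e \<otimes> s n = s n" "s n \<otimes> e = s n" for n e
  proof -
    have "(nn e)\<^sup>2 \<le> m" unfolding m_def Q_def using e(1) bdd unfolding Q_def by (intro cSup_upper) auto
    then have "(nn (s n \<ominus> e))\<^sup>2 < 1 / Suc n"
      using projection_diff[OF s(1)[of n] e(1)] e s(2)[of n] by simp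
    then show ?thesis by (rule real_less_rsqrt)
  qed
  have sq0: "(\<lambda>n. sqrt (1 / Suc n)) \<longlonglongrightarrow> 0"
    using tendsto_real_sqrt[OF LIMSEQ_inverse_real_of_nat] by (simp add: inverse_eq_divide)
  have "cauchy s"
    unfolding cauchy_def
  proof (intro conjI allI impI sc)
    fix r :: real assume "r > 0"
    then have "\<forall>\<^sub>F n in sequentially. sqrt (1 / Suc n) < r/2"
      using sq0 by (intro order_tendstoD(2)) auto
    then obtain k where k: "\<And>n. n \<ge> k \<Longrightarrow> sqrt (1 / Suc n) < r/2" unfolding eventually_sequentially by blast
    show "\<exists>k. \<forall>m\<ge>k. \<forall>n\<ge>k. nn (s m \<ominus> s n) < r"
    proof (intro exI allI impI)
      fix i j assume ij: "k \<le> i" "k \<le> j"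
      obtain e where e: "projection e" "e \<otimes> s i = s i" "s i \<otimes> e = s i" "e \<otimes> s j = s j" "s j \<otimes> e = s j"
        using common_projection[of "{s i, s j}"] sc by auto
      have ec: "e \<in> carrier A" using e unfolding projection_def by blast
      have "nn (s i \<ominus> s j) \<le> nn (s i \<ominus> e) + nn (e \<ominus> s j)" by (rule nn_triangle[OF sc ec sc])
      also have "\<dots> < r"
        using near[OF e(1,2,3)] near[OF e(1,4,5)] k[OF ij(1)] k[OF ij(2)] nn_minus_commute[OF ec sc[of j]] by simp
      finally show "nn (s i \<ominus> s j) < r" .
    qed
  qed
  moreover have "(\<lambda>n. B (s n) a) \<longlonglongrightarrow> cyc a" if a: "a \<in> carrier A" for a
  proof -
    have "(\<lambda>n. B (s n) a - cyc a) \<longlonglongrightarrow> 0"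
    proof (rule Lim_null_comparison)
      show "\<forall>\<^sub>F n in sequentially. norm (B (s n) a - cyc a) \<le> sqrt (1 / Suc n) * nn a"
      proof (intro always_eventually allI)
        fix n
        \<comment> \<open>Besides dominating \<open>s n\<close>, this \<open>e\<close> fixes the
          adjoint of \<open>a\<close> and thus acts as a unit in the pairing with \<open>a\<close>;
          only the distance from \<open>s n\<close> to \<open>e\<close> remains.\<close>
        obtain e where e: "projection e" "e \<otimes> s n = s n" "s n \<otimes> e = s n" "star A a \<otimes> e = star A a"
          using common_projection[of "{s n, star A a}"] sc a by auto
        have ec: "e \<in> carrier A" using e unfolding projection_def by blast
        have "B (s n) a - cyc a = B (s n \<ominus> e) a" unfolding cyc_def using e a sc ec by (simp add: B_minus) (simp add: B_def)
        also have "norm \<dots> \<le> nn (s n \<ominus> e) * nn a" using B_bound sc ec a by simp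
        also have "\<dots> \<le> sqrt (1 / Suc n) * nn a"
          using near[OF e(1,2,3)] nn_nonneg[OF a] by (intro mult_right_mono) auto
        finally show "norm (B (s n) a - cyc a) \<le> sqrt (1 / Suc n) * nn a" .
      qed
      show "(\<lambda>n. sqrt (1 / Suc n) * nn a) \<longlonglongrightarrow> 0" by (intro tendsto_mult_left_zero sq0)
    qed
    then show ?thesis by (simp add: LIM_zero_iff)
  qed
  ultimately have "represents s cyc" unfolding represents_def by (auto simp: cyc_def)
  then show thesis using that projection_le_1 s(1) by blast
qed

lemma cyc_in: "cyc \<in> carrier space"
  using represents_cyc in_space by metis

lemma vnorm_cyc: "vnorm space cyc \<le> 1"
proof -
  obtain s where s: "represents s cyc" "\<And>n. nn (s n) \<le> 1" using represents_cyc by blast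
  show ?thesis by (rule LIMSEQ_le_const2[OF vnorm_limit[OF s(1)]]) (use s(2) in blast)
qed

lemma act_cyc: "c \<in> carrier A \<Longrightarrow> act c cyc = vec c"
  unfolding act_def cyc_def vec_def B_def by (auto simp: star_mult)

lemma coef_cyc: "coef A space act cyc = \<psi>"
proof (rule lin_fun_eqI[OF U.lin_fun_coef[OF cyc_in] pos_funD(1)[OF pos]])
  fix a assume a: "a \<in> carrier A"
  have "ip space (act a cyc) cyc = cnj (ip space cyc (vec a))"
    using act_cyc[OF a] S.ip_commute[OF cyc_in vec_in[OF a]] by simp
  also have "\<dots> = cnj (cyc a)" using ip_vec_right[OF cyc_in a] by simp
  also have "\<dots> = \<psi> a" unfolding cyc_def using a pos_funD(2)[OF pos a] by simp
  finally show "coef A space act cyc a = \<psi> a" using a unfolding coef_def by simp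
qed

lemma vec_eq_zero:
  assumes "f \<in> carrier space" "\<And>a. a \<in> carrier A \<Longrightarrow> ip space f (vec a) = 0"
  shows "f = \<zero>\<^bsub>space\<^esub>"
proof -
  obtain s where "represents s f" using assms(1) in_space by blast
  then have "f a = 0" for a
    using assms(2)[of a] ip_vec_right[OF assms(1), of a] representsD(4)[of s f a] by (cases "a \<in> carrier A") auto
  then show ?thesis by auto
qed

end

section \<open>Approximation by irreducible representations\<close>

context op_rep_family
begin

lemma gns_hull:
  assumes "\<psi> \<in> weak_hull coefs"
  shows "gns A \<psi> M"
  by unfold_locales (use assms hull_pos hull_contractive hull_bounded_op in auto)

text \<open>All functionals of the hull vanish off the carrier, so the coordinates that distinguish
  them from \<psi> are elements of the algebra, and the linear form defining the slice is evaluation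
  at one element.\<close>

lemma extreme_slice:
  assumes \<psi>: "extreme_fun \<psi> (weak_hull coefs)" and T: "finite T" and \<epsilon>: "0 < \<epsilon>"
  shows "\<exists>a\<in>carrier A. \<exists>\<delta>>0. \<forall>\<xi>\<in>weak_hull coefs.
    (\<exists>b\<in>T. \<epsilon> \<le> cmod (\<xi> b - \<psi> b)) \<longrightarrow> Re (\<xi> a) + \<delta> \<le> Re (\<psi> a)"
proof -
  obtain S c \<delta> where S: "finite S" "S \<subseteq> {a. \<exists>\<xi>\<in>weak_hull coefs. \<xi> a \<noteq> \<psi> a}" "0 < \<delta>"
    "\<And>\<xi>. \<xi> \<in> weak_hull coefs \<Longrightarrow> \<exists>b\<in>T. \<epsilon> \<le> cmod (\<xi> b - \<psi> b) \<Longrightarrow>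
       Re (\<Sum>a\<in>S. c a * \<xi> a) + \<delta> \<le> Re (\<Sum>a\<in>S. c a * \<psi> a)"
    using extreme_point_slice[OF compact_hull convex_weak_hull \<psi> T \<epsilon>] by blast
  have \<psi>h: "\<psi> \<in> weak_hull coefs" using \<psi> unfolding extreme_fun_def by blast
  have "S \<subseteq> carrier A"
  proof
    fix a assume "a \<in> S"
    then obtain \<xi> where "\<xi> \<in> weak_hull coefs" "\<xi> a \<noteq> \<psi> a" using S(2) by blast
    then show "a \<in> carrier A"
      using lin_funD(3)[OF weak_hull_lin, of \<xi> coefs a] lin_funD(3)[OF weak_hull_lin[OF \<psi>h], of a] by metis
  qed
  then obtain a where "a \<in> carrier A" "\<And>\<xi>. lin_fun \<xi> \<Longrightarrow> \<xi> a = (\<Sum>s\<in>S. c s * \<xi> s)"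
    using lin_fun_sum[OF S(1)] by blast
  then show ?thesis using S(3,4) weak_hull_lin \<psi>h
    by (intro bexI[of _ a] exI[of _ \<delta>]) auto
qed

text \<open>Milman's converse to the theorem of Krein and Milman: if all coefficients were far from
  \<psi>, the strict slice inequality would hold on them and hence on their hull, to which \<psi>
  belongs.\<close>

lemma extreme_approx:
  assumes \<psi>: "extreme_fun \<psi> (weak_hull coefs)" and T: "finite T" and \<epsilon>: "0 < \<epsilon>"
  shows "\<exists>\<eta>\<in>coefs. \<forall>a\<in>T. cmod (\<eta> a - \<psi> a) < \<epsilon>"
proof (rule ccontr)
  assume "\<not> ?thesis"
  then have far: "\<exists>b\<in>T. \<epsilon> \<le> cmod (\<eta> b - \<psi> b)" if "\<eta> \<in> coefs" for \<eta> using that by force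
  obtain a \<delta> where a: "a \<in> carrier A" "0 < \<delta>"
    "\<And>\<xi>. \<xi> \<in> weak_hull coefs \<Longrightarrow> \<exists>b\<in>T. \<epsilon> \<le> cmod (\<xi> b - \<psi> b) \<Longrightarrow> Re (\<xi> a) + \<delta> \<le> Re (\<psi> a)"
    using extreme_slice[OF \<psi> T \<epsilon>] by blast
  have \<psi>h: "\<psi> \<in> weak_hull coefs" using \<psi> unfolding extreme_fun_def by blast
  have "Re (\<psi> a) \<le> Re (\<psi> a) - \<delta>"
  proof (rule weak_hullD[OF \<psi>h a(1)])
    fix \<eta> assume "\<eta> \<in> coefs"
    then show "Re (\<eta> a) \<le> Re (\<psi> a) - \<delta>"
      using a(3)[of \<eta>] far weak_hull_incl coefs_bound a(1) by fastforce
  qed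
  then show False using a(2) by simp
qed

text \<open>Weak containment asks for unit vectors, while the approximations produce vectors whose
  norms merely tend to 1; rescaling does not affect the limits of the coefficients. The member of
  the family may change with \<open>n\<close>.\<close>

lemma unit_approx:
  assumes T: "finite T" "T \<subseteq> carrier A" and \<epsilon>: "0 < \<epsilon>"
    and y: "\<And>n. j n \<in> J" "\<And>n. y n \<in> carrier (H (j n))"
    and norm: "(\<lambda>n. vnorm (H (j n)) (y n)) \<longlonglongrightarrow> 1"
    and lim: "\<And>a. a \<in> T \<Longrightarrow> (\<lambda>n. ip (H (j n)) (\<rho> (j n) a (y n)) (y n)) \<longlonglongrightarrow> z a"
  shows "\<exists>i\<in>J. \<exists>w\<in>carrier (H i). vnorm (H i) w = 1 \<and> (\<forall>a\<in>T. cmod (z a - ip (H i) (\<rho> i a w) w) < \<epsilon>)"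
proof -
  define r where "r n = vnorm (H (j n)) (y n)" for n
  have "\<forall>\<^sub>F n in sequentially. cmod (z a - ip (H (j n)) (\<rho> (j n) a (y n)) (y n) / of_real ((r n)\<^sup>2)) < \<epsilon>"
    if "a \<in> T" for a
  proof -
    have "(\<lambda>n. cmod (z a - ip (H (j n)) (\<rho> (j n) a (y n)) (y n) / of_real ((r n)\<^sup>2)))
      \<longlonglongrightarrow> cmod (z a - z a / of_real (1\<^sup>2))"
      using norm unfolding r_def[symmetric] by (intro tendsto_intros lim[OF that]) auto
    then show ?thesis using \<epsilon> by (intro order_tendstoD(2)) auto
  qed
  then have "\<forall>\<^sub>F n in sequentially. \<forall>a\<in>T. cmod (z a - ip (H (j n)) (\<rho> (j n) a (y n)) (y n) / of_real ((r n)\<^sup>2)) < \<epsilon>"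
    using T(1) by (simp add: eventually_ball_finite)
  moreover have "\<forall>\<^sub>F n in sequentially. 0 < r n"
    using norm unfolding r_def by (intro order_tendstoD(1)) auto
  ultimately have "\<forall>\<^sub>F n in sequentially. (\<forall>a\<in>T. cmod (z a - ip (H (j n)) (\<rho> (j n) a (y n)) (y n) / of_real ((r n)\<^sup>2)) < \<epsilon>) \<and> 0 < r n"
    by (rule eventually_conj)
  then obtain n where n: "0 < r n"
    "\<And>a. a \<in> T \<Longrightarrow> cmod (z a - ip (H (j n)) (\<rho> (j n) a (y n)) (y n) / of_real ((r n)\<^sup>2)) < \<epsilon>"
    using eventually_happens'[OF sequentially_bot] by blast
  interpret op_rep A "H (j n)" "\<rho> (j n)" M by (rule fam[OF y(1)])
  define w where "w = of_real (1 / r n) \<odot>\<^bsub>H (j n)\<^esub> y n"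
  have w: "w \<in> carrier (H (j n))" unfolding w_def using y by simp
  have "vnorm (H (j n)) w = 1"
    unfolding w_def using y n by (simp add: vnorm_smult norm_divide) (simp add: r_def)
  moreover have "ip (H (j n)) (\<rho> (j n) a w) w = ip (H (j n)) (\<rho> (j n) a (y n)) (y n) / of_real ((r n)\<^sup>2)"
    if "a \<in> T" for a
    unfolding w_def using y that T(2) n
    by (simp add: rep_vsmult subset_iff power2_eq_square)
  ultimately show ?thesis using n(2) w y(1) by (intro bexI[of _ "j n"] bexI[of _ w]) auto
qed

end

text \<open>The zero functional lies in the hull and its GNS space is zero, so it has to be
  excluded.\<close>

locale extreme_state = op_rep_family A J H \<rho> M
  for A :: "'a alg" (structure) and J :: "'j set" and H :: "'j \<Rightarrow> 'h inner_space" and \<rho> M +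
  fixes \<psi> :: "'a \<Rightarrow> complex"
  assumes extreme: "extreme_fun \<psi> (weak_hull coefs)" and nz: "\<exists>a. \<psi> a \<noteq> 0" and J: "J \<noteq> {}"
begin

lemma hull: "\<psi> \<in> weak_hull coefs"
  using extreme unfolding extreme_fun_def by blast

sublocale gns A \<psi> M
  by (rule gns_hull[OF hull])

text \<open>If \<open>a\<close> is bounded above by \<open>c\<close> on the vectors of norm at most
  1 in the family, then b*ab - c b*b is nonpositive on all coefficients, hence at \<psi>. This is
  the claim for the vectors \<open>vec b\<close>, and these are dense.\<close>

lemma hull_quadratic:
  assumes a: "a \<in> carrier A" and c: "\<And>\<eta>. \<eta> \<in> coefs \<Longrightarrow> Re (\<eta> a) \<le> c" and x: "x \<in> carrier space"
  shows "Re (ip space (act a x) x) \<le> c * (vnorm space x)\<^sup>2"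
proof -
  have *: "Re (B (a \<otimes> b) b) \<le> c * (nn b)\<^sup>2" if b: "b \<in> carrier A" for b
  proof -
    let ?d = "star A b \<otimes> (a \<otimes> b) \<oplus> of_real (- c) \<odot> (star A b \<otimes> b)"
    have "Re (\<psi> ?d) \<le> 0"
    proof (rule weak_hullD[OF hull])
      fix \<eta> assume "\<eta> \<in> coefs"
      then show "Re (\<eta> ?d) \<le> 0"
      proof (elim coefsE)
        fix i w assume i: "i \<in> J" "w \<in> carrier (H i)" "vnorm (H i) w \<le> 1" "\<eta> = coef A (H i) (\<rho> i) w"
        interpret R: op_rep A "H i" "\<rho> i" M by (rule fam[OF i(1)])
        define y where "y = \<rho> i b w"
        have y: "y \<in> carrier (H i)" unfolding y_def using b i by simp
        have eq: "\<eta> ?d = ip (H i) (\<rho> i a y) y - of_real c * ip (H i) y y"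
          using lin_funD[OF R.lin_fun_coef[OF i(2)]] a b i(2,4) R.coef_star_mult[of w b "a \<otimes> b"]
            R.coef_star_mult[of w b b] unfolding y_def by (simp add: R.rep_mult)
        show ?thesis
        proof (cases "vnorm (H i) y = 0")
          case True
          then have "y = \<zero>\<^bsub>H i\<^esub>" using R.vnorm_eq_0[OF y] by simp
          then show ?thesis unfolding eq using a by (simp add: R.rep_zero)
        next
          case False
          define r where "r = vnorm (H i) y"
          have r: "r > 0" unfolding r_def using False R.vnorm_nonneg[OF y] by simp
          \<comment> \<open>The bound \<open>c\<close> speaks of vectors of norm at most 1, whereas
            \<open>y\<close> is arbitrary, so it is normalized.\<close>
          define w' where "w' = of_real (1 / r) \<odot>\<^bsub>H i\<^esub> y"
          have w': "w' \<in> carrier (H i)" unfolding w'_def using y by simp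
          have "vnorm (H i) w' = 1"
            unfolding w'_def using y r by (simp add: R.vnorm_smult norm_divide) (simp add: r_def)
          then have "coef A (H i) (\<rho> i) w' \<in> coefs"
            using i(1) w' unfolding coefs_def unit_coefs_def
            by (intro UN_I[of i] CollectI exI[of _ w'] conjI) simp_all
          from c[OF this] have "Re (ip (H i) (\<rho> i a w') w') \<le> c" using a unfolding coef_def by simp
          moreover have "ip (H i) (\<rho> i a w') w' = ip (H i) (\<rho> i a y) y / of_real (r\<^sup>2)"
            unfolding w'_def using y a r by (simp add: R.rep_vsmult power2_eq_square)
          moreover have "ip (H i) y y = of_real (r\<^sup>2)" unfolding r_def by (rule R.ip_self[OF y])
          ultimately show ?thesis unfolding eq using r
            by (simp add: divide_le_eq flip: of_real_power of_real_mult)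
        qed
      qed
    qed (use a b in auto)
    then show ?thesis using lin a b by (simp add: B_def nn_sq)
  qed
  obtain s where s: "represents s x" using x unfolding in_space by blast
  note sc = representsD(2)[OF s]
  show ?thesis
  proof (rule LIMSEQ_le)
    show "(\<lambda>n. Re (B (a \<otimes> s n) (s n))) \<longlonglongrightarrow> Re (ip space (act a x) x)"
      by (intro tendsto_Re ip_limits(2)[OF represents_act[OF a s] s])
    show "(\<lambda>n. c * (nn (s n))\<^sup>2) \<longlonglongrightarrow> c * (vnorm space x)\<^sup>2"
      by (intro tendsto_intros vnorm_limit[OF s])
  qed (use * sc in auto)
qed

text \<open>Hence splitting the cyclic vector splits \<psi> inside the hull. The coefficient 0
  belongs to \<open>coefs\<close>, so the bound \<open>c\<close> is nonnegative and also serves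
  vectors of norm below 1.\<close>

lemma coef_in_hull:
  assumes x: "x \<in> carrier space" "vnorm space x \<le> 1"
  shows "coef A space act x \<in> weak_hull coefs"
  unfolding weak_hull_def
proof (intro CollectI conjI ballI allI impI)
  show "lin_fun (coef A space act x)" by (rule U.lin_fun_coef[OF x(1)])
  fix a c assume a: "a \<in> carrier A" and c: "\<forall>\<eta>\<in>coefs. Re (\<eta> a) \<le> c"
  obtain i where i: "i \<in> J" using J by blast
  interpret R: op_rep A "H i" "\<rho> i" M by (rule fam[OF i])
  have "coef A (H i) (\<rho> i) \<zero>\<^bsub>H i\<^esub> \<in> coefs"
    using i unfolding coefs_def unit_coefs_def by (intro UN_I CollectI exI[of _ "\<zero>\<^bsub>H i\<^esub>"]) auto
  then have "0 \<le> c" using c a unfolding coef_def by (force simp: R.rep_zero)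
  have "Re (ip space (act a x) x) \<le> c * (vnorm space x)\<^sup>2" using hull_quadratic a c x by blast
  also have "\<dots> \<le> c * 1" using \<open>0 \<le> c\<close> x by (intro mult_left_mono) (auto simp: power_le_one)
  finally show "Re (coef A space act x a) \<le> c" using a unfolding coef_def by simp
qed

text \<open>The projection \<open>p\<close> of the cyclic vector to an invariant closed
  \<open>W\<close> and the remainder \<open>q\<close> have orthogonal orbits, so \<psi> is the sum
  of their coefficients. Extremality makes the part from \<open>p\<close> proportional to \<psi>,
  and then \<open>p\<close> is a multiple of the cyclic vector. Thus \<open>W\<close> contains the
  cyclic vector, unless \<open>p = 0\<close> and \<open>W\<close> is orthogonal to its
  orbit.\<close>

theorem gns_irreducible: "irreducible_rep A space act"
  unfolding irreducible_rep_def
proof (intro conjI allI impI unitary_rep_space)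
  show "carrier space \<noteq> {\<zero>\<^bsub>space\<^esub>}"
  proof
    assume "carrier space = {\<zero>\<^bsub>space\<^esub>}"
    then have "cyc = \<zero>\<^bsub>space\<^esub>" using cyc_in by blast
    moreover have "coef A space act \<zero>\<^bsub>space\<^esub> a = 0" for a
      unfolding coef_def using S.ip_zero_right[OF act_in[OF _ S.M.zero_closed]] by simp
    ultimately have "coef A space act cyc a = 0" for a by simp
    then show False using nz coef_cyc by auto
  qed
  fix W assume W: "submodule W complex_ring space \<and> (\<forall>a\<in>carrier A. act a ` W \<subseteq> W) \<and> closedin S.MS.mtopology W"
  then have sub: "W \<subseteq> carrier space" and W0: "W \<noteq> {}" and cl: "closedin S.MS.mtopology W"
    and inv: "\<And>a w. a \<in> carrier A \<Longrightarrow> w \<in> W \<Longrightarrow> act a w \<in> W"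
    using S.submoduleE[of W] by blast+
  have Wadd: "x \<oplus>\<^bsub>space\<^esub> y \<in> W" if "x \<in> W" "y \<in> W" for x y using W S.submoduleE(5) that by blast
  have Wsmult: "c \<odot>\<^bsub>space\<^esub> x \<in> W" if "x \<in> W" for x c
    using W S.submoduleE(4)[of W c x] that by simp
  have lim: "x \<in> W" if "\<And>n. s n \<in> W" "vconv space s x" for s x
    using cl that unfolding S.closedin_iff_vconv by blast
  have "\<exists>s p. (\<forall>n. s n \<in> W) \<and> vconv space s p \<and> (\<forall>w\<in>W. ip space w cyc = ip space w p)"
  proof (rule riesz_on_subspace[OF hilbert_space sub W0])
    show "cmod (ip space w cyc) \<le> vnorm space cyc * vnorm space w" if "w \<in> W" for w
      using S.cauchy_schwarz[of w cyc] that sub cyc_in by (auto simp: mult.commute)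
  qed (use Wadd Wsmult sub cyc_in in \<open>auto simp: subset_iff simp del: space_sel\<close>)
  then obtain p where pW: "p \<in> W" and p: "\<And>w. w \<in> W \<Longrightarrow> ip space w cyc = ip space w p"
    using lim by blast
  have pc: "p \<in> carrier space" using pW sub by blast
  define q where "q = cyc \<ominus>\<^bsub>space\<^esub> p"
  have qc: "q \<in> carrier space" unfolding q_def using pc cyc_in by (intro S.M.minus_closed)
  have Wq: "ip space w q = 0" if "w \<in> W" for w
    unfolding q_def using p[OF that] that sub pc cyc_in by (simp add: subset_iff del: space_sel)
  have qW: "ip space q w = 0" if "w \<in> W" for w
    using Wq[OF that] S.ip_commute[of w q] that sub qc by auto
  show "W = {\<zero>\<^bsub>space\<^esub>} \<or> W = carrier space"
  proof (cases "p = \<zero>\<^bsub>space\<^esub>")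
    case True
    \<comment> \<open>\<open>W\<close> is orthogonal to the cyclic vector and, being invariant, to
      its whole orbit.\<close>
    have "w = \<zero>\<^bsub>space\<^esub>" if w: "w \<in> W" for w
    proof (rule vec_eq_zero)
      show wc: "w \<in> carrier space" using w sub by blast
      fix a assume a: "a \<in> carrier A"
      have "ip space w (vec a) = ip space (act (star A a) w) cyc"
        using U.rep_adj[of "star A a" w cyc] a wc cyc_in by (simp add: act_cyc)
      also have "\<dots> = ip space (act (star A a) w) p" using p inv a w by simp
      also have "\<dots> = 0" using True S.ip_zero_right act_in[of "star A a" w] a wc by simp
      finally show "ip space w (vec a) = 0" .
    qed
    then show ?thesis using W0 by blast
  next
    case False
    have "cyc \<in> W"
    proof (cases "q = \<zero>\<^bsub>space\<^esub>")
      case True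
      then have "cyc = p" using S.minus_eq_zero_iff[OF cyc_in pc] unfolding q_def by simp
      then show ?thesis using pW by simp
    next
      case q0: False
      define \<alpha> \<beta> where "\<alpha> = (vnorm space p)\<^sup>2" and "\<beta> = (vnorm space q)\<^sup>2"
      have cyc_eq: "cyc = p \<oplus>\<^bsub>space\<^esub> q" unfolding q_def using minus_space[OF cyc_in pc] by auto
      have ab: "\<alpha> + \<beta> \<le> 1"
      proof -
        have "(vnorm space cyc)\<^sup>2 = \<alpha> + \<beta>"
          unfolding cyc_eq S.vnorm_add_sq[OF pc qc] \<alpha>_def \<beta>_def using Wq[OF pW] by simp
        then show ?thesis using vnorm_cyc cyc_in power_le_one[of "vnorm space cyc" 2] by simp
      qed
      have \<alpha>: "0 < \<alpha>" and \<beta>: "0 < \<beta>" unfolding \<alpha>_def \<beta>_def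
        using False q0 S.vnorm_eq_0[OF pc] S.vnorm_eq_0[OF qc] by auto
      then have \<alpha>1: "0 < 1 - \<alpha>" using ab by simp
      \<comment> \<open>\<open>q\<close> is divided by the root of \<open>1 - \<alpha>\<close> and
        not by its own norm, since the weights must add up to 1 while the cyclic vector may have
        norm below 1. As \<open>\<alpha> + \<beta> \<le> 1\<close>, the vector \<open>y\<close>
        still has norm at most 1.\<close>
      define x y where "x = of_real (1 / sqrt \<alpha>) \<odot>\<^bsub>space\<^esub> p" and "y = of_real (1 / sqrt (1 - \<alpha>)) \<odot>\<^bsub>space\<^esub> q"
      have xc: "x \<in> carrier space" and yc: "y \<in> carrier space"
        unfolding x_def y_def using S.smult_in[OF pc] S.smult_in[OF qc] by blast+
      have xn: "vnorm space x \<le> 1"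
        unfolding x_def S.vnorm_smult[OF pc] \<alpha>_def using \<alpha> pc by (simp add: norm_divide)
      have "sqrt \<beta> \<le> sqrt (1 - \<alpha>)" using ab by simp
      then have yn: "vnorm space y \<le> 1"
        unfolding y_def S.vnorm_smult[OF qc] using \<alpha>1 qc by (simp add: norm_divide \<beta>_def)
      have split: "\<psi> a = of_real \<alpha> * coef A space act x a + of_real (1 - \<alpha>) * coef A space act y a"
        and cx: "a \<in> carrier A \<Longrightarrow> of_real \<alpha> * coef A space act x a = ip space (act a p) p" for a
      proof -
        show cx: "of_real \<alpha> * coef A space act x a = ip space (act a p) p" if a: "a \<in> carrier A"
          unfolding x_def coef_def using a \<alpha> pc
          by (simp add: U.rep_vsmult act_in del: space_sel of_real_divide flip: of_real_mult) 
        have cy: "of_real (1 - \<alpha>) * coef A space act y a = ip space (act a q) q" if a: "a \<in> carrier A"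
          unfolding y_def coef_def using a \<alpha>1 qc
          by (simp add: U.rep_vsmult act_in del: space_sel of_real_divide of_real_diff flip: of_real_mult)
        show "\<psi> a = of_real \<alpha> * coef A space act x a + of_real (1 - \<alpha>) * coef A space act y a"
        proof (cases "a \<in> carrier A")
          case True
          have "ip space (act a p) q = 0" using Wq inv True pW by blast
          moreover have "ip space (act a q) p = 0"
            using qW[OF inv[of "star A a" p]] True pW U.rep_adj[of a q p] qc pc by simp
          moreover have "\<psi> a = ip space (act a (p \<oplus>\<^bsub>space\<^esub> q)) (p \<oplus>\<^bsub>space\<^esub> q)"
            unfolding cyc_eq[symmetric] using fun_cong[OF coef_cyc, of a] True by (simp add: coef_def)
          moreover have "act a (p \<oplus>\<^bsub>space\<^esub> q) = act a p \<oplus>\<^bsub>space\<^esub> act a q" by (rule U.rep_vadd[OF True pc qc])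
          ultimately show ?thesis
            using cx[OF True] cy[OF True] act_in[OF True pc] act_in[OF True qc] pc qc by (simp del: space_sel)
        qed (simp add: lin coef_def)
      qed
      have "mix (1 - \<alpha>) (coef A space act x) (coef A space act y) = \<psi>"
        unfolding mix_def using split by auto
      then have "coef A space act x = \<psi>"
        using extreme[unfolded extreme_fun_def, THEN conjunct2, rule_format,
          OF coef_in_hull[OF xc xn] coef_in_hull[OF yc yn], of "1 - \<alpha>"] \<alpha> \<alpha>1 by simp
      then have eq: "ip space (act a p) p = of_real \<alpha> * ip space (act a cyc) cyc" if "a \<in> carrier A" for a
        using cx[OF that] fun_cong[OF coef_cyc, of a] that by (simp add: coef_def)
      \<comment> \<open>Equality of the coefficients of \<open>x\<close> and of the cyclic vector,
        together with the projection property of \<open>p\<close>, identifies the inner products of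
        both sides with all \<open>vec a\<close>.\<close>
      have "p \<ominus>\<^bsub>space\<^esub> of_real \<alpha> \<odot>\<^bsub>space\<^esub> cyc = \<zero>\<^bsub>space\<^esub>"
      proof (rule vec_eq_zero)
        show "p \<ominus>\<^bsub>space\<^esub> of_real \<alpha> \<odot>\<^bsub>space\<^esub> cyc \<in> carrier space"
          using pc cyc_in by (intro S.M.minus_closed S.smult_in)
        fix a assume a: "a \<in> carrier A"
        let ?b = "star A a"
        have "ip space p (vec a) = ip space (act ?b p) cyc"
          using U.rep_adj[of ?b p cyc] a pc cyc_in by (simp add: act_cyc)
        also have "\<dots> = ip space (act ?b p) p" using p inv a pW by simp
        also have "\<dots> = of_real \<alpha> * ip space (act ?b cyc) cyc" using eq a by simp
        also have "ip space (act ?b cyc) cyc = ip space cyc (vec a)"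
          using U.rep_adj[of ?b cyc cyc] a cyc_in by (simp add: act_cyc)
        finally show "ip space (p \<ominus>\<^bsub>space\<^esub> of_real \<alpha> \<odot>\<^bsub>space\<^esub> cyc) (vec a) = 0"
          using pc cyc_in vec_in[OF a] by (simp del: space_sel)
      qed
      then have "p = of_real \<alpha> \<odot>\<^bsub>space\<^esub> cyc" using S.minus_eq_zero_iff[OF pc S.smult_in[OF cyc_in]] by blast
      then have "of_real (1/\<alpha>) \<odot>\<^bsub>space\<^esub> p = cyc" using \<alpha> by auto
      then show ?thesis using Wsmult[OF pW] by metis
    qed
    have "x \<in> W" if "x \<in> carrier space" for x
    proof -
      obtain s where s: "represents s x" using \<open>x \<in> carrier space\<close> unfolding in_space by blast
      have "vec (s n) \<in> W" for n using inv[OF representsD(2)[OF s] \<open>cyc \<in> W\<close>] act_cyc representsD(2)[OF s] by simp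
      then show ?thesis using lim[OF _ represents_conv[OF s]] by blast
    qed
    then show ?thesis using sub by blast
  qed
qed

text \<open>\<open>x\<close> is a limit of \<open>s n\<close> applied to the cyclic vector. Let
  \<open>w n\<close> be vectors of the family whose coefficients approximate \<psi> at the elements
  s_n* a s_n and s_n* s_n; then the vectors \<open>s n\<close> applied to \<open>w n\<close> have
  asymptotically the coefficients and the norm of \<open>x\<close>.\<close>

theorem gns_weakly_contained:
  assumes x: "x \<in> carrier space" "vnorm space x = 1" and T: "finite T" "T \<subseteq> carrier A" and \<epsilon>: "0 < \<epsilon>"
  shows "\<exists>i\<in>J. \<exists>w\<in>carrier (H i). vnorm (H i) w = 1 \<and>
    (\<forall>a\<in>T. cmod (ip space (act a x) x - ip (H i) (\<rho> i a w) w) < \<epsilon>)"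
proof -
  obtain s where s: "represents s x" using x(1) unfolding in_space by blast
  note sc = representsD(2)[OF s]
  let ?T = "\<lambda>n. insert (star A (s n) \<otimes> s n) ((\<lambda>a. star A (s n) \<otimes> (a \<otimes> s n)) ` T)"
  have "\<exists>\<eta>\<in>coefs. \<forall>b\<in>?T n. cmod (\<eta> b - \<psi> b) < 1 / Suc n" for n
    by (rule extreme_approx[OF extreme]) (use T in auto)
  then have "\<exists>j w. j \<in> J \<and> w \<in> carrier (H j) \<and> (\<forall>b\<in>?T n. cmod (coef A (H j) (\<rho> j) w b - \<psi> b) < 1 / Suc n)" for n
    by (metis (no_types, lifting) coefsE)
  then obtain j w where j: "\<And>n. j n \<in> J" and w: "\<And>n. w n \<in> carrier (H (j n))"
    and approx: "\<And>n b. b \<in> ?T n \<Longrightarrow> cmod (coef A (H (j n)) (\<rho> (j n)) (w n) b - \<psi> b) < 1 / Suc n"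
    by metis
  define y where "y n = \<rho> (j n) (s n) (w n)" for n
  note R = op_rep.rep_in[OF fam[OF j]]
  have y: "y n \<in> carrier (H (j n))" for n unfolding y_def using R sc w by blast
  have inv0: "(\<lambda>n. 1 / real (Suc n)) \<longlonglongrightarrow> 0"
    using LIMSEQ_inverse_real_of_nat by (simp add: inverse_eq_divide)
  have coef_lim: "(\<lambda>n. coef A (H (j n)) (\<rho> (j n)) (w n) (c n)) \<longlonglongrightarrow> l"
    if c: "\<And>n. c n \<in> ?T n" and l: "(\<lambda>n. \<psi> (c n)) \<longlonglongrightarrow> l" for c l
  proof -
    have "(\<lambda>n. coef A (H (j n)) (\<rho> (j n)) (w n) (c n) - \<psi> (c n)) \<longlonglongrightarrow> 0"
      by (rule Lim_null_comparison[OF _ inv0]) (use approx[OF c] in \<open>auto intro!: always_eventually less_imp_le\<close>)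
    from tendsto_add[OF this l] show ?thesis by simp
  qed
  have ny: "(vnorm (H (j n)) (y n))\<^sup>2 = Re (coef A (H (j n)) (\<rho> (j n)) (w n) (star A (s n) \<otimes> s n))" for n
    using op_rep.coef_star_mult[OF fam[OF j] w sc sc] prehil.vnorm_sq[OF op_rep.axioms(2)[OF fam[OF j]] y]
    unfolding y_def by simp
  have "(\<lambda>n. \<psi> (star A (s n) \<otimes> s n)) \<longlonglongrightarrow> ip space x x"
    using ip_limits(2)[OF s s] unfolding B_def .
  then have "(\<lambda>n. coef A (H (j n)) (\<rho> (j n)) (w n) (star A (s n) \<otimes> s n)) \<longlonglongrightarrow> ip space x x"
    by (intro coef_lim) auto
  then have "(\<lambda>n. sqrt (Re (coef A (H (j n)) (\<rho> (j n)) (w n) (star A (s n) \<otimes> s n)))) \<longlonglongrightarrow> sqrt (Re (ip space x x))"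
    by (intro tendsto_real_sqrt tendsto_Re)
  moreover have "sqrt (Re (ip space x x)) = 1" using x(2) unfolding vnorm_def .
  moreover have "sqrt (Re (coef A (H (j n)) (\<rho> (j n)) (w n) (star A (s n) \<otimes> s n))) = vnorm (H (j n)) (y n)" for n
    unfolding ny[symmetric] using prehil.vnorm_nonneg[OF op_rep.axioms(2)[OF fam[OF j]] y] by simp
  ultimately have norm: "(\<lambda>n. vnorm (H (j n)) (y n)) \<longlonglongrightarrow> 1" by simp
  have lim: "(\<lambda>n. ip (H (j n)) (\<rho> (j n) a (y n)) (y n)) \<longlonglongrightarrow> ip space (act a x) x" if a: "a \<in> T" for a
  proof -
    have ac: "a \<in> carrier A" using a T by blast
    have "(\<lambda>n. \<psi> (star A (s n) \<otimes> (a \<otimes> s n))) \<longlonglongrightarrow> ip space (act a x) x"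
      using ip_limits(2)[OF represents_act[OF ac s] s] unfolding B_def .
    then have "(\<lambda>n. coef A (H (j n)) (\<rho> (j n)) (w n) (star A (s n) \<otimes> (a \<otimes> s n))) \<longlonglongrightarrow> ip space (act a x) x"
      by (intro coef_lim) (use a in auto)
    moreover have "coef A (H (j n)) (\<rho> (j n)) (w n) (star A (s n) \<otimes> (a \<otimes> s n)) = ip (H (j n)) (\<rho> (j n) a (y n)) (y n)" for n
      using op_rep.coef_star_mult[OF fam[OF j] w sc mult_in[OF ac sc], of n n n]
        op_rep.rep_mult[OF fam[OF j] ac sc w, of n n] unfolding y_def by simp
    ultimately show ?thesis by simp
  qed
  show ?thesis by (rule unit_approx[OF T \<epsilon> j y norm lim])
qed

end

context op_rep_family
begin

text \<open>
  A slice of the hull of all coefficients that is small around the extreme point given by \<open>v\<close> meets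
  the hull of the coefficients of a single member of the family. The extreme point of the latter at
  which the functional defining the slice is maximal yields an irreducible representation.
\<close>

theorem irreducible_approx:
  assumes V: "irreducible_rep A V \<sigma>" and v: "v \<in> carrier V" "vnorm V v = 1"
    and approx: "\<And>T \<epsilon>. finite T \<Longrightarrow> T \<subseteq> carrier A \<Longrightarrow> 0 < \<epsilon> \<Longrightarrow>
      \<exists>j\<in>J. \<exists>w\<in>carrier (H j). vnorm (H j) w = 1 \<and> (\<forall>a\<in>T. cmod (ip V (\<sigma> a v) v - ip (H j) (\<rho> j a w) w) < \<epsilon>)"
    and T: "finite T" "T \<subseteq> carrier A" and \<epsilon>: "0 < \<epsilon>"
  shows "\<exists>j\<in>J. \<exists>(U, \<tau>)\<in>irreps A. (\<exists>u\<in>carrier U. \<forall>a\<in>T. cmod (ip V (\<sigma> a v) v - ip U (\<tau> a u) u) < \<epsilon>) \<and>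
    weakly_contained A U \<tau> (H j) (\<rho> j)"
proof -
  interpret V: irrep_vector A V \<sigma> v
    by unfold_locales (use V v in auto)
  let ?\<phi> = "coef A V \<sigma> v"
  have appr: "\<exists>j\<in>J. \<exists>\<eta>\<in>unit_coefs A (H j) (\<rho> j). \<forall>a\<in>S. cmod (\<eta> a - ?\<phi> a) < \<delta>"
    if S: "finite S" "S \<subseteq> carrier A" and \<delta>: "0 < \<delta>" for S \<delta>
  proof -
    obtain j w where j: "j \<in> J" "w \<in> carrier (H j)" "vnorm (H j) w = 1"
      "\<And>a. a \<in> S \<Longrightarrow> cmod (ip V (\<sigma> a v) v - ip (H j) (\<rho> j a w) w) < \<delta>"
      using approx[OF S \<delta>] by blast
    have "cmod (coef A (H j) (\<rho> j) w a - ?\<phi> a) < \<delta>" if "a \<in> S" for a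
      using j(4)[OF that] S that by (auto simp: coef_def norm_minus_commute)
    then show ?thesis using j unfolding unit_coefs_def
      by (intro bexI[of _ j] bexI[of _ "coef A (H j) (\<rho> j) w"]) auto
  qed
  have \<phi>h: "?\<phi> \<in> weak_hull coefs"
    unfolding weak_hull_def
  proof (intro CollectI conjI ballI allI impI V.lin_fun_coef v(1))
    fix a c assume a: "a \<in> carrier A" and c: "\<forall>\<eta>\<in>coefs. Re (\<eta> a) \<le> c"
    show "Re (?\<phi> a) \<le> c"
    proof (rule field_le_epsilon)
      fix e :: real assume "0 < e"
      then obtain j \<eta> where "j \<in> J" "\<eta> \<in> unit_coefs A (H j) (\<rho> j)" "cmod (\<eta> a - ?\<phi> a) < e"
        using appr[of "{a}" e] a by auto
      then have "Re (\<eta> a) \<le> c" "Re (?\<phi> a) \<le> Re (\<eta> a) + e"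
        using c complex_Re_le_cmod[of "?\<phi> a - \<eta> a"] unfolding coefs_def by (auto simp: norm_minus_commute)
      then show "Re (?\<phi> a) \<le> c + e" by linarith
    qed
  qed
  have ext: "extreme_fun ?\<phi> (weak_hull coefs)"
    by (rule V.extreme_coef[OF _ _ \<phi>h]) (auto intro: hull_pos hull_contractive)
  obtain b where b: "?\<phi> b \<noteq> 0"
  proof -
    obtain s where "(\<lambda>n. ?\<phi> (s n)) \<longlonglongrightarrow> 1" using V.approximate_vector by blast
    moreover have "\<not> (\<lambda>_. 0 :: complex) \<longlonglongrightarrow> 1"
      using LIMSEQ_unique[OF tendsto_const, of "0 :: complex" 1] by auto
    ultimately have "(\<lambda>n. ?\<phi> (s n)) \<noteq> (\<lambda>_. 0)" by metis
    then have "\<exists>n. ?\<phi> (s n) \<noteq> 0" by auto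
    then show thesis using that by blast
  qed
  \<comment> \<open>Staying within \<open>cmod (?\<phi> b)\<close> at \<open>b\<close> forces the
    extreme point found below to be nonzero.\<close>
  define \<epsilon>' where "\<epsilon>' = min \<epsilon> (cmod (?\<phi> b))"
  have "0 < \<epsilon>'" unfolding \<epsilon>'_def using \<epsilon> b by simp
  obtain a \<delta> where a: "a \<in> carrier A" "0 < \<delta>"
    and slice: "\<And>\<xi>. \<xi> \<in> weak_hull coefs \<Longrightarrow> \<exists>c\<in>insert b T. \<epsilon>' \<le> cmod (\<xi> c - ?\<phi> c) \<Longrightarrow> Re (\<xi> a) + \<delta> \<le> Re (?\<phi> a)"
    using extreme_slice[OF ext _ \<open>0 < \<epsilon>'\<close>, of "insert b T"] T(1) by auto
  obtain j \<eta> where j: "j \<in> J" and \<eta>: "\<eta> \<in> unit_coefs A (H j) (\<rho> j)" "cmod (\<eta> a - ?\<phi> a) < \<delta>"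
    using appr[of "{a}" \<delta>] a by auto
  \<comment> \<open>The maximization takes place in the hull of one member only, so that the
    resulting representation is weakly contained in that member.\<close>
  interpret F: op_rep_family A "{j}" H \<rho> M
    by (intro op_rep_family.intro op_rep_family_axioms.intro stalg_axioms) (use fam j in simp)
  have Fc: "F.coefs = unit_coefs A (H j) (\<rho> j)" unfolding F.coefs_def by simp
  then have sub: "weak_hull F.coefs \<subseteq> weak_hull coefs"
    using j unfolding coefs_def by (intro weak_hull_mono) auto
  have \<eta>h: "\<eta> \<in> weak_hull F.coefs" using \<eta> Fc F.coefs_bound a(1) weak_hull_incl by blast
  then obtain \<psi> where \<psi>: "extreme_fun \<psi> (weak_hull F.coefs)"
    "\<forall>\<xi>\<in>weak_hull F.coefs. Re (\<Sum>x\<in>{a}. 1 * \<xi> x) \<le> Re (\<Sum>x\<in>{a}. 1 * \<psi> x)"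
    using extreme_maximizer[OF F.compact_hull closed_weak_hull _
        continuous_fun_Re[of "\<lambda>_. 1" "{a}"] affine_fun_Re] by blast
  have "Re (\<eta> a) \<le> Re (\<psi> a)" using \<psi>(2) \<eta>h by simp
  moreover have "Re (?\<phi> a) - \<delta> < Re (\<eta> a)"
    using \<eta>(2) complex_Re_le_cmod[of "?\<phi> a - \<eta> a"] by (simp add: norm_minus_commute)
  ultimately have "Re (?\<phi> a) < Re (\<psi> a) + \<delta>" by linarith
  moreover have "\<psi> \<in> weak_hull coefs" using \<psi>(1) sub unfolding extreme_fun_def by blast
  ultimately have near: "cmod (\<psi> c - ?\<phi> c) < \<epsilon>'" if "c \<in> insert b T" for c
    using slice[of \<psi>] that by (meson not_le)
  have "\<psi> b \<noteq> 0" using near[of b] unfolding \<epsilon>'_def by auto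
  then interpret E: extreme_state A "{j}" H \<rho> M \<psi>
    by unfold_locales (use \<psi>(1) in auto)
  have "(E.space, E.act) \<in> irreps A" unfolding irreps_def using E.gns_irreducible by simp
  moreover have "cmod (ip V (\<sigma> c v) v - ip E.space (E.act c E.cyc) E.cyc) < \<epsilon>" if "c \<in> T" for c
  proof -
    have "c \<in> carrier A" using that T by blast
    then have "ip E.space (E.act c E.cyc) E.cyc = \<psi> c" "ip V (\<sigma> c v) v = ?\<phi> c"
      using fun_cong[OF E.coef_cyc, of c] by (auto simp: coef_def)
    then show ?thesis using near[of c] that unfolding \<epsilon>'_def by (simp add: norm_minus_commute)
  qed
  moreover have "weakly_contained A E.space E.act (H j) (\<rho> j)"
    unfolding weakly_contained_def using E.gns_weakly_contained by blast
  ultimately show ?thesis using j E.cyc_in by blast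
qed

end

section \<open>Completions\<close>

context prehil
begin

lemma vcauchy_vnorm_bounded:
  assumes "vcauchy V s"
  obtains K where "K > 0" "\<And>n. vnorm V (s n) \<le> K"
proof -
  have c: "s n \<in> carrier V" for n using assms unfolding vcauchy_def by blast
  obtain k where k: "\<And>n. n \<ge> k \<Longrightarrow> vnorm V (s n \<ominus> s k) < 1"
    using assms unfolding vcauchy_def by (metis order_refl zero_less_one)
  define K where "K = (\<Sum>i\<le>k. vnorm V (s i)) + 1"
  have "vnorm V (s n) \<le> K" for n
  proof (cases "n \<le> k")
    case True
    then have "vnorm V (s n) \<le> (\<Sum>i\<le>k. vnorm V (s i))" using c by (intro member_le_sum) auto
    then show ?thesis unfolding K_def by simp
  next
    case False
    moreover have "vnorm V (s k) \<le> (\<Sum>i\<le>k. vnorm V (s i))" using c by (intro member_le_sum) auto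
    ultimately show ?thesis using k[of n] vnorm_diff_le[of "s n" "s k"] c unfolding K_def by fastforce
  qed
  moreover have "0 \<le> (\<Sum>i\<le>k. vnorm V (s i))" using c by (intro sum_nonneg) auto
  then have "0 < K" unfolding K_def by simp
  ultimately show thesis using that by blast
qed

lemma vcauchy_ip_convergent:
  assumes s: "vcauchy V s" and t: "vcauchy V t"
  shows "convergent (\<lambda>n. ip V (s n) (t n))"
proof (rule Cauchy_convergent, rule metric_CauchyI)
  fix e :: real assume e: "e > 0"
  have c: "s n \<in> carrier V" "t n \<in> carrier V" for n using s t unfolding vcauchy_def by blast+
  obtain K where K: "K > 0" "\<And>n. vnorm V (s n) \<le> K" using vcauchy_vnorm_bounded[OF s] by blast
  obtain K' where K': "K' > 0" "\<And>n. vnorm V (t n) \<le> K'" using vcauchy_vnorm_bounded[OF t] by blast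
  have pos: "0 < e / (2 * K')" "0 < e / (2 * K)" using e K K' by auto
  obtain k where k: "\<And>m n. m \<ge> k \<Longrightarrow> n \<ge> k \<Longrightarrow> vnorm V (s m \<ominus> s n) < e / (2 * K')"
    using s pos(1) unfolding vcauchy_def by blast
  obtain k' where k': "\<And>m n. m \<ge> k' \<Longrightarrow> n \<ge> k' \<Longrightarrow> vnorm V (t m \<ominus> t n) < e / (2 * K)"
    using t pos(2) unfolding vcauchy_def by blast
  show "\<exists>k. \<forall>m\<ge>k. \<forall>n\<ge>k. dist (ip V (s m) (t m)) (ip V (s n) (t n)) < e"
  proof (intro exI allI impI)
    fix m n assume mn: "max k k' \<le> m" "max k k' \<le> n"
    have "ip V (s m) (t m) - ip V (s n) (t n) = ip V (s m \<ominus> s n) (t m) + ip V (s n) (t m \<ominus> t n)"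
      using c by simp
    then have "dist (ip V (s m) (t m)) (ip V (s n) (t n))
      \<le> cmod (ip V (s m \<ominus> s n) (t m)) + cmod (ip V (s n) (t m \<ominus> t n))"
      unfolding dist_norm by (metis norm_triangle_ineq)
    also have "\<dots> \<le> vnorm V (s m \<ominus> s n) * vnorm V (t m) + vnorm V (s n) * vnorm V (t m \<ominus> t n)"
      using c by (intro add_mono cauchy_schwarz) auto
    also have "\<dots> \<le> vnorm V (s m \<ominus> s n) * K' + K * vnorm V (t m \<ominus> t n)"
      using c K K' by (intro add_mono mult_left_mono mult_right_mono) auto
    also have "\<dots> < e / (2 * K') * K' + K * (e / (2 * K))"
      using k[of m n] k'[of m n] mn K K' by (intro add_strict_mono mult_strict_left_mono mult_strict_right_mono) auto
    also have "\<dots> = e" using K(1) K'(1) by simp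
    finally show "dist (ip V (s m) (t m)) (ip V (s n) (t n)) < e" .
  qed
qed

lemma cauchy_seqs_iff: "s \<in> cauchy_seqs V \<longleftrightarrow> vcauchy V s"
  unfolding cauchy_seqs_def using MCauchy_iff_vcauchy by simp

lemma cauchy_rel_iff:
  "(s, t) \<in> cauchy_rel V \<longleftrightarrow> vcauchy V s \<and> vcauchy V t \<and> (\<lambda>n. vnorm V (s n \<ominus> t n)) \<longlonglongrightarrow> 0"
proof -
  have "(\<lambda>n. vdist V (s n) (t n)) = (\<lambda>n. vnorm V (s n \<ominus> t n))" if "vcauchy V s" "vcauchy V t"
    using that unfolding vcauchy_def vdist_def by auto
  then show ?thesis unfolding cauchy_rel_def cauchy_seqs_iff by auto
qed

lemma cauchy_rep_class:
  assumes "vcauchy V s"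
  shows "(s, cauchy_rep (cauchy_class V s)) \<in> cauchy_rel V"
proof -
  have "(s, s) \<in> cauchy_rel V"
    unfolding cauchy_rel_iff using assms by (simp add: vcauchy_def a_minus_def M.r_neg)
  then have "s \<in> cauchy_class V s" unfolding cauchy_class_def by blast
  from someI[of "\<lambda>t. t \<in> cauchy_class V s", OF this]
  have "cauchy_rep (cauchy_class V s) \<in> cauchy_class V s" unfolding cauchy_rep_def .
  then show ?thesis unfolding cauchy_class_def by blast
qed

lemma completion_carrierE:
  assumes "P \<in> carrier (completion V)"
  obtains s where "vcauchy V s" "P = cauchy_class V s"
  using assms unfolding completion_def cauchy_class_def quotient_def by (auto simp: cauchy_seqs_iff)

lemma cauchy_class_in: "vcauchy V s \<Longrightarrow> cauchy_class V s \<in> carrier (completion V)"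
  unfolding completion_def cauchy_class_def by (simp add: cauchy_seqs_iff quotientI)

lemma cauchy_rel_ip_limit:
  assumes s: "(s, s') \<in> cauchy_rel V" and t: "vcauchy V t" and l: "(\<lambda>n. ip V (s n) (t n)) \<longlonglongrightarrow> l"
  shows "(\<lambda>n. ip V (s' n) (t n)) \<longlonglongrightarrow> l"
proof -
  have c: "s n \<in> carrier V" "s' n \<in> carrier V" "t n \<in> carrier V" for n
    using s t unfolding cauchy_rel_iff vcauchy_def by blast+
  obtain K where K: "K > 0" "\<And>n. vnorm V (t n) \<le> K" using vcauchy_vnorm_bounded[OF t] by blast
  have "(\<lambda>n. ip V (s n \<ominus> s' n) (t n)) \<longlonglongrightarrow> 0"
  proof (rule Lim_null_comparison)
    show "\<forall>\<^sub>F n in sequentially. norm (ip V (s n \<ominus> s' n) (t n)) \<le> vnorm V (s n \<ominus> s' n) * K"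
    proof (intro always_eventually allI)
      fix n
      have "norm (ip V (s n \<ominus> s' n) (t n)) \<le> vnorm V (s n \<ominus> s' n) * vnorm V (t n)"
        using c by (intro cauchy_schwarz) auto
      also have "\<dots> \<le> vnorm V (s n \<ominus> s' n) * K" using c K by (intro mult_left_mono) auto
      finally show "norm (ip V (s n \<ominus> s' n) (t n)) \<le> vnorm V (s n \<ominus> s' n) * K" .
    qed
    show "(\<lambda>n. vnorm V (s n \<ominus> s' n) * K) \<longlonglongrightarrow> 0"
      using s unfolding cauchy_rel_iff by (intro tendsto_mult_left_zero) auto
  qed
  from tendsto_diff[OF l this] show ?thesis using c by simp
qed

lemma vcauchy_map:
  assumes s: "vcauchy V s" and f: "linear_map V V f" "bounded_map V V f"
  shows "vcauchy V (\<lambda>n. f (s n))"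
  unfolding vcauchy_def
proof (intro conjI allI impI)
  have c: "s n \<in> carrier V" for n using s unfolding vcauchy_def by blast
  then show "f (s n) \<in> carrier V" for n using linear_map_props(1)[OF f(1)] by blast
  obtain k where k: "\<And>u. u \<in> carrier V \<Longrightarrow> vnorm V (f u) \<le> k * vnorm V u"
    using f(2) unfolding bounded_map_def by auto
  fix e :: real assume e: "e > 0"
  then have "e/(\<bar>k\<bar> + 1) > 0" by (simp add: add_nonneg_pos)
  then obtain N where N: "\<And>m n. m \<ge> N \<Longrightarrow> n \<ge> N \<Longrightarrow> vnorm V (s m \<ominus> s n) < e/(\<bar>k\<bar> + 1)"
    using s unfolding vcauchy_def by blast
  show "\<exists>N. \<forall>m\<ge>N. \<forall>n\<ge>N. vnorm V (f (s m) \<ominus> f (s n)) < e"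
  proof (intro exI allI impI)
    fix m n assume mn: "N \<le> m" "N \<le> n"
    have "vnorm V (f (s m) \<ominus> f (s n)) \<le> k * vnorm V (s m \<ominus> s n)"
      using k[of "s m \<ominus> s n"] linear_map_props(4)[OF f(1) c c] c by simp
    also have "\<dots> \<le> \<bar>k\<bar> * (e/(\<bar>k\<bar> + 1))" using N[OF mn] c by (intro mult_mono) auto
    also have "\<dots> < e" using e by (intro mult_divide_add_one_less) auto
    finally show "vnorm V (f (s m) \<ominus> f (s n)) < e" .
  qed
qed

lemma vcauchy_rep:
  assumes "P \<in> carrier (completion V)"
  shows "vcauchy V (cauchy_rep P)"
  using assms cauchy_rep_class unfolding cauchy_rel_iff by (elim completion_carrierE) blast

lemma completion_ip:
  assumes P: "P \<in> carrier (completion V)" and Q: "Q \<in> carrier (completion V)"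
  shows "(\<lambda>n. ip V (cauchy_rep P n) (cauchy_rep Q n)) \<longlonglongrightarrow> ip (completion V) P Q"
proof -
  have "convergent (\<lambda>n. ip V (cauchy_rep P n) (cauchy_rep Q n))"
    by (intro vcauchy_ip_convergent vcauchy_rep P Q)
  then show ?thesis unfolding completion_def by (simp add: convergent_LIMSEQ_iff)
qed

lemma completion_vnorm:
  assumes P: "P \<in> carrier (completion V)"
  shows "(\<lambda>n. vnorm V (cauchy_rep P n)) \<longlonglongrightarrow> vnorm (completion V) P"
  unfolding vnorm_def by (intro tendsto_real_sqrt tendsto_Re completion_ip P)

text \<open>The class of the image sequence comes with a representative of its own, which differs
  from the image sequence by a null sequence; pairing with a bounded sequence does not see the
  difference.\<close>

lemma completion_op_ip:
  assumes P: "P \<in> carrier (completion V)" and f: "linear_map V V f" "bounded_map V V f"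
  shows "(\<lambda>n. ip V (f (cauchy_rep P n)) (cauchy_rep P n)) \<longlonglongrightarrow> ip (completion V) (completion_op V f P) P"
proof -
  define r where "r = cauchy_rep P"
  have r: "vcauchy V r" unfolding r_def by (rule vcauchy_rep[OF P])
  have fr: "vcauchy V (\<lambda>n. f (r n))" by (rule vcauchy_map[OF r f])
  define Q where "Q = completion_op V f P"
  have Q: "Q = cauchy_class V (\<lambda>n. f (r n))" unfolding Q_def completion_op_def r_def ..
  have rel: "(\<lambda>n. f (r n), cauchy_rep Q) \<in> cauchy_rel V" unfolding Q by (rule cauchy_rep_class[OF fr])
  obtain l where l: "(\<lambda>n. ip V (f (r n)) (r n)) \<longlonglongrightarrow> l"
    using vcauchy_ip_convergent[OF fr r] unfolding convergent_def by blast
  have "(\<lambda>n. ip V (cauchy_rep Q n) (r n)) \<longlonglongrightarrow> l" by (rule cauchy_rel_ip_limit[OF rel r l])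
  moreover have "(\<lambda>n. ip V (cauchy_rep Q n) (r n)) \<longlonglongrightarrow> ip (completion V) Q P"
    unfolding r_def by (rule completion_ip) (use P Q cauchy_class_in[OF fr] in auto)
  ultimately have "l = ip (completion V) Q P" by (rule LIMSEQ_unique)
  then show ?thesis using l unfolding r_def Q_def by simp
qed

lemma completion_const:
  assumes w: "w \<in> carrier V"
  defines "P \<equiv> cauchy_class V (\<lambda>_. w)"
  shows "P \<in> carrier (completion V)" "vnorm (completion V) P = vnorm V w"
    "linear_map V V f \<Longrightarrow> bounded_map V V f \<Longrightarrow> ip (completion V) (completion_op V f P) P = ip V (f w) w"
proof -
  have cw: "vcauchy V (\<lambda>_. w)" unfolding vcauchy_def using w by (simp add: a_minus_def M.r_neg)
  show P: "P \<in> carrier (completion V)" unfolding P_def by (rule cauchy_class_in[OF cw])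
  \<comment> \<open>The representative chosen in the class of a constant sequence need not be
    constant, but it converges to \<open>w\<close>.\<close>
  have conv: "vconv V (cauchy_rep P) w"
  proof -
    have rel: "(\<lambda>_. w, cauchy_rep P) \<in> cauchy_rel V" unfolding P_def by (rule cauchy_rep_class[OF cw])
    then have c: "cauchy_rep P n \<in> carrier V" for n unfolding cauchy_rel_iff vcauchy_def by blast
    then have "vnorm V (cauchy_rep P n \<ominus> w) = vnorm V (w \<ominus> cauchy_rep P n)" for n
      using vnorm_minus_commute w by blast
    then show ?thesis unfolding vconv_def using rel c w unfolding cauchy_rel_iff by simp
  qed
  show "vnorm (completion V) P = vnorm V w"
    using LIMSEQ_unique[OF completion_vnorm[OF P] vconv_vnorm[OF conv]] .
  show "ip (completion V) (completion_op V f P) P = ip V (f w) w"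
    if f: "linear_map V V f" "bounded_map V V f"
    using LIMSEQ_unique[OF completion_op_ip[OF P f] vconv_ip[OF vconv_map[OF conv f] conv]] .
qed

end

lemma (in op_rep) weakly_contained_completion:
  assumes wc: "weakly_contained A V' \<sigma> H \<rho>"
  shows "weakly_contained A V' \<sigma> (completion H) (\<lambda>a. completion_op H (\<rho> a))"
  unfolding weakly_contained_def
proof (intro allI impI)
  fix v S and \<epsilon> :: real assume a: "v \<in> carrier V' \<and> vnorm V' v = 1 \<and> 0 < \<epsilon> \<and> finite S \<and> S \<subseteq> carrier A"
  then obtain w where w: "w \<in> carrier H" "vnorm H w = 1"
    "\<And>a. a \<in> S \<Longrightarrow> cmod (ip V' (\<sigma> a v) v - ip H (\<rho> a w) w) < \<epsilon>"
    using wc[unfolded weakly_contained_def, rule_format, OF a] by blast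
  note cc = completion_const[OF w(1)]
  show "\<exists>v'\<in>carrier (completion H). vnorm (completion H) v' = 1 \<and>
     (\<forall>a\<in>S. cmod (ip V' (\<sigma> a v) v - ip (completion H) (completion_op H (\<rho> a) v') v') < \<epsilon>)"
  proof (intro bexI[OF _ cc(1)] conjI ballI)
    show "vnorm (completion H) (cauchy_class H (\<lambda>_. w)) = 1" using cc(2) w(2) by simp
    fix b assume b: "b \<in> S"
    then have "b \<in> carrier A" using a by blast
    then show "cmod (ip V' (\<sigma> b v) v - ip (completion H)
      (completion_op H (\<rho> b) (cauchy_class H (\<lambda>_. w))) (cauchy_class H (\<lambda>_. w))) < \<epsilon>"
      using cc(3)[OF rep_linear rep_bounded] w(3)[OF b] by simp
  qed
qed

text \<open>Coefficients depend continuously on the vector, so weak containment can be tested on a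
  dense subspace. This permits working in \<open>F X\<close> itself, where vectors have finite
  support in the ambient elementary functor.\<close>

lemma (in op_rep) weakly_contained_completionD:
  assumes wc: "weakly_contained A V' \<sigma> (completion H) (\<lambda>a. completion_op H (\<rho> a))"
  shows "weakly_contained A V' \<sigma> H \<rho>"
  unfolding weakly_contained_def
proof (intro allI impI)
  fix v S and \<epsilon> :: real assume a: "v \<in> carrier V' \<and> vnorm V' v = 1 \<and> 0 < \<epsilon> \<and> finite S \<and> S \<subseteq> carrier A"
  then have half: "v \<in> carrier V' \<and> vnorm V' v = 1 \<and> 0 < \<epsilon>/2 \<and> finite S \<and> S \<subseteq> carrier A" by simp
  obtain P where P: "P \<in> carrier (completion H)" "vnorm (completion H) P = 1"
    "\<And>a. a \<in> S \<Longrightarrow> cmod (ip V' (\<sigma> a v) v - ip (completion H) (completion_op H (\<rho> a) P) P) < \<epsilon>/2"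
    using wc[unfolded weakly_contained_def, rule_format, OF half] by blast
  \<comment> \<open>A family with a single member, to make the normalization of
    \<open>unit_approx\<close> available.\<close>
  interpret F: op_rep_family A "{()}" "\<lambda>_. H" "\<lambda>_. \<rho>" M
    by (intro op_rep_family.intro op_rep_family_axioms.intro stalg_axioms) (rule op_rep_axioms)
  have "\<exists>i\<in>{()}. \<exists>w\<in>carrier H. vnorm H w = 1 \<and>
      (\<forall>a\<in>S. cmod (ip (completion H) (completion_op H (\<rho> a) P) P - ip H (\<rho> a w) w) < \<epsilon>/2)"
  proof (rule F.unit_approx[where y = "cauchy_rep P" and j = "\<lambda>_. ()"])
    show "cauchy_rep P n \<in> carrier H" for n using vcauchy_rep[OF P(1)] unfolding vcauchy_def by blast
    show "(\<lambda>n. vnorm H (cauchy_rep P n)) \<longlonglongrightarrow> 1" using completion_vnorm[OF P(1)] P(2) by simp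
    show "(\<lambda>n. ip H (\<rho> a (cauchy_rep P n)) (cauchy_rep P n)) \<longlonglongrightarrow>
        ip (completion H) (completion_op H (\<rho> a) P) P" if "a \<in> S" for a
      using that a by (intro completion_op_ip[OF P(1)] rep_linear rep_bounded) auto
  qed (use a in auto)
  then obtain w where w: "w \<in> carrier H" "vnorm H w = 1"
    "\<And>a. a \<in> S \<Longrightarrow> cmod (ip (completion H) (completion_op H (\<rho> a) P) P - ip H (\<rho> a w) w) < \<epsilon>/2" by blast
  have "cmod (ip V' (\<sigma> a v) v - ip H (\<rho> a w) w) < \<epsilon>" if "a \<in> S" for a
    using norm_triangle_lt[OF add_strict_mono[OF P(3)[OF that] w(3)[OF that]]] by simp
  then show "\<exists>w\<in>carrier H. vnorm H w = 1 \<and> (\<forall>a\<in>S. cmod (ip V' (\<sigma> a v) v - ip H (\<rho> a w) w) < \<epsilon>)"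
    using w by blast
qed

section \<open>Closures in the unitary dual\<close>

lemma (in stalg) rep_iso_refl: "(V, \<sigma>) \<in> irreps A \<Longrightarrow> (V, \<sigma>) \<in> rep_class A (V, \<sigma>)"
  unfolding rep_class_def rep_iso_def unitary_map_def linear_map_def
  by (auto intro!: exI[of _ "\<lambda>x. x"] bij_betwI[where g = "\<lambda>x. x"])

text \<open>
  Since every nonzero vector \<open>v\<close> of an irreducible representation is cyclic, the coefficients of
  finitely many vectors are controlled by those of \<open>v\<close>.
\<close>

lemma (in stalg) dual_open_nbhd:
  assumes V: "(V, \<sigma>) \<in> irreps A" and O: "openin (dual_topology A) W" "rep_class A (V, \<sigma>) \<in> W"
  shows "\<exists>Y T \<epsilon>. finite Y \<and> Y \<subseteq> carrier V \<and> finite T \<and> T \<subseteq> carrier A \<and> 0 < \<epsilon> \<and>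
    (\<forall>U \<tau>. (U, \<tau>) \<in> irreps A \<longrightarrow> (\<forall>y\<in>Y. \<exists>u\<in>carrier U. \<forall>a\<in>T. cmod (ip V (\<sigma> a y) y - ip U (\<tau> a u) u) < \<epsilon>)
       \<longrightarrow> rep_class A (U, \<tau>) \<in> W)" (is "?P W")
proof -
  let ?B = "{dual_nbhd A V \<rho> v \<epsilon> S | V \<rho> v \<epsilon> S.
     (V, \<rho>) \<in> irreps A \<and> v \<in> carrier V \<and> vnorm V v = 1 \<and> 0 < \<epsilon> \<and> finite S \<and> S \<subseteq> carrier A}"
  have "generate_topology_on ?B W"
    using O(1) unfolding dual_topology_def openin_topology_generated_by_iff .
  then show ?thesis
    using O(2)
  proof (induction W)
    case Empty
    then show ?case by simp
  next
    case (Int W1 W2)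
    obtain Y1 T1 \<epsilon>1 where 1: "finite Y1" "Y1 \<subseteq> carrier V" "finite T1" "T1 \<subseteq> carrier A" "0 < \<epsilon>1"
      "\<forall>U \<tau>. (U, \<tau>) \<in> irreps A \<longrightarrow> (\<forall>y\<in>Y1. \<exists>u\<in>carrier U. \<forall>a\<in>T1. cmod (ip V (\<sigma> a y) y - ip U (\<tau> a u) u) < \<epsilon>1)
       \<longrightarrow> rep_class A (U, \<tau>) \<in> W1" using Int.IH(1) Int.prems by blast
    obtain Y2 T2 \<epsilon>2 where 2: "finite Y2" "Y2 \<subseteq> carrier V" "finite T2" "T2 \<subseteq> carrier A" "0 < \<epsilon>2"
      "\<forall>U \<tau>. (U, \<tau>) \<in> irreps A \<longrightarrow> (\<forall>y\<in>Y2. \<exists>u\<in>carrier U. \<forall>a\<in>T2. cmod (ip V (\<sigma> a y) y - ip U (\<tau> a u) u) < \<epsilon>2)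
       \<longrightarrow> rep_class A (U, \<tau>) \<in> W2" using Int.IH(2) Int.prems by blast
    show ?case
    proof (intro exI[of _ "Y1 \<union> Y2"] exI[of _ "T1 \<union> T2"] exI[of _ "min \<epsilon>1 \<epsilon>2"] conjI allI impI)
      fix U \<tau> assume X: "(U, \<tau>) \<in> irreps A"
      assume *: "\<forall>y\<in>Y1 \<union> Y2. \<exists>u\<in>carrier U. \<forall>a\<in>T1 \<union> T2. cmod (ip V (\<sigma> a y) y - ip U (\<tau> a u) u) < min \<epsilon>1 \<epsilon>2"
      show "rep_class A (U, \<tau>) \<in> W1 \<inter> W2"
      proof
        have "\<exists>u\<in>carrier U. \<forall>a\<in>T1. cmod (ip V (\<sigma> a y) y - ip U (\<tau> a u) u) < \<epsilon>1" if y: "y \<in> Y1" for y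
        proof -
          obtain u where "u \<in> carrier U" "\<forall>a\<in>T1 \<union> T2. cmod (ip V (\<sigma> a y) y - ip U (\<tau> a u) u) < min \<epsilon>1 \<epsilon>2"
            using * y by blast
          then show ?thesis by (intro bexI[of _ u]) auto
        qed
        then show "rep_class A (U, \<tau>) \<in> W1" using X 1(6) by blast
        have "\<exists>u\<in>carrier U. \<forall>a\<in>T2. cmod (ip V (\<sigma> a y) y - ip U (\<tau> a u) u) < \<epsilon>2" if y: "y \<in> Y2" for y
        proof -
          obtain u where "u \<in> carrier U" "\<forall>a\<in>T1 \<union> T2. cmod (ip V (\<sigma> a y) y - ip U (\<tau> a u) u) < min \<epsilon>1 \<epsilon>2"
            using * y by blast
          then show ?thesis by (intro bexI[of _ u]) auto
        qed
        then show "rep_class A (U, \<tau>) \<in> W2" using X 2(6) by blast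
      qed
    qed (use 1 2 in auto)
  next
    case (UN K)
    then obtain k where k: "k \<in> K" "rep_class A (V, \<sigma>) \<in> k" by blast
    from UN.IH[OF k] obtain Y T \<epsilon> where *: "finite Y" "Y \<subseteq> carrier V" "finite T" "T \<subseteq> carrier A" "0 < \<epsilon>"
      "\<forall>U \<tau>. (U, \<tau>) \<in> irreps A \<longrightarrow> (\<forall>y\<in>Y. \<exists>u\<in>carrier U. \<forall>a\<in>T. cmod (ip V (\<sigma> a y) y - ip U (\<tau> a u) u) < \<epsilon>)
       \<longrightarrow> rep_class A (U, \<tau>) \<in> k" by blast
    show ?case
      by (intro exI[of _ Y] exI[of _ T] exI[of _ \<epsilon>] conjI) (use * k(1) in \<open>blast+\<close>)
  next
    case (Basis W)
    then obtain V' \<rho>' v' \<epsilon>' S' where W: "W = dual_nbhd A V' \<rho>' v' \<epsilon>' S'" "0 < \<epsilon>'" "finite S'" "S' \<subseteq> carrier A"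
      by blast
    from Basis.prems obtain U0 \<tau>0 u0 where U0: "rep_class A (V, \<sigma>) = rep_class A (U0, \<tau>0)"
      "(U0, \<tau>0) \<in> irreps A" "u0 \<in> carrier U0"
      "\<And>a. a \<in> S' \<Longrightarrow> cmod (ip V' (\<rho>' a v') v' - ip U0 (\<tau>0 a u0) u0) < \<epsilon>'"
      unfolding W(1) dual_nbhd_def by blast
    \<comment> \<open>The subbasic set is centred at some other representation, and its witness
      \<open>U0\<close> is only isomorphic to \<open>V\<close>; the vector \<open>u0\<close> is
      carried to \<open>V\<close> by the isomorphism.\<close>
    have "(V, \<sigma>) \<in> rep_class A (U0, \<tau>0)" using rep_iso_refl[OF V] U0(1) by simp
    then obtain f where f: "unitary_map U0 V f"
      "\<And>a v. a \<in> carrier A \<Longrightarrow> v \<in> carrier U0 \<Longrightarrow> f (\<tau>0 a v) = \<sigma> a (f v)"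
      unfolding rep_class_def rep_iso_def by auto
    interpret U0: irrep A U0 \<tau>0
      by unfold_locales (use U0(2) in \<open>simp add: irreps_def\<close>)
    have fu: "f u0 \<in> carrier V" using f(1) U0(3) unfolding unitary_map_def linear_map_def by blast
    have coef: "ip V (\<sigma> a (f u0)) (f u0) = ip U0 (\<tau>0 a u0) u0" if "a \<in> S'" for a
    proof -
      have a: "a \<in> carrier A" using that W(4) by blast
      have "ip V (f (\<tau>0 a u0)) (f u0) = ip U0 (\<tau>0 a u0) u0"
        using f(1) U0(3) U0.rep_in[OF a U0(3)] unfolding unitary_map_def by blast
      then show ?thesis using f(2)[OF a U0(3)] by simp
    qed
    \<comment> \<open>The least slack in the strict inequalities satisfied by \<open>u0\<close>; the
      inserted 1 covers an empty \<open>S'\<close>.\<close>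
    define \<epsilon> where "\<epsilon> = Min (insert 1 ((\<lambda>a. \<epsilon>' - cmod (ip V' (\<rho>' a v') v' - ip U0 (\<tau>0 a u0) u0)) ` S'))"
    have \<epsilon>: "0 < \<epsilon>" unfolding \<epsilon>_def using W(3) U0(4) by (subst Min_gr_iff) auto
    have \<epsilon>_le: "\<epsilon> \<le> \<epsilon>' - cmod (ip V' (\<rho>' a v') v' - ip U0 (\<tau>0 a u0) u0)" if "a \<in> S'" for a
      unfolding \<epsilon>_def using W(3) that by (intro Min_le) auto
    show ?case
    proof (intro exI[of _ "{f u0}"] exI[of _ S'] exI[of _ \<epsilon>] conjI allI impI)
      fix U \<tau> assume X: "(U, \<tau>) \<in> irreps A"
        assume "\<forall>y\<in>{f u0}. \<exists>u\<in>carrier U. \<forall>a\<in>S'. cmod (ip V (\<sigma> a y) y - ip U (\<tau> a u) u) < \<epsilon>"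
        then obtain u where u: "u \<in> carrier U"
          "\<And>a. a \<in> S' \<Longrightarrow> cmod (ip U0 (\<tau>0 a u0) u0 - ip U (\<tau> a u) u) < \<epsilon>" using coef by auto
        have "cmod (ip V' (\<rho>' a v') v' - ip U (\<tau> a u) u) < \<epsilon>'" if a: "a \<in> S'" for a
        proof -
          have "cmod (ip V' (\<rho>' a v') v' - ip U (\<tau> a u) u) \<le>
            cmod (ip V' (\<rho>' a v') v' - ip U0 (\<tau>0 a u0) u0) + cmod (ip U0 (\<tau>0 a u0) u0 - ip U (\<tau> a u) u)"
            using norm_triangle_ineq[of "ip V' (\<rho>' a v') v' - ip U0 (\<tau>0 a u0) u0"
              "ip U0 (\<tau>0 a u0) u0 - ip U (\<tau> a u) u"] by simp
          then show ?thesis using u(2)[OF a] \<epsilon>_le[OF a] by linarith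
        qed
        then show "rep_class A (U, \<tau>) \<in> W"
          unfolding W(1) dual_nbhd_def using u(1) X by blast
    qed (use fu W \<epsilon> in auto)
  qed
qed

text \<open>The sets \<open>dual_nbhd\<close> form only a subbasis, so a neighbourhood may restrict
  several vectors. Each of them is nearly \<open>\<sigma> b v\<close> for one fixed unit vector
  \<open>v\<close>, and its coefficient at \<open>a\<close> is nearly that of \<open>v\<close> at
  b*ab; one approximation of \<open>v\<close> thus meets all restrictions, with
  \<open>\<tau> b u\<close> as the vectors in \<open>U\<close>.\<close>

theorem (in stalg) dual_closure_criterion:
  assumes V: "(V, \<sigma>) \<in> irreps A"
    and approx: "\<And>v T \<epsilon>. v \<in> carrier V \<Longrightarrow> vnorm V v = 1 \<Longrightarrow> finite T \<Longrightarrow> T \<subseteq> carrier A \<Longrightarrow> 0 < \<epsilon> \<Longrightarrow>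
      \<exists>(U, \<tau>)\<in>irreps A. rep_class A (U, \<tau>) \<in> S \<and>
        (\<exists>u\<in>carrier U. \<forall>a\<in>T. cmod (ip V (\<sigma> a v) v - ip U (\<tau> a u) u) < \<epsilon>)"
  shows "rep_class A (V, \<sigma>) \<in> dual_topology A closure_of S"
  unfolding in_closure_of
proof (intro conjI allI impI)
  interpret V: irrep A V \<sigma>
    by unfold_locales (use V in \<open>simp add: irreps_def\<close>)
  obtain w where w: "w \<in> carrier V" "w \<noteq> \<zero>\<^bsub>V\<^esub>" using V.nonzero by auto
  define v where "v = of_real (1 / vnorm V w) \<odot>\<^bsub>V\<^esub> w"
  have "vnorm V w > 0" using w V.vnorm_eq_0[of w] V.vnorm_nonneg[of w] by linarith
  then have v: "v \<in> carrier V" "vnorm V v = 1"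
    unfolding v_def using w by (auto simp: V.vnorm_smult norm_divide)
  then have v0: "v \<noteq> \<zero>\<^bsub>V\<^esub>" using V.vnorm_zero by auto
  \<comment> \<open>An empty set of tests gives a subbasic set containing every class, which shows
    that the class is a point of the space.\<close>
  have "rep_class A (V, \<sigma>) \<in> dual_nbhd A V \<sigma> v 1 {}"
    unfolding dual_nbhd_def using V v(1) by blast
  moreover have "openin (dual_topology A) (dual_nbhd A V \<sigma> v 1 {})"
    unfolding dual_topology_def openin_topology_generated_by_iff
    by (rule generate_topology_on.Basis) (use V v in \<open>fastforce\<close>)
  ultimately show "rep_class A (V, \<sigma>) \<in> topspace (dual_topology A)"
    using openin_subset by blast
  fix W assume W: "rep_class A (V, \<sigma>) \<in> W \<and> openin (dual_topology A) W"
  obtain Y T \<epsilon> where Y: "finite Y" "Y \<subseteq> carrier V" and T: "finite T" "T \<subseteq> carrier A" and \<epsilon>: "0 < \<epsilon>"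
    and W': "\<forall>U \<tau>. (U, \<tau>) \<in> irreps A \<longrightarrow> (\<forall>y\<in>Y. \<exists>u\<in>carrier U. \<forall>a\<in>T. cmod (ip V (\<sigma> a y) y - ip U (\<tau> a u) u) < \<epsilon>)
       \<longrightarrow> rep_class A (U, \<tau>) \<in> W"
    using dual_open_nbhd[OF V, of W] W by blast
  have "\<exists>b\<in>carrier A. \<forall>a\<in>T. cmod (ip V (\<sigma> a y) y - ip V (\<sigma> a (\<sigma> b v)) (\<sigma> b v)) < \<epsilon>/2" if y: "y \<in> Y" for y
  proof -
    obtain s where s: "\<And>n. s n \<in> carrier A" "vconv V (\<lambda>n. \<sigma> (s n) v) y"
      using V.cyclic[OF v(1) v0, of y] y Y by blast
    have "\<forall>\<^sub>F n in sequentially. cmod (ip V (\<sigma> a y) y - ip V (\<sigma> a (\<sigma> (s n) v)) (\<sigma> (s n) v)) < \<epsilon>/2"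
      if a: "a \<in> T" for a
    proof -
      have a: "a \<in> carrier A" using a T by blast
      have "(\<lambda>n. cmod (ip V (\<sigma> a y) y - ip V (\<sigma> a (\<sigma> (s n) v)) (\<sigma> (s n) v))) \<longlonglongrightarrow> cmod (ip V (\<sigma> a y) y - ip V (\<sigma> a y) y)"
        by (intro tendsto_norm tendsto_diff tendsto_const
            V.vconv_ip[OF V.vconv_map[OF s(2) V.rep_linear[OF a] V.rep_bounded[OF a]] s(2)])
      then show ?thesis using \<epsilon> by (intro order_tendstoD(2)) auto
    qed
    then have "\<forall>\<^sub>F n in sequentially. \<forall>a\<in>T. cmod (ip V (\<sigma> a y) y - ip V (\<sigma> a (\<sigma> (s n) v)) (\<sigma> (s n) v)) < \<epsilon>/2"
      using T(1) by (simp add: eventually_ball_finite)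
    then obtain n where "\<forall>a\<in>T. cmod (ip V (\<sigma> a y) y - ip V (\<sigma> a (\<sigma> (s n) v)) (\<sigma> (s n) v)) < \<epsilon>/2"
      using eventually_happens'[OF sequentially_bot] by blast
    then show ?thesis using s(1) by blast
  qed
  then obtain b where b: "\<And>y. y \<in> Y \<Longrightarrow> b y \<in> carrier A"
    "\<And>y a. y \<in> Y \<Longrightarrow> a \<in> T \<Longrightarrow> cmod (ip V (\<sigma> a y) y - ip V (\<sigma> a (\<sigma> (b y) v)) (\<sigma> (b y) v)) < \<epsilon>/2"
    by metis
  let ?T = "(\<lambda>(y, a). star A (b y) \<otimes> (a \<otimes> b y)) ` (Y \<times> T)"
  have "finite ?T" "?T \<subseteq> carrier A" "0 < \<epsilon>/2" using Y T b(1) \<epsilon> by auto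
  from approx[OF v this] obtain U \<tau> u where U: "(U, \<tau>) \<in> irreps A" "rep_class A (U, \<tau>) \<in> S"
    and u: "u \<in> carrier U" "\<And>c. c \<in> ?T \<Longrightarrow> cmod (ip V (\<sigma> c v) v - ip U (\<tau> c u) u) < \<epsilon>/2" by blast
  interpret U: irrep A U \<tau>
    by unfold_locales (use U(1) in \<open>simp add: irreps_def\<close>)
  have "\<exists>u\<in>carrier U. \<forall>a\<in>T. cmod (ip V (\<sigma> a y) y - ip U (\<tau> a u) u) < \<epsilon>" if y: "y \<in> Y" for y
  proof (intro bexI[of _ "\<tau> (b y) u"] ballI)
    fix a assume a: "a \<in> T"
    have ac: "a \<in> carrier A" using a T by blast
    let ?c = "star A (b y) \<otimes> (a \<otimes> b y)"
    have "?c \<in> ?T" using y a by (intro image_eqI[of _ _ "(y, a)"]) auto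
    from u(2)[OF this] have "cmod (ip V (\<sigma> ?c v) v - ip U (\<tau> ?c u) u) < \<epsilon>/2" .
    moreover have "ip V (\<sigma> ?c v) v = ip V (\<sigma> a (\<sigma> (b y) v)) (\<sigma> (b y) v)"
      using b(1)[OF y] ac v(1) by (simp add: V.rep_mult V.rep_adj)
    moreover have "ip U (\<tau> ?c u) u = ip U (\<tau> a (\<tau> (b y) u)) (\<tau> (b y) u)"
      using b(1)[OF y] ac u(1) by (simp add: U.rep_mult U.rep_adj)
    ultimately have "cmod (ip V (\<sigma> a (\<sigma> (b y) v)) (\<sigma> (b y) v) - ip U (\<tau> a (\<tau> (b y) u)) (\<tau> (b y) u)) < \<epsilon>/2"
      by simp
    from norm_diff_triangle_less[OF b(2)[OF y a] this]
    show "cmod (ip V (\<sigma> a y) y - ip U (\<tau> a (\<tau> (b y) u)) (\<tau> (b y) u)) < \<epsilon>" by simp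
  qed (use b(1)[OF y] u(1) in auto)
  then have "rep_class A (U, \<tau>) \<in> W" using W' U(1) by blast
  then show "\<exists>y. y \<in> S \<and> y \<in> W" using U(2) by blast
qed

section \<open>Simplicial complexes with a group action\<close>

locale simplicial =
  fixes X :: "'c rel"
  assumes complex: "simplicial_complex X"
begin

lemma Partial_order: "Partial_order X"
  using complex unfolding simplicial_complex_def simplicial_poset_def by blast

lemma cell_refl: "x \<in> Field X \<Longrightarrow> (x, x) \<in> X"
  using Partial_order unfolding partial_order_on_def preorder_on_def refl_on_def by blast

lemma cell_trans: "(x, y) \<in> X \<Longrightarrow> (y, z) \<in> X \<Longrightarrow> (x, z) \<in> X"
  using Partial_order unfolding partial_order_on_def preorder_on_def trans_def by blast

lemma cell_antisym: "(x, y) \<in> X \<Longrightarrow> (y, x) \<in> X \<Longrightarrow> x = y"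
  using Partial_order unfolding partial_order_on_def antisym_def by blast

lemma connected: "vertices X \<noteq> {}" "v \<in> vertices X \<Longrightarrow> w \<in> vertices X \<Longrightarrow> \<exists>ys. cell_chain X v w ys"
  using complex unfolding simplicial_complex_def connected_complex_def by blast+

lemma finite_star: "v \<in> vertices X \<Longrightarrow> finite {x. (v, x) \<in> X}"
  using complex unfolding simplicial_complex_def locally_finite_complex_def by blast

lemma set_model:
  obtains K :: "'c set set" and f where "is_set_complex K" "bij_betw f (Field X) K"
    "\<And>x y. x \<in> Field X \<Longrightarrow> y \<in> Field X \<Longrightarrow> (x, y) \<in> X \<longleftrightarrow> f x \<subseteq> f y"
  using complex unfolding simplicial_complex_def simplicial_poset_def by blast

lemma vertexD: "v \<in> vertices X \<Longrightarrow> v \<in> Field X" "v \<in> vertices X \<Longrightarrow> \<not> empty_cell X v"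
  unfolding vertices_def by blast+

lemma finite_faces: "x \<in> Field X \<Longrightarrow> finite {y. (y, x) \<in> X}"
proof -
  assume x: "x \<in> Field X"
  obtain K :: "'c set set" and f where K: "is_set_complex K" "bij_betw f (Field X) K"
    "\<And>x y. x \<in> Field X \<Longrightarrow> y \<in> Field X \<Longrightarrow> (x, y) \<in> X \<longleftrightarrow> f x \<subseteq> f y"
    using set_model by blast
  have sub: "{y. (y, x) \<in> X} \<subseteq> Field X" by (auto simp: Field_def)
  have "f ` {y. (y, x) \<in> X} \<subseteq> Pow (f x)"
  proof
    fix z assume "z \<in> f ` {y. (y, x) \<in> X}"
    then obtain y where "(y, x) \<in> X" "z = f y" by blast
    moreover from this have "y \<in> Field X" using sub by blast
    ultimately show "z \<in> Pow (f x)" using K(3) x by blast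
  qed
  moreover have "finite (f x)" using K x unfolding is_set_complex_def bij_betw_def by blast
  ultimately have "finite (f ` {y. (y, x) \<in> X})" by (simp add: finite_subset)
  moreover have "inj_on f {y. (y, x) \<in> X}" using K(2) sub unfolding bij_betw_def using inj_on_subset by blast
  ultimately show ?thesis using finite_imageD by blast
qed

lemma finite_vertices_of: "x \<in> Field X \<Longrightarrow> finite (vertices_of X x)"
  using finite_faces[of x] unfolding vertices_of_def by (rule rev_finite_subset) auto

text \<open>In the set model a nonempty cell contains a point, and the cell modelled by the
  singleton of that point is a vertex.\<close>

lemma vertex_exists:
  assumes x: "x \<in> Field X" "\<not> empty_cell X x"
  shows "vertices_of X x \<noteq> {}"
proof -
  obtain K :: "'c set set" and f where K: "is_set_complex K" "bij_betw f (Field X) K"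
    "\<And>x y. x \<in> Field X \<Longrightarrow> y \<in> Field X \<Longrightarrow> (x, y) \<in> X \<longleftrightarrow> f x \<subseteq> f y"
    using set_model by blast
  have f: "f ` Field X = K" "inj_on f (Field X)" using K(2) unfolding bij_betw_def by auto
  have "f x \<noteq> {}" using x K(3) unfolding empty_cell_def by auto
  then obtain p where p: "p \<in> f x" by blast
  have sub: "\<And>z. z \<subseteq> f x \<Longrightarrow> z \<in> K" using K(1) x(1) f(1) unfolding is_set_complex_def by blast
  obtain v where v: "v \<in> Field X" "f v = {p}" using sub[of "{p}"] p f(1) by (metis empty_subsetI imageE insert_subset)
  obtain o' where o: "o' \<in> Field X" "f o' = {}" using sub[of "{}"] f(1) by (metis empty_subsetI imageE)
  have "\<not> empty_cell X v" using K(3)[OF v(1) o(1)] v(2) o unfolding empty_cell_def by auto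
  moreover have "u = v \<or> empty_cell X u" if u: "(u, v) \<in> X" for u
  proof -
    have uF: "u \<in> Field X" using u by (auto simp: Field_def)
    have "f u \<subseteq> {p}" using K(3)[OF uF v(1)] u v(2) by simp
    then consider "f u = {p}" | "f u = {}" by blast
    then show ?thesis
    proof cases
      case 1
      then show ?thesis using f(2) uF v unfolding inj_on_def by metis
    next
      case 2
      then have "(u, y) \<in> X" if "y \<in> Field X" for y using K(3)[OF uF that] by simp
      then show ?thesis using uF unfolding empty_cell_def by blast
    qed
  qed
  ultimately have "v \<in> vertices X" using v(1) unfolding vertices_def by blast
  moreover have "(v, x) \<in> X" using K(3)[OF v(1) x(1)] v(2) p by simp
  ultimately show ?thesis unfolding vertices_of_def by blast
qed

lemma empty_cell_unique: "empty_cell X x \<Longrightarrow> empty_cell X y \<Longrightarrow> x = y"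
  unfolding empty_cell_def using cell_antisym by blast

lemma cell_chain_to_cell:
  assumes v: "v \<in> vertices X" and x: "x \<in> Field X"
  shows "\<exists>ys. cell_chain X v x ys"
proof (cases "empty_cell X x")
  case True
  \<comment> \<open>The empty cell lies below \<open>v\<close>, so a chain of one term
    suffices.\<close>
  then have "cell_chain X v x [v]"
    using vertexD(1)[OF v] cell_refl unfolding cell_chain_def empty_cell_def by simp
  then show ?thesis by blast
next
  case False
  then obtain w where w: "w \<in> vertices_of X x" using vertex_exists[OF x] by blast
  then obtain ys where ys: "cell_chain X v w ys"
    using connected(2)[OF v] unfolding vertices_of_def by blast
  have "w \<in> vertices_of X (last ys)" using ys w unfolding cell_chain_def vertices_of_def by simp
  then have "vertices_of X (last ys) \<inter> vertices_of X x \<noteq> {}" using w by blast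
  moreover have "ys ! i = last ys" if "Suc i = length ys" for i
    using that last_conv_nth[of ys] by (metis diff_Suc_1 length_0_conv nat.distinct(1))
  ultimately have "vertices_of X ((ys @ [x]) ! i) \<inter> vertices_of X ((ys @ [x]) ! Suc i) \<noteq> {}"
    if "Suc i < length (ys @ [x])" for i
    using that ys unfolding cell_chain_def by (cases "Suc i < length ys") (auto simp: nth_append less_Suc_eq)
  then have "cell_chain X v x (ys @ [x])"
    using ys x cell_refl[OF x] unfolding cell_chain_def by auto
  then show ?thesis by blast
qed

lemma cell_dist_chain:
  assumes "v \<in> vertices X" "x \<in> Field X" "v \<noteq> x"
  shows "\<exists>ys. length ys = cell_dist X v x \<and> cell_chain X v x ys"
proof -
  obtain ys where "cell_chain X v x ys" using cell_chain_to_cell assms by blast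
  then have "\<exists>ys'. length ys' = length ys \<and> cell_chain X v x ys'" by blast
  then show ?thesis unfolding cell_dist_def using assms(3) by (simp) (rule LeastI)
qed

lemma cell_dist_le: "cell_chain X v x ys \<Longrightarrow> cell_dist X v x \<le> length ys"
  unfolding cell_dist_def by (auto intro: Least_le)

text \<open>\<open>N k\<close> contains every cell that can occur at position \<open>k\<close>,
  counted from 0, in a chain starting above \<open>v\<close>; it is finite since stars and vertex
  sets are. A chain of length at most \<open>n\<close> ends in some \<open>N k\<close> with
  \<open>k < n\<close>, and the cell reached is a face of its last term.\<close>

lemma finite_ball:
  assumes v: "v \<in> vertices X"
  shows "finite (cell_ball X v n)"
proof -
  define N where "N = rec_nat {y. (v, y) \<in> X}
    (\<lambda>_ M. {y \<in> Field X. \<exists>z\<in>M. vertices_of X z \<inter> vertices_of X y \<noteq> {}})"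
  have N0: "N 0 = {y. (v, y) \<in> X}"
    and NS: "N (Suc k) = {y \<in> Field X. \<exists>z\<in>N k. vertices_of X z \<inter> vertices_of X y \<noteq> {}}" for k
    unfolding N_def by simp_all
  have fin: "finite (N k) \<and> N k \<subseteq> Field X" for k
  proof (induction k)
    case 0
    show ?case unfolding N0 using finite_star[OF v] by (auto simp: Field_def)
  next
    case (Suc k)
    have "N (Suc k) \<subseteq> (\<Union>z\<in>N k. \<Union>w\<in>vertices_of X z. {y. (w, y) \<in> X})"
      unfolding NS vertices_of_def by blast
    moreover have "finite (\<Union>z\<in>N k. \<Union>w\<in>vertices_of X z. {y. (w, y) \<in> X})"
      using Suc finite_vertices_of finite_star unfolding vertices_of_def by (intro finite_UN_I) auto
    ultimately show ?case unfolding NS by (auto intro: finite_subset)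
  qed
  have chain: "ys ! i \<in> N i" if "cell_chain X v x ys" "i < length ys" for ys i x
    using that(2)
  proof (induction i)
    case 0
    then show ?case using that(1) hd_conv_nth[of ys] unfolding N0 cell_chain_def by auto
  next
    case (Suc i)
    then have "ys ! i \<in> N i" "vertices_of X (ys ! i) \<inter> vertices_of X (ys ! Suc i) \<noteq> {}"
      "ys ! Suc i \<in> Field X" using that(1) nth_mem[of "Suc i" ys] unfolding cell_chain_def by auto
    then show ?case unfolding NS by blast
  qed
  have "cell_ball X v n \<subseteq> insert v (\<Union>k<n. \<Union>y\<in>N k. {x. (x, y) \<in> X})"
  proof
    fix x assume x: "x \<in> cell_ball X v n"
    show "x \<in> insert v (\<Union>k<n. \<Union>y\<in>N k. {x. (x, y) \<in> X})"
    proof (cases "v = x")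
      case False
      then obtain ys where ys: "length ys = cell_dist X v x" "cell_chain X v x ys"
        using cell_dist_chain[OF v] x unfolding cell_ball_def by blast
      have ne: "ys \<noteq> []" and last: "(x, last ys) \<in> X" using ys(2) unfolding cell_chain_def by auto
      then have "length ys - 1 < n" using ys(1) x unfolding cell_ball_def
        by (metis (no_types, lifting) Suc_pred' le_less_trans length_greater_0_conv less_Suc_eq_le mem_Collect_eq not_less_eq)
      moreover have "last ys \<in> N (length ys - 1)"
        using chain[OF ys(2), of "length ys - 1"] ne by (simp add: last_conv_nth)
      ultimately show ?thesis using last by blast
    qed simp
  qed
  moreover have "finite (insert v (\<Union>k<n. \<Union>y\<in>N k. {x. (x, y) \<in> X}))"
    using fin finite_faces by (intro finite.insertI finite_UN_I) auto
  ultimately show ?thesis by (rule finite_subset)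
qed

end

section \<open>Group actions on complexes and freeness of covering subgroups\<close>

locale gcomplex =
  fixes G :: "('g, 'k) monoid_scheme" (structure) and T :: "'g topology"
    and X :: "'c rel" and \<phi> :: "'g \<Rightarrow> 'c \<Rightarrow> 'c"
  assumes ell: "ell_group G T" and gc: "G_complex G T X \<phi>"
begin

sublocale simplicial X
  by unfold_locales (use gc in \<open>simp add: G_complex_def\<close>)

sublocale faithful_action G "Field X" \<phi>
  using gc unfolding G_complex_def by blast

sublocale group G
  using ell unfolding ell_group_def by blast

lemma act_in: "g \<in> carrier G \<Longrightarrow> x \<in> Field X \<Longrightarrow> \<phi> g x \<in> Field X"
  using element_image by blast

lemma act_one: "x \<in> Field X \<Longrightarrow> \<phi> \<one> x = x"
  using id_eq_one by (metis restrict_apply')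

lemma act_mult: "x \<in> Field X \<Longrightarrow> g \<in> carrier G \<Longrightarrow> h \<in> carrier G \<Longrightarrow> \<phi> (g \<otimes> h) x = \<phi> g (\<phi> h x)"
  using composition_rule by blast

lemma act_inv:
  assumes "g \<in> carrier G" "x \<in> Field X"
  shows "\<phi> (inv g) (\<phi> g x) = x" "\<phi> g (\<phi> (inv g) x) = x"
  using assms act_mult[of x "inv g" g] act_mult[of x g "inv g"] act_one[of x] by auto

lemma act_mono: "g \<in> carrier G \<Longrightarrow> x \<in> Field X \<Longrightarrow> y \<in> Field X \<Longrightarrow> (\<phi> g x, \<phi> g y) \<in> X \<longleftrightarrow> (x, y) \<in> X"
  using gc unfolding G_complex_def by blast

lemma act_empty:
  assumes g: "g \<in> carrier G" and x: "x \<in> Field X"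
  shows "empty_cell X (\<phi> g x) \<longleftrightarrow> empty_cell X x"
proof -
  have "(\<forall>y\<in>Field X. (\<phi> g x, y) \<in> X) \<longleftrightarrow> (\<forall>y\<in>Field X. (\<phi> g x, \<phi> g y) \<in> X)"
    using act_in[OF g] act_inv(2)[OF g] act_in[of "inv g"] g by (metis inv_closed)
  then show ?thesis unfolding empty_cell_def using act_mono g x act_in by blast
qed

lemma act_vertex:
  assumes g: "g \<in> carrier G" and x: "x \<in> Field X"
  shows "\<phi> g x \<in> vertices X \<longleftrightarrow> x \<in> vertices X"
proof -
  have *: "\<phi> h y \<in> vertices X" if h: "h \<in> carrier G" and y: "y \<in> vertices X" for h y
    unfolding vertices_def
  proof (intro CollectI conjI allI impI)
    have yF: "y \<in> Field X" using vertexD(1)[OF y] .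
    show "\<phi> h y \<in> Field X" using act_in h yF by blast
    show "\<not> empty_cell X (\<phi> h y)" using act_empty[OF h yF] vertexD(2)[OF y] by simp
    fix u assume u: "(u, \<phi> h y) \<in> X"
    then have uF: "u \<in> Field X" by (auto simp: Field_def)
    then have u': "\<phi> (inv h) u \<in> Field X" using act_in h by simp
    have "(\<phi> (inv h) u, y) \<in> X"
      using act_mono[OF h u' yF] act_inv(2)[OF h uF] u by simp
    then have "\<phi> (inv h) u = y \<or> empty_cell X (\<phi> (inv h) u)" using y unfolding vertices_def by blast
    then show "u = \<phi> h y \<or> empty_cell X u"
      using act_inv(2)[OF h uF] act_empty[of "inv h" u] uF h by auto
  qed
  show ?thesis using *[OF g, of x] *[of "inv g" "\<phi> g x"] act_inv(1)[OF g x] g by auto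
qed

lemma act_vertices_of:
  assumes g: "g \<in> carrier G" and x: "x \<in> Field X"
  shows "vertices_of X (\<phi> g x) = \<phi> g ` vertices_of X x"
proof
  show "\<phi> g ` vertices_of X x \<subseteq> vertices_of X (\<phi> g x)"
    unfolding vertices_of_def using act_vertex act_mono g x vertexD(1) by blast
  show "vertices_of X (\<phi> g x) \<subseteq> \<phi> g ` vertices_of X x"
  proof
    fix v assume v: "v \<in> vertices_of X (\<phi> g x)"
    then have vV: "v \<in> vertices X" and le: "(v, \<phi> g x) \<in> X" unfolding vertices_of_def by auto
    have vF: "v \<in> Field X" using vertexD(1)[OF vV] .
    have "\<phi> (inv g) v \<in> vertices X" using act_vertex[of "inv g" v] vV vF g by simp
    moreover have "(\<phi> (inv g) v, x) \<in> X"
      using act_mono[OF g, of "\<phi> (inv g) v" x] act_inv(2)[OF g vF] le x act_in[of "inv g" v] vF g by simp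
    ultimately have "\<phi> (inv g) v \<in> vertices_of X x" unfolding vertices_of_def by blast
    then show "v \<in> \<phi> g ` vertices_of X x" using act_inv(2)[OF g vF] by (metis imageI)
  qed
qed

lemma act_chain:
  assumes g: "g \<in> carrier G" and x: "x \<in> Field X" "y \<in> Field X" and ys: "cell_chain X x y ys"
  shows "cell_chain X (\<phi> g x) (\<phi> g y) (map (\<phi> g) ys)"
  unfolding cell_chain_def
proof (intro conjI allI impI)
  have ne: "ys \<noteq> []" and sub: "set ys \<subseteq> Field X" and hd: "(x, hd ys) \<in> X" and last: "(y, last ys) \<in> X"
    and link: "\<And>i. Suc i < length ys \<Longrightarrow> vertices_of X (ys ! i) \<inter> vertices_of X (ys ! Suc i) \<noteq> {}"
    using ys unfolding cell_chain_def by auto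
  show "map (\<phi> g) ys \<noteq> []" using ne by simp
  show "set (map (\<phi> g) ys) \<subseteq> Field X" using sub act_in[OF g] by auto
  show "(\<phi> g x, hd (map (\<phi> g) ys)) \<in> X" using ne sub hd act_mono[OF g x(1)] by (simp add: hd_map subset_iff)
  show "(\<phi> g y, last (map (\<phi> g) ys)) \<in> X" using ne sub last act_mono[OF g x(2)] by (simp add: last_map subset_iff)
  fix i assume i: "Suc i < length (map (\<phi> g) ys)"
  then have F: "ys ! i \<in> Field X" "ys ! Suc i \<in> Field X" using sub by auto
  have "\<phi> g ` (vertices_of X (ys ! i) \<inter> vertices_of X (ys ! Suc i)) \<noteq> {}" using link i by simp
  then show "vertices_of X (map (\<phi> g) ys ! i) \<inter> vertices_of X (map (\<phi> g) ys ! Suc i) \<noteq> {}"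
    using i act_vertices_of[OF g F(1)] act_vertices_of[OF g F(2)] by auto
qed

lemma act_dist_le:
  assumes g: "g \<in> carrier G" and v: "v \<in> vertices X" and x: "x \<in> Field X"
  shows "cell_dist X (\<phi> g v) (\<phi> g x) \<le> cell_dist X v x"
proof (cases "v = x")
  case False
  then obtain ys where "length ys = cell_dist X v x" "cell_chain X v x ys"
    using cell_dist_chain[OF v x] by blast
  then show ?thesis using cell_dist_le[OF act_chain[OF g vertexD(1)[OF v] x]] by (metis length_map)
qed (simp add: cell_dist_def)

lemma quot_map_alt: "quot_map G \<phi> \<Gamma> x = {\<phi> \<gamma> x | \<gamma>. \<gamma> \<in> \<Gamma>}"
  unfolding quot_map_def orbit_def by simp

lemma quot_map_eq_iff:
  assumes \<Gamma>: "subgroup \<Gamma> G" and x: "x \<in> Field X" "y \<in> Field X"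
  shows "quot_map G \<phi> \<Gamma> x = quot_map G \<phi> \<Gamma> y \<longleftrightarrow> (\<exists>\<gamma>\<in>\<Gamma>. \<phi> \<gamma> x = y)"
proof
  note sub = subgroup.mem_carrier[OF \<Gamma>]
  assume "quot_map G \<phi> \<Gamma> x = quot_map G \<phi> \<Gamma> y"
  moreover have "y \<in> quot_map G \<phi> \<Gamma> y"
    unfolding quot_map_alt using act_one[OF x(2)] subgroup.one_closed[OF \<Gamma>] by force
  ultimately have "y \<in> quot_map G \<phi> \<Gamma> x" by simp
  then show "\<exists>\<gamma>\<in>\<Gamma>. \<phi> \<gamma> x = y" unfolding quot_map_alt by auto
next
  note sub = subgroup.mem_carrier[OF \<Gamma>]
  assume "\<exists>\<gamma>\<in>\<Gamma>. \<phi> \<gamma> x = y"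
  then obtain \<gamma> where \<gamma>: "\<gamma> \<in> \<Gamma>" "\<phi> \<gamma> x = y" by blast
  have "\<phi> \<delta> y = \<phi> (\<delta> \<otimes> \<gamma>) x" "\<phi> \<delta> x = \<phi> (\<delta> \<otimes> inv \<gamma>) y" if "\<delta> \<in> \<Gamma>" for \<delta>
    using \<gamma>(2) sub[OF \<gamma>(1)] sub[OF that] x act_mult[of x \<delta> \<gamma>] act_mult[of y \<delta> "inv \<gamma>"] act_inv(1)[of \<gamma> x] by auto
  then show "quot_map G \<phi> \<Gamma> x = quot_map G \<phi> \<Gamma> y"
    unfolding quot_map_alt using \<gamma>(1) \<Gamma> by (blast intro: subgroup.m_closed subgroup.m_inv_closed)
qed

text \<open>Rigidity of deck transformations. Preservation of vertex numbers makes the quotient map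
  injective on the vertices of a cell, so a fixed cell has fixed vertices; injectivity on stars
  makes every cell containing a fixed vertex fixed. This spreads along chains over the whole
  complex, and faithfulness concludes.\<close>

lemma free_action:
  assumes \<Gamma>: "covering_subgroup G X \<phi> \<Gamma>" and \<gamma>: "\<gamma> \<in> \<Gamma>"
    and x: "x \<in> Field X" "\<not> empty_cell X x" "\<phi> \<gamma> x = x"
  shows "\<gamma> = \<one>"
proof -
  let ?p = "quot_map G \<phi> \<Gamma>" and ?Y = "quot_complex G X \<phi> \<Gamma>"
  have sg: "subgroup \<Gamma> G" and cov: "cover_map X ?Y ?p" using \<Gamma> unfolding covering_subgroup_def by blast+
  have \<gamma>G: "\<gamma> \<in> carrier G" using subgroup.mem_carrier[OF sg \<gamma>] .
  have same: "?p (\<phi> \<gamma> z) = ?p z" if "z \<in> Field X" for z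
    using quot_map_eq_iff[OF sg that act_in[OF \<gamma>G that]] \<gamma> by metis
  have star: "\<phi> \<gamma> z = z" if v: "v \<in> vertices X" "\<phi> \<gamma> v = v" and z: "(v, z) \<in> X" for v z
  proof -
    have "inj_on ?p {z. (v, z) \<in> X}" using cov v unfolding cover_map_def bij_betw_def by blast
    moreover have zF: "z \<in> Field X" using z by (auto simp: Field_def)
    moreover have "(v, \<phi> \<gamma> z) \<in> X" using act_mono[OF \<gamma>G vertexD(1)[OF v(1)] zF] v(2) z by simp
    ultimately show ?thesis using z same[of z] unfolding inj_on_def by blast
  qed
  have verts: "\<phi> \<gamma> w = w" if z: "z \<in> Field X" "\<phi> \<gamma> z = z" and w: "w \<in> vertices_of X z" for z w
  proof -
    have "card (vertices_of ?Y (?p z)) = card (vertices_of X z)" "vertices_of ?Y (?p z) = ?p ` vertices_of X z"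
      using cov[unfolded cover_map_def, THEN conjunct2, THEN conjunct2, THEN conjunct1]
        cov[unfolded cover_map_def, THEN conjunct2, THEN conjunct1] z(1) by (blast, blast)
    then have "inj_on ?p (vertices_of X z)"
      using finite_vertices_of[OF z(1)] by (simp add: eq_card_imp_inj_on)
    moreover have "\<phi> \<gamma> w \<in> vertices_of X z" using act_vertices_of[OF \<gamma>G z(1)] z w by auto
    moreover have "w \<in> Field X" using w vertexD(1) unfolding vertices_of_def by blast
    ultimately show ?thesis using w same[of w] unfolding inj_on_def by blast
  qed
  obtain v where v: "v \<in> vertices_of X x" using vertex_exists[OF x(1,2)] by blast
  then have v0: "v \<in> vertices X" "\<phi> \<gamma> v = v" using verts[OF x(1,3)] unfolding vertices_of_def by auto
  have all: "\<phi> \<gamma> w = w" if w: "w \<in> vertices X" for w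
  proof -
    obtain ys where ys: "cell_chain X v w ys" using connected(2)[OF v0(1) w] by blast
    then have ne: "ys \<noteq> []" and sub: "set ys \<subseteq> Field X" and hd: "(v, hd ys) \<in> X" and last: "(w, last ys) \<in> X"
      and link: "\<And>i. Suc i < length ys \<Longrightarrow> vertices_of X (ys ! i) \<inter> vertices_of X (ys ! Suc i) \<noteq> {}"
      unfolding cell_chain_def by auto
    have "\<phi> \<gamma> (ys ! i) = ys ! i" if "i < length ys" for i
      using that
    proof (induction i)
      case 0
      then show ?case using star[OF v0 hd] by (simp add: hd_conv_nth)
    next
      case (Suc i)
      then obtain u where u: "u \<in> vertices_of X (ys ! i)" "u \<in> vertices_of X (ys ! Suc i)"
        using link[of i] by blast
      have "ys ! i \<in> Field X" using Suc sub by (meson Suc_lessD nth_mem subsetD)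
      then have "\<phi> \<gamma> u = u" using verts[of "ys ! i" u] u(1) Suc by simp
      then show ?case using star[of u "ys ! Suc i"] u unfolding vertices_of_def by blast
    qed
    then have "\<phi> \<gamma> (last ys) = last ys" using ne by (simp add: last_conv_nth)
    moreover have "w \<in> vertices_of X (last ys)" using w last unfolding vertices_of_def by blast
    moreover have "last ys \<in> Field X" using ne sub by auto
    ultimately show ?thesis using verts by blast
  qed
  have "\<phi> \<gamma> z = z" if z: "z \<in> Field X" for z
  proof (cases "empty_cell X z")
    case True
    then show ?thesis using act_empty[OF \<gamma>G z] empty_cell_unique by blast
  next
    case False
    then obtain w where "w \<in> vertices_of X z" using vertex_exists[OF z] by blast
    then show ?thesis using star[of w z] all unfolding vertices_of_def by blast
  qed
  then have "\<phi> \<gamma> = \<phi> \<one>"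
    using bij_prop0[OF \<gamma>G] unfolding id_eq_one[symmetric] Bij_def by (auto simp: extensional_def)
  then show ?thesis using faithful \<gamma>G unfolding inj_on_def by blast
qed

lemma continuous_translation:
  assumes "g \<in> carrier G"
  shows "continuous_map T T (\<lambda>h. g \<otimes> h)"
proof -
  have top: "topspace T = carrier G" and mult: "continuous_map (prod_topology T T) T (\<lambda>(x, y). x \<otimes> y)"
    using ell unfolding ell_group_def by auto
  have "continuous_map T (prod_topology T T) (\<lambda>h. (g, h))"
    using assms top by (intro continuous_map_pairedI) auto
  from continuous_map_compose[OF this mult] show ?thesis by (simp add: o_def)
qed

text \<open>A nonempty transporter is a translate of the stabilizer. The laws of an action are
  assumed only at \<open>x\<close>, so that the lemma fits both cells and points of a set-valued
  functor.\<close>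

lemma compact_transporter:
  assumes one: "\<psi> \<one> x = x"
    and mult: "\<And>g h. g \<in> carrier G \<Longrightarrow> h \<in> carrier G \<Longrightarrow> \<psi> (g \<otimes> h) x = \<psi> g (\<psi> h x)"
    and inv: "\<And>g z. g \<in> carrier G \<Longrightarrow> \<psi> g x = z \<Longrightarrow> \<psi> (inv g) z = x"
    and comp: "compactin T (stabilizer G \<psi> x)"
  shows "compactin T {g \<in> carrier G. \<psi> g x = y}"
proof (cases "\<exists>g0\<in>carrier G. \<psi> g0 x = y")
  case True
  then obtain g0 where g0: "g0 \<in> carrier G" "\<psi> g0 x = y" by blast
  have "{g \<in> carrier G. \<psi> g x = y} = (\<lambda>h. g0 \<otimes> h) ` stabilizer G \<psi> x"
  proof
    show "(\<lambda>h. g0 \<otimes> h) ` stabilizer G \<psi> x \<subseteq> {g \<in> carrier G. \<psi> g x = y}"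
      using g0 mult[OF g0(1)] unfolding stabilizer_def by auto
    show "{g \<in> carrier G. \<psi> g x = y} \<subseteq> (\<lambda>h. g0 \<otimes> h) ` stabilizer G \<psi> x"
    proof
      fix g assume g: "g \<in> {g \<in> carrier G. \<psi> g x = y}"
      then have "\<psi> (inv g0 \<otimes> g) x = x" using mult[of "inv g0" g] g0 inv[OF g0] by simp
      then have "inv g0 \<otimes> g \<in> stabilizer G \<psi> x" using g g0 unfolding stabilizer_def by simp
      moreover have "g = g0 \<otimes> (inv g0 \<otimes> g)" using g g0 by (simp add: m_assoc[symmetric])
      ultimately show "g \<in> (\<lambda>h. g0 \<otimes> h) ` stabilizer G \<psi> x" by blast
    qed
  qed
  then show ?thesis using image_compactin[OF comp continuous_translation[OF g0(1)]] by simp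
next
  case False
  then have "{g \<in> carrier G. \<psi> g x = y} = {}" by blast
  then show ?thesis by (simp only: compactin_empty)
qed

lemma compact_cell_transporter:
  assumes x: "x \<in> Field X" "\<not> empty_cell X x"
  shows "compactin T {g \<in> carrier G. \<phi> g x = y}"
proof (rule compact_transporter)
  show "compactin T (stabilizer G \<phi> x)" using gc x unfolding G_complex_def by blast
qed (use x act_one act_mult act_inv in auto)

text \<open>The cosets of the open stabilizer cover \<open>C\<close>, finitely many suffice, and
  \<phi> moves \<open>x\<close> to the same cell throughout a coset.\<close>

lemma compact_finite_orbit:
  assumes C: "compactin T C" and x: "x \<in> Field X" "\<not> empty_cell X x"
  shows "finite ((\<lambda>g. \<phi> g x) ` C)"
proof -
  have top: "topspace T = carrier G" using ell unfolding ell_group_def by auto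
  have CG: "C \<subseteq> carrier G" using compactin_subset_topspace[OF C] top by simp
  define U where "U g0 = {g \<in> carrier G. inv g0 \<otimes> g \<in> stabilizer G \<phi> x}" for g0
  have U: "openin T (U g0)" if "g0 \<in> C" for g0
  proof -
    have "openin T (stabilizer G \<phi> x)" using gc x unfolding G_complex_def by blast
    then show ?thesis unfolding U_def top[symmetric]
      using openin_continuous_map_preimage[OF continuous_translation] that CG by (auto simp: top)
  qed
  have orb: "\<phi> g x = \<phi> g0 x" if "g \<in> U g0" "g0 \<in> C" for g g0
  proof -
    have g0: "g0 \<in> carrier G" "g \<in> carrier G" using that CG unfolding U_def by auto
    have "\<phi> g0 (\<phi> (inv g0 \<otimes> g) x) = \<phi> g0 x" using that unfolding U_def stabilizer_def by simp
    then show ?thesis using g0 x act_mult[of x g0 "inv g0 \<otimes> g"] by (simp add: m_assoc[symmetric])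
  qed
  have "C \<subseteq> \<Union> (U ` C)"
  proof
    fix g assume "g \<in> C"
    then show "g \<in> \<Union> (U ` C)" using CG act_one[OF x(1)] unfolding U_def stabilizer_def
      by (intro UN_I[of g]) auto
  qed
  then obtain \<F> where "finite \<F>" "\<F> \<subseteq> U ` C" "C \<subseteq> \<Union> \<F>"
    using compactinD[OF C, of "U ` C"] U by auto
  then obtain D where D: "finite D" "D \<subseteq> C" "C \<subseteq> \<Union> (U ` D)"
    by (metis finite_subset_image)
  have "(\<lambda>g. \<phi> g x) ` C \<subseteq> (\<lambda>g. \<phi> g x) ` D"
  proof
    fix z assume "z \<in> (\<lambda>g. \<phi> g x) ` C"
    then obtain g where "g \<in> C" "z = \<phi> g x" by blast
    moreover from this D(3) obtain g0 where "g0 \<in> D" "g \<in> U g0" by blast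
    ultimately show "z \<in> (\<lambda>g. \<phi> g x) ` D" using orb[of g g0] D(2) by auto
  qed
  then show ?thesis using D(1) finite_subset by blast
qed

section \<open>Equivalence of the condition on compact sets and the condition on balls\<close>

definition compact_condition :: "'i set \<Rightarrow> ('i \<Rightarrow> 'g set) \<Rightarrow> bool" where
  "compact_condition I \<Gamma> \<longleftrightarrow> (\<forall>C. compactin T C \<and> \<one> \<in> C \<longrightarrow>
      (\<exists>\<alpha>\<in>I. \<exists>g\<in>carrier G. C \<inter> (\<lambda>\<gamma>. inv g \<otimes> \<gamma> \<otimes> g) ` \<Gamma> \<alpha> = {\<one>}))"

definition ball_condition :: "'i set \<Rightarrow> ('i \<Rightarrow> 'g set) \<Rightarrow> bool" where
  "ball_condition I \<Gamma> \<longleftrightarrow>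
     (\<forall>n. \<exists>\<alpha>\<in>I. \<exists>v\<in>vertices X. inj_on (quot_map G \<phi> (\<Gamma> \<alpha>)) (cell_ball X v n))"

text \<open>\<open>C\<close> collects the transporters between nonempty cells of one ball around a
  fixed \<open>v\<close>. Two cells of the ball around \<open>g v\<close> in one orbit pull back
  along \<open>g\<close> to cells of the fixed ball, and the conjugated group element between them
  lies in \<open>C\<close>, so it is 1. The empty cell, stabilized by all of \<open>G\<close>, is
  kept out of \<open>C\<close> and handled by its uniqueness.\<close>

lemma compact_imp_ball:
  assumes \<Gamma>: "\<And>\<alpha>. \<alpha> \<in> I \<Longrightarrow> covering_subgroup G X \<phi> (\<Gamma> \<alpha>)" and c: "compact_condition I \<Gamma>"
  shows "ball_condition I \<Gamma>"
  unfolding ball_condition_def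
proof
  fix n
  obtain v where v: "v \<in> vertices X" using connected(1) by blast
  define D where "D = {x \<in> cell_ball X v n. \<not> empty_cell X x}"
  have D: "finite D" "D \<subseteq> Field X" 
    unfolding D_def using finite_ball[OF v, of n] by (auto simp del: mem_Collect_eq intro: finite_subset)
      (auto simp: cell_ball_def)
  define C where "C = {\<one>} \<union> (\<Union>x\<in>D. \<Union>y\<in>D. {g \<in> carrier G. \<phi> g x = y})"
  have top: "topspace T = carrier G" using ell unfolding ell_group_def by auto
  have "compactin T C"
  proof -
    have "compactin T {g \<in> carrier G. \<phi> g x = y}" if "x \<in> D" for x y
      using compact_cell_transporter[of x y] that D(2) unfolding D_def by blast
    then have "compactin T (\<Union>p\<in>D \<times> D. {g \<in> carrier G. \<phi> g (fst p) = snd p})"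
      using D(1) by (intro compactin_Union) auto
    moreover have "compactin T {\<one>}" using top by (simp add: finite_imp_compactin)
    moreover have "C = {\<one>} \<union> (\<Union>p\<in>D \<times> D. {g \<in> carrier G. \<phi> g (fst p) = snd p})"
      unfolding C_def by auto
    ultimately show ?thesis by (simp only: compactin_Un)
  qed
  then obtain \<alpha> g where \<alpha>: "\<alpha> \<in> I" "g \<in> carrier G" "C \<inter> (\<lambda>\<gamma>. inv g \<otimes> \<gamma> \<otimes> g) ` \<Gamma> \<alpha> = {\<one>}"
    using c unfolding compact_condition_def C_def by blast
  have sg: "subgroup (\<Gamma> \<alpha>) G" using \<Gamma>[OF \<alpha>(1)] unfolding covering_subgroup_def by blast
  have "inj_on (quot_map G \<phi> (\<Gamma> \<alpha>)) (cell_ball X (\<phi> g v) n)"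
  proof (rule inj_onI)
    fix x y assume x: "x \<in> cell_ball X (\<phi> g v) n" and y: "y \<in> cell_ball X (\<phi> g v) n"
      and eq: "quot_map G \<phi> (\<Gamma> \<alpha>) x = quot_map G \<phi> (\<Gamma> \<alpha>) y"
    have F: "x \<in> Field X" "y \<in> Field X" using x y unfolding cell_ball_def by auto
    obtain \<gamma> where \<gamma>: "\<gamma> \<in> \<Gamma> \<alpha>" "\<phi> \<gamma> x = y" using eq quot_map_eq_iff[OF sg F] by blast
    have \<gamma>G: "\<gamma> \<in> carrier G" using subgroup.mem_carrier[OF sg \<gamma>(1)] .
    show "x = y"
    proof (cases "empty_cell X x")
      case True
      then show ?thesis using act_empty[OF \<gamma>G F(1)] \<gamma>(2) empty_cell_unique by blast
    next
      case False
      then have ney: "\<not> empty_cell X y" using act_empty[OF \<gamma>G F(1)] \<gamma>(2) by simp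
      have pull: "\<phi> (inv g) z \<in> D" if z: "z \<in> cell_ball X (\<phi> g v) n" "\<not> empty_cell X z" for z
      proof -
        have zF: "z \<in> Field X" using z unfolding cell_ball_def by auto
        have gv: "\<phi> g v \<in> vertices X" using act_vertex[OF \<alpha>(2) vertexD(1)[OF v]] v by simp
        have "cell_dist X v (\<phi> (inv g) z) \<le> cell_dist X (\<phi> g v) z"
          using act_dist_le[of "inv g" "\<phi> g v" z] gv zF \<alpha>(2) act_inv(1)[OF \<alpha>(2) vertexD(1)[OF v]] by simp
        then show ?thesis
          using z zF \<alpha>(2) act_in[of "inv g" z] act_empty[of "inv g" z] unfolding D_def cell_ball_def by simp
      qed
      let ?h = "inv g \<otimes> \<gamma> \<otimes> g"
      have "\<phi> ?h (\<phi> (inv g) x) = \<phi> (inv g) y"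
        using \<alpha>(2) \<gamma> \<gamma>G F act_in[of "inv g" x] act_inv(2)[OF \<alpha>(2) F(1)]
          act_mult[of "\<phi> (inv g) x" "inv g \<otimes> \<gamma>" g] act_mult[of x "inv g" \<gamma>] by simp
      then have "?h \<in> C" unfolding C_def using \<alpha>(2) \<gamma>G
        by (intro UnI2 UN_I[OF pull[OF x False]] UN_I[OF pull[OF y ney]]) simp
      then have "?h = \<one>" using \<alpha>(3) \<gamma>(1) by blast
      then have "\<phi> (inv g) x = \<phi> (inv g) y"
        using \<open>\<phi> ?h (\<phi> (inv g) x) = \<phi> (inv g) y\<close> act_one act_in[of "inv g" x] F \<alpha>(2) by simp
      then show ?thesis using act_inv(2)[OF \<alpha>(2)] F by metis
    qed
  qed
  moreover have "\<phi> g v \<in> vertices X" using act_vertex[OF \<alpha>(2) vertexD(1)[OF v]] v by simp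
  ultimately show "\<exists>\<alpha>\<in>I. \<exists>v\<in>vertices X. inj_on (quot_map G \<phi> (\<Gamma> \<alpha>)) (cell_ball X v n)"
    using \<alpha>(1) by blast
qed

lemma vertex_representatives:
  assumes "almost_transitive G X \<phi>"
  obtains R where "finite R" "R \<subseteq> vertices X" "\<And>v. v \<in> vertices X \<Longrightarrow> \<exists>r\<in>R. \<exists>g\<in>carrier G. v = \<phi> g r"
proof -
  have fin: "finite (orbits G (Field X) \<phi>)" using assms unfolding almost_transitive_def .
  define r where "r O' = (SOME v. v \<in> O' \<and> v \<in> vertices X)" for O'
  let ?R = "r ` {O' \<in> orbits G (Field X) \<phi>. \<exists>v\<in>O'. v \<in> vertices X}"
  have r: "r O' \<in> O' \<and> r O' \<in> vertices X" if "\<exists>v\<in>O'. v \<in> vertices X" for O'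
    unfolding r_def using that by (intro someI_ex[of "\<lambda>v. v \<in> O' \<and> v \<in> vertices X"]) blast
  have "\<exists>r\<in>?R. \<exists>g\<in>carrier G. v = \<phi> g r" if v: "v \<in> vertices X" for v
  proof -
    have vF: "v \<in> Field X" using vertexD(1)[OF v] .
    let ?O = "orbit G \<phi> v"
    have O: "?O \<in> orbits G (Field X) \<phi>" "\<exists>v\<in>?O. v \<in> vertices X"
      using vF v orbit_refl[OF vF] unfolding orbits_def by blast+
    obtain h where h: "h \<in> carrier G" "r ?O = \<phi> h v" using r[OF O(2)] unfolding orbit_def by blast
    then have "v = \<phi> (inv h) (r ?O)" using act_inv(1)[OF h(1) vF] by simp
    then show ?thesis using O h(1) by blast
  qed
  moreover have "finite ?R" using fin by simp
  moreover have "?R \<subseteq> vertices X" using r by blast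
  ultimately show thesis using that[of ?R] by simp
qed

text \<open>The radius \<open>n\<close> bounds how far \<open>C\<close> moves a finite set of vertex
  representatives. After translating the centre \<open>v\<close> to a representative, an element of
  \<open>C\<close> conjugate to \<gamma> shows that \<gamma> moves \<open>v\<close> within the ball
  of radius \<open>n\<close>; injectivity there gives a fixed vertex, and freeness gives \<gamma> =
  1.\<close>

lemma ball_imp_compact:
  assumes trans: "almost_transitive G X \<phi>"
    and \<Gamma>: "\<And>\<alpha>. \<alpha> \<in> I \<Longrightarrow> covering_subgroup G X \<phi> (\<Gamma> \<alpha>)" and b: "ball_condition I \<Gamma>"
  shows "compact_condition I \<Gamma>"
  unfolding compact_condition_def
proof (intro allI impI)
  fix C assume C: "compactin T C \<and> \<one> \<in> C"
  have top: "topspace T = carrier G" using ell unfolding ell_group_def by auto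
  have CG: "C \<subseteq> carrier G" using compactin_subset_topspace C top by metis
  obtain R where R: "finite R" "R \<subseteq> vertices X" "\<And>v. v \<in> vertices X \<Longrightarrow> \<exists>r\<in>R. \<exists>g\<in>carrier G. v = \<phi> g r"
    using vertex_representatives[OF trans] by blast
  define E where "E = (\<Union>r\<in>R. cell_dist X r ` ((\<lambda>g. \<phi> g r) ` C))"
  have "finite E"
    unfolding E_def
  proof (intro finite_UN_I R(1))
    fix r assume "r \<in> R"
    then have "r \<in> vertices X" using R(2) by blast
    then have "finite ((\<lambda>g. \<phi> g r) ` C)" using compact_finite_orbit C vertexD by blast
    then show "finite (cell_dist X r ` (\<lambda>g. \<phi> g r) ` C)" by (rule finite_imageI)
  qed
  then obtain n where n: "\<And>e. e \<in> E \<Longrightarrow> e \<le> n" unfolding finite_nat_set_iff_bounded_le by blast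
  obtain \<alpha> v where \<alpha>: "\<alpha> \<in> I" "v \<in> vertices X" and inj: "inj_on (quot_map G \<phi> (\<Gamma> \<alpha>)) (cell_ball X v n)"
    using b unfolding ball_condition_def by blast
  obtain r g where r: "r \<in> R" "g \<in> carrier G" "v = \<phi> g r" using R(3)[OF \<alpha>(2)] by blast
  have rV: "r \<in> vertices X" and rF: "r \<in> Field X" using r(1) R(2) vertexD(1) by blast+
  have vF: "v \<in> Field X" using vertexD(1)[OF \<alpha>(2)] .
  have sg: "subgroup (\<Gamma> \<alpha>) G" using \<Gamma>[OF \<alpha>(1)] unfolding covering_subgroup_def by blast
  have "c = \<one>" if c: "c \<in> C" "\<gamma> \<in> \<Gamma> \<alpha>" "c = inv g \<otimes> \<gamma> \<otimes> g" for c \<gamma>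
  proof -
    have \<gamma>G: "\<gamma> \<in> carrier G" using subgroup.mem_carrier[OF sg c(2)] .
    have cG: "c \<in> carrier G" using c CG by blast
    have "g \<otimes> c = \<gamma> \<otimes> g" unfolding c(3) using r(2) \<gamma>G by (simp add: m_assoc[symmetric])
    then have \<gamma>v: "\<phi> \<gamma> v = \<phi> g (\<phi> c r)"
      unfolding r(3) using act_mult[OF rF \<gamma>G r(2)] act_mult[OF rF r(2) cG] by simp
    have "cell_dist X r (\<phi> c r) \<le> n" using n c(1) r(1) unfolding E_def by blast
    then have "cell_dist X v (\<phi> \<gamma> v) \<le> n"
      unfolding \<gamma>v using act_dist_le[OF r(2) rV act_in[OF cG rF]] r(3) by simp
    then have "\<phi> \<gamma> v \<in> cell_ball X v n" unfolding cell_ball_def using act_in[OF \<gamma>G vF] by simp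
    moreover have "v \<in> cell_ball X v n" unfolding cell_ball_def cell_dist_def using vF by simp
    moreover have "quot_map G \<phi> (\<Gamma> \<alpha>) v = quot_map G \<phi> (\<Gamma> \<alpha>) (\<phi> \<gamma> v)"
      using quot_map_eq_iff[OF sg vF act_in[OF \<gamma>G vF]] c(2) by blast
    ultimately have "\<phi> \<gamma> v = v" using inj unfolding inj_on_def by metis
    then have "\<gamma> = \<one>" using free_action[OF \<Gamma>[OF \<alpha>(1)] c(2) vF vertexD(2)[OF \<alpha>(2)]] by blast
    then show ?thesis using c(3) r(2) by simp
  qed
  moreover have "\<one> = inv g \<otimes> \<one> \<otimes> g" using r(2) by simp
  then have "\<one> \<in> C \<inter> (\<lambda>\<gamma>. inv g \<otimes> \<gamma> \<otimes> g) ` \<Gamma> \<alpha>" using C subgroup.one_closed[OF sg] by blast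
  ultimately have "C \<inter> (\<lambda>\<gamma>. inv g \<otimes> \<gamma> \<otimes> g) ` \<Gamma> \<alpha> = {\<one>}" by blast
  then show "\<exists>\<alpha>\<in>I. \<exists>g\<in>carrier G. C \<inter> (\<lambda>\<gamma>. inv g \<otimes> \<gamma> \<otimes> g) ` \<Gamma> \<alpha> = {\<one>}" using \<alpha>(1) r(2) by blast
qed

end

subsection \<open>The complex as its own quotient\<close>

context simplicial
begin

text \<open>Orbits of the trivial group are singletons, so this relabelled copy is what the quotient
  by that group literally is.\<close>

definition singleton_complex :: "'c set rel" where
  "singleton_complex = (\<lambda>(x, y). ({x}, {y})) ` X"

lemma singleton_complex_iff [simp]: "({x}, {y}) \<in> singleton_complex \<longleftrightarrow> (x, y) \<in> X"
  unfolding singleton_complex_def by auto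

lemma mem_singleton_complex:
  "(u, w) \<in> singleton_complex \<longleftrightarrow> (\<exists>x y. u = {x} \<and> w = {y} \<and> (x, y) \<in> X)"
  unfolding singleton_complex_def by auto

lemma Field_singleton: "Field singleton_complex = (\<lambda>x. {x}) ` Field X"
  unfolding singleton_complex_def Field_def image_Un Domain_fst Range_snd
  by (simp add: image_image case_prod_unfold)

lemma empty_cell_singleton: "empty_cell singleton_complex {x} \<longleftrightarrow> empty_cell X x"
  unfolding empty_cell_def Field_singleton by auto

lemma vertices_singleton: "vertices singleton_complex = (\<lambda>x. {x}) ` vertices X"
proof -
  have le: "(u, {v}) \<in> singleton_complex \<longleftrightarrow> (\<exists>w. u = {w} \<and> (w, v) \<in> X)" for u v
    unfolding singleton_complex_def by auto
  have "{v} \<in> vertices singleton_complex \<longleftrightarrow> v \<in> vertices X" for v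
  proof -
    have "(\<forall>u. (u, {v}) \<in> singleton_complex \<longrightarrow> u = {v} \<or> empty_cell singleton_complex u)
      \<longleftrightarrow> (\<forall>w. (w, v) \<in> X \<longrightarrow> {w} = {v} \<or> empty_cell singleton_complex {w})"
      unfolding le by blast
    then show ?thesis
      unfolding vertices_def by (auto simp: Field_singleton empty_cell_singleton)
  qed
  moreover have "vertices singleton_complex \<subseteq> (\<lambda>x. {x}) ` Field X"
    unfolding vertices_def Field_singleton by auto
  ultimately show ?thesis using vertexD(1) by auto
qed

lemma vertices_of_singleton: "vertices_of singleton_complex {x} = (\<lambda>x. {x}) ` vertices_of X x"
  unfolding vertices_of_def vertices_singleton by auto

lemma simplicial_singleton: "simplicial_complex singleton_complex"
  unfolding simplicial_complex_def
proof (intro conjI)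
  obtain K :: "'c set set" and f where K: "is_set_complex K" "bij_betw f (Field X) K"
    "\<And>x y. x \<in> Field X \<Longrightarrow> y \<in> Field X \<Longrightarrow> (x, y) \<in> X \<longleftrightarrow> f x \<subseteq> f y"
    using set_model by blast
  \<comment> \<open>The points of the set model are relabelled by their singletons, because the
    model must have the cells of the new complex, which are sets, as its points.\<close>
  let ?s = "(`) (\<lambda>p. {p})"
  let ?K = "?s ` K" and ?f = "\<lambda>z. ?s (f (the_elem z))"
  have "Partial_order singleton_complex"
  proof -
    have "refl_on (Field singleton_complex) singleton_complex"
      unfolding refl_on_def Field_singleton using cell_refl by simp
    moreover have "singleton_complex \<subseteq> Field singleton_complex \<times> Field singleton_complex"
      by (auto simp: FieldI1 FieldI2)
    moreover have "trans singleton_complex"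
    proof (rule transI)
      fix u v w assume "(u, v) \<in> singleton_complex" "(v, w) \<in> singleton_complex"
      then obtain x y z where "u = {x}" "w = {z}" "(x, y) \<in> X" "(y, z) \<in> X"
        unfolding mem_singleton_complex by blast
      then show "(u, w) \<in> singleton_complex" using cell_trans by simp
    qed
    moreover have "antisym singleton_complex"
    proof (rule antisymI)
      fix u v assume "(u, v) \<in> singleton_complex" "(v, u) \<in> singleton_complex"
      then obtain x y where "u = {x}" "v = {y}" "(x, y) \<in> X" "(y, x) \<in> X"
        unfolding mem_singleton_complex by blast
      then show "u = v" using cell_antisym by simp
    qed
    ultimately show ?thesis unfolding partial_order_on_def preorder_on_def by simp
  qed
  moreover have "is_set_complex ?K"
    unfolding is_set_complex_def
  proof (intro conjI ballI allI impI)
    show "?K \<noteq> {}" "\<And>x. x \<in> ?K \<Longrightarrow> finite x" using K(1) unfolding is_set_complex_def by auto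
    fix x y assume "x \<in> ?K" "y \<subseteq> x"
    then obtain z where z: "z \<in> K" "y \<subseteq> ?s z" by auto
    then obtain z' where "z' \<subseteq> z" "y = ?s z'" by (meson subset_imageE)
    moreover have "z' \<in> K" using z(1) \<open>z' \<subseteq> z\<close> K(1) unfolding is_set_complex_def by blast
    ultimately show "y \<in> ?K" by blast
  qed
  moreover have "bij_betw ?f (Field singleton_complex) ?K"
    unfolding bij_betw_def
  proof
    have inj: "inj_on f (Field X)" and im: "f ` Field X = K" using K(2) unfolding bij_betw_def by auto
    have "?s x = ?s y \<longleftrightarrow> x = y" for x y :: "'c set" by (simp add: inj_image_eq_iff)
    then show "inj_on ?f (Field singleton_complex)"
      unfolding Field_singleton inj_on_def using inj by (auto dest: inj_onD)
    show "?f ` Field singleton_complex = ?K"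
      unfolding Field_singleton im[symmetric] by (simp add: image_image)
  qed
  moreover have "(x, y) \<in> singleton_complex \<longleftrightarrow> ?f x \<subseteq> ?f y"
    if x: "x \<in> Field singleton_complex" and y: "y \<in> Field singleton_complex" for x y
  proof -
    obtain x' y' where "x = {x'}" "x' \<in> Field X" "y = {y'}" "y' \<in> Field X"
      using x y unfolding Field_singleton by auto
    then show ?thesis using K(3)[of x' y'] by (auto simp: image_subset_iff)
  qed
  ultimately show "simplicial_poset singleton_complex"
    unfolding simplicial_poset_def by (intro conjI exI[of _ ?K] exI[of _ ?f] ballI)
next
  show "connected_complex singleton_complex"
    unfolding connected_complex_def
  proof (intro conjI ballI)
    show "vertices singleton_complex \<noteq> {}" using connected(1) unfolding vertices_singleton by simp
    fix v w assume "v \<in> vertices singleton_complex" "w \<in> vertices singleton_complex"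
    then obtain v' w' where v: "v = {v'}" "v' \<in> vertices X" and w: "w = {w'}" "w' \<in> vertices X"
      unfolding vertices_singleton by auto
    obtain ys where ys: "cell_chain X v' w' ys" using connected(2)[OF v(2) w(2)] by blast
    have "cell_chain singleton_complex v w (map (\<lambda>x. {x}) ys)"
      unfolding cell_chain_def v w
    proof (intro conjI allI impI)
      show "({v'}, hd (map (\<lambda>x. {x}) ys)) \<in> singleton_complex" "({w'}, last (map (\<lambda>x. {x}) ys)) \<in> singleton_complex"
        "map (\<lambda>x. {x}) ys \<noteq> []" "set (map (\<lambda>x. {x}) ys) \<subseteq> Field singleton_complex"
        using ys unfolding cell_chain_def Field_singleton by (auto simp: hd_map last_map)
      fix i assume "Suc i < length (map (\<lambda>x. {x}) ys)"
      moreover from this have "vertices_of X (ys ! i) \<inter> vertices_of X (ys ! Suc i) \<noteq> {}"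
        using ys unfolding cell_chain_def by simp
      ultimately show "vertices_of singleton_complex (map (\<lambda>x. {x}) ys ! i) \<inter>
        vertices_of singleton_complex (map (\<lambda>x. {x}) ys ! Suc i) \<noteq> {}"
        by (auto simp: vertices_of_singleton)
    qed
    then show "\<exists>ys. cell_chain singleton_complex v w ys" by blast
  qed
  show "locally_finite_complex singleton_complex"
    unfolding locally_finite_complex_def
  proof
    fix v assume "v \<in> vertices singleton_complex"
    then obtain v' where v: "v = {v'}" "v' \<in> vertices X" unfolding vertices_singleton by auto
    have "{x. (v, x) \<in> singleton_complex} = (\<lambda>x. {x}) ` {x. (v', x) \<in> X}"
      unfolding v singleton_complex_def by auto
    then show "finite {x. (v, x) \<in> singleton_complex}" using finite_star[OF v(2)] by simp
  qed
qed

lemma cover_singleton: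
  assumes f: "\<And>x. x \<in> Field X \<Longrightarrow> f x = {x}"
  shows "cover_map X singleton_complex f"
proof -
  have v: "vertices_of X x \<subseteq> Field X" for x unfolding vertices_of_def using vertexD(1) by blast
  have st: "{x. (v, x) \<in> X} \<subseteq> Field X" for v by (auto simp: Field_def)
  have im: "f ` Z = (\<lambda>x. {x}) ` Z" if "Z \<subseteq> Field X" for Z using f that by (intro image_cong) auto
  have inj: "inj_on f Z" if "Z \<subseteq> Field X" for Z using f that by (auto simp: inj_on_def subset_iff)
  show ?thesis
    unfolding cover_map_def
  proof (intro conjI ballI)
    show "f \<in> Field X \<rightarrow> Field singleton_complex" using f by (auto simp: Field_singleton)
    show "f ` vertices X = vertices singleton_complex"
      unfolding vertices_singleton using vertexD(1) by (intro im) blast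
    fix x assume x: "x \<in> Field X"
    show "vertices_of singleton_complex (f x) = f ` vertices_of X x"
      unfolding f[OF x] vertices_of_singleton im[OF v] ..
    show "card (vertices_of singleton_complex (f x)) = card (vertices_of X x)"
      unfolding f[OF x] vertices_of_singleton by (simp add: card_image)
  next
    fix w assume w: "w \<in> vertices X"
    have "{y. (f w, y) \<in> singleton_complex} = (\<lambda>x. {x}) ` {x. (w, x) \<in> X}"
      unfolding f[OF vertexD(1)[OF w]] singleton_complex_def by auto
    then show "bij_betw f {x. (w, x) \<in> X} {y. (f w, y) \<in> singleton_complex}"
      unfolding bij_betw_def using inj[OF st] im[OF st] by simp
  qed
qed

end

section \<open>Morphisms from the complex to its quotients\<close>

context gcomplex
begin

lemma quot_map_one: "x \<in> Field X \<Longrightarrow> quot_map G \<phi> {\<one>} x = {x}"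
  unfolding quot_map_alt by (simp add: act_one)

lemma covering_one: "covering_subgroup G X \<phi> {\<one>}"
proof -
  have "quot_complex G X \<phi> {\<one>} = singleton_complex"
  proof (rule Set.set_eqI)
    fix z :: "'c set \<times> 'c set"
    have "z \<in> quot_complex G X \<phi> {\<one>} \<longleftrightarrow> (\<exists>x y. z = (quot_map G \<phi> {\<one>} x, quot_map G \<phi> {\<one>} y) \<and>
        x \<in> Field X \<and> y \<in> Field X \<and> (\<phi> \<one> x, y) \<in> X)"
      unfolding quot_complex_def by auto
    also have "\<dots> \<longleftrightarrow> (\<exists>x y. z = ({x}, {y}) \<and> x \<in> Field X \<and> y \<in> Field X \<and> (x, y) \<in> X)"
      by (intro ex_cong1) (auto simp: quot_map_one act_one)
    also have "\<dots> \<longleftrightarrow> z \<in> singleton_complex"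
      by (cases z) (auto simp: mem_singleton_complex FieldI1 FieldI2)
    finally show "z \<in> quot_complex G X \<phi> {\<one>} \<longleftrightarrow> z \<in> singleton_complex" .
  qed
  then show ?thesis
    unfolding covering_subgroup_def
    using simplicial_singleton cover_singleton[OF quot_map_one] triv_subgroup by simp
qed

abbreviation C :: "('g set, 'c set \<Rightarrow> 'c set) category" where
  "C \<equiv> quot_category G X \<phi>"

abbreviation qm :: "'g set \<Rightarrow> 'g \<Rightarrow> 'c set \<Rightarrow> 'c set" where
  "qm \<Gamma> g \<equiv> quot_morphism G X \<phi> {\<one>} \<Gamma> g"

lemma Obj_iff: "\<Gamma> \<in> Obj C \<longleftrightarrow> covering_subgroup G X \<phi> \<Gamma>"
  unfolding quot_category_def by simp

lemma one_Obj: "{\<one>} \<in> Obj C"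
  unfolding Obj_iff by (rule covering_one)

lemma qm_Hom: "g \<in> carrier G \<Longrightarrow> qm \<Gamma> g \<in> Hom C {\<one>} \<Gamma>"
  unfolding quot_category_def by auto

lemma quot_cells_one: "quot_cells G X \<phi> {\<one>} = (\<lambda>x. {x}) ` Field X"
proof -
  have "quot_cells G X \<phi> {\<one>} = quot_map G \<phi> {\<one>} ` Field X"
    unfolding quot_cells_def orbits_def quot_map_def by auto
  also have "\<dots> = (\<lambda>x. {x}) ` Field X" by (intro image_cong quot_map_one) auto
  finally show ?thesis .
qed

lemma qm_apply: "x \<in> Field X \<Longrightarrow> qm \<Gamma> g {x} = quot_map G \<phi> \<Gamma> (\<phi> g x)"
  unfolding quot_morphism_def quot_cells_one by simp

lemma qm_Ident: "Ident C {\<one>} = qm {\<one>} \<one>"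
proof
  fix c
  show "Ident C {\<one>} c = qm {\<one>} \<one> c"
  proof (cases "c \<in> quot_cells G X \<phi> {\<one>}")
    case True
    then obtain x where "x \<in> Field X" "c = {x}" unfolding quot_cells_one by blast
    then show ?thesis using True qm_apply[of x "{\<one>}" \<one>] quot_map_one act_one
      unfolding quot_category_def by simp
  qed (simp add: quot_category_def quot_morphism_def)
qed

lemma qm_Comp:
  assumes "g \<in> carrier G" "h \<in> carrier G"
  shows "Comp C {\<one>} (qm \<Gamma> h) (qm {\<one>} g) = qm \<Gamma> (h \<otimes> g)"
proof
  fix c
  show "Comp C {\<one>} (qm \<Gamma> h) (qm {\<one>} g) c = qm \<Gamma> (h \<otimes> g) c"
  proof (cases "c \<in> quot_cells G X \<phi> {\<one>}")
    case True
    then obtain x where x: "x \<in> Field X" "c = {x}" unfolding quot_cells_one by blast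
    then show ?thesis
      using True qm_apply[of x] qm_apply[of "\<phi> g x"] act_in[of g x] quot_map_one act_mult[of x h g] assms
      unfolding quot_category_def by (simp add: compose_def)
  qed (simp add: quot_category_def quot_morphism_def compose_def)
qed

end

section \<open>Set-valued functors with compact stabilizers and finitely many orbits\<close>

locale cell_functor = gcomplex G T X \<phi>
  for G :: "('g, 'k) monoid_scheme" (structure) and T :: "'g topology"
    and X :: "'c rel" and \<phi> :: "'g \<Rightarrow> 'c \<Rightarrow> 'c" +
  fixes S :: "('g set, 'c set \<Rightarrow> 'c set, 's set, 's \<Rightarrow> 's) cfunctor"
  assumes S: "set_functor C S"
    and compact_stab: "x \<in> ob S {\<one>} \<Longrightarrow> compactin T (stabilizer G (induced_action G X \<phi> S) x)"
    and quot: "covering_subgroup G X \<phi> \<Gamma> \<Longrightarrow>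
       \<exists>\<beta>. bij_betw \<beta> (orbits (G\<lparr>carrier := \<Gamma>\<rparr>) (ob S {\<one>}) (induced_action G X \<phi> S)) (ob S \<Gamma>) \<and>
         (\<forall>x\<in>ob S {\<one>}. \<beta> (orbit (G\<lparr>carrier := \<Gamma>\<rparr>) (induced_action G X \<phi> S) x) =
            mor S {\<one>} \<Gamma> (qm \<Gamma> \<one>) x)"
    and finite_orbits: "finite (orbits G (ob S {\<one>}) (induced_action G X \<phi> S))"
begin

abbreviation \<psi> :: "'g \<Rightarrow> 's \<Rightarrow> 's" where
  "\<psi> \<equiv> induced_action G X \<phi> S"

lemma mor_in: "\<Gamma> \<in> Obj C \<Longrightarrow> g \<in> carrier G \<Longrightarrow> s \<in> ob S {\<one>} \<Longrightarrow> mor S {\<one>} \<Gamma> (qm \<Gamma> g) s \<in> ob S \<Gamma>"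
  using S one_Obj qm_Hom unfolding set_functor_def by blast

text \<open>With \<open>h\<close> the neutral element this factors a twisted quotient map through
  the action of \<open>g\<close>, which gives access to the description of
  \<open>ob S \<Gamma>\<close> by orbits.\<close>

lemma mor_comp:
  assumes "\<Gamma> \<in> Obj C" "g \<in> carrier G" "h \<in> carrier G" "s \<in> ob S {\<one>}"
  shows "mor S {\<one>} \<Gamma> (qm \<Gamma> (h \<otimes> g)) s = mor S {\<one>} \<Gamma> (qm \<Gamma> h) (\<psi> g s)"
proof -
  have "mor S {\<one>} \<Gamma> (Comp C {\<one>} (qm \<Gamma> h) (qm {\<one>} g)) s = mor S {\<one>} \<Gamma> (qm \<Gamma> h) (mor S {\<one>} {\<one>} (qm {\<one>} g) s)"
    using S assms one_Obj qm_Hom unfolding set_functor_def by blast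
  then show ?thesis using qm_Comp[OF assms(2,3)] unfolding induced_action_def by simp
qed

lemma psi_in: "g \<in> carrier G \<Longrightarrow> s \<in> ob S {\<one>} \<Longrightarrow> \<psi> g s \<in> ob S {\<one>}"
  unfolding induced_action_def using mor_in one_Obj by blast

lemma psi_one: "s \<in> ob S {\<one>} \<Longrightarrow> \<psi> \<one> s = s"
  using S one_Obj qm_Ident unfolding set_functor_def induced_action_def by metis

lemma psi_mult: "g \<in> carrier G \<Longrightarrow> h \<in> carrier G \<Longrightarrow> s \<in> ob S {\<one>} \<Longrightarrow> \<psi> (h \<otimes> g) s = \<psi> h (\<psi> g s)"
  using mor_comp[OF one_Obj, of g h s] unfolding induced_action_def by simp

lemma psi_inv: "g \<in> carrier G \<Longrightarrow> s \<in> ob S {\<one>} \<Longrightarrow> \<psi> (inv g) (\<psi> g s) = s"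
  using psi_mult[of g "inv g" s] psi_one by simp

lemma quot_surj:
  assumes "\<Gamma> \<in> Obj C" "y \<in> ob S \<Gamma>"
  obtains s where "s \<in> ob S {\<one>}" "y = mor S {\<one>} \<Gamma> (qm \<Gamma> \<one>) s"
proof -
  obtain \<beta> where "bij_betw \<beta> (orbits (G\<lparr>carrier := \<Gamma>\<rparr>) (ob S {\<one>}) \<psi>) (ob S \<Gamma>)"
    "\<And>x. x \<in> ob S {\<one>} \<Longrightarrow> \<beta> (orbit (G\<lparr>carrier := \<Gamma>\<rparr>) \<psi> x) = mor S {\<one>} \<Gamma> (qm \<Gamma> \<one>) x"
    using quot assms(1) unfolding Obj_iff by blast
  moreover from this(1) obtain O' where "O' \<in> orbits (G\<lparr>carrier := \<Gamma>\<rparr>) (ob S {\<one>}) \<psi>" "y = \<beta> O'"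
    using assms(2) unfolding bij_betw_def by blast
  ultimately show thesis using that unfolding orbits_def by auto
qed

lemma quot_eq:
  assumes \<Gamma>: "\<Gamma> \<in> Obj C" and s: "s \<in> ob S {\<one>}" "t \<in> ob S {\<one>}"
    and eq: "mor S {\<one>} \<Gamma> (qm \<Gamma> \<one>) s = mor S {\<one>} \<Gamma> (qm \<Gamma> \<one>) t"
  shows "\<exists>\<gamma>\<in>\<Gamma>. \<psi> \<gamma> s = t"
proof -
  obtain \<beta> where \<beta>: "bij_betw \<beta> (orbits (G\<lparr>carrier := \<Gamma>\<rparr>) (ob S {\<one>}) \<psi>) (ob S \<Gamma>)"
    "\<And>x. x \<in> ob S {\<one>} \<Longrightarrow> \<beta> (orbit (G\<lparr>carrier := \<Gamma>\<rparr>) \<psi> x) = mor S {\<one>} \<Gamma> (qm \<Gamma> \<one>) x"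
    using quot \<Gamma> unfolding Obj_iff by blast
  have "orbit (G\<lparr>carrier := \<Gamma>\<rparr>) \<psi> x \<in> orbits (G\<lparr>carrier := \<Gamma>\<rparr>) (ob S {\<one>}) \<psi>" if "x \<in> ob S {\<one>}" for x
    using that unfolding orbits_def by blast
  then have eq': "orbit (G\<lparr>carrier := \<Gamma>\<rparr>) \<psi> s = orbit (G\<lparr>carrier := \<Gamma>\<rparr>) \<psi> t"
    using \<beta> s eq unfolding bij_betw_def inj_on_def by metis
  have "\<one> \<in> \<Gamma>" using \<Gamma> unfolding Obj_iff covering_subgroup_def by (simp add: subgroup.one_closed)
  then have "t \<in> orbit (G\<lparr>carrier := \<Gamma>\<rparr>) \<psi> t" using psi_one[OF s(2)] unfolding orbit_def by force
  then have "t \<in> orbit (G\<lparr>carrier := \<Gamma>\<rparr>) \<psi> s" using eq' by simp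
  then show ?thesis unfolding orbit_def by auto
qed

text \<open>The mechanism of \<open>compact_imp_ball\<close> for points of \<open>S\<close>: two
  points of \<open>D\<close> with the same image differ by a conjugate of an element of the covering
  subgroup, and this conjugate lies in the finite union \<open>Q\<close> of transporters, which is
  compact because stabilizers are.\<close>

lemma injective_quotient:
  assumes \<Gamma>: "\<And>\<alpha>. \<alpha> \<in> I \<Longrightarrow> covering_subgroup G X \<phi> (\<Gamma> \<alpha>)" and c: "compact_condition I \<Gamma>"
    and D: "finite D" "D \<subseteq> ob S {\<one>}"
  shows "\<exists>\<alpha>\<in>I. \<exists>g\<in>carrier G. inj_on (mor S {\<one>} (\<Gamma> \<alpha>) (qm (\<Gamma> \<alpha>) g)) D"
proof -
  define Q where "Q = {\<one>} \<union> (\<Union>p\<in>D \<times> D. {g \<in> carrier G. \<psi> g (fst p) = snd p})"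
  have top: "topspace T = carrier G" using ell unfolding ell_group_def by auto
  have "compactin T {g \<in> carrier G. \<psi> g x = y}" if "x \<in> D" for x y
  proof (rule compact_transporter)
    have x: "x \<in> ob S {\<one>}" using that D by blast
    show "\<psi> \<one> x = x" by (rule psi_one[OF x])
    show "compactin T (stabilizer G \<psi> x)" by (rule compact_stab[OF x])
  qed (use that D psi_mult psi_inv in auto)
  then have "compactin T Q"
    unfolding Q_def using D(1) top by (intro compactin_Un compactin_Union) auto
  moreover have "\<one> \<in> Q" unfolding Q_def by simp
  ultimately obtain \<alpha> g where \<alpha>: "\<alpha> \<in> I" "g \<in> carrier G" "Q \<inter> (\<lambda>\<gamma>. inv g \<otimes> \<gamma> \<otimes> g) ` \<Gamma> \<alpha> = {\<one>}"
    using c unfolding compact_condition_def by blast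
  have Obj: "\<Gamma> \<alpha> \<in> Obj C" using \<Gamma>[OF \<alpha>(1)] unfolding Obj_iff .
  have sg: "subgroup (\<Gamma> \<alpha>) G" using \<Gamma>[OF \<alpha>(1)] unfolding covering_subgroup_def by blast
  have "inj_on (mor S {\<one>} (\<Gamma> \<alpha>) (qm (\<Gamma> \<alpha>) g)) D"
  proof (rule inj_onI)
    fix s t assume s: "s \<in> D" and t: "t \<in> D"
      and eq: "mor S {\<one>} (\<Gamma> \<alpha>) (qm (\<Gamma> \<alpha>) g) s = mor S {\<one>} (\<Gamma> \<alpha>) (qm (\<Gamma> \<alpha>) g) t"
    have S1: "s \<in> ob S {\<one>}" "t \<in> ob S {\<one>}" using s t D by auto
    have "mor S {\<one>} (\<Gamma> \<alpha>) (qm (\<Gamma> \<alpha>) \<one>) (\<psi> g s) = mor S {\<one>} (\<Gamma> \<alpha>) (qm (\<Gamma> \<alpha>) \<one>) (\<psi> g t)"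
      using eq mor_comp[OF Obj \<alpha>(2) one_closed S1(1)] mor_comp[OF Obj \<alpha>(2) one_closed S1(2)] \<alpha>(2) by simp
    then obtain \<gamma> where \<gamma>: "\<gamma> \<in> \<Gamma> \<alpha>" "\<psi> \<gamma> (\<psi> g s) = \<psi> g t"
      using quot_eq[OF Obj psi_in[OF \<alpha>(2) S1(1)] psi_in[OF \<alpha>(2) S1(2)]] by blast
    have \<gamma>G: "\<gamma> \<in> carrier G" using subgroup.mem_carrier[OF sg \<gamma>(1)] .
    let ?h = "inv g \<otimes> \<gamma> \<otimes> g"
    have h: "\<psi> ?h s = t"
      using \<alpha>(2) \<gamma>G S1 \<gamma>(2) psi_mult[of g "inv g \<otimes> \<gamma>" s] psi_mult[of \<gamma> "inv g" "\<psi> g s"] psi_in[of g s]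
        psi_inv[of g t] by simp
    then have "?h \<in> Q" unfolding Q_def using \<alpha>(2) \<gamma>G s t by (intro UnI2 UN_I[of "(s, t)"]) auto
    then have "?h = \<one>" using \<alpha>(3) \<gamma>(1) by blast
    then show "s = t" using h psi_one[OF S1(1)] by simp
  qed
  then show ?thesis using \<alpha>(1,2) by blast
qed

end

section \<open>Finitely supported functions\<close>

definition supp :: "('s \<Rightarrow> complex) \<Rightarrow> 's set" where
  "supp u = {x. u x \<noteq> 0}"

definition l1_norm :: "('s \<Rightarrow> complex) \<Rightarrow> real" where
  "l1_norm u = (\<Sum>x\<in>supp u. cmod (u x))"

definition point :: "'s \<Rightarrow> 's \<Rightarrow> complex" where
  "point s = (\<lambda>x. if x = s then 1 else 0)"

lemma fin_l2_carrier: "u \<in> carrier (fin_l2 S) \<longleftrightarrow> finite (supp u) \<and> supp u \<subseteq> S"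
  unfolding fin_l2_def supp_def by simp

lemma fin_l2_sel [simp]: "add (fin_l2 S) = (\<lambda>f g x. f x + g x)" "smult (fin_l2 S) = (\<lambda>c f x. c * f x)"
  "zero (fin_l2 S) = (\<lambda>x. 0)"
  unfolding fin_l2_def by simp_all

lemma fin_l2_ip:
  assumes "finite (supp u)" "finite Z" "supp u \<inter> supp v \<subseteq> Z"
  shows "ip (fin_l2 S) u v = (\<Sum>x\<in>Z. u x * cnj (v x))"
proof -
  have "ip (fin_l2 S) u v = (\<Sum>x\<in>supp u. u x * cnj (v x))" unfolding fin_l2_def supp_def by simp
  also have "\<dots> = (\<Sum>x\<in>supp u \<inter> supp v. u x * cnj (v x))"
    using assms by (intro sum.mono_neutral_right) (auto simp: supp_def)
  also have "\<dots> = (\<Sum>x\<in>Z. u x * cnj (v x))"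
    using assms by (intro sum.mono_neutral_left) (auto simp: supp_def)
  finally show ?thesis .
qed

lemma point_self [simp]: "point s s = 1"
  by (simp add: point_def)

lemma supp_point [simp]: "supp (point s) = {s}"
  unfolding supp_def point_def by auto

lemma point_in: "s \<in> S \<Longrightarrow> point s \<in> carrier (fin_l2 S)"
  unfolding fin_l2_carrier by simp

lemma ip_point_right: "finite (supp u) \<Longrightarrow> ip (fin_l2 S) u (point s) = u s"
  by (subst fin_l2_ip[of _ "{s}"]) auto

lemma ip_point_left: "ip (fin_l2 S) (point s) u = cnj (u s)"
  by (subst fin_l2_ip[of _ "{s}"]) auto

lemma l1_norm_bound: "finite (supp u) \<Longrightarrow> finite Z \<Longrightarrow> (\<Sum>x\<in>Z. cmod (u x)) \<le> l1_norm u"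
proof -
  assume f: "finite (supp u)" "finite Z"
  have "(\<Sum>x\<in>Z. cmod (u x)) = (\<Sum>x\<in>Z \<inter> supp u. cmod (u x))"
    using f by (intro sum.mono_neutral_right) (auto simp: supp_def)
  also have "\<dots> \<le> (\<Sum>x\<in>supp u. cmod (u x))" using f by (intro sum_mono2) auto
  finally show ?thesis unfolding l1_norm_def .
qed

lemma push_alt: "fin_l2_push f u y = (\<Sum>x\<in>{x \<in> supp u. f x = y}. u x)"
  unfolding fin_l2_push_def supp_def by simp

lemma supp_push: "supp (fin_l2_push f u) \<subseteq> f ` supp u"
proof
  fix y assume "y \<in> supp (fin_l2_push f u)"
  then have "fin_l2_push f u y \<noteq> 0" by (simp add: supp_def)
  then have "(\<Sum>x\<in>{x \<in> supp u. f x = y}. u x) \<noteq> 0" unfolding push_alt .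
  then have "{x \<in> supp u. f x = y} \<noteq> {}" by (metis sum.empty)
  then show "y \<in> f ` supp u" by blast
qed

lemma push_in: "u \<in> carrier (fin_l2 S) \<Longrightarrow> f \<in> S \<rightarrow> S' \<Longrightarrow> fin_l2_push f u \<in> carrier (fin_l2 S')"
  unfolding fin_l2_carrier using supp_push[of f u] by (auto dest: finite_subset[OF _ finite_imageI])

lemma push_point: "fin_l2_push f (point s) = point (f s)"
proof
  fix y
  have "{x \<in> supp (point s). f x = y} = (if y = f s then {s} else {})" by auto
  then show "fin_l2_push f (point s) y = point (f s) y" unfolding push_alt by (auto simp: point_def)
qed

text \<open>Unlike the l2 norm, the l1 norm cannot grow when values are added up along a map that is
  not injective; so bounds found upstairs hold for all quotients.\<close>

lemma l1_norm_push: "finite (supp u) \<Longrightarrow> l1_norm (fin_l2_push f u) \<le> l1_norm u"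
proof -
  assume f: "finite (supp u)"
  have "l1_norm (fin_l2_push f u) \<le> (\<Sum>y\<in>f ` supp u. cmod (fin_l2_push f u y))"
    unfolding l1_norm_def using supp_push[of f u] f by (intro sum_mono2) auto
  also have "\<dots> \<le> (\<Sum>y\<in>f ` supp u. \<Sum>x\<in>{x \<in> supp u. f x = y}. cmod (u x))"
    unfolding push_alt by (intro sum_mono norm_sum)
  also have "\<dots> = l1_norm u" unfolding l1_norm_def using f by (intro sum.image_gen[symmetric])
  finally show ?thesis .
qed

lemma push_inj_ip:
  assumes u: "finite (supp u)" and v: "finite (supp v)" and inj: "inj_on f (supp u \<union> supp v)"
  shows "ip (fin_l2 S') (fin_l2_push f u) (fin_l2_push f v) = ip (fin_l2 S) u v"
proof -
  let ?Z = "supp u \<union> supp v"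
  have val: "fin_l2_push f w (f x) = w x" if x: "x \<in> ?Z" and w: "supp w \<subseteq> ?Z" for w x
  proof -
    have "{z \<in> supp w. f z = f x} = (if x \<in> supp w then {x} else {})"
      using inj x w by (auto simp: inj_on_def)
    then show ?thesis unfolding push_alt by (auto simp: supp_def)
  qed
  have "finite (supp (fin_l2_push f u))" using supp_push[of f u] u finite_subset by blast
  then have "ip (fin_l2 S') (fin_l2_push f u) (fin_l2_push f v)
    = (\<Sum>y\<in>f ` ?Z. fin_l2_push f u y * cnj (fin_l2_push f v y))"
    using supp_push[of f u] u v by (intro fin_l2_ip) auto
  also have "\<dots> = (\<Sum>x\<in>?Z. fin_l2_push f u (f x) * cnj (fin_l2_push f v (f x)))"
    using inj by (simp add: sum.reindex)
  also have "\<dots> = (\<Sum>x\<in>?Z. u x * cnj (v x))" by (intro sum.cong refl) (simp add: val)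
  also have "\<dots> = ip (fin_l2 S) u v" using u v by (intro fin_l2_ip[symmetric]) auto
  finally show ?thesis .
qed

text \<open>Columns of the matrix of \<open>b\<close> are the images of points, and its rows are
  conjugate to the columns of the matrix of \<open>b'\<close>, so both have sums of moduli at most
  \<open>K\<close>. Summing 2|u_x||v_y| \<le> |u_x|^2 + |v_y|^2 against the moduli of the entries
  gives the claim.\<close>

lemma schur_test:
  fixes b b' :: "('s \<Rightarrow> complex) \<Rightarrow> 's \<Rightarrow> complex"
  assumes b_in: "\<And>u. u \<in> carrier (fin_l2 S) \<Longrightarrow> b u \<in> carrier (fin_l2 S)"
    and b'_in: "\<And>u. u \<in> carrier (fin_l2 S) \<Longrightarrow> b' u \<in> carrier (fin_l2 S)"
    and b_add: "\<And>u v. u \<in> carrier (fin_l2 S) \<Longrightarrow> v \<in> carrier (fin_l2 S) \<Longrightarrow> b (\<lambda>x. u x + v x) = (\<lambda>x. b u x + b v x)"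
    and b_smult: "\<And>c u. u \<in> carrier (fin_l2 S) \<Longrightarrow> b (\<lambda>x. c * u x) = (\<lambda>x. c * b u x)"
    and adj: "\<And>u v. u \<in> carrier (fin_l2 S) \<Longrightarrow> v \<in> carrier (fin_l2 S) \<Longrightarrow>
       ip (fin_l2 S) (b u) v = ip (fin_l2 S) u (b' v)"
    and K: "\<And>s. s \<in> S \<Longrightarrow> l1_norm (b (point s)) \<le> K" and K': "\<And>s. s \<in> S \<Longrightarrow> l1_norm (b' (point s)) \<le> K"
    and u: "u \<in> carrier (fin_l2 S)" and v: "v \<in> carrier (fin_l2 S)"
  shows "2 * cmod (ip (fin_l2 S) (b u) v)
    \<le> K * (Re (ip (fin_l2 S) u u) + Re (ip (fin_l2 S) v v))"
proof -
  let ?k = "\<lambda>y x. b (point x) y"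
  have fu: "finite (supp u)" "supp u \<subseteq> S" and fv: "finite (supp v)" "supp v \<subseteq> S"
    using u v unfolding fin_l2_carrier by auto
  have expand: "b u y = (\<Sum>x\<in>supp u. u x * ?k y x)" for y
  proof -
    \<comment> \<open>Linearity is available for two summands at a time, hence the induction over a
      finite support.\<close>
    have "b (\<lambda>y. \<Sum>x\<in>Z. u x * point x y) y = (\<Sum>x\<in>Z. u x * ?k y x) \<and> (\<lambda>y. \<Sum>x\<in>Z. u x * point x y) \<in> carrier (fin_l2 S)"
      if "finite Z" "Z \<subseteq> S" for Z
      using that
    proof (induction Z)
      case empty
      have z: "(\<lambda>_. 0) \<in> carrier (fin_l2 S)" unfolding fin_l2_carrier supp_def by simp
      from b_smult[OF z, of 0] have "b (\<lambda>_. 0) y = 0" by (simp add: fun_eq_iff)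
      then show ?case using z by simp
    next
      case (insert x Z)
      have p: "point x \<in> carrier (fin_l2 S)" using insert.prems by (intro point_in) simp
      then have xp: "(\<lambda>y. u x * point x y) \<in> carrier (fin_l2 S)"
        unfolding fin_l2_carrier supp_def by (auto intro: finite_subset)
      have IH: "b (\<lambda>y. \<Sum>x\<in>Z. u x * point x y) y = (\<Sum>x\<in>Z. u x * ?k y x)" "(\<lambda>y. \<Sum>x\<in>Z. u x * point x y) \<in> carrier (fin_l2 S)"
        using insert by auto
      have "(\<lambda>y. u x * point x y + (\<Sum>x\<in>Z. u x * point x y)) \<in> carrier (fin_l2 S)"
      proof -
        have "supp (\<lambda>y. u x * point x y + (\<Sum>x\<in>Z. u x * point x y))
          \<subseteq> supp (\<lambda>y. u x * point x y) \<union> supp (\<lambda>y. \<Sum>x\<in>Z. u x * point x y)"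
          by (auto simp: supp_def)
        then show ?thesis using xp IH(2) finite_subset unfolding fin_l2_carrier by blast
      qed
      then show ?case
        using insert.hyps b_add[OF xp IH(2)] b_smult[OF p, of "u x"] IH(1) by simp
    qed
    from this[OF fu, THEN conjunct1] have "b (\<lambda>y. \<Sum>x\<in>supp u. u x * point x y) y = (\<Sum>x\<in>supp u. u x * ?k y x)" .
    moreover have "(\<lambda>y. \<Sum>x\<in>supp u. u x * point x y) = u"
    proof
      fix z
      have "(\<Sum>x\<in>supp u. u x * point x z) = (\<Sum>x\<in>supp u. if x = z then u z else 0)"
        by (intro sum.cong) (auto simp: point_def)
      then show "(\<Sum>x\<in>supp u. u x * point x z) = u z" using fu by (simp add: supp_def)
    qed
    ultimately show ?thesis by simp
  qed
  have bu: "finite (supp (b u))" using b_in[OF u] unfolding fin_l2_carrier by blast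
  have ipv: "ip (fin_l2 S) (b u) v = (\<Sum>y\<in>supp v. \<Sum>x\<in>supp u. u x * ?k y x * cnj (v y))"
    using bu fv by (subst fin_l2_ip[of _ "supp v"]) (auto simp: expand sum_distrib_right)
  have col: "(\<Sum>y\<in>supp v. cmod (?k y x)) \<le> K" if x: "x \<in> supp u" for x
  proof -
    have "x \<in> S" using x fu by blast
    then have "finite (supp (b (point x)))" using b_in[OF point_in] unfolding fin_l2_carrier by blast
    then show ?thesis using l1_norm_bound[of "b (point x)" "supp v"] fv(1) K[OF \<open>x \<in> S\<close>] by linarith
  qed
  have row: "(\<Sum>x\<in>supp u. cmod (?k y x)) \<le> K" if y: "y \<in> supp v" for y
  proof -
    have "y \<in> S" using y fv by blast
    then have fin: "finite (supp (b' (point y)))" using b'_in[OF point_in] unfolding fin_l2_carrier by blast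
    have "?k y x = cnj (b' (point y) x)" if "x \<in> supp u" for x
    proof -
      have "x \<in> S" using that fu by blast
      then have "finite (supp (b (point x)))" using b_in[OF point_in] unfolding fin_l2_carrier by blast
      then have "?k y x = ip (fin_l2 S) (b (point x)) (point y)" by (simp add: ip_point_right)
      also have "\<dots> = ip (fin_l2 S) (point x) (b' (point y))"
        by (rule adj[OF point_in[OF \<open>x \<in> S\<close>] point_in[OF \<open>y \<in> S\<close>]])
      finally show ?thesis by (simp add: ip_point_left)
    qed
    then have "(\<Sum>x\<in>supp u. cmod (?k y x)) = (\<Sum>x\<in>supp u. cmod (b' (point y) x))" by simp
    then show ?thesis using l1_norm_bound[OF fin fu(1)] K'[OF \<open>y \<in> S\<close>] by linarith
  qed
  have sq: "Re (ip (fin_l2 S) w w) = (\<Sum>x\<in>supp w. (cmod (w x))\<^sup>2)" if "finite (supp w)" for w :: "'s \<Rightarrow> complex"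
  proof -
    have "Re (z * cnj z) = (cmod z)\<^sup>2" for z by (simp only: cmod_power2) (simp add: power2_eq_square)
    then show ?thesis using that fin_l2_ip[of w "supp w" w] by (simp only: Re_sum) simp
  qed
  have "2 * cmod (ip (fin_l2 S) (b u) v)
      \<le> 2 * (\<Sum>y\<in>supp v. \<Sum>x\<in>supp u. cmod (u x) * cmod (?k y x) * cmod (v y))"
    unfolding ipv by (intro mult_left_mono order_trans[OF norm_sum] sum_mono) (auto simp: norm_mult)
  also have "\<dots> = (\<Sum>y\<in>supp v. \<Sum>x\<in>supp u. cmod (?k y x) * (2 * (cmod (u x) * cmod (v y))))"
    by (simp add: sum_distrib_left mult_ac)
  also have "\<dots> \<le> (\<Sum>y\<in>supp v. \<Sum>x\<in>supp u. cmod (?k y x) * ((cmod (u x))\<^sup>2 + (cmod (v y))\<^sup>2))"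
    using sum_squares_bound by (intro sum_mono mult_left_mono) (auto simp: mult.assoc)
  also have "\<dots> = (\<Sum>y\<in>supp v. \<Sum>x\<in>supp u. (cmod (u x))\<^sup>2 * cmod (?k y x)) + (\<Sum>y\<in>supp v. (cmod (v y))\<^sup>2 * (\<Sum>x\<in>supp u. cmod (?k y x)))"
    by (simp add: ring_distribs sum.distrib sum_distrib_left mult.commute)
  also have "(\<Sum>y\<in>supp v. \<Sum>x\<in>supp u. (cmod (u x))\<^sup>2 * cmod (?k y x)) = (\<Sum>x\<in>supp u. (cmod (u x))\<^sup>2 * (\<Sum>y\<in>supp v. cmod (?k y x)))"
    by (subst sum.swap) (simp add: sum_distrib_left)
  also have "\<dots> + (\<Sum>y\<in>supp v. (cmod (v y))\<^sup>2 * (\<Sum>x\<in>supp u. cmod (?k y x)))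
     \<le> (\<Sum>x\<in>supp u. (cmod (u x))\<^sup>2 * K) + (\<Sum>y\<in>supp v. (cmod (v y))\<^sup>2 * K)"
    by (intro add_mono sum_mono mult_left_mono col row) auto
  also have "\<dots> = K * (Re (ip (fin_l2 S) u u) + Re (ip (fin_l2 S) v v))"
    unfolding sq[OF fu(1)] sq[OF fv(1)] by (simp add: sum_distrib_left ring_distribs mult.commute)
  finally show ?thesis .
qed

section \<open>Semi-elementary functors\<close>

lemma fin_l2_add_in:
  assumes "u \<in> carrier (fin_l2 S)" "v \<in> carrier (fin_l2 S)"
  shows "(\<lambda>x. u x + v x) \<in> carrier (fin_l2 S)"
proof -
  have "supp (\<lambda>x. u x + v x) \<subseteq> supp u \<union> supp v" by (auto simp: supp_def)
  then show ?thesis using assms finite_subset unfolding fin_l2_carrier by blast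
qed

lemma fin_l2_smult_in:
  assumes "u \<in> carrier (fin_l2 S)"
  shows "(\<lambda>x. c * u x) \<in> carrier (fin_l2 S)"
proof -
  have "supp (\<lambda>x. c * u x) \<subseteq> supp u" by (auto simp: supp_def)
  then show ?thesis using assms finite_subset unfolding fin_l2_carrier by blast
qed

lemma direct_sum_sel [simp]:
  "carrier (direct_sum V W) = carrier V \<times> carrier W"
  "zero (direct_sum V W) = (\<zero>\<^bsub>V\<^esub>, \<zero>\<^bsub>W\<^esub>)"
  "(u, w) \<oplus>\<^bsub>direct_sum V W\<^esub> (u', w') = (u \<oplus>\<^bsub>V\<^esub> u', w \<oplus>\<^bsub>W\<^esub> w')"
  "c \<odot>\<^bsub>direct_sum V W\<^esub> (u, w) = (c \<odot>\<^bsub>V\<^esub> u, c \<odot>\<^bsub>W\<^esub> w)"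
  "ip (direct_sum V W) (u, w) (u', w') = ip V u u' + ip W w w'"
  unfolding direct_sum_def by simp_all

locale semi_elementary_functor = cell_functor G T X \<phi> S
  for G :: "('g, 'k) monoid_scheme" (structure) and T :: "'g topology"
    and X :: "'c rel" and \<phi> :: "'g \<Rightarrow> 'c \<Rightarrow> 'c"
    and S :: "('g set, 'c set \<Rightarrow> 'c set, 's set, 's \<Rightarrow> 's) cfunctor" +
  fixes F :: "('g set, 'c set \<Rightarrow> 'c set, 'v inner_space, 'v \<Rightarrow> 'v) cfunctor"
    and F' :: "('g set, 'c set \<Rightarrow> 'c set, 'w inner_space, 'w \<Rightarrow> 'w) cfunctor"
    and \<Theta> :: "'g set \<Rightarrow> ('s \<Rightarrow> complex) \<Rightarrow> 'v \<times> 'w"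
  assumes F: "phil_functor C F" and F': "phil_functor C F'"
    and \<Theta>: "\<Theta> \<in> nat_trans C (l2_functor S) (sum_functor F F')"
    and \<Theta>_unitary: "\<Gamma> \<in> Obj C \<Longrightarrow> unitary_map (fin_l2 (ob S \<Gamma>)) (direct_sum (ob F \<Gamma>) (ob F' \<Gamma>)) (\<Theta> \<Gamma>)"
begin

lemma prehil_F: "\<Gamma> \<in> Obj C \<Longrightarrow> prehil (ob F \<Gamma>)"
  using F unfolding phil_functor_def prehil_def by blast

lemma prehil_F': "\<Gamma> \<in> Obj C \<Longrightarrow> prehil (ob F' \<Gamma>)"
  using F' unfolding phil_functor_def prehil_def by blast

lemma zero_F': "\<Gamma> \<in> Obj C \<Longrightarrow> \<zero>\<^bsub>ob F' \<Gamma>\<^esub> \<in> carrier (ob F' \<Gamma>)"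
proof -
  assume "\<Gamma> \<in> Obj C"
  then interpret prehil "ob F' \<Gamma>" by (rule prehil_F')
  show ?thesis by simp
qed

text \<open>The inclusion of \<open>F \<Gamma>\<close> as first summand into the finitely supported
  functions on \<open>S \<Gamma>\<close>. It is isometric, and \<open>proj\<close> below is its
  adjoint.\<close>

definition emb :: "'g set \<Rightarrow> 'v \<Rightarrow> 's \<Rightarrow> complex" where
  "emb \<Gamma> u = inv_into (carrier (fin_l2 (ob S \<Gamma>))) (\<Theta> \<Gamma>) (u, \<zero>\<^bsub>ob F' \<Gamma>\<^esub>)"

definition proj :: "'g set \<Rightarrow> ('s \<Rightarrow> complex) \<Rightarrow> 'v" where
  "proj \<Gamma> \<xi> = fst (\<Theta> \<Gamma> \<xi>)"

lemma Theta_bij: "\<Gamma> \<in> Obj C \<Longrightarrow> bij_betw (\<Theta> \<Gamma>) (carrier (fin_l2 (ob S \<Gamma>))) (carrier (ob F \<Gamma>) \<times> carrier (ob F' \<Gamma>))"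
  using \<Theta>_unitary[of \<Gamma>] unfolding unitary_map_def by simp

lemma Theta_ip:
  "\<Gamma> \<in> Obj C \<Longrightarrow> \<xi> \<in> carrier (fin_l2 (ob S \<Gamma>)) \<Longrightarrow> \<eta> \<in> carrier (fin_l2 (ob S \<Gamma>)) \<Longrightarrow>
    ip (direct_sum (ob F \<Gamma>) (ob F' \<Gamma>)) (\<Theta> \<Gamma> \<xi>) (\<Theta> \<Gamma> \<eta>) = ip (fin_l2 (ob S \<Gamma>)) \<xi> \<eta>"
  using \<Theta>_unitary[of \<Gamma>] unfolding unitary_map_def by blast

lemma Theta_add:
  "\<Gamma> \<in> Obj C \<Longrightarrow> \<xi> \<in> carrier (fin_l2 (ob S \<Gamma>)) \<Longrightarrow> \<eta> \<in> carrier (fin_l2 (ob S \<Gamma>)) \<Longrightarrow>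
    \<Theta> \<Gamma> (\<lambda>x. \<xi> x + \<eta> x) = \<Theta> \<Gamma> \<xi> \<oplus>\<^bsub>direct_sum (ob F \<Gamma>) (ob F' \<Gamma>)\<^esub> \<Theta> \<Gamma> \<eta>"
  using \<Theta>_unitary[of \<Gamma>] unfolding unitary_map_def linear_map_def by simp

lemma Theta_smult:
  "\<Gamma> \<in> Obj C \<Longrightarrow> \<xi> \<in> carrier (fin_l2 (ob S \<Gamma>)) \<Longrightarrow>
    \<Theta> \<Gamma> (\<lambda>x. c * \<xi> x) = c \<odot>\<^bsub>direct_sum (ob F \<Gamma>) (ob F' \<Gamma>)\<^esub> \<Theta> \<Gamma> \<xi>"
  using \<Theta>_unitary[of \<Gamma>] unfolding unitary_map_def linear_map_def by simp

lemma emb: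
  assumes "\<Gamma> \<in> Obj C" "u \<in> carrier (ob F \<Gamma>)"
  shows "emb \<Gamma> u \<in> carrier (fin_l2 (ob S \<Gamma>))" "\<Theta> \<Gamma> (emb \<Gamma> u) = (u, \<zero>\<^bsub>ob F' \<Gamma>\<^esub>)"
proof -
  have "(u, \<zero>\<^bsub>ob F' \<Gamma>\<^esub>) \<in> \<Theta> \<Gamma> ` carrier (fin_l2 (ob S \<Gamma>))"
    using Theta_bij[OF assms(1)] assms zero_F' unfolding bij_betw_def by auto
  then show "emb \<Gamma> u \<in> carrier (fin_l2 (ob S \<Gamma>))" "\<Theta> \<Gamma> (emb \<Gamma> u) = (u, \<zero>\<^bsub>ob F' \<Gamma>\<^esub>)"
    unfolding emb_def by (rule inv_into_into, rule f_inv_into_f)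
qed

lemma emb_unique:
  assumes "\<Gamma> \<in> Obj C" "u \<in> carrier (ob F \<Gamma>)" "\<xi> \<in> carrier (fin_l2 (ob S \<Gamma>))" "\<Theta> \<Gamma> \<xi> = (u, \<zero>\<^bsub>ob F' \<Gamma>\<^esub>)"
  shows "emb \<Gamma> u = \<xi>"
  using Theta_bij[OF assms(1)] emb[OF assms(1,2)] assms(3,4) unfolding bij_betw_def inj_on_def by metis

lemma proj_in: "\<Gamma> \<in> Obj C \<Longrightarrow> \<xi> \<in> carrier (fin_l2 (ob S \<Gamma>)) \<Longrightarrow> proj \<Gamma> \<xi> \<in> carrier (ob F \<Gamma>)"
proof -
  assume "\<Gamma> \<in> Obj C" "\<xi> \<in> carrier (fin_l2 (ob S \<Gamma>))"
  then have "\<Theta> \<Gamma> \<xi> \<in> carrier (ob F \<Gamma>) \<times> carrier (ob F' \<Gamma>)"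
    using Theta_bij[of \<Gamma>] unfolding bij_betw_def by blast
  then show ?thesis unfolding proj_def by auto
qed

lemma proj_emb: "\<Gamma> \<in> Obj C \<Longrightarrow> u \<in> carrier (ob F \<Gamma>) \<Longrightarrow> proj \<Gamma> (emb \<Gamma> u) = u"
  unfolding proj_def by (simp add: emb)

lemma ip_proj:
  assumes \<Gamma>: "\<Gamma> \<in> Obj C" and \<xi>: "\<xi> \<in> carrier (fin_l2 (ob S \<Gamma>))" and u: "u \<in> carrier (ob F \<Gamma>)"
  shows "ip (ob F \<Gamma>) (proj \<Gamma> \<xi>) u = ip (fin_l2 (ob S \<Gamma>)) \<xi> (emb \<Gamma> u)"
    "ip (ob F \<Gamma>) u (proj \<Gamma> \<xi>) = ip (fin_l2 (ob S \<Gamma>)) (emb \<Gamma> u) \<xi>"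
proof -
  interpret P': prehil "ob F' \<Gamma>" by (rule prehil_F'[OF \<Gamma>])
  have "\<Theta> \<Gamma> \<xi> \<in> carrier (ob F \<Gamma>) \<times> carrier (ob F' \<Gamma>)"
    using Theta_bij[OF \<Gamma>] \<xi> unfolding bij_betw_def by blast
  then obtain x y where xy: "\<Theta> \<Gamma> \<xi> = (x, y)" "x \<in> carrier (ob F \<Gamma>)" "y \<in> carrier (ob F' \<Gamma>)" by auto
  show "ip (ob F \<Gamma>) (proj \<Gamma> \<xi>) u = ip (fin_l2 (ob S \<Gamma>)) \<xi> (emb \<Gamma> u)"
    using Theta_ip[OF \<Gamma> \<xi> emb(1)[OF \<Gamma> u]] emb(2)[OF \<Gamma> u] xy unfolding proj_def by simp
  show "ip (ob F \<Gamma>) u (proj \<Gamma> \<xi>) = ip (fin_l2 (ob S \<Gamma>)) (emb \<Gamma> u) \<xi>"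
    using Theta_ip[OF \<Gamma> emb(1)[OF \<Gamma> u] \<xi>] emb(2)[OF \<Gamma> u] xy unfolding proj_def by simp
qed

lemma ip_emb:
  "\<Gamma> \<in> Obj C \<Longrightarrow> u \<in> carrier (ob F \<Gamma>) \<Longrightarrow> v \<in> carrier (ob F \<Gamma>) \<Longrightarrow>
    ip (fin_l2 (ob S \<Gamma>)) (emb \<Gamma> u) (emb \<Gamma> v) = ip (ob F \<Gamma>) u v"
  using ip_proj(1)[of \<Gamma> "emb \<Gamma> u" v] emb(1)[of \<Gamma> u] proj_emb[of \<Gamma> u] by simp

lemma proj_add:
  "\<Gamma> \<in> Obj C \<Longrightarrow> \<xi> \<in> carrier (fin_l2 (ob S \<Gamma>)) \<Longrightarrow> \<eta> \<in> carrier (fin_l2 (ob S \<Gamma>)) \<Longrightarrow>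
    proj \<Gamma> (\<lambda>x. \<xi> x + \<eta> x) = proj \<Gamma> \<xi> \<oplus>\<^bsub>ob F \<Gamma>\<^esub> proj \<Gamma> \<eta>"
  unfolding proj_def by (simp add: Theta_add) (cases "\<Theta> \<Gamma> \<xi>"; cases "\<Theta> \<Gamma> \<eta>"; simp)

lemma proj_smult:
  "\<Gamma> \<in> Obj C \<Longrightarrow> \<xi> \<in> carrier (fin_l2 (ob S \<Gamma>)) \<Longrightarrow> proj \<Gamma> (\<lambda>x. c * \<xi> x) = c \<odot>\<^bsub>ob F \<Gamma>\<^esub> proj \<Gamma> \<xi>"
  unfolding proj_def by (simp add: Theta_smult) (cases "\<Theta> \<Gamma> \<xi>"; simp)

lemma emb_add:
  assumes \<Gamma>: "\<Gamma> \<in> Obj C" and u: "u \<in> carrier (ob F \<Gamma>)" "v \<in> carrier (ob F \<Gamma>)"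
  shows "emb \<Gamma> (u \<oplus>\<^bsub>ob F \<Gamma>\<^esub> v) = (\<lambda>x. emb \<Gamma> u x + emb \<Gamma> v x)"
proof -
  interpret P: prehil "ob F \<Gamma>" by (rule prehil_F[OF \<Gamma>])
  interpret P': prehil "ob F' \<Gamma>" by (rule prehil_F'[OF \<Gamma>])
  show ?thesis
    using u by (intro emb_unique[OF \<Gamma>] fin_l2_add_in) (simp_all add: emb[OF \<Gamma>] Theta_add[OF \<Gamma>])
qed

lemma emb_smult:
  assumes \<Gamma>: "\<Gamma> \<in> Obj C" and u: "u \<in> carrier (ob F \<Gamma>)"
  shows "emb \<Gamma> (c \<odot>\<^bsub>ob F \<Gamma>\<^esub> u) = (\<lambda>x. c * emb \<Gamma> u x)"
proof -
  interpret P: prehil "ob F \<Gamma>" by (rule prehil_F[OF \<Gamma>])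
  interpret P': prehil "ob F' \<Gamma>" by (rule prehil_F'[OF \<Gamma>])
  show ?thesis
    using u P'.smult_r_null[of c]
    by (intro emb_unique[OF \<Gamma>] fin_l2_smult_in) (simp_all add: emb[OF \<Gamma>] Theta_smult[OF \<Gamma>])
qed

lemma mor_F_in: "\<Gamma> \<in> Obj C \<Longrightarrow> g \<in> carrier G \<Longrightarrow> u \<in> carrier (ob F {\<one>}) \<Longrightarrow> mor F {\<one>} \<Gamma> (qm \<Gamma> g) u \<in> carrier (ob F \<Gamma>)"
  using F one_Obj qm_Hom unfolding phil_functor_def linear_map_def by blast

lemma push_mor_in:
  "\<Gamma> \<in> Obj C \<Longrightarrow> g \<in> carrier G \<Longrightarrow> \<xi> \<in> carrier (fin_l2 (ob S {\<one>})) \<Longrightarrow>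
    fin_l2_push (mor S {\<one>} \<Gamma> (qm \<Gamma> g)) \<xi> \<in> carrier (fin_l2 (ob S \<Gamma>))"
  using mor_in by (intro push_in[of \<xi> "ob S {\<one>}"]) auto

lemma Theta_natural:
  assumes "\<Gamma> \<in> Obj C" "g \<in> carrier G" "\<xi> \<in> carrier (fin_l2 (ob S {\<one>}))"
  shows "\<Theta> \<Gamma> (fin_l2_push (mor S {\<one>} \<Gamma> (qm \<Gamma> g)) \<xi>)
    = map_prod (mor F {\<one>} \<Gamma> (qm \<Gamma> g)) (mor F' {\<one>} \<Gamma> (qm \<Gamma> g)) (\<Theta> {\<one>} \<xi>)"
proof -
  have "\<forall>x\<in>Obj C. \<forall>y\<in>Obj C. \<forall>f\<in>Hom C x y. \<forall>u\<in>carrier (ob (l2_functor S) x).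
    \<Theta> y (mor (l2_functor S) x y f u) = mor (sum_functor F F') x y f (\<Theta> x u)"
    using \<Theta> unfolding nat_trans_def by blast
  from this[rule_format, OF one_Obj assms(1) qm_Hom[OF assms(2)], of \<xi>]
  show ?thesis using assms(3) unfolding l2_functor_def sum_functor_def by simp
qed

lemma proj_natural:
  assumes "\<Gamma> \<in> Obj C" "g \<in> carrier G" "\<xi> \<in> carrier (fin_l2 (ob S {\<one>}))"
  shows "proj \<Gamma> (fin_l2_push (mor S {\<one>} \<Gamma> (qm \<Gamma> g)) \<xi>) = mor F {\<one>} \<Gamma> (qm \<Gamma> g) (proj {\<one>} \<xi>)"
  unfolding proj_def Theta_natural[OF assms] by simp

lemma emb_natural:
  assumes \<Gamma>: "\<Gamma> \<in> Obj C" and g: "g \<in> carrier G" and u: "u \<in> carrier (ob F {\<one>})"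
  shows "emb \<Gamma> (mor F {\<one>} \<Gamma> (qm \<Gamma> g) u) = fin_l2_push (mor S {\<one>} \<Gamma> (qm \<Gamma> g)) (emb {\<one>} u)"
proof (rule emb_unique[OF \<Gamma> mor_F_in[OF \<Gamma> g u] push_mor_in[OF \<Gamma> g emb(1)[OF one_Obj u]]])
  \<comment> \<open>The second component has to remain 0, which follows from homogeneity with scalar
    0.\<close>
  have "mor F' {\<one>} \<Gamma> (qm \<Gamma> g) \<zero>\<^bsub>ob F' {\<one>}\<^esub> = \<zero>\<^bsub>ob F' \<Gamma>\<^esub>"
  proof -
    interpret P1: prehil "ob F' {\<one>}" by (rule prehil_F'[OF one_Obj])
    interpret P: prehil "ob F' \<Gamma>" by (rule prehil_F'[OF \<Gamma>])
    have l: "linear_map (ob F' {\<one>}) (ob F' \<Gamma>) (mor F' {\<one>} \<Gamma> (qm \<Gamma> g))"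
      using F' \<Gamma> one_Obj qm_Hom[OF g] unfolding phil_functor_def by blast
    define z where "z = mor F' {\<one>} \<Gamma> (qm \<Gamma> g) \<zero>\<^bsub>ob F' {\<one>}\<^esub>"
    have z: "z \<in> carrier (ob F' \<Gamma>)" using l unfolding z_def linear_map_def by auto
    have "mor F' {\<one>} \<Gamma> (qm \<Gamma> g) (0 \<odot>\<^bsub>ob F' {\<one>}\<^esub> \<zero>\<^bsub>ob F' {\<one>}\<^esub>) = 0 \<odot>\<^bsub>ob F' \<Gamma>\<^esub> z"
      using l P1.M.zero_closed unfolding z_def linear_map_def by blast
    then show ?thesis using P1.smult_r_null[of 0] P.smult_l_null[OF z] unfolding z_def by simp
  qed
  then show "\<Theta> \<Gamma> (fin_l2_push (mor S {\<one>} \<Gamma> (qm \<Gamma> g)) (emb {\<one>} u)) = (mor F {\<one>} \<Gamma> (qm \<Gamma> g) u, \<zero>\<^bsub>ob F' \<Gamma>\<^esub>)"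
    using Theta_natural[OF \<Gamma> g emb(1)[OF one_Obj u]] emb(2)[OF one_Obj u] by simp
qed

lemma nat_transD:
  assumes a: "a \<in> nat_trans C F F" and \<Gamma>: "\<Gamma> \<in> Obj C"
  shows "u \<in> carrier (ob F \<Gamma>) \<Longrightarrow> a \<Gamma> u \<in> carrier (ob F \<Gamma>)"
    "u \<in> carrier (ob F \<Gamma>) \<Longrightarrow> v \<in> carrier (ob F \<Gamma>) \<Longrightarrow> a \<Gamma> (u \<oplus>\<^bsub>ob F \<Gamma>\<^esub> v) = a \<Gamma> u \<oplus>\<^bsub>ob F \<Gamma>\<^esub> a \<Gamma> v"
    "u \<in> carrier (ob F \<Gamma>) \<Longrightarrow> a \<Gamma> (c \<odot>\<^bsub>ob F \<Gamma>\<^esub> u) = c \<odot>\<^bsub>ob F \<Gamma>\<^esub> a \<Gamma> u"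
    "g \<in> carrier G \<Longrightarrow> w \<in> carrier (ob F {\<one>}) \<Longrightarrow> a \<Gamma> (mor F {\<one>} \<Gamma> (qm \<Gamma> g) w) = mor F {\<one>} \<Gamma> (qm \<Gamma> g) (a {\<one>} w)"
proof -
  have lin: "linear_map (ob F \<Gamma>) (ob F \<Gamma>) (a \<Gamma>)" using a \<Gamma> unfolding nat_trans_def by blast
  show "u \<in> carrier (ob F \<Gamma>) \<Longrightarrow> a \<Gamma> u \<in> carrier (ob F \<Gamma>)" for u using lin unfolding linear_map_def by blast
  show "u \<in> carrier (ob F \<Gamma>) \<Longrightarrow> v \<in> carrier (ob F \<Gamma>) \<Longrightarrow> a \<Gamma> (u \<oplus>\<^bsub>ob F \<Gamma>\<^esub> v) = a \<Gamma> u \<oplus>\<^bsub>ob F \<Gamma>\<^esub> a \<Gamma> v"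
    using lin unfolding linear_map_def by blast
  show "u \<in> carrier (ob F \<Gamma>) \<Longrightarrow> a \<Gamma> (c \<odot>\<^bsub>ob F \<Gamma>\<^esub> u) = c \<odot>\<^bsub>ob F \<Gamma>\<^esub> a \<Gamma> u"
    using lin unfolding linear_map_def by blast
  assume g: "g \<in> carrier G" and w: "w \<in> carrier (ob F {\<one>})"
  have "\<forall>x\<in>Obj C. \<forall>y\<in>Obj C. \<forall>f\<in>Hom C x y. \<forall>u\<in>carrier (ob F x). a y (mor F x y f u) = mor F x y f (a x u)"
    using a unfolding nat_trans_def by blast
  from this[rule_format, OF one_Obj \<Gamma> qm_Hom[OF g] w]
  show "a \<Gamma> (mor F {\<one>} \<Gamma> (qm \<Gamma> g) w) = mor F {\<one>} \<Gamma> (qm \<Gamma> g) (a {\<one>} w)" .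
qed

text \<open>The operator that is \<open>a\<close> on \<open>F\<close> and 0 on the complementary
  summand, transported along \<open>\<Theta>\<close>; it can be tested on points of
  \<open>S\<close>.\<close>

definition lift :: "('g set \<Rightarrow> 'v \<Rightarrow> 'v) \<Rightarrow> 'g set \<Rightarrow> ('s \<Rightarrow> complex) \<Rightarrow> 's \<Rightarrow> complex" where
  "lift a \<Gamma> \<xi> = emb \<Gamma> (a \<Gamma> (proj \<Gamma> \<xi>))"

lemma lift_in:
  "a \<in> nat_trans C F F \<Longrightarrow> \<Gamma> \<in> Obj C \<Longrightarrow> \<xi> \<in> carrier (fin_l2 (ob S \<Gamma>)) \<Longrightarrow> lift a \<Gamma> \<xi> \<in> carrier (fin_l2 (ob S \<Gamma>))"
  unfolding lift_def by (rule emb(1)[OF _ nat_transD(1)[OF _ _ proj_in]])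

lemma lift_natural:
  assumes a: "a \<in> nat_trans C F F" and \<Gamma>: "\<Gamma> \<in> Obj C" and g: "g \<in> carrier G"
    and \<xi>: "\<xi> \<in> carrier (fin_l2 (ob S {\<one>}))"
  shows "lift a \<Gamma> (fin_l2_push (mor S {\<one>} \<Gamma> (qm \<Gamma> g)) \<xi>) = fin_l2_push (mor S {\<one>} \<Gamma> (qm \<Gamma> g)) (lift a {\<one>} \<xi>)"
  unfolding lift_def proj_natural[OF \<Gamma> g \<xi>]
    nat_transD(4)[OF a \<Gamma> g proj_in[OF one_Obj \<xi>]]
  by (rule emb_natural[OF \<Gamma> g nat_transD(1)[OF a one_Obj proj_in[OF one_Obj \<xi>]]])

text \<open>
  A natural transformation is determined on the points of \<open>S \<Gamma>\<close> by its values on representatives of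
  the finitely many \<open>G\<close>-orbits, whence a bound independent of \<open>\<Gamma>\<close>.
\<close>

lemma lift_l1_bounded:
  assumes a: "a \<in> nat_trans C F F"
  shows "\<exists>K. \<forall>\<Gamma>\<in>Obj C. \<forall>y\<in>ob S \<Gamma>. l1_norm (lift a \<Gamma> (point y)) \<le> K"
proof -
  have fin: "finite (supp (lift a {\<one>} (point s)))" if "s \<in> ob S {\<one>}" for s
    using lift_in[OF a one_Obj point_in[OF that]] unfolding fin_l2_carrier by blast
  define r where "r O' = (SOME s. s \<in> O' \<and> s \<in> ob S {\<one>})" for O'
  define K where "K = (\<Sum>O'\<in>orbits G (ob S {\<one>}) \<psi>. l1_norm (lift a {\<one>} (point (r O'))))"
  have nn: "0 \<le> l1_norm u" for u :: "'s \<Rightarrow> complex" unfolding l1_norm_def by (simp add: sum_nonneg)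
  have base: "l1_norm (lift a {\<one>} (point s)) \<le> K" if s: "s \<in> ob S {\<one>}" for s
  proof -
    let ?O = "orbit G \<psi> s"
    have O: "?O \<in> orbits G (ob S {\<one>}) \<psi>" using s unfolding orbits_def by blast
    have "s \<in> ?O" unfolding orbit_def using psi_one[OF s] by force
    then have "r ?O \<in> ?O \<and> r ?O \<in> ob S {\<one>}"
      unfolding r_def using s by (intro someI[of "\<lambda>t. t \<in> ?O \<and> t \<in> ob S {\<one>}"]) auto
    then obtain g where g: "g \<in> carrier G" "r ?O = \<psi> g s" and rS: "r ?O \<in> ob S {\<one>}"
      unfolding orbit_def by blast
    then have s_eq: "s = \<psi> (inv g) (r ?O)" using psi_inv[OF g(1) s] by simp
    have "point s = fin_l2_push (mor S {\<one>} {\<one>} (qm {\<one>} (inv g))) (point (r ?O))"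
      unfolding push_point using s_eq unfolding induced_action_def by simp
    then have "lift a {\<one>} (point s) = fin_l2_push (mor S {\<one>} {\<one>} (qm {\<one>} (inv g))) (lift a {\<one>} (point (r ?O)))"
      using lift_natural[OF a one_Obj inv_closed[OF g(1)] point_in[OF rS]] by simp
    then have "l1_norm (lift a {\<one>} (point s)) \<le> l1_norm (lift a {\<one>} (point (r ?O)))"
      using l1_norm_push fin[OF rS] by simp
    also have "\<dots> \<le> K"
      unfolding K_def using finite_orbits O nn
      by (intro member_le_sum[where f = "\<lambda>O'. l1_norm (lift a {\<one>} (point (r O')))"]) auto
    finally show ?thesis .
  qed
  have "l1_norm (lift a \<Gamma> (point y)) \<le> K" if \<Gamma>: "\<Gamma> \<in> Obj C" and y: "y \<in> ob S \<Gamma>" for \<Gamma> y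
  proof -
    obtain s where s: "s \<in> ob S {\<one>}" "y = mor S {\<one>} \<Gamma> (qm \<Gamma> \<one>) s" using quot_surj[OF \<Gamma> y] by blast
    have "lift a \<Gamma> (point y) = fin_l2_push (mor S {\<one>} \<Gamma> (qm \<Gamma> \<one>)) (lift a {\<one>} (point s))"
      using lift_natural[OF a \<Gamma> one_closed point_in[OF s(1)]] s(2) by (simp add: push_point)
    then have "l1_norm (lift a \<Gamma> (point y)) \<le> l1_norm (lift a {\<one>} (point s))"
      using l1_norm_push[OF fin[OF s(1)]] by simp
    also have "\<dots> \<le> K" by (rule base[OF s(1)])
    finally show ?thesis .
  qed
  then show ?thesis by blast
qed

text \<open>The lifts of \<open>a\<close> and of its adjoint have l1 bounds on points that are
  independent of \<Gamma>, the latter controlling the rows. The Schur test then bounds the inner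
  product of \<open>a \<Gamma> x\<close> with \<open>y\<close> by a sum of squares, and rescaling
  \<open>y\<close> turns this into an operator bound.\<close>

theorem nat_trans_bounded:
  assumes a: "a \<in> nat_trans C F F" and a': "a' \<in> nat_trans C F F" and adj: "adjoint_trans C F a a'"
  shows "\<exists>M. \<forall>\<Gamma>\<in>Obj C. \<forall>u\<in>carrier (ob F \<Gamma>). vnorm (ob F \<Gamma>) (a \<Gamma> u) \<le> M * vnorm (ob F \<Gamma>) u"
proof -
  obtain K1 where K1: "\<And>\<Gamma> y. \<Gamma> \<in> Obj C \<Longrightarrow> y \<in> ob S \<Gamma> \<Longrightarrow> l1_norm (lift a \<Gamma> (point y)) \<le> K1"
    using lift_l1_bounded[OF a] by blast
  obtain K2 where K2: "\<And>\<Gamma> y. \<Gamma> \<in> Obj C \<Longrightarrow> y \<in> ob S \<Gamma> \<Longrightarrow> l1_norm (lift a' \<Gamma> (point y)) \<le> K2"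
    using lift_l1_bounded[OF a'] by blast
  define K where "K = max K1 K2"
  have "vnorm (ob F \<Gamma>) (a \<Gamma> u) \<le> K * vnorm (ob F \<Gamma>) u" if \<Gamma>: "\<Gamma> \<in> Obj C" and u: "u \<in> carrier (ob F \<Gamma>)" for \<Gamma> u
  proof -
    let ?V = "ob F \<Gamma>" and ?S = "fin_l2 (ob S \<Gamma>)"
    interpret V: prehil ?V by (rule prehil_F[OF \<Gamma>])
    have au: "a \<Gamma> u \<in> carrier ?V" by (rule nat_transD(1)[OF a \<Gamma> u])
    have form: "2 * cmod (ip ?V (a \<Gamma> x) y) \<le> K * ((vnorm ?V x)\<^sup>2 + (vnorm ?V y)\<^sup>2)"
      if x: "x \<in> carrier ?V" and y: "y \<in> carrier ?V" for x y
    proof -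
      have "2 * cmod (ip ?S (lift a \<Gamma> (emb \<Gamma> x)) (emb \<Gamma> y))
         \<le> K * (Re (ip ?S (emb \<Gamma> x) (emb \<Gamma> x)) + Re (ip ?S (emb \<Gamma> y) (emb \<Gamma> y)))"
      proof (rule schur_test[where b = "lift a \<Gamma>" and b' = "lift a' \<Gamma>"])
        fix \<xi> \<eta> assume \<xi>: "\<xi> \<in> carrier ?S" and \<eta>: "\<eta> \<in> carrier ?S"
        note p\<xi> = proj_in[OF \<Gamma> \<xi>] and p\<eta> = proj_in[OF \<Gamma> \<eta>]
        note a\<xi> = nat_transD(1)[OF a \<Gamma> p\<xi>] and a\<eta> = nat_transD(1)[OF a \<Gamma> p\<eta>] and a'\<eta> = nat_transD(1)[OF a' \<Gamma> p\<eta>]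
        show "lift a \<Gamma> (\<lambda>x. \<xi> x + \<eta> x) = (\<lambda>x. lift a \<Gamma> \<xi> x + lift a \<Gamma> \<eta> x)"
          unfolding lift_def proj_add[OF \<Gamma> \<xi> \<eta>] nat_transD(2)[OF a \<Gamma> p\<xi> p\<eta>] emb_add[OF \<Gamma> a\<xi> a\<eta>] ..
        show "ip ?S (lift a \<Gamma> \<xi>) \<eta> = ip ?S \<xi> (lift a' \<Gamma> \<eta>)"
          using adj \<Gamma> p\<xi> p\<eta> ip_proj(2)[OF \<Gamma> \<eta> a\<xi>] ip_proj(1)[OF \<Gamma> \<xi> a'\<eta>]
          unfolding lift_def adjoint_trans_def by simp
      next
        fix c \<xi> assume \<xi>: "\<xi> \<in> carrier ?S"
        note p\<xi> = proj_in[OF \<Gamma> \<xi>]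
        show "lift a \<Gamma> (\<lambda>x. c * \<xi> x) = (\<lambda>x. c * lift a \<Gamma> \<xi> x)"
          unfolding lift_def proj_smult[OF \<Gamma> \<xi>] nat_transD(3)[OF a \<Gamma> p\<xi>] emb_smult[OF \<Gamma> nat_transD(1)[OF a \<Gamma> p\<xi>]] ..
      next
        fix s assume s: "s \<in> ob S \<Gamma>"
        show "l1_norm (lift a \<Gamma> (point s)) \<le> K" "l1_norm (lift a' \<Gamma> (point s)) \<le> K"
          using K1[OF \<Gamma> s] K2[OF \<Gamma> s] unfolding K_def by auto
      qed (use lift_in a a' \<Gamma> emb(1) x y in auto)
      moreover have "lift a \<Gamma> (emb \<Gamma> x) = emb \<Gamma> (a \<Gamma> x)" unfolding lift_def proj_emb[OF \<Gamma> x] ..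
      ultimately show ?thesis
        using ip_emb[OF \<Gamma> nat_transD(1)[OF a \<Gamma> x] y] ip_emb[OF \<Gamma> x x] ip_emb[OF \<Gamma> y y] x y
        by (simp add: V.vnorm_sq)
    qed
    show ?thesis
    proof (cases "vnorm ?V (a \<Gamma> u) = 0")
      case True
      have "0 \<le> K * (vnorm ?V u)\<^sup>2" 
        using form[OF u u] norm_ge_zero[of "ip ?V (a \<Gamma> u) u"] unfolding distrib_left by linarith
      then show ?thesis using True V.vnorm_nonneg[OF u]
        by (cases "vnorm ?V u = 0") (auto simp: zero_le_mult_iff)
    next
      case False
      define p q where "p = vnorm ?V u" and "q = vnorm ?V (a \<Gamma> u)"
      have q: "q > 0" unfolding q_def using False V.vnorm_nonneg[OF au] by simp
      have p0: "p \<ge> 0" unfolding p_def using V.vnorm_nonneg[OF u] .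
      have "p \<noteq> 0"
      proof
        assume "p = 0"
        then have "u = \<zero>\<^bsub>?V\<^esub>" using V.vnorm_eq_0[OF u] unfolding p_def by simp
        then have "a \<Gamma> u = 0 \<odot>\<^bsub>?V\<^esub> a \<Gamma> u"
          using nat_transD(3)[OF a \<Gamma> u, of 0] V.smult_r_null[of 0] by simp
        then have "q = 0" unfolding q_def using V.vnorm_smult[OF au, of 0] by simp
        then show False using q by simp
      qed
      then have p: "p > 0" using p0 by simp
      \<comment> \<open>The multiple of \<open>a \<Gamma> u\<close> that has the norm of
        \<open>u\<close>.\<close>
      define y where "y = of_real (p / q) \<odot>\<^bsub>?V\<^esub> a \<Gamma> u"
      have y: "y \<in> carrier ?V" unfolding y_def using au by (rule V.smult_in)
      have "ip ?V (a \<Gamma> u) y = of_real (p * q)"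
        unfolding y_def using V.ip_self[OF au] au q unfolding q_def[symmetric] by (simp add: power2_eq_square)
      then have "cmod (ip ?V (a \<Gamma> u) y) = p * q" using p q by (simp add: norm_mult)
      moreover have "vnorm ?V y = p"
        unfolding y_def V.vnorm_smult[OF au] q_def[symmetric] using p q by (simp add: norm_divide)
      ultimately have "2 * (p * q) \<le> K * (p\<^sup>2 + p\<^sup>2)" using form[OF u y] unfolding p_def[symmetric] by simp
      then have "p * q \<le> p * (K * p)" by (simp add: power2_eq_square algebra_simps)
      then have "q \<le> K * p" using p by simp
      then show ?thesis unfolding p_def q_def .
    qed
  qed
  then show ?thesis by blast
qed

text \<open>Finitely many vectors involve finitely many points of \<open>S\<close>. A quotient map
  that is injective on these points preserves inner products of functions supported there, and
  \<open>emb\<close> is isometric and natural.\<close>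

theorem isometric_quotient:
  assumes \<Gamma>: "\<And>\<alpha>. \<alpha> \<in> I \<Longrightarrow> covering_subgroup G X \<phi> (\<Gamma> \<alpha>)" and c: "compact_condition I \<Gamma>"
    and Z: "finite Z" "Z \<subseteq> carrier (ob F {\<one>})"
  shows "\<exists>\<alpha>\<in>I. \<exists>g\<in>carrier G. \<forall>u\<in>Z. \<forall>v\<in>Z.
    ip (ob F (\<Gamma> \<alpha>)) (mor F {\<one>} (\<Gamma> \<alpha>) (qm (\<Gamma> \<alpha>) g) u) (mor F {\<one>} (\<Gamma> \<alpha>) (qm (\<Gamma> \<alpha>) g) v) = ip (ob F {\<one>}) u v"
proof -
  have s: "finite (supp (emb {\<one>} u))" "supp (emb {\<one>} u) \<subseteq> ob S {\<one>}" if "u \<in> Z" for u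
    using emb(1)[OF one_Obj, of u] Z that unfolding fin_l2_carrier by blast+
  let ?D = "\<Union>u\<in>Z. supp (emb {\<one>} u)"
  have "finite ?D" "?D \<subseteq> ob S {\<one>}" using s Z(1) by auto
  then obtain \<alpha> g where \<alpha>: "\<alpha> \<in> I" "g \<in> carrier G" and inj: "inj_on (mor S {\<one>} (\<Gamma> \<alpha>) (qm (\<Gamma> \<alpha>) g)) ?D"
    using injective_quotient[OF \<Gamma> c] by blast
  have Obj: "\<Gamma> \<alpha> \<in> Obj C" using \<Gamma>[OF \<alpha>(1)] unfolding Obj_iff .
  have "ip (ob F (\<Gamma> \<alpha>)) (mor F {\<one>} (\<Gamma> \<alpha>) (qm (\<Gamma> \<alpha>) g) u) (mor F {\<one>} (\<Gamma> \<alpha>) (qm (\<Gamma> \<alpha>) g) v) = ip (ob F {\<one>}) u v"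
    if u: "u \<in> Z" and v: "v \<in> Z" for u v
  proof -
    let ?f = "mor S {\<one>} (\<Gamma> \<alpha>) (qm (\<Gamma> \<alpha>) g)"
    have c: "u \<in> carrier (ob F {\<one>})" "v \<in> carrier (ob F {\<one>})" using u v Z by auto
    have "ip (ob F (\<Gamma> \<alpha>)) (mor F {\<one>} (\<Gamma> \<alpha>) (qm (\<Gamma> \<alpha>) g) u) (mor F {\<one>} (\<Gamma> \<alpha>) (qm (\<Gamma> \<alpha>) g) v)
      = ip (fin_l2 (ob S (\<Gamma> \<alpha>))) (fin_l2_push ?f (emb {\<one>} u)) (fin_l2_push ?f (emb {\<one>} v))"
      using ip_emb[OF Obj mor_F_in[OF Obj \<alpha>(2) c(1)] mor_F_in[OF Obj \<alpha>(2) c(2)]]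
        emb_natural[OF Obj \<alpha>(2) c(1)] emb_natural[OF Obj \<alpha>(2) c(2)] by simp
    also have "\<dots> = ip (fin_l2 (ob S {\<one>})) (emb {\<one>} u) (emb {\<one>} v)"
      using s[OF u] s[OF v] by (intro push_inj_ip inj_on_subset[OF inj]) (use u v in auto)
    also have "\<dots> = ip (ob F {\<one>}) u v" by (rule ip_emb[OF one_Obj c])
    finally show ?thesis .
  qed
  then show ?thesis using \<alpha> by blast
qed

end

section \<open>Algebras of operators\<close>

lemma prehil_submodule:
  assumes "prehil V" "submodule W complex_ring V"
  shows "prehil (V\<lparr>carrier := W\<rparr>)"
proof -
  interpret prehil V by fact
  have W: "W \<subseteq> carrier V" using submoduleE(1)[OF assms(2)] .
  show ?thesis
  proof
    have "Module.module complex_ring (V\<lparr>carrier := W\<rparr>)" 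
      using pre_hilbert unfolding pre_hilbert_def by (intro submodule.submodule_is_module[OF assms(2)]) blast
    moreover have "u \<in> carrier V" if "u \<in> carrier (V\<lparr>carrier := W\<rparr>)" for u
      using W that by (simp add: subset_iff)
    ultimately show "pre_hilbert (V\<lparr>carrier := W\<rparr>)"
      unfolding pre_hilbert_def
    proof (intro conjI ballI allI impI)
      fix u v assume "u \<in> carrier (V\<lparr>carrier := W\<rparr>)" "v \<in> carrier (V\<lparr>carrier := W\<rparr>)"
      then have c: "u \<in> carrier V" "v \<in> carrier V" using W by auto
      show "ip (V\<lparr>carrier := W\<rparr>) v u = cnj (ip (V\<lparr>carrier := W\<rparr>) u v)" using ip_commute[OF c] by simp
      show "ip (V\<lparr>carrier := W\<rparr>) (z \<odot>\<^bsub>V\<lparr>carrier := W\<rparr>\<^esub> u) v = z * ip (V\<lparr>carrier := W\<rparr>) u v" for z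
        using c by simp
      fix w assume "w \<in> carrier (V\<lparr>carrier := W\<rparr>)"
      then have "w \<in> carrier V" using W by auto
      then show "ip (V\<lparr>carrier := W\<rparr>) (u \<oplus>\<^bsub>V\<lparr>carrier := W\<rparr>\<^esub> v) w
          = ip (V\<lparr>carrier := W\<rparr>) u w + ip (V\<lparr>carrier := W\<rparr>) v w" using c by simp
    next
      fix u assume "u \<in> carrier (V\<lparr>carrier := W\<rparr>)" "u \<noteq> \<zero>\<^bsub>V\<lparr>carrier := W\<rparr>\<^esub>"
      then show "0 < Re (ip (V\<lparr>carrier := W\<rparr>) u u)" using W Re_ip_self_pos[of u] by auto
    qed
  qed
qed

locale operator_algebra = semi_elementary_functor G T X \<phi> S F F' \<Theta>
  for G :: "('g, 'k) monoid_scheme" (structure) and T :: "'g topology"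
    and X :: "'c rel" and \<phi> :: "'g \<Rightarrow> 'c \<Rightarrow> 'c"
    and S :: "('g set, 'c set \<Rightarrow> 'c set, 's set, 's \<Rightarrow> 's) cfunctor"
    and F :: "('g set, 'c set \<Rightarrow> 'c set, 'v inner_space, 'v \<Rightarrow> 'v) cfunctor"
    and F' :: "('g set, 'c set \<Rightarrow> 'c set, 'w inner_space, 'w \<Rightarrow> 'w) cfunctor" and \<Theta> +
  fixes A :: "('g set \<Rightarrow> 'v \<Rightarrow> 'v) alg"
  assumes A: "algebra_of_operators C F A"
begin

sublocale A: stalg A
  by unfold_locales (use A in \<open>simp add: algebra_of_operators_def\<close>)

lemma A_nat: "a \<in> carrier A \<Longrightarrow> a \<in> nat_trans C F F"
  using A unfolding algebra_of_operators_def op_algebra_def by auto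

lemma A_adjoint_exists: "a \<in> carrier A \<Longrightarrow> \<exists>b\<in>nat_trans C F F. adjoint_trans C F a b"
  using A unfolding algebra_of_operators_def op_algebra_def by auto

lemma A_ops:
  assumes "\<Gamma> \<in> Obj C" "u \<in> carrier (ob F \<Gamma>)"
  shows "(a \<otimes>\<^bsub>A\<^esub> b) \<Gamma> u = a \<Gamma> (b \<Gamma> u)" "(a \<oplus>\<^bsub>A\<^esub> b) \<Gamma> u = a \<Gamma> u \<oplus>\<^bsub>ob F \<Gamma>\<^esub> b \<Gamma> u"
    "(c \<odot>\<^bsub>A\<^esub> a) \<Gamma> u = c \<odot>\<^bsub>ob F \<Gamma>\<^esub> a \<Gamma> u"
  using A assms unfolding algebra_of_operators_def op_algebra_def by auto

text \<open>The definite description in \<open>star\<close> denotes: inner products determine an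
  adjoint on the carriers, and extensionality determines it elsewhere.\<close>

lemma A_star:
  assumes a: "a \<in> carrier A"
  shows "adjoint_trans C F a (star A a)"
proof -
  have star: "star A a = (THE b. b \<in> nat_trans C F F \<and> adjoint_trans C F a b)"
    using A unfolding algebra_of_operators_def op_algebra_def by auto
  obtain b where b: "b \<in> nat_trans C F F" "adjoint_trans C F a b" using A_adjoint_exists[OF a] by blast
  have "b' = b" if b': "b' \<in> nat_trans C F F" "adjoint_trans C F a b'" for b'
  proof
    fix \<Gamma>
    show "b' \<Gamma> = b \<Gamma>"
    proof (cases "\<Gamma> \<in> Obj C")
      case \<Gamma>: True
      interpret V: prehil "ob F \<Gamma>" by (rule prehil_F[OF \<Gamma>])
      show ?thesis
      proof
        fix u
        show "b' \<Gamma> u = b \<Gamma> u"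
        proof (cases "u \<in> carrier (ob F \<Gamma>)")
          case True
          show ?thesis
          proof (rule V.vector_eqI)
            fix w assume w: "w \<in> carrier (ob F \<Gamma>)"
            note c = nat_transD(1)[OF b(1) \<Gamma> True] nat_transD(1)[OF b'(1) \<Gamma> True]
            have "ip (ob F \<Gamma>) w (b' \<Gamma> u) = ip (ob F \<Gamma>) w (b \<Gamma> u)"
              using b(2) b'(2) \<Gamma> True w unfolding adjoint_trans_def by metis
            then show "ip (ob F \<Gamma>) (b' \<Gamma> u) w = ip (ob F \<Gamma>) (b \<Gamma> u) w"
              using V.ip_commute[OF w c(1)] V.ip_commute[OF w c(2)] by simp
          qed (use nat_transD(1)[OF b(1) \<Gamma> True] nat_transD(1)[OF b'(1) \<Gamma> True] in auto)
        next
          case False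
          then show ?thesis using b(1) b'(1) \<Gamma> unfolding nat_trans_def by (auto simp: PiE_iff extensional_def)
        qed
      qed
    next
      case False
      then show ?thesis using b(1) b'(1) unfolding nat_trans_def by (auto simp: PiE_iff extensional_def)
    qed
  qed
  then have "star A a = b" unfolding star by (intro the_equality conjI b) blast
  then show ?thesis using b(2) by simp
qed

text \<open>One constant for all quotients at once, so that the coefficients of all of them lie in
  one compact hull.\<close>

definition opM :: "('g set \<Rightarrow> 'v \<Rightarrow> 'v) \<Rightarrow> real" where
  "opM a = (SOME M. \<forall>\<Gamma>\<in>Obj C. \<forall>u\<in>carrier (ob F \<Gamma>). vnorm (ob F \<Gamma>) (a \<Gamma> u) \<le> M * vnorm (ob F \<Gamma>) u)"

lemma opM:
  assumes "a \<in> carrier A" "\<Gamma> \<in> Obj C" "u \<in> carrier (ob F \<Gamma>)"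
  shows "vnorm (ob F \<Gamma>) (a \<Gamma> u) \<le> opM a * vnorm (ob F \<Gamma>) u"
proof -
  have "\<exists>M. \<forall>\<Gamma>\<in>Obj C. \<forall>u\<in>carrier (ob F \<Gamma>). vnorm (ob F \<Gamma>) (a \<Gamma> u) \<le> M * vnorm (ob F \<Gamma>) u"
  proof -
    obtain b where "b \<in> nat_trans C F F" "adjoint_trans C F a b" using A_adjoint_exists[OF assms(1)] by blast
    then show ?thesis by (rule nat_trans_bounded[OF A_nat[OF assms(1)]])
  qed
  then have "\<forall>\<Gamma>\<in>Obj C. \<forall>u\<in>carrier (ob F \<Gamma>). vnorm (ob F \<Gamma>) (a \<Gamma> u) \<le> opM a * vnorm (ob F \<Gamma>) u"
    unfolding opM_def by (rule someI_ex)
  then show ?thesis using assms by blast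
qed

abbreviation img :: "'g set \<Rightarrow> 'v set" where
  "img \<Gamma> \<equiv> {a \<Gamma> u | a u. a \<in> carrier A \<and> u \<in> carrier (ob F \<Gamma>)}"

text \<open>For a sum of \<open>a \<Gamma> u\<close> and \<open>b \<Gamma> v\<close> take a local
  unit of \<open>a\<close> and \<open>b\<close>: it fixes both terms, so the sum is its value at the
  sum itself. Thus every vector of \<open>image_space\<close> has the form
  \<open>a \<Gamma> u\<close>.\<close>

lemma submodule_img:
  assumes \<Gamma>: "\<Gamma> \<in> Obj C"
  shows "submodule (img \<Gamma>) complex_ring (ob F \<Gamma>)"
proof -
  interpret V: prehil "ob F \<Gamma>" by (rule prehil_F[OF \<Gamma>])
  note nt = nat_transD[OF A_nat \<Gamma>]
  show ?thesis
  proof (rule V.submodule_subspaceI)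
    show "img \<Gamma> \<subseteq> carrier (ob F \<Gamma>)" using nt(1) by blast
    show smult: "c \<odot>\<^bsub>ob F \<Gamma>\<^esub> x \<in> img \<Gamma>" if x: "x \<in> img \<Gamma>" for c x
    proof -
      obtain a u where "a \<in> carrier A" "u \<in> carrier (ob F \<Gamma>)" "x = a \<Gamma> u" using x by blast
      then show ?thesis using nt(3)[of a u c] V.smult_in[of u c] by (intro CollectI exI[of _ a] exI[of _ "c \<odot>\<^bsub>ob F \<Gamma>\<^esub> u"]) simp
    qed
    fix x y assume "x \<in> img \<Gamma>" "y \<in> img \<Gamma>"
    then obtain a u b v where ab: "a \<in> carrier A" "u \<in> carrier (ob F \<Gamma>)" "x = a \<Gamma> u"
      "b \<in> carrier A" "v \<in> carrier (ob F \<Gamma>)" "y = b \<Gamma> v" by blast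
    have "finite {a, b}" "{a, b} \<subseteq> carrier A" using ab by auto
    then have "\<exists>e\<in>carrier A. e \<otimes>\<^bsub>A\<^esub> a = a \<and> e \<otimes>\<^bsub>A\<^esub> b = b"
      by (rule A.local_unit) (intro bexI conjI, simp_all)
    then obtain e where e: "e \<in> carrier A" "e \<otimes>\<^bsub>A\<^esub> a = a" "e \<otimes>\<^bsub>A\<^esub> b = b" by blast
    have "x = e \<Gamma> x" "y = e \<Gamma> y" using A_ops(1)[OF \<Gamma> ab(2), of e a] A_ops(1)[OF \<Gamma> ab(5), of e b] e ab by auto
    then have "x \<oplus>\<^bsub>ob F \<Gamma>\<^esub> y = e \<Gamma> (x \<oplus>\<^bsub>ob F \<Gamma>\<^esub> y)" using nt(1,2) ab e(1) by metis
    moreover have "x \<oplus>\<^bsub>ob F \<Gamma>\<^esub> y \<in> carrier (ob F \<Gamma>)" using nt(1) ab by simp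
    ultimately show "x \<oplus>\<^bsub>ob F \<Gamma>\<^esub> y \<in> img \<Gamma>" using e(1) by blast
  next
    obtain e where e: "e \<in> carrier A" using A.local_unit[of "{}"] by auto
    have "e \<Gamma> \<zero>\<^bsub>ob F \<Gamma>\<^esub> = \<zero>\<^bsub>ob F \<Gamma>\<^esub>"
      using opM[OF e \<Gamma> V.M.zero_closed] V.vnorm_nonneg[OF nt(1)[OF e V.M.zero_closed]]
        V.vnorm_eq_0[OF nt(1)[OF e V.M.zero_closed]] by simp
    then show "\<zero>\<^bsub>ob F \<Gamma>\<^esub> \<in> img \<Gamma>" using e V.M.zero_closed by (intro CollectI exI[of _ e] exI[of _ "\<zero>\<^bsub>ob F \<Gamma>\<^esub>"]) auto
  qed
qed

lemma image_space_eq: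
  assumes \<Gamma>: "\<Gamma> \<in> Obj C"
  shows "image_space F A \<Gamma> = (ob F \<Gamma>)\<lparr>carrier := img \<Gamma>\<rparr>"
proof -
  interpret V: prehil "ob F \<Gamma>" by (rule prehil_F[OF \<Gamma>])
  have "lin_span (ob F \<Gamma>) (img \<Gamma>) = img \<Gamma>"
  proof
    show "lin_span (ob F \<Gamma>) (img \<Gamma>) \<subseteq> img \<Gamma>" by (rule V.lin_span_minimal[OF submodule_img[OF \<Gamma>]]) simp
    show "img \<Gamma> \<subseteq> lin_span (ob F \<Gamma>) (img \<Gamma>)" unfolding lin_span_def by blast
  qed
  then show ?thesis unfolding image_space_def by simp
qed

lemma op_rep_image:
  assumes \<Gamma>: "\<Gamma> \<in> Obj C"
  shows "op_rep A (image_space F A \<Gamma>) (\<lambda>a. a \<Gamma>) opM"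
proof -
  interpret V: prehil "ob F \<Gamma>" by (rule prehil_F[OF \<Gamma>])
  have sub: "img \<Gamma> \<subseteq> carrier (ob F \<Gamma>)" using V.submoduleE(1)[OF submodule_img[OF \<Gamma>]] .
  interpret W: prehil "(ob F \<Gamma>)\<lparr>carrier := img \<Gamma>\<rparr>"
    by (rule prehil_submodule[OF prehil_F[OF \<Gamma>] submodule_img[OF \<Gamma>]])
  note nt = nat_transD[OF A_nat \<Gamma>]
  have in_img: "a \<Gamma> w \<in> img \<Gamma>" if "a \<in> carrier A" "w \<in> carrier (ob F \<Gamma>)" for a w
    using that by blast
  have vn: "vnorm ((ob F \<Gamma>)\<lparr>carrier := img \<Gamma>\<rparr>) = vnorm (ob F \<Gamma>)"
    unfolding vnorm_def by auto
  show ?thesis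
    unfolding image_space_eq[OF \<Gamma>]
  proof (rule op_rep.intro[OF A.stalg_axioms W.prehil_axioms op_rep_axioms.intro])
    fix a w assume a: "a \<in> carrier A" and w: "w \<in> carrier ((ob F \<Gamma>)\<lparr>carrier := img \<Gamma>\<rparr>)"
    then have wI: "w \<in> img \<Gamma>" by simp
    then have wc: "w \<in> carrier (ob F \<Gamma>)" using sub by (rule subsetD[rotated])
    show "a \<Gamma> w \<in> carrier ((ob F \<Gamma>)\<lparr>carrier := img \<Gamma>\<rparr>)" using in_img[OF a wc] by simp
    show "a \<Gamma> (c \<odot>\<^bsub>(ob F \<Gamma>)\<lparr>carrier := img \<Gamma>\<rparr>\<^esub> w) = c \<odot>\<^bsub>(ob F \<Gamma>)\<lparr>carrier := img \<Gamma>\<rparr>\<^esub> a \<Gamma> w" for c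
      using nt(3)[OF a wc] by simp
    show "vnorm ((ob F \<Gamma>)\<lparr>carrier := img \<Gamma>\<rparr>) (a \<Gamma> w) \<le> opM a * vnorm ((ob F \<Gamma>)\<lparr>carrier := img \<Gamma>\<rparr>) w"
      unfolding vn by (rule opM[OF a \<Gamma> wc])
    show "(c \<odot>\<^bsub>A\<^esub> a) \<Gamma> w = c \<odot>\<^bsub>(ob F \<Gamma>)\<lparr>carrier := img \<Gamma>\<rparr>\<^esub> a \<Gamma> w" for c
      using A_ops(3)[OF \<Gamma> wc] by simp
    show "(a \<oplus>\<^bsub>A\<^esub> b) \<Gamma> w = a \<Gamma> w \<oplus>\<^bsub>(ob F \<Gamma>)\<lparr>carrier := img \<Gamma>\<rparr>\<^esub> b \<Gamma> w" for b
      using A_ops(2)[OF \<Gamma> wc] by simp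
    show "(a \<otimes>\<^bsub>A\<^esub> b) \<Gamma> w = a \<Gamma> (b \<Gamma> w)" for b by (rule A_ops(1)[OF \<Gamma> wc])
    fix w' assume w': "w' \<in> carrier ((ob F \<Gamma>)\<lparr>carrier := img \<Gamma>\<rparr>)"
    then have "w' \<in> img \<Gamma>" by simp
    then have wc': "w' \<in> carrier (ob F \<Gamma>)" using sub by (rule subsetD[rotated])
    show "a \<Gamma> (w \<oplus>\<^bsub>(ob F \<Gamma>)\<lparr>carrier := img \<Gamma>\<rparr>\<^esub> w') = a \<Gamma> w \<oplus>\<^bsub>(ob F \<Gamma>)\<lparr>carrier := img \<Gamma>\<rparr>\<^esub> a \<Gamma> w'"
      using nt(2)[OF a wc wc'] by simp
    show "ip ((ob F \<Gamma>)\<lparr>carrier := img \<Gamma>\<rparr>) (a \<Gamma> w) w' = ip ((ob F \<Gamma>)\<lparr>carrier := img \<Gamma>\<rparr>) w (star A a \<Gamma> w')"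
      using A_star[OF a] \<Gamma> wc wc' unfolding adjoint_trans_def by simp
  qed
qed

text \<open>For each finite set of tests some quotient carries a unit vector that nearly has the
  coefficients of \<open>v\<close>; which quotient it is depends on the tests, and
  \<open>irreducible_approx\<close> is made for this situation.\<close>

theorem spectrum_closure:
  assumes \<Gamma>: "\<And>\<alpha>. \<alpha> \<in> I \<Longrightarrow> covering_subgroup G X \<phi> (\<Gamma> \<alpha>)" and c: "compact_condition I \<Gamma>"
  shows "spectrum F A {\<one>} \<subseteq> dual_topology A closure_of (\<Union>\<alpha>\<in>I. spectrum F A (\<Gamma> \<alpha>))"
proof
  fix x assume "x \<in> spectrum F A {\<one>}"
  then obtain V \<sigma> where x: "x = rep_class A (V, \<sigma>)" and V: "(V, \<sigma>) \<in> irreps A"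
    and wc': "weakly_contained A V \<sigma> (completion (image_space F A {\<one>}))
      (\<lambda>a. completion_op (image_space F A {\<one>}) (a {\<one>}))"
    unfolding spectrum_def rep_spectrum_def by blast
  have Obj: "\<Gamma> \<alpha> \<in> Obj C" if "\<alpha> \<in> I" for \<alpha> using \<Gamma>[OF that] unfolding Obj_iff .
  interpret R1: op_rep A "image_space F A {\<one>}" "\<lambda>a. a {\<one>}" opM by (rule op_rep_image[OF one_Obj])
  interpret V1: prehil "ob F {\<one>}" by (rule prehil_F[OF one_Obj])
  have wc: "weakly_contained A V \<sigma> (image_space F A {\<one>}) (\<lambda>a. a {\<one>})"
    by (rule R1.weakly_contained_completionD[OF wc'])
  interpret fam: op_rep_family A I "\<lambda>\<alpha>. image_space F A (\<Gamma> \<alpha>)" "\<lambda>\<alpha> a. a (\<Gamma> \<alpha>)" opM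
    by (intro op_rep_family.intro op_rep_family_axioms.intro A.stalg_axioms op_rep_image Obj)
  have irr: "irreducible_rep A V \<sigma>" using V unfolding irreps_def by blast
  show "x \<in> dual_topology A closure_of (\<Union>\<alpha>\<in>I. spectrum F A (\<Gamma> \<alpha>))"
    unfolding x
  proof (rule A.dual_closure_criterion[OF V])
    fix v Q and \<epsilon> :: real assume v: "v \<in> carrier V" "vnorm V v = 1" and Q: "finite Q" "Q \<subseteq> carrier A" and \<epsilon>: "0 < \<epsilon>"
    have "\<exists>\<alpha>\<in>I. \<exists>w\<in>carrier (image_space F A (\<Gamma> \<alpha>)). vnorm (image_space F A (\<Gamma> \<alpha>)) w = 1 \<and>
        (\<forall>a\<in>Q'. cmod (ip V (\<sigma> a v) v - ip (image_space F A (\<Gamma> \<alpha>)) (a (\<Gamma> \<alpha>) w) w) < \<delta>)"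
      if Q': "finite Q'" "Q' \<subseteq> carrier A" and \<delta>: "0 < \<delta>" for Q' and \<delta> :: real
    proof -
      have "v \<in> carrier V \<and> vnorm V v = 1 \<and> 0 < \<delta> \<and> finite Q' \<and> Q' \<subseteq> carrier A" using v Q' \<delta> by simp
      from wc[unfolded weakly_contained_def, rule_format, OF this]
      obtain w where w: "w \<in> carrier (image_space F A {\<one>})" "vnorm (image_space F A {\<one>}) w = 1"
        "\<And>a. a \<in> Q' \<Longrightarrow> cmod (ip V (\<sigma> a v) v - ip (image_space F A {\<one>}) (a {\<one>} w) w) < \<delta>" by blast
      obtain b u where b: "b \<in> carrier A" "u \<in> carrier (ob F {\<one>})" "w = b {\<one>} u"
        using w(1) unfolding image_space_eq[OF one_Obj] by auto
      have wc: "w \<in> carrier (ob F {\<one>})" using nat_transD(1)[OF A_nat one_Obj] b by simp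
      \<comment> \<open>The inner products among these vectors include the norm of \<open>w\<close>
        and all coefficients under test.\<close>
      let ?Z = "insert w ((\<lambda>a. a {\<one>} w) ` Q')"
      have "finite ?Z" "?Z \<subseteq> carrier (ob F {\<one>})"
        using Q' wc nat_transD(1)[OF A_nat one_Obj wc] by auto
      then obtain \<alpha> g where \<alpha>: "\<alpha> \<in> I" "g \<in> carrier G" and iso: "\<And>y z. y \<in> ?Z \<Longrightarrow> z \<in> ?Z \<Longrightarrow>
        ip (ob F (\<Gamma> \<alpha>)) (mor F {\<one>} (\<Gamma> \<alpha>) (qm (\<Gamma> \<alpha>) g) y) (mor F {\<one>} (\<Gamma> \<alpha>) (qm (\<Gamma> \<alpha>) g) z) = ip (ob F {\<one>}) y z"
        using isometric_quotient[OF \<Gamma> c, of ?Z] by blast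
      note O = Obj[OF \<alpha>(1)]
      let ?w = "mor F {\<one>} (\<Gamma> \<alpha>) (qm (\<Gamma> \<alpha>) g) w"
      have nat: "a (\<Gamma> \<alpha>) (mor F {\<one>} (\<Gamma> \<alpha>) (qm (\<Gamma> \<alpha>) g) y) = mor F {\<one>} (\<Gamma> \<alpha>) (qm (\<Gamma> \<alpha>) g) (a {\<one>} y)"
        if "a \<in> carrier A" "y \<in> carrier (ob F {\<one>})" for a y
        by (rule nat_transD(4)[OF A_nat[OF that(1)] O \<alpha>(2) that(2)])
      \<comment> \<open>Naturality of \<open>b\<close> keeps the moved vector in the subspace
        generated by the algebra, from which the spectrum of the quotient is formed.\<close>
      have "?w = b (\<Gamma> \<alpha>) (mor F {\<one>} (\<Gamma> \<alpha>) (qm (\<Gamma> \<alpha>) g) u)" using nat[OF b(1,2)] b(3) by simp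
      then have "?w \<in> carrier (image_space F A (\<Gamma> \<alpha>))"
        unfolding image_space_eq[OF O] using b(1) mor_F_in[OF O \<alpha>(2) b(2)] by auto
      moreover have "vnorm (image_space F A (\<Gamma> \<alpha>)) ?w = 1"
        using w(2) iso[of w w] unfolding image_space_eq[OF O] image_space_eq[OF one_Obj] vnorm_def by simp
      moreover have "cmod (ip V (\<sigma> a v) v - ip (image_space F A (\<Gamma> \<alpha>)) (a (\<Gamma> \<alpha>) ?w) ?w) < \<delta>" if a: "a \<in> Q'" for a
      proof -
        have "a \<in> carrier A" using a Q' by blast
        then have "ip (ob F (\<Gamma> \<alpha>)) (a (\<Gamma> \<alpha>) ?w) ?w = ip (ob F {\<one>}) (a {\<one>} w) w"
          using iso[of "a {\<one>} w" w] a nat[OF _ wc] by simp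
        then show ?thesis using w(3)[OF a] unfolding image_space_eq[OF O] image_space_eq[OF one_Obj] by simp
      qed
      ultimately show ?thesis using \<alpha>(1) by blast
    qed
    from fam.irreducible_approx[OF irr v this Q \<epsilon>]
    obtain \<alpha> U \<tau> where \<alpha>: "\<alpha> \<in> I" and U: "(U, \<tau>) \<in> irreps A"
      "\<exists>u\<in>carrier U. \<forall>a\<in>Q. cmod (ip V (\<sigma> a v) v - ip U (\<tau> a u) u) < \<epsilon>"
      "weakly_contained A U \<tau> (image_space F A (\<Gamma> \<alpha>)) (\<lambda>a. a (\<Gamma> \<alpha>))" by blast
    have "weakly_contained A U \<tau> (completion (image_space F A (\<Gamma> \<alpha>)))
      (\<lambda>a. completion_op (image_space F A (\<Gamma> \<alpha>)) (a (\<Gamma> \<alpha>)))"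
      by (rule op_rep.weakly_contained_completion[OF op_rep_image[OF Obj[OF \<alpha>]] U(3)])
    then have "rep_class A (U, \<tau>) \<in> spectrum F A (\<Gamma> \<alpha>)"
      unfolding spectrum_def rep_spectrum_def using U(1) by blast
    then show "\<exists>(U, \<tau>)\<in>irreps A. rep_class A (U, \<tau>) \<in> (\<Union>\<alpha>\<in>I. spectrum F A (\<Gamma> \<alpha>)) \<and>
        (\<exists>u\<in>carrier U. \<forall>a\<in>Q. cmod (ip V (\<sigma> a v) v - ip U (\<tau> a u) u) < \<epsilon>)"
      using U(1,2) \<alpha> by (intro bexI[of _ "(U, \<tau>)"]) auto
  qed
qed

end

theorem theorem5p1:
  fixes G :: "('g, 'k) monoid_scheme" and T :: "'g topology"
    and X :: "'c rel" and \<phi> :: "'g \<Rightarrow> 'c \<Rightarrow> 'c"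
    and F :: "('g set, 'c set \<Rightarrow> 'c set, 'v inner_space, 'v \<Rightarrow> 'v) cfunctor"
    and A :: "('g set \<Rightarrow> 'v \<Rightarrow> 'v) alg"
    and I :: "'i set" and \<Gamma> :: "'i \<Rightarrow> 'g set"
  assumes "ell_group G T"
    and "G_complex G T X \<phi>"
    and "almost_transitive G X \<phi>"
    and "semi_elementary TYPE('w) TYPE('s) G T X \<phi> F"
    and "algebra_of_operators (quot_category G X \<phi>) F A"
    and "\<And>\<alpha>. \<alpha> \<in> I \<Longrightarrow> covering_subgroup G X \<phi> (\<Gamma> \<alpha>)"
  defines "cond1 \<equiv> \<forall>C. compactin T C \<and> \<one>\<^bsub>G\<^esub> \<in> C \<longrightarrow>
      (\<exists>\<alpha>\<in>I. \<exists>g\<in>carrier G. C \<inter> (\<lambda>\<gamma>. inv\<^bsub>G\<^esub> g \<otimes>\<^bsub>G\<^esub> \<gamma> \<otimes>\<^bsub>G\<^esub> g) ` \<Gamma> \<alpha> = {\<one>\<^bsub>G\<^esub>})"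
    and "cond2 \<equiv> \<forall>n::nat. \<exists>\<alpha>\<in>I. \<exists>v\<in>vertices X. inj_on (quot_map G \<phi> (\<Gamma> \<alpha>)) (cell_ball X v n)"
  shows "(cond1 \<longleftrightarrow> cond2) \<and>
    (cond1 \<and> cond2 \<longrightarrow>
       spectrum F A {\<one>\<^bsub>G\<^esub>} \<subseteq> dual_topology A closure_of (\<Union>\<alpha>\<in>I. spectrum F A (\<Gamma> \<alpha>)))"
proof -
  interpret gcomplex G T X \<phi>
    by unfold_locales (rule assms(1), rule assms(2))
  have iff: "cond1 \<longleftrightarrow> cond2"
    using compact_imp_ball[of I \<Gamma>] ball_imp_compact[OF assms(3), of I \<Gamma>] assms(6)
    unfolding cond1_def cond2_def compact_condition_def ball_condition_def by blast
  obtain F' :: "('g set, 'c set \<Rightarrow> 'c set, 'w inner_space, 'w \<Rightarrow> 'w) cfunctor"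
    where F: "phil_functor C F" "phil_functor C F'" and el: "elementary TYPE('s) G T X \<phi> (sum_functor F F')"
    using assms(4) unfolding semi_elementary_def by blast
  from el obtain S :: "('g set, 'c set \<Rightarrow> 'c set, 's set, 's \<Rightarrow> 's) cfunctor" where
    S: "set_functor C S"
    and iso: "unitarily_isomorphic C (l2_functor S) (sum_functor F F')"
    and stab: "\<forall>x\<in>ob S {\<one>\<^bsub>G\<^esub>}. compactin T (stabilizer G (induced_action G X \<phi> S) x) \<and>
           openin T (stabilizer G (induced_action G X \<phi> S) x) \<and>
           (\<exists>c\<in>Field X. \<not> empty_cell X c \<and>
              stabilizer G (induced_action G X \<phi> S) x \<subseteq> stabilizer G \<phi> c)"
    and quot: "\<forall>\<Gamma>. covering_subgroup G X \<phi> \<Gamma> \<longrightarrow>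
           (\<exists>\<beta>. bij_betw \<beta>
                  (orbits (G\<lparr>carrier := \<Gamma>\<rparr>) (ob S {\<one>\<^bsub>G\<^esub>}) (induced_action G X \<phi> S)) (ob S \<Gamma>) \<and>
                (\<forall>x\<in>ob S {\<one>\<^bsub>G\<^esub>}.
                   \<beta> (orbit (G\<lparr>carrier := \<Gamma>\<rparr>) (induced_action G X \<phi> S) x) =
                   mor S {\<one>\<^bsub>G\<^esub>} \<Gamma> (quot_morphism G X \<phi> {\<one>\<^bsub>G\<^esub>} \<Gamma> \<one>\<^bsub>G\<^esub>) x))"
    and fin: "finite (orbits G (ob S {\<one>\<^bsub>G\<^esub>}) (induced_action G X \<phi> S))"
    unfolding elementary_def by (elim conjE exE)
  obtain \<Theta> where \<Theta>: "\<Theta> \<in> nat_trans C (l2_functor S) (sum_functor F F')"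
    "\<And>\<Gamma>. \<Gamma> \<in> Obj C \<Longrightarrow> unitary_map (fin_l2 (ob S \<Gamma>)) (direct_sum (ob F \<Gamma>) (ob F' \<Gamma>)) (\<Theta> \<Gamma>)"
    using iso unfolding unitarily_isomorphic_def by (auto simp: l2_functor_def sum_functor_def)
  interpret cell_functor G T X \<phi> S
    by unfold_locales (use S stab quot fin in simp_all)
  interpret operator_algebra G T X \<phi> S F F' \<Theta> A
    by unfold_locales (use F \<Theta> assms(5) in simp_all)
  have "spectrum F A {\<one>\<^bsub>G\<^esub>} \<subseteq> dual_topology A closure_of (\<Union>\<alpha>\<in>I. spectrum F A (\<Gamma> \<alpha>))" if cond1
    using that spectrum_closure[of I \<Gamma>] assms(6) unfolding cond1_def compact_condition_def by blast
  with iff show ?thesis by blast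
qed

end
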